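(* Let $n\ge 5$ and $p$ be integers with $1\le p<\frac n2-1$, and let $f:F_{n,p}\to F_{n,p}$ be a quasisymmetric self-map (a quasisymmetric homeomorphism of $F_{n,p}$ onto itself). Then $f$ is a Euclidean isometry.
   Context: Construction of $F_{n,p}$ ($n\ge5$, $1\le p<\frac n2-1$ integers): Let $Q^{(0)}_{n,p}=[0,1]\times[0,1]\subset\mathbb{R}^2$. Subdivide it into $n^2$ closed subsquares of side length $1/n$ and remove the interiors of the four subsquares $[a,a+\frac1n]\times[b,b+\frac1n]$ with $a,b\in\{\frac pn,\,1-\frac{p+1}{n}\}$ (each is at distance $\sqrt2\,p/n$ from one of the four corners of the unit square). The result is $Q^{(1)}_{n,p}$, a union of $n^2-4$ squares of side length $1/n$. Inductively, $Q^{(k+1)}_{n,p}$ is obtained from $Q^{(k)}_{n,p}$ by applying the same (scaled) subdivision and removal to each of the remaining squares of side length $1/n^k$. Then $F_{n,p}=\bigcap_{k\ge0}Q^{(k)}_{n,p}$, with the Euclidean metric (bi-Lipschitz equivalent on $F_{n,p}$ to the spherical metric). A homeomorphism $f:X\to Y$ of metric spaces is quasisymmetric if there is a homeomorphism $\eta:[0,\infty)\to[0,\infty)$ with $\frac{d_Y(f(x),f(y))}{d_Y(f(x),f(z))}\le\eta\left(\frac{d_X(x,y)}{d_X(x,z)}\right)$ for all $x,y,z\in X$, $x\ne z$. *)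

theory Defs
  imports "HOL-Analysis.Analysis"
begin

text \<open>
  The plane is \<^typ>\<open>real \<times> real\<close>, whose library metric is the Euclidean one.
  The carpet is obtained from the unit square; at stage \<open>k\<close> the surviving squares have side
  \<open>1 / n ^ k\<close> and are recorded by their lower left corners.
\<close>

definition square_at :: "real \<times> real \<Rightarrow> real \<Rightarrow> (real \<times> real) set" where
  "square_at c s = {fst c .. fst c + s} \<times> {snd c .. snd c + s}"

definition subcorner :: "nat \<Rightarrow> real \<times> real \<Rightarrow> real \<Rightarrow> nat \<times> nat \<Rightarrow> real \<times> real" where
  "subcorner n c s ij =
     (fst c + real (fst ij) * (s / real n), snd c + real (snd ij) * (s / real n))"

text \<open>
  The offsets \<open>p / n\<close> and \<open>1 - (p + 1) / n\<close> correspond to the subdivision indices \<open>p\<close> and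
  \<open>n - p - 1\<close>; the latter is written additively to avoid truncated subtraction.
\<close>

definition removed_indices :: "nat \<Rightarrow> nat \<Rightarrow> (nat \<times> nat) set" where
  "removed_indices n p = {i. i = p \<or> i + p + 1 = n} \<times> {j. j = p \<or> j + p + 1 = n}"

primrec remaining_corners :: "nat \<Rightarrow> nat \<Rightarrow> nat \<Rightarrow> (real \<times> real) set" where
  "remaining_corners n p 0 = {(0, 0)}"
| "remaining_corners n p (Suc k) =
     (\<Union>c \<in> remaining_corners n p k.
        subcorner n c (1 / real n ^ k) ` ({..<n} \<times> {..<n} - removed_indices n p))"

text \<open>
  For \<open>1 \<le> p < n / 2 - 1\<close> the removed squares are pairwise disjoint and avoid the boundary of the
  square being subdivided, so what is left at each stage is exactly the union of the closed
  squares listed by \<open>remaining_corners\<close> at the next index.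
\<close>

primrec carpet_stage :: "nat \<Rightarrow> nat \<Rightarrow> nat \<Rightarrow> (real \<times> real) set" where
  "carpet_stage n p 0 = {0..1} \<times> {0..1}"
| "carpet_stage n p (Suc k) =
     (\<Union>c \<in> remaining_corners n p k.
        square_at c (1 / real n ^ k) -
        (\<Union>ij \<in> removed_indices n p.
           interior (square_at (subcorner n c (1 / real n ^ k) ij) (1 / real n ^ Suc k))))"

definition carpet :: "nat \<Rightarrow> nat \<Rightarrow> (real \<times> real) set" where
  "carpet n p = (\<Inter>k. carpet_stage n p k)"

text \<open>
  A self-homeomorphism of \<open>{0..}\<close> is automatically increasing and fixes \<open>0\<close>. The denominators
  below are nonzero, as \<open>f\<close> is injective on \<open>X\<close>.
\<close>

definition quasisymmetric_map ::
  "'a::metric_space set \<Rightarrow> 'b::metric_space set \<Rightarrow> ('a \<Rightarrow> 'b) \<Rightarrow> bool" where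
  "quasisymmetric_map X Y f \<longleftrightarrow>
     (\<exists>g. homeomorphism X Y f g) \<and>
     (\<exists>\<eta> \<theta>. homeomorphism {0::real..} {0::real..} \<eta> \<theta> \<and>
        (\<forall>x\<in>X. \<forall>y\<in>X. \<forall>z\<in>X. x \<noteq> z \<longrightarrow>
           dist (f x) (f y) / dist (f x) (f z) \<le> \<eta> (dist x y / dist x z)))"

definition isometry_between ::
  "'a::metric_space set \<Rightarrow> 'b::metric_space set \<Rightarrow> ('a \<Rightarrow> 'b) \<Rightarrow> bool" where
  "isometry_between X Y f \<longleftrightarrow>
     f ` X = Y \<and> (\<forall>x\<in>X. \<forall>y\<in>X. dist (f x) (f y) = dist x y)"

end

theory Submission
 imports Defs
begin

text \<open>
 Functions on the carpet are measured by their oscillations on the peripheral circles and on the cells of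
 generation \<open>k\<close>. A quasisymmetric self-map \<open>f\<close> permutes the circles, and the squared diameters of the images
 of the cells of generation \<open>k\<close> have a sum tending to \<open>0\<close>; so in length--area estimates along rows and columns
 only the circles count in the limit, and capacities defined by sums of squared oscillations over circles are
 invariant under \<open>f\<close>.

 If \<open>f\<close> fixes the outer circle and two of the four largest holes, and preserves orientation, it is the
 identity: an estimate of the argument around a hole yields a fixed point on the outer circle, logarithmic
 cutoffs at shrinking arcs show that the whole outer circle is fixed, and then Cauchy--Schwarz for the
 coordinate functions becomes an equality, as the squared sides of the holes sum to \<open>1\<close>.

 The capacity of a circle in a proper cell relative to circles at least as large is strictly smaller than its
 analogue for the whole carpet. Applied to the smallest image circle, this shows that \<open>f\<close> permutes the five
 largest circles; commutators with the symmetries of the square then leave no other maps than these symmetries.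
\<close>

text \<open>Two obstacles shape the argument. First, nothing is known in advance about a
  quasisymmetric map along a single row, so the cells must be controlled as well as the circles.
  They become negligible because each cell contains a hole of comparable image size, and these
  holes, over all generations, have distinct circles as images: the cell sums are dominated by the
  terms of a convergent series. Second, no minimiser of a capacity is at hand, so strictness is
  extracted from near-minimisers. Transplanted into a cell, such a function vanishes on the boundary
  of the cell; raising it slightly along a path of small holes would lower its energy, unless its
  drop there were concentrated on finitely many holes, and a pigeonhole choice of the level excludes
  this. The path has to avoid all constrained circles, which is why these are required to be at
  least as large. Two fixed holes are used to stop rotation: the argument is taken around one of
  them, and the other anchors its branch, so that the iterates of the map cannot wind the outer
  circle indefinitely.\<close>

type_synonym plane = "real \<times> real"

abbreviation unit_sq :: "plane set" where "unit_sq \<equiv> {0..1} \<times> {0..1}"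

section \<open>Base-n digits and the squares of the carpet\<close>

locale carpet_np =
 fixes n p :: nat
 assumes n5: "n \<ge> 5" and p1: "1 \<le> p" and pn: "2 * p + 3 \<le> n"
begin

abbreviation rn :: "nat => real" where "rn k \<equiv> real n ^ k"
abbreviation gr :: "nat => nat => real" where "gr k i \<equiv> real i / rn k"
abbreviation ix :: "nat => nat set" where "ix k \<equiv> {..<n ^ k}"

definition q :: nat where "q = n - 1 - p"

text \<open>The removed digits \<open>p\<close> and \<open>q\<close> are at least two apart and
  differ from the extreme digits 0 and n - 1. These gaps are why holes touch neither each other nor
  the sides of their parent cell.\<close>

lemma q_facts: "q + p + 1 = n" "p + 2 \<le> q" "q + 2 \<le> n" "1 \<le> q" "p < n" "q < n" "0 < n"
 using n5 p1 pn by (auto simp: q_def)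

lemma npos [simp]: "0 < n" "real n > 0" "real n \<noteq> 0" "n \<noteq> 0"
 using n5 by auto

lemma n_ge1: "real n \<ge> 1" using n5 by auto

definition bad :: "nat => nat => bool" where
 "bad a b \<longleftrightarrow> (a = p \<or> a = q) \<and> (b = p \<or> b = q)"

text \<open>Cells of generation k are pairs of integers below \<open>n ^ k\<close>;
  \<open>i div n\<close> is the parent and \<open>i mod n\<close> the position in it, so survival
  becomes a condition on pairs of base-n digits.\<close>

primrec rem :: "nat => nat => nat => bool" where
 "rem 0 i j = (i = 0 \<and> j = 0)"
| "rem (Suc k) i j = (rem k (i div n) (j div n) \<and> \<not> bad (i mod n) (j mod n))"

definition hole :: "nat => nat => nat => bool" where
 "hole k i j \<longleftrightarrow> k > 0 \<and> rem (k - 1) (i div n) (j div n) \<and> bad (i mod n) (j mod n)"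

definition seg :: "nat => nat => real => bool" where
 "seg k i x \<longleftrightarrow> real i \<le> x * rn k \<and> x * rn k \<le> real i + 1"

definition oseg :: "nat => nat => real => bool" where
 "oseg k i x \<longleftrightarrow> real i < x * rn k \<and> x * rn k < real i + 1"

definition sq :: "nat => nat => nat => plane set" where
 "sq k i j = {z. seg k i (fst z) \<and> seg k j (snd z)}"

definition osq :: "nat => nat => nat => plane set" where
 "osq k i j = {z. oseg k i (fst z) \<and> oseg k j (snd z)}"

definition circ :: "nat => nat => nat => plane set" where
 "circ k i j = sq k i j - osq k i j"

definition F :: "plane set" where
 "F = {z. \<forall>k. \<exists>i j. rem k i j \<and> z \<in> sq k i j}"

lemma bad_swap: "bad b a = bad a b" by (auto simp: bad_def)
lemma rem_swap: "rem k j i = rem k i j"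
 by (induction k arbitrary: i j) (auto simp: bad_swap)
lemma hole_swap: "hole k j i = hole k i j"
 by (auto simp: hole_def rem_swap bad_swap)
lemma sq_swap: "prod.swap z \<in> sq k j i \<longleftrightarrow> z \<in> sq k i j"
 by (auto simp: sq_def)
lemma osq_swap: "prod.swap z \<in> osq k j i \<longleftrightarrow> z \<in> osq k i j"
 by (auto simp: osq_def)
lemma circ_swap: "prod.swap z \<in> circ k j i \<longleftrightarrow> z \<in> circ k i j"
 by (auto simp: circ_def sq_swap osq_swap)
lemma F_swap: "prod.swap z \<in> F \<longleftrightarrow> z \<in> F"
proof -
 have *: "prod.swap z \<in> F" if z: "z \<in> F" for z
  unfolding F_def
 proof (clarify)
  fix k
  obtain i j where "rem k i j" "z \<in> sq k i j" using z unfolding F_def by blast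
  hence "rem k j i \<and> prod.swap z \<in> sq k j i" by (simp add: rem_swap sq_swap)
  thus "\<exists>i j. rem k i j \<and> prod.swap z \<in> sq k i j" by blast
 qed
 from *[of z] *[of "prod.swap z"] show ?thesis by (auto simp: prod.swap_def)
qed

lemma div_less_pow: "i div n < n ^ k \<longleftrightarrow> i < n ^ Suc k"
 by (simp add: div_less_iff_less_mult mult.commute)

lemma rem_bound: "rem k i j ==> i < n ^ k \<and> j < n ^ k"
proof (induction k arbitrary: i j)
 case (Suc k)
 hence "i div n < n ^ k" "j div n < n ^ k" by auto
 thus ?case using div_less_pow by blast
qed auto

lemma hole_bound: "hole k i j ==> i < n ^ k \<and> j < n ^ k"
 unfolding hole_def using rem_bound[of "k - 1" "i div n" "j div n"] div_less_pow[of _ "k - 1"] by auto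

lemma hole_not_rem: "hole k i j ==> \<not> rem k i j"
 by (cases k) (auto simp: hole_def)

lemma real_div_mod: "real i = real n * real (i div n) + real (i mod n)"
 by (metis mult_div_mod_eq of_nat_add of_nat_mult)

lemma seg_parent: assumes "seg (Suc k) i x" shows "seg k (i div n) x"
proof -
 have m: "real (i mod n) + 1 \<le> real n"
 proof -
  have "i mod n < n" by simp
  hence "i mod n + 1 \<le> n" by linarith
  thus ?thesis by (metis of_nat_1 of_nat_add of_nat_le_iff)
 qed
 have e: "x * rn (Suc k) = real n * (x * rn k)" by simp
 have 1: "real n * real (i div n) \<le> real n * (x * rn k)"
  using assms real_div_mod[of i] e of_nat_0_le_iff[of "i mod n", where 'a=real] unfolding seg_def by linarith
 have e2: "real n * (real (i div n) + 1) = real n * real (i div n) + real n" by (simp add: algebra_simps)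
 have 2: "real n * (x * rn k) \<le> real n * (real (i div n) + 1)"
  using assms real_div_mod[of i] m e e2 unfolding seg_def by linarith
 show ?thesis using 1 2 unfolding seg_def by simp
qed

lemma seg_child: assumes "seg k i x" shows "\<exists>a<n. seg (Suc k) (n * i + a) x"
proof -
 define t where "t = x * rn (Suc k) - real n * real i"
 have t: "0 \<le> t" "t \<le> real n"
 proof -
  have "real n * real i \<le> real n * (x * rn k)" "real n * (x * rn k) \<le> real n * (real i + 1)"
   using assms unfolding seg_def by (auto intro: mult_left_mono)
  thus "0 \<le> t" "t \<le> real n" unfolding t_def by (auto simp: algebra_simps)
 qed
 \<comment> \<open>The right end t = n belongs to the last subinterval, hence the cap at n -
   1.\<close>
 define a where "a = min (nat \<lfloor>t\<rfloor>) (n - 1)"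
 have "a < n" unfolding a_def using n5 by (auto simp: min_def)
 moreover have "real a \<le> t" unfolding a_def using t(1)
  by (metis min.cobounded1 of_nat_floor of_nat_le_iff order_trans)
 moreover have "t \<le> real a + 1"
 proof (cases "nat \<lfloor>t\<rfloor> \<le> n - 1")
  case True
  thus ?thesis unfolding a_def using t by (simp add: min_def)
 next
  case False
  hence "a = n - 1" by (simp add: a_def)
  thus ?thesis using t n5 by (simp add: of_nat_diff)
 qed
 ultimately show ?thesis unfolding seg_def t_def by (intro exI[of _ a]) (auto simp: algebra_simps)
qed

lemma oseg_seg_eq: assumes "oseg k i x" "seg k j x" shows "i = j"
proof -
 have "real i < real j + 1" "real j < real i + 1" using assms by (auto simp: oseg_def seg_def)
 thus ?thesis by linarith
qed

lemma oseg_imp_seg: "oseg k i x ==> seg k i x" by (auto simp: oseg_def seg_def)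
lemma osq_sub_sq: "osq k i j \<subseteq> sq k i j" by (auto simp: osq_def sq_def oseg_imp_seg)

lemma sq_parent: "z \<in> sq (Suc k) i j ==> z \<in> sq k (i div n) (j div n)"
 by (auto simp: sq_def seg_parent)

text \<open>A grid line belongs to the closed cells on both sides of it, so ancestors are ambiguous
  there; at points interior to the coarse interval they are not.\<close>

lemma oseg_anc: assumes "oseg k i x" "k \<le> l" "seg l a x" shows "a div n ^ (l - k) = i"
 using assms(2,1,3)
proof (induction arbitrary: a rule: dec_induct)
 case base
 thus ?case using oseg_seg_eq by auto
next
 case (step l)
 have "seg l (a div n) x" using step.prems(2) seg_parent by blast
 hence "a div n div n ^ (l - k) = i" using step by blast
 moreover have "Suc l - k = Suc (l - k)" using step.hyps by auto
 ultimately show ?case by (simp add: div_mult2_eq)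
qed

lemma rem_anc: "rem (k + l) i j ==> rem k (i div n ^ l) (j div n ^ l)"
proof (induction l arbitrary: i j)
 case (Suc l)
 have "rem (k + l) (i div n) (j div n)" using Suc.prems by simp
 from Suc.IH[OF this] show ?case by (simp add: div_mult2_eq)
qed auto

lemma hole_pos: assumes "hole k i j" shows "i > 0" "j > 0" "k > 0"
 using assms p1 q_facts unfolding hole_def bad_def by (auto intro: Nat.gr0I)

text \<open>A step of one from the digit p or q stays in the same parent and reaches a digit outside
  {p, q}. The surviving neighbours are what places the boundary of a hole in
  \<open>F\<close>.\<close>

lemma hole_nbr: assumes "hole k i j"
 shows "rem k (i - 1) j" "rem k (i + 1) j" "rem k i (j - 1)" "rem k i (j + 1)"
proof -
 have *: "rem k (i - 1) j \<and> rem k (i + 1) j" if h: "hole k i j" for i j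
 proof -
  from h obtain k' where k: "k = Suc k'" and r: "rem k' (i div n) (j div n)" and b: "bad (i mod n) (j mod n)"
   by (cases k) (auto simp: hole_def)
  define a where "a = i mod n"
  define c where "c = i div n"
  have i: "i = n * c + a" by (simp add: a_def c_def)
  have a: "a = p \<or> a = q" using b by (auto simp: a_def bad_def)
  have a': "1 \<le> a" "a + 1 < n" using a p1 q_facts by auto
  then obtain d where d: "a = Suc d" by (cases a) auto
  have i1: "i - 1 = n * c + d" "i + 1 = n * c + (a + 1)" using i a' d by auto
  have dm: "(n * c + x) div n = c \<and> (n * c + x) mod n = x" if "x < n" for x using that by simp
  have "(i - 1) div n = c" "(i - 1) mod n = a - 1" "(i + 1) div n = c" "(i + 1) mod n = a + 1"
   unfolding i1 using dm[of d] dm[of "a + 1"] a' d by auto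
  moreover have "a - 1 \<noteq> p \<and> a - 1 \<noteq> q \<and> a + 1 \<noteq> p \<and> a + 1 \<noteq> q" using a q_facts p1 by auto
  ultimately show ?thesis using r by (auto simp: k bad_def c_def)
 qed
 show "rem k (i - 1) j" "rem k (i + 1) j" using *[OF assms] by auto
 have "hole k j i" using assms by (simp add: hole_swap)
 from *[OF this] show "rem k i (j - 1)" "rem k i (j + 1)" by (auto simp: rem_swap)
qed

text \<open>In the next generation the point lies in a child touching the same vertical side. The
  horizontal digit of this child is 0 or n - 1, so the child survives whatever its other digit is,
  and the descent never stops.\<close>

lemma edge_in_F_x: assumes "rem k i j" "z \<in> sq k i j" "fst z * rn k = real i \<or> fst z * rn k = real i + 1"
 shows "z \<in> F"
proof -
 have *: "\<exists>i' j'. rem (k + l) i' j' \<and> z \<in> sq (k + l) i' j' \<and>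
   (fst z * rn (k + l) = real i' \<or> fst z * rn (k + l) = real i' + 1)" for l
 proof (induction l)
  case 0 thus ?case using assms by auto
 next
  case (Suc l)
  then obtain i' j' where h: "rem (k + l) i' j'" "z \<in> sq (k + l) i' j'"
   "fst z * rn (k + l) = real i' \<or> fst z * rn (k + l) = real i' + 1" by blast
  from h(2) have "seg (k + l) j' (snd z)" by (simp add: sq_def)
  then obtain b where b: "b < n" "seg (Suc (k + l)) (n * j' + b) (snd z)" using seg_child by blast
  define a where "a = (if fst z * rn (k + l) = real i' then 0 else n - 1)"
  have a: "a < n" "a \<noteq> p" "a \<noteq> q" using p1 q_facts by (auto simp: a_def)
  have e: "fst z * rn (Suc (k + l)) = real n * (fst z * rn (k + l))" by simp
  have ee: "fst z * rn (Suc (k + l)) = real (n * i' + a) \<or> fst z * rn (Suc (k + l)) = real (n * i' + a) + 1"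
  proof (cases "fst z * rn (k + l) = real i'")
   case True thus ?thesis unfolding e a_def by simp
  next
   case False
   hence "fst z * rn (k + l) = real i' + 1" using h(3) by blast
   thus ?thesis unfolding e a_def using False n5 by (simp add: of_nat_diff algebra_simps)
  qed
  hence s: "seg (Suc (k + l)) (n * i' + a) (fst z)" unfolding seg_def by auto
  have "rem (Suc (k + l)) (n * i' + a) (n * j' + b)" using h(1) a b by (simp add: bad_def)
  thus ?case using s b ee by (intro exI[of _ "n * i' + a"] exI[of _ "n * j' + b"]) (auto simp: sq_def)
 qed
 show ?thesis unfolding F_def
 proof (clarify)
  fix l
  obtain i' j' where h: "rem (k + l) i' j'" "z \<in> sq (k + l) i' j'" using * by blast
  have "z \<in> sq l (i' div n ^ k) (j' div n ^ k)" using h(2)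
  proof (induction k arbitrary: i' j')
   case (Suc k)
   hence "z \<in> sq (k + l) (i' div n) (j' div n)" using sq_parent[of z "k + l"] by simp
   from Suc.IH[OF this] show ?case by (simp add: div_mult2_eq)
  qed auto
  moreover have "rem l (i' div n ^ k) (j' div n ^ k)" using rem_anc[of l k i' j'] h(1) by (simp add: add.commute)
  ultimately show "\<exists>i j. rem l i j \<and> z \<in> sq l i j" by blast
 qed
qed

lemma edge_in_F_y: assumes "rem k i j" "z \<in> sq k i j" "snd z * rn k = real j \<or> snd z * rn k = real j + 1"
 shows "z \<in> F"
 using edge_in_F_x[of k j i "prod.swap z"] assms by (auto simp: rem_swap sq_swap F_swap)

lemma circ_alt: "z \<in> circ k i j \<longleftrightarrow> z \<in> sq k i j \<and> (fst z * rn k = real i \<or> fst z * rn k = real i + 1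
  \<or> snd z * rn k = real j \<or> snd z * rn k = real j + 1)"
 unfolding circ_def sq_def osq_def seg_def oseg_def by auto

lemma circ_rem_F: "rem k i j ==> circ k i j \<subseteq> F"
 using edge_in_F_x edge_in_F_y by (auto simp: circ_alt)

lemma circ_hole_F: assumes h: "hole k i j" shows "circ k i j \<subseteq> F"
proof
 fix z assume "z \<in> circ k i j"
 hence z: "z \<in> sq k i j" and c: "fst z * rn k = real i \<or> fst z * rn k = real i + 1
  \<or> snd z * rn k = real j \<or> snd z * rn k = real j + 1" by (auto simp: circ_alt)
 note pos = hole_pos[OF h]
 note nb = hole_nbr[OF h]
 have ri: "real (i - 1) = real i - 1" "real (j - 1) = real j - 1" using pos by (auto simp: of_nat_diff)
 from c show "z \<in> F"
 proof (elim disjE)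
  assume "fst z * rn k = real i"
  thus ?thesis using edge_in_F_x[OF nb(1), of z] z ri by (auto simp: sq_def seg_def)
 next
  assume "fst z * rn k = real i + 1"
  thus ?thesis using edge_in_F_x[OF nb(2), of z] z ri by (auto simp: sq_def seg_def)
 next
  assume "snd z * rn k = real j"
  thus ?thesis using edge_in_F_y[OF nb(3), of z] z ri by (auto simp: sq_def seg_def)
 next
  assume "snd z * rn k = real j + 1"
  thus ?thesis using edge_in_F_y[OF nb(4), of z] z ri by (auto simp: sq_def seg_def)
 qed
qed

lemma osq_hole_disj: assumes "hole k i j" "z \<in> osq k i j" "rem l a b" "k \<le> l" shows "z \<notin> sq l a b"
proof
 assume "z \<in> sq l a b"
 hence "a div n ^ (l - k) = i" "b div n ^ (l - k) = j"
  using oseg_anc[OF _ assms(4)] assms(2) by (auto simp: sq_def osq_def)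
 moreover have "rem k (a div n ^ (l - k)) (b div n ^ (l - k))" using rem_anc[of k "l - k" a b] assms by simp
 ultimately show False using assms(1) hole_not_rem by blast
qed

lemma F_osq_hole: assumes "hole k i j" shows "F \<inter> osq k i j = {}"
proof -
 have "z \<notin> F" if z: "z \<in> osq k i j" for z
 proof
  assume "z \<in> F"
  then obtain a b where "rem k a b" "z \<in> sq k a b" unfolding F_def by blast
  thus False using osq_hole_disj[OF assms z, of k a b] by simp
 qed
 thus ?thesis by blast
qed

lemma sq_zero: "sq 0 0 0 = unit_sq" by (auto simp: sq_def seg_def)

lemma F_unit: "F \<subseteq> unit_sq"
proof
 fix z assume "z \<in> F"
 then obtain i j where "rem 0 i j" "z \<in> sq 0 i j" unfolding F_def by blast
 thus "z \<in> unit_sq" using sq_zero by simp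
qed

text \<open>In the first generation where z lies in no surviving square, its parent square still
  survives; so z lies in a hole of that generation, and not on its boundary, because boundaries
  belong to \<open>F\<close>.\<close>

lemma not_F_hole: assumes "z \<in> unit_sq" "z \<notin> F" shows "\<exists>k i j. hole k i j \<and> z \<in> osq k i j"
proof -
 have ex: "\<exists>k. \<not> (\<exists>i j. rem k i j \<and> z \<in> sq k i j)" using assms(2) by (auto simp: F_def)
 define m where "m = (LEAST k. \<not> (\<exists>i j. rem k i j \<and> z \<in> sq k i j))"
 have m: "\<not> (\<exists>i j. rem m i j \<and> z \<in> sq m i j)" unfolding m_def by (rule LeastI_ex[OF ex])
 have m0: "m \<noteq> 0" using m assms(1) sq_zero by (metis rem.simps(1))
 then obtain k where k: "m = Suc k" by (cases m) auto
 have "\<exists>i j. rem k i j \<and> z \<in> sq k i j" using not_less_Least[of k "\<lambda>k. \<not> (\<exists>i j. rem k i j \<and> z \<in> sq k i j)"] k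
  unfolding m_def by auto
 then obtain i j where ij: "rem k i j" "z \<in> sq k i j" by blast
 obtain a where a: "a < n" "seg (Suc k) (n * i + a) (fst z)" using seg_child ij(2) by (force simp: sq_def)
 obtain b where b: "b < n" "seg (Suc k) (n * j + b) (snd z)" using seg_child ij(2) by (force simp: sq_def)
 have z: "z \<in> sq (Suc k) (n * i + a) (n * j + b)" using a b by (simp add: sq_def)
 have dm: "(n * x + y) div n = x \<and> (n * x + y) mod n = y" if "y < n" for x y using that by simp
 have bd: "bad a b" using m k z ij dm[OF a(1), of i] dm[OF b(1), of j] by force
 have h: "hole (Suc k) (n * i + a) (n * j + b)" using ij a b bd by (simp add: hole_def)
 have "z \<notin> circ (Suc k) (n * i + a) (n * j + b)" using circ_hole_F[OF h] assms by auto
 hence "z \<in> osq (Suc k) (n * i + a) (n * j + b)" using z by (simp add: circ_def)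
 thus ?thesis using h by blast
qed

lemma F_alt: "F = unit_sq - (\<Union>{osq k i j | k i j. hole k i j})"
proof (intro equalityI subsetI)
 fix z assume z: "z \<in> F"
 hence "z \<notin> osq k i j" if "hole k i j" for k i j using F_osq_hole[OF that] by blast
 thus "z \<in> unit_sq - (\<Union>{osq k i j | k i j. hole k i j})" using z F_unit by blast
next
 fix z assume z: "z \<in> unit_sq - (\<Union>{osq k i j | k i j. hole k i j})"
 show "z \<in> F"
 proof (rule ccontr)
  assume "z \<notin> F"
  with z obtain k i j where "hole k i j" "z \<in> osq k i j" using not_F_hole[of z] by blast
  thus False using z by blast
 qed
qed

lemma closed_sq: "closed (sq k i j)"
proof -
 have "sq k i j = {z. real i \<le> fst z * rn k} \<inter> {z. fst z * rn k \<le> real i + 1} \<inter>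
   {z. real j \<le> snd z * rn k} \<inter> {z. snd z * rn k \<le> real j + 1}"
  by (auto simp: sq_def seg_def)
 also have "closed ..." by (intro closed_Int closed_Collect_le continuous_intros)
 finally show ?thesis .
qed

lemma open_osq: "open (osq k i j)"
proof -
 have "osq k i j = {z. real i < fst z * rn k} \<inter> {z. fst z * rn k < real i + 1} \<inter>
   {z. real j < snd z * rn k} \<inter> {z. snd z * rn k < real j + 1}"
  by (auto simp: osq_def oseg_def)
 also have "open ..." by (intro open_Int open_Collect_less continuous_intros)
 finally show ?thesis .
qed

lemma closed_F: "closed F"
 unfolding F_alt by (intro closed_Diff closed_Times open_Union) (auto simp: open_osq)

lemma compact_F: "compact F"
proof -
 have "compact ({0..1::real} \<times> {0..1::real})" by (intro compact_Times) auto
 moreover have "F = unit_sq \<inter> F" using F_unit by auto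
 ultimately show ?thesis using closed_F compact_Int_closed by metis
qed

definition St :: "nat => plane set" where
 "St k = {z. \<exists>i j. rem k i j \<and> z \<in> sq k i j}"

lemma F_St: "F = (\<Inter>k. St k)" by (auto simp: F_def St_def)

lemma finite_rem: "finite {(i, j). rem k i j}"
 by (rule finite_subset[of _ "ix k \<times> ix k"]) (auto dest: rem_bound)

lemma closed_St: "closed (St k)"
proof -
 have "St k = (\<Union>x \<in> {(i, j). rem k i j}. sq k (fst x) (snd x))" unfolding St_def by force
 also have "closed ..." by (rule closed_UN[OF finite_rem]) (auto simp: closed_sq)
 finally show ?thesis .
qed

lemma St_mono: "St (Suc k) \<subseteq> St k" 
proof
 fix z assume "z \<in> St (Suc k)"
 then obtain i j where "rem (Suc k) i j" "z \<in> sq (Suc k) i j" unfolding St_def by blast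
 hence "rem k (i div n) (j div n)" "z \<in> sq k (i div n) (j div n)" using sq_parent by auto
 thus "z \<in> St k" unfolding St_def by blast
qed

type_synonym label = "nat \<times> nat \<times> nat"

subsection \<open>Row sums over lattice cells\<close>

text \<open>A lattice cell of generation \<open>k\<close> is attributed to the hole containing it, or to itself.\<close>

primrec lab :: "nat => nat => nat => label" where
 "lab 0 i j = (0, i, j)"
| "lab (Suc k) i j = (if rem k (i div n) (j div n) then (Suc k, i, j) else lab k (i div n) (j div n))"

text \<open>A hole is represented by its boundary alone, since functions are evaluated on
  \<open>F\<close> only.\<close>

fun elt :: "nat \<times> nat \<times> nat => plane set" where
 "elt (m, i, j) = (if rem m i j then sq m i j \<inter> F else circ m i j)"

abbreviation col_hit :: "plane set => nat => nat => bool" where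
 "col_hit S k i \<equiv> \<exists>j<n ^ k. \<exists>P\<in>elt (lab k i j). P \<in> S"

abbreviation row_hit :: "plane set => nat => nat => bool" where
 "row_hit S k j \<equiv> \<exists>i<n ^ k. \<exists>P\<in>elt (lab k i j). P \<in> S"

abbreviation cols_dense :: "plane set => real => nat => bool" where
 "cols_dense S t k \<equiv> \<exists>I\<subseteq>ix k. t * rn k \<le> real (card I) \<and> (\<forall>i\<in>I. col_hit S k i)"

abbreviation rows_dense :: "plane set => real => nat => bool" where
 "rows_dense S t k \<equiv> \<exists>I\<subseteq>ix k. t * rn k \<le> real (card I) \<and> (\<forall>j\<in>I. row_hit S k j)"

lemma lab_props:
 assumes "i < n ^ k" "j < n ^ k" "lab k i j = (m, a, b)"
 shows "m \<le> k \<and> a = i div n ^ (k - m) \<and> b = j div n ^ (k - m) \<and> ((m = k \<and> rem k i j) \<or> hole m a b)"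
 using assms
proof (induction k arbitrary: i j)
 case (Suc k)
 show ?case
 proof (cases "rem k (i div n) (j div n)")
  case True
  hence "m = Suc k" "a = i" "b = j" using Suc.prems by auto
  moreover have "rem (Suc k) i j \<or> hole (Suc k) i j" using True by (auto simp: hole_def)
  ultimately show ?thesis by auto
 next
  case False
  have "i div n < n ^ k" "j div n < n ^ k" using Suc.prems div_less_pow by auto
  moreover have "lab k (i div n) (j div n) = (m, a, b)" using False Suc.prems by simp
  ultimately have *: "m \<le> k \<and> a = i div n div n ^ (k - m) \<and> b = j div n div n ^ (k - m) \<and>
    ((m = k \<and> rem k (i div n) (j div n)) \<or> hole m a b)" using Suc.IH by blast
  hence "Suc k - m = Suc (k - m)" by auto
  thus ?thesis using * False by (auto simp: div_mult2_eq)
 qed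
qed auto

lemma lab_rem: "rem k i j ==> lab k i j = (k, i, j)"
 by (cases k) auto

lemma lab_hole:
 assumes "hole m a b" "m \<le> k" "i div n ^ (k - m) = a" "j div n ^ (k - m) = b"
 shows "lab k i j = (m, a, b)"
 using assms(2,3,4)
proof (induction k arbitrary: i j rule: dec_induct)
 case base
 thus ?case using assms(1) by (cases m) (auto simp: hole_def)
next
 case (step k)
 have d: "Suc k - m = Suc (k - m)" using step.hyps by auto
 have 1: "i div n div n ^ (k - m) = a" "j div n div n ^ (k - m) = b"
  using step.prems d by (auto simp: div_mult2_eq)
 have "\<not> rem k (i div n) (j div n)"
 proof
  assume "rem k (i div n) (j div n)"
  hence "rem m (i div n div n ^ (k - m)) (j div n div n ^ (k - m))"
   using rem_anc[of m "k - m"] step.hyps by simp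
  thus False using 1 assms(1) hole_not_rem by auto
 qed
 thus ?case using step.IH[OF 1] by simp
qed

lemma lab_swap: "lab k j i = (case lab k i j of (m, a, b) => (m, b, a))"
proof (induction k arbitrary: i j)
 case (Suc k)
 show ?case using Suc[of "j div n" "i div n"] rem_swap[of k "j div n" "i div n"] by simp
qed simp

lemma div_eqI: fixes a M i :: nat assumes "a * M \<le> i" "i < (a + 1) * M" shows "i div M = a"
 using assms by (intro div_nat_eqI) (auto simp: algebra_simps)

lemma swap_image_iff: "z \<in> prod.swap ` A \<longleftrightarrow> prod.swap z \<in> A"
 by (cases z) force

lemma swap_image_sq: "prod.swap ` sq m i j = sq m j i"
 by (intro set_eqI) (simp add: swap_image_iff sq_swap)
lemma swap_image_F: "prod.swap ` F = F"
 by (intro set_eqI) (simp add: swap_image_iff F_swap)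
lemma swap_image_circ: "prod.swap ` circ m i j = circ m j i"
 by (intro set_eqI) (simp add: swap_image_iff circ_swap)

lemma div_bounds: fixes i M :: nat assumes "M > 0"
 shows "(i div M) * M \<le> i" "i < (i div M + 1) * M"
proof -
 have 1: "(i div M) * M + i mod M = i" by simp
 have 2: "i mod M < M" using assms by simp
 have 3: "(i div M + 1) * M = (i div M) * M + M" by simp
 show "(i div M) * M \<le> i" "i < (i div M + 1) * M" using 1 2 3 by linarith+
qed

lemma elt_swap: "prod.swap ` elt (m, i, j) = elt (m, j, i)"
proof (cases "rem m i j")
 case True
 moreover have "rem m j i" using True rem_swap[of m j i] by simp
 ultimately show ?thesis by (simp add: image_Int[OF inj_swap] swap_image_sq swap_image_F)
next
 case False
 moreover have "\<not> rem m j i" using False rem_swap[of m j i] by simp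
 ultimately show ?thesis by (simp add: swap_image_circ)
qed

lemma elt_lab_F: assumes "i < n ^ k" "j < n ^ k" shows "elt (lab k i j) \<subseteq> F"
proof -
 obtain m a b where l: "lab k i j = (m, a, b)" by (metis prod_cases3)
 from lab_props[OF assms l] circ_hole_F[of m a b] hole_not_rem[of m a b] show ?thesis
  unfolding l by auto
qed

lemma lat_mem_sq:
 fixes i j k m a b :: nat
 assumes "m \<le> k" "a * n ^ (k - m) \<le> i" "i \<le> (a + 1) * n ^ (k - m)" "b * n ^ (k - m) \<le> j" "j \<le> (b + 1) * n ^ (k - m)"
 shows "(gr k i, gr k j) \<in> sq m a b"
proof -
 have e: "rn k = rn (k - m) * rn m" using assms(1) by (simp add: power_add[symmetric])
 have r: "gr k x * rn m = gr (k - m) x" for x using e by (simp add: field_simps)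
 have "real (a * n ^ (k - m)) \<le> real i" "real i \<le> real ((a + 1) * n ^ (k - m))"
    "real (b * n ^ (k - m)) \<le> real j" "real j \<le> real ((b + 1) * n ^ (k - m))"
  using assms by (auto simp only: of_nat_le_iff)
 thus ?thesis unfolding sq_def seg_def mem_Collect_eq fst_conv snd_conv r
  by (auto simp: field_simps)
qed

text \<open>A hole covers a full block of columns, so a change of label to the right of a cell
  happens exactly at the right side of its element. Lattice points on that line lie on the boundary
  of the element; together with \<open>left_pt\<close> they allow passing from one element of a row
  to the next inside \<open>F\<close>.\<close>

lemma right_pt:
 assumes "i < n ^ k" "j < n ^ k" "lab k i j \<noteq> lab k (i + 1) j \<or> Suc i = n ^ k" "jj = j \<or> jj = Suc j"
 shows "(gr k (i + 1), gr k jj) \<in> elt (lab k i j)"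
proof -
 obtain m a b where l: "lab k i j = (m, a, b)" by (metis prod_cases3)
 note P = lab_props[OF assms(1,2) l]
 define M where "M = n ^ (k - m)"
 have M: "M > 0" by (simp add: M_def)
 have a: "a = i div M" and b: "b = j div M" and mk: "m \<le> k" using P by (auto simp: M_def)
 have bj: "b * M \<le> jj" "jj \<le> (b + 1) * M"
 proof -
  have "b * M \<le> j" "j < (b + 1) * M" unfolding b using div_bounds[OF M, of j] by auto
  thus "b * M \<le> jj" "jj \<le> (b + 1) * M" using assms(4) by auto
 qed
 have ai: "a * M \<le> i" "i < (a + 1) * M" unfolding a using div_bounds[OF M, of i] by auto
 have sqm: "(gr k (i + 1), gr k jj) \<in> sq m a b"
  using lat_mem_sq[OF mk, of a "i + 1" b jj] bj ai by (auto simp: M_def)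
 have e: "i + 1 = (a + 1) * M"
 proof (cases "m = k \<and> rem k i j")
  case True thus ?thesis using a by (simp add: M_def)
 next
  case False
  hence h: "hole m a b" using P by auto
  have "(i + 1) div M \<noteq> a \<or> Suc i = n ^ k"
  proof (rule ccontr)
   assume as: "\<not> ((i + 1) div M \<noteq> a \<or> Suc i = n ^ k)"
   hence "lab k (i + 1) j = (m, a, b)" using lab_hole[OF h mk] b by (auto simp: M_def)
   thus False using assms(3) l as by auto
  qed
  moreover have "Suc i = (a + 1) * M" if "Suc i = n ^ k"
  proof -
   have "(a + 1) * M \<le> n ^ k"
   proof -
    have "a < n ^ m" using hole_bound[OF h] by auto
    hence "(a + 1) * M \<le> n ^ m * M" by (intro mult_right_mono) auto
    also have "... = n ^ k" using mk by (simp add: M_def power_add[symmetric])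
    finally show ?thesis .
   qed
   thus ?thesis using ai that by auto
  qed
  moreover have "Suc i = (a + 1) * M" if "(i + 1) div M \<noteq> a"
  proof (rule ccontr)
   assume "Suc i \<noteq> (a + 1) * M"
   hence "a * M \<le> i + 1" "i + 1 < (a + 1) * M" using ai by auto
   hence "(i + 1) div M = a" using div_eqI by blast
   thus False using that by simp
  qed
  ultimately show ?thesis unfolding Suc_eq_plus1 by blast
 qed
 have "gr k (i + 1) * rn m = real (a + 1)"
 proof -
  have "rn k = real M * rn m" using mk by (simp add: M_def power_add[symmetric])
  moreover have "real (i + 1) = real (a + 1) * real M" using e by (metis of_nat_mult)
  ultimately show ?thesis using M by (simp add: field_simps)
 qed
 hence c: "(gr k (i + 1), gr k jj) \<in> circ m a b"
  using sqm unfolding circ_alt by auto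
 thus ?thesis unfolding l using sqm circ_rem_F[of m a b] by auto
qed

lemma left_pt:
 assumes "i < n ^ k" "j < n ^ k" "i = 0 \<or> lab k (i - 1) j \<noteq> lab k i j" "jj = j \<or> jj = Suc j"
 shows "(gr k i, gr k jj) \<in> elt (lab k i j)"
proof -
 obtain m a b where l: "lab k i j = (m, a, b)" by (metis prod_cases3)
 note P = lab_props[OF assms(1,2) l]
 define M where "M = n ^ (k - m)"
 have M: "M > 0" by (simp add: M_def)
 have a: "a = i div M" and b: "b = j div M" and mk: "m \<le> k" using P by (auto simp: M_def)
 have bj: "b * M \<le> jj" "jj \<le> (b + 1) * M"
 proof -
  have "b * M \<le> j" "j < (b + 1) * M" unfolding b using div_bounds[OF M, of j] by auto
  thus "b * M \<le> jj" "jj \<le> (b + 1) * M" using assms(4) by auto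
 qed
 have ai: "a * M \<le> i" "i < (a + 1) * M" unfolding a using div_bounds[OF M, of i] by auto
 have sqm: "(gr k i, gr k jj) \<in> sq m a b"
  using lat_mem_sq[OF mk, of a i b jj] bj ai by (auto simp: M_def)
 have e: "i = a * M"
 proof (cases "m = k \<and> rem k i j")
  case True thus ?thesis using a by (simp add: M_def)
 next
  case False
  hence h: "hole m a b" using P by auto
  show ?thesis
  proof (rule ccontr)
   assume ne: "i \<noteq> a * M"
   hence i0: "i > 0" and "a * M \<le> i - 1" "i - 1 < (a + 1) * M" using ai by auto
   hence "(i - 1) div M = a" using div_eqI by blast
   hence "lab k (i - 1) j = (m, a, b)" using lab_hole[OF h mk] b by (auto simp: M_def)
   thus False using assms(3) l i0 by auto
  qed
 qed
 have "gr k i * rn m = real a"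
 proof -
  have "rn k = real M * rn m" using mk by (simp add: M_def power_add[symmetric])
  moreover have "real i = real a * real M" using e by (metis of_nat_mult)
  ultimately show ?thesis using M by (simp add: field_simps)
 qed
 hence c: "(gr k i, gr k jj) \<in> circ m a b"
  using sqm unfolding circ_alt by auto
 thus ?thesis unfolding l using sqm circ_rem_F[of m a b] by auto
qed

section \<open>Oscillation along rows and columns\<close>

definition osc :: "('a => 'b::metric_space) => 'a set => real" where
 "osc u A = diameter (u ` A)"

lemma osc_ge: "bounded (u ` A) ==> x \<in> A ==> y \<in> A ==> dist (u x) (u y) \<le> osc u A"
 unfolding osc_def by (rule diameter_bounded_bound) auto

lemma osc_le:
 assumes "\<And>x y. x \<in> A ==> y \<in> A ==> dist (u x) (u y) \<le> d" "0 \<le> d"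
 shows "osc u A \<le> d"
proof (cases "A = {}")
 case True thus ?thesis using assms by (simp add: osc_def)
next
 case False
 hence "diameter (u ` A) = (SUP (x,y) \<in> u ` A \<times> u ` A. dist x y)" by (simp add: diameter_def)
 also have "... \<le> d" using False assms(1) by (intro cSUP_least) auto
 finally show ?thesis by (simp add: osc_def)
qed

lemma osc_nonneg: "bounded (u ` A) ==> 0 \<le> osc u A"
 unfolding osc_def by (rule diameter_ge_0)

text \<open>Neighbouring elements of a row share a lattice point, so the increments telescope.
  Summing over the set of labels counts a wide hole once, however many columns it spans.\<close>

lemma row_chain:
 fixes u :: "plane => real"
 assumes bd: "bounded (u ` F)" and j: "j < n ^ k" and i2: "i2 < n ^ k" and i: "i1 \<le> i2"
  and x: "x \<in> elt (lab k i1 j)" and y: "y \<in> elt (lab k i2 j)"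
 shows "\<bar>u x - u y\<bar> \<le> (\<Sum>e\<in>(\<lambda>i. lab k i j) ` {i1..i2}. osc u (elt e))"
 using i i2 y
proof (induction i2 arbitrary: y rule: dec_induct)
 case base
 have "elt (lab k i1 j) \<subseteq> F" using elt_lab_F base j by auto
 hence "bounded (u ` elt (lab k i1 j))" using bd by (meson bounded_subset image_mono)
 thus ?case using osc_ge[of u "elt (lab k i1 j)" x y] x base by (simp add: dist_real_def)
next
 case (step i2)
 have b: "bounded (u ` elt (lab k i j))" if "i < n ^ k" for i
  using elt_lab_F[OF that j] bd by (meson bounded_subset image_mono)
 have fin: "finite ((\<lambda>i. lab k i j) ` {i1..i2})" by simp
 have nn: "0 \<le> osc u (elt e)" if "e \<in> (\<lambda>i. lab k i j) ` {i1..Suc i2}" for e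
  using that b step.prems by (auto intro!: osc_nonneg)
 have set: "(\<lambda>i. lab k i j) ` {i1..Suc i2} = insert (lab k (Suc i2) j) ((\<lambda>i. lab k i j) ` {i1..i2})"
  using step.hyps by (simp add: atLeastAtMostSuc_conv)
 show ?case
 proof (cases "lab k (Suc i2) j = lab k i2 j")
  case True
  hence "\<bar>u x - u y\<bar> \<le> (\<Sum>e\<in>(\<lambda>i. lab k i j) ` {i1..i2}. osc u (elt e))"
   using step by auto
  moreover have "(\<lambda>i. lab k i j) ` {i1..Suc i2} = (\<lambda>i. lab k i j) ` {i1..i2}"
   using set True step.hyps by auto
  ultimately show ?thesis by simp
 next
  case False
  define P where "P = (gr k (i2 + 1), gr k j)"
  have P1: "P \<in> elt (lab k i2 j)" unfolding P_def using right_pt[of i2 k j j] False step.prems j by auto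
  have P2: "P \<in> elt (lab k (Suc i2) j)" unfolding P_def using left_pt[of "Suc i2" k j j] False step.prems j by auto
  have 1: "\<bar>u x - u P\<bar> \<le> (\<Sum>e\<in>(\<lambda>i. lab k i j) ` {i1..i2}. osc u (elt e))"
   using step.IH[OF _ P1] step.prems by auto
  show ?thesis
  proof (cases "lab k (Suc i2) j \<in> (\<lambda>i. lab k i j) ` {i1..i2}")
   case True
   txt \<open>A label that reappears belongs to one hole, whose columns are consecutive.\<close>
   then obtain i' where i': "i' \<in> {i1..i2}" "lab k (Suc i2) j = lab k i' j" by auto
   obtain m a b' where l: "lab k (Suc i2) j = (m, a, b')" by (metis prod_cases3)
   have ii: "i' < n ^ k" using i' step.prems by auto
   note Q1 = lab_props[OF step.prems(1) j l]
   note Q2 = lab_props[OF ii j, of m a b']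
   have mk: "m \<le> k" using Q1 by auto
   have a1: "a = Suc i2 div n ^ (k - m)" "a = i' div n ^ (k - m)" using Q1 Q2 l i' by auto
   have "i' div n ^ (k - m) \<le> i2 div n ^ (k - m)" "i2 div n ^ (k - m) \<le> Suc i2 div n ^ (k - m)"
    using i' by (auto intro: div_le_mono)
   hence a2: "i2 div n ^ (k - m) = a" using a1 by linarith
   have "hole m a b'"
   proof (rule ccontr)
    assume "\<not> hole m a b'"
    hence "m = k" using Q1 by auto
    thus False using a1 a2 by simp
   qed
   hence "lab k i2 j = (m, a, b')" using lab_hole mk a2 Q1 by blast
   thus ?thesis using False l by simp
  next
   case nin: False
   have "\<bar>u P - u y\<bar> \<le> osc u (elt (lab k (Suc i2) j))"
    using osc_ge[OF b[OF step.prems(1)] P2 step.prems(2)] by (simp add: dist_real_def)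
   thus ?thesis unfolding set using nin 1 fin by simp
  qed
 qed
qed

text \<open>An element spanning several columns spreads its oscillation evenly over them, so a row sum counts it once.\<close>

definition cost :: "nat => (plane => real) => nat => nat => real" where
 "cost k u i j = osc u (elt (lab k i j)) / rn (k - fst (lab k i j))"

lemma lab_ex: obtains m a b where "lab k i j = (m, a, b)" by (metis prod_cases3)

lemma bounded_elt: "bounded (u ` F) ==> i < n ^ k ==> j < n ^ k ==> bounded (u ` elt (lab k i j))"
 using elt_lab_F by (meson bounded_subset image_mono)

lemma row_block:
 assumes "i < n ^ k" "j < n ^ k" "lab k i j = (m, a, b)"
 shows "{i'. i' < n ^ k \<and> lab k i' j = (m, a, b)} = {a * n ^ (k - m) ..< (a + 1) * n ^ (k - m)}"
proof -
 note P = lab_props[OF assms]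
 define M where "M = n ^ (k - m)"
 have M: "M > 0" by (simp add: M_def)
 have mk: "m \<le> k" and a: "a = i div M" and b: "b = j div M" using P by (auto simp: M_def)
 have am: "a < n ^ m"
 proof -
  have "i < n ^ m * M" using assms(1) mk by (simp add: M_def power_add[symmetric])
  thus ?thesis unfolding a using M by (simp add: less_mult_imp_div_less)
 qed
 have NM: "n ^ m * M = n ^ k" using mk by (simp add: M_def power_add[symmetric])
 have "i' < n ^ k \<and> lab k i' j = (m, a, b) \<longleftrightarrow> a * M \<le> i' \<and> i' < (a + 1) * M" for i'
 proof
  assume h: "i' < n ^ k \<and> lab k i' j = (m, a, b)"
  hence "a = i' div M" using lab_props[of i' k j m a b] assms by (auto simp: M_def)
  thus "a * M \<le> i' \<and> i' < (a + 1) * M" using div_bounds[OF M, of i'] by simp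
 next
  assume h: "a * M \<le> i' \<and> i' < (a + 1) * M"
  have "(a + 1) * M \<le> n ^ m * M" using am by (intro mult_right_mono) auto
  hence i': "i' < n ^ k" using h NM by linarith
  have d: "i' div M = a" using div_eqI[of a M i'] h by blast
  have "lab k i' j = (m, a, b)"
  proof (cases "hole m a b")
   case True
   thus ?thesis using lab_hole[OF True mk] d b by (simp add: M_def)
  next
   case False
   hence "m = k" "rem k i j" using P by auto
   hence "i' = i" using d a by (simp add: M_def)
   thus ?thesis using assms by simp
  qed
  thus "i' < n ^ k \<and> lab k i' j = (m, a, b)" using i' by simp
 qed
 thus ?thesis unfolding M_def[symmetric] set_eq_iff by simp
qed

text \<open>The range from x to y cuts no element of the row. The alternatives 0 and
  \<open>n ^ k\<close> cover the ends of the row, where one of the two labels would lie outside the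
  grid.\<close>

definition sat :: "nat => nat => nat => nat => bool" where
 "sat k j x y \<longleftrightarrow> y \<le> n ^ k \<and> (x = 0 \<or> x = n ^ k \<or> lab k (x - 1) j \<noteq> lab k x j) \<and> (y = n ^ k \<or> y = 0 \<or> lab k (y - 1) j \<noteq> lab k y j)"

lemma row_sum_eq:
 assumes j: "j < n ^ k" and s: "sat k j x y"
 shows "(\<Sum>e\<in>(\<lambda>i. lab k i j) ` {x..<y}. osc u (elt e)) = (\<Sum>i\<in>{x..<y}. cost k u i j)"
proof -
 let ?f = "\<lambda>i. lab k i j"
 have "(\<Sum>i\<in>{x..<y}. cost k u i j) = (\<Sum>e\<in>?f ` {x..<y}. \<Sum>i\<in>{i. i \<in> {x..<y} \<and> ?f i = e}. cost k u i j)"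
  by (rule sum.image_gen) simp
 also have "... = (\<Sum>e\<in>?f ` {x..<y}. osc u (elt e))"
 proof (rule sum.cong)
  fix e assume "e \<in> ?f ` {x..<y}"
  then obtain i0 where i0: "i0 \<in> {x..<y}" "e = lab k i0 j" by auto
  obtain m a b where l: "lab k i0 j = (m, a, b)" by (rule lab_ex)
  have y: "y \<le> n ^ k" using s by (simp add: sat_def)
  have i0N: "i0 < n ^ k" using i0 y by auto
  define M where "M = n ^ (k - m)"
  have blk: "i' < n ^ k \<and> lab k i' j = (m, a, b) \<longleftrightarrow> a * M \<le> i' \<and> i' < (a + 1) * M" for i'
   using row_block[OF i0N j l] unfolding M_def set_eq_iff by simp
  have i0b: "a * M \<le> i0" "i0 < (a + 1) * M" using blk[of i0] i0N l by auto
  have x: "x \<le> a * M"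
  proof (rule ccontr)
   assume "\<not> x \<le> a * M"
   hence 1: "a * M \<le> x - 1" "x - 1 < (a + 1) * M" "a * M \<le> x" "x < (a + 1) * M" "x \<noteq> 0"
    using i0 i0b by auto
   hence "lab k (x - 1) j = lab k x j" "x \<noteq> n ^ k" using blk[of "x - 1"] blk[of x] by auto
   thus False using s 1 unfolding sat_def by auto
  qed
  have yy: "(a + 1) * M \<le> y"
  proof (rule ccontr)
   assume "\<not> (a + 1) * M \<le> y"
   hence 1: "a * M \<le> y - 1" "y - 1 < (a + 1) * M" "a * M \<le> y" "y < (a + 1) * M" "y \<noteq> 0"
    using i0 i0b by auto
   hence "lab k (y - 1) j = lab k y j" "y \<noteq> n ^ k" using blk[of "y - 1"] blk[of y] by auto
   thus False using s 1 unfolding sat_def by auto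
  qed
  have A: "{i. i \<in> {x..<y} \<and> ?f i = e} = {a * M..<(a + 1) * M}"
  proof -
   have "i \<in> {x..<y} \<and> ?f i = e \<longleftrightarrow> a * M \<le> i \<and> i < (a + 1) * M" for i
    using blk[of i] x yy y unfolding i0(2) l by auto
   thus ?thesis unfolding set_eq_iff by simp
  qed
  have B: "cost k u i j = osc u (elt e) / real M" if "?f i = e" for i
   using that unfolding cost_def i0(2) l by (simp add: M_def)
  have "(\<Sum>i\<in>{i. i \<in> {x..<y} \<and> ?f i = e}. cost k u i j) = (\<Sum>i\<in>{i. i \<in> {x..<y} \<and> ?f i = e}. osc u (elt e) / real M)"
   by (rule sum.cong[OF refl]) (use B in blast)
  also have "... = (\<Sum>i\<in>{a * M..<(a + 1) * M}. osc u (elt e) / real M)" unfolding A ..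
  also have "... = osc u (elt e)" by (simp add: M_def algebra_simps)
  finally show "(\<Sum>i\<in>{i. i \<in> {x..<y} \<and> ?f i = e}. cost k u i j) = osc u (elt e)" .
 qed simp
 finally show ?thesis by simp
qed

lemma row_le:
 fixes u :: "plane => real"
 assumes bd: "bounded (u ` F)" and j: "j < n ^ k" and s: "sat k j x y"
  and i: "i1 \<in> {x..<y}" "i2 \<in> {x..<y}"
  and P: "P \<in> elt (lab k i1 j)" and Q: "Q \<in> elt (lab k i2 j)"
 shows "\<bar>u P - u Q\<bar> \<le> (\<Sum>i\<in>{x..<y}. cost k u i j)"
proof -
 have *: "\<bar>u P - u Q\<bar> \<le> (\<Sum>i\<in>{x..<y}. cost k u i j)"
  if i: "i1 \<in> {x..<y}" "i2 \<in> {x..<y}" "i1 \<le> i2" and P: "P \<in> elt (lab k i1 j)" and Q: "Q \<in> elt (lab k i2 j)" for P Q i1 i2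
 proof -
  have y: "y \<le> n ^ k" using s by (simp add: sat_def)
  have "\<bar>u P - u Q\<bar> \<le> (\<Sum>e\<in>(\<lambda>i. lab k i j) ` {i1..i2}. osc u (elt e))"
   using row_chain[OF bd j _ i(3) P Q] i y by auto
  also have "... \<le> (\<Sum>e\<in>(\<lambda>i. lab k i j) ` {x..<y}. osc u (elt e))"
   using i y bounded_elt[OF bd _ j] by (intro sum_mono2) (auto intro!: osc_nonneg)
  also have "... = (\<Sum>i\<in>{x..<y}. cost k u i j)" by (rule row_sum_eq[OF j s])
  finally show ?thesis .
 qed
 show ?thesis
 proof (cases "i1 \<le> i2")
  case True thus ?thesis using *[OF i True P Q] by simp
 next
  case False thus ?thesis using *[OF i(2,1) _ Q P] by (simp add: abs_minus_commute)
 qed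
qed

lemma osc_swap: "osc (u \<circ> prod.swap) A = osc u (prod.swap ` A)"
 by (simp add: osc_def image_comp)

lemma cost_swap: "cost k (u \<circ> prod.swap) i j = cost k u j i"
proof -
 obtain m a b where l: "lab k j i = (m, a, b)" by (rule lab_ex)
 have l2: "lab k i j = (m, b, a)" using lab_swap[of k i j] l by simp
 show ?thesis unfolding cost_def l l2 osc_swap elt_swap by simp
qed

lemma bounded_swap: "bounded (u ` F) ==> bounded ((u \<circ> prod.swap) ` F)"
 by (metis image_comp swap_image_F)

lemma elt_swap': "z \<in> elt (lab k i j) \<longleftrightarrow> prod.swap z \<in> elt (lab k j i)"
proof -
 obtain m a b where l: "lab k i j = (m, a, b)" by (rule lab_ex)
 have l2: "lab k j i = (m, b, a)" using lab_swap[of k j i] l by simp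
 show ?thesis unfolding l l2 using elt_swap[of m b a] swap_image_iff[of z "elt (m, b, a)"] by simp
qed

lemma col_le:
 fixes u :: "plane => real"
 assumes bd: "bounded (u ` F)" and i: "i < n ^ k" and s: "sat k i x y"
  and j: "j1 \<in> {x..<y}" "j2 \<in> {x..<y}"
  and P: "P \<in> elt (lab k i j1)" and Q: "Q \<in> elt (lab k i j2)"
 shows "\<bar>u P - u Q\<bar> \<le> (\<Sum>j\<in>{x..<y}. cost k u i j)"
proof -
 have "\<bar>(u \<circ> prod.swap) (prod.swap P) - (u \<circ> prod.swap) (prod.swap Q)\<bar> \<le> (\<Sum>j\<in>{x..<y}. cost k (u \<circ> prod.swap) j i)"
  by (rule row_le[OF bounded_swap[OF bd] i s j]) (use P Q in \<open>auto simp: elt_swap'[symmetric]\<close>)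
 thus ?thesis by (simp add: cost_swap)
qed

lemma sat_full: "sat k j 0 (n ^ k)" by (simp add: sat_def)

text \<open>An older hole containing the lattice cell would also contain its surviving
  ancestor.\<close>

lemma lab_ge:
 assumes "l \<le> k" "i < n ^ k" "j < n ^ k" "rem l (i div n ^ (k - l)) (j div n ^ (k - l))"
 shows "l \<le> fst (lab k i j)"
proof (rule ccontr)
 assume c: "\<not> l \<le> fst (lab k i j)"
 obtain m a b where L: "lab k i j = (m, a, b)" by (rule lab_ex)
 have ml: "m < l" using c L by simp
 hence h: "hole m a b" and ab: "a = i div n ^ (k - m)" "b = j div n ^ (k - m)"
  using lab_props[OF assms(2,3) L] assms(1) by auto
 have e: "k - m = (k - l) + (l - m)" using ml assms(1) by auto
 have "rem m (i div n ^ (k - l) div n ^ (l - m)) (j div n ^ (k - l) div n ^ (l - m))"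
  using rem_anc[of m "l - m"] assms(4) ml by simp
 hence "rem m a b" unfolding ab e by (simp add: div_mult2_eq power_add)
 thus False using h hole_not_rem by blast
qed

text \<open>A grid line of generation l can run through the interior of older elements only; next to
  an element of generation at least l it separates labels.\<close>

lemma lab_sep:
 assumes "l \<le> k" "0 < x" "x < n ^ k" "j < n ^ k" "n ^ (k - l) dvd x" "l \<le> fst (lab k x j) \<or> l \<le> fst (lab k (x - 1) j)"
 shows "lab k (x - 1) j \<noteq> lab k x j"
proof
 assume e: "lab k (x - 1) j = lab k x j"
 obtain m a b where L: "lab k x j = (m, a, b)" by (rule lab_ex)
 have lm: "l \<le> m" using assms(6) e L by auto
 have 1: "m \<le> k" "a = x div n ^ (k - m)" using lab_props[OF assms(3,4) L] by auto
 have 2: "a = (x - 1) div n ^ (k - m)" using lab_props[of "x - 1" k j m a b] assms e L by auto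
 have "n ^ (k - m) dvd x" using assms(5) lm by (meson dvd_trans le_imp_power_dvd diff_le_mono2)
 hence "x = a * n ^ (k - m)" using 1 by simp
 moreover have "a * n ^ (k - m) \<le> x - 1" unfolding 2 using div_bounds[of "n ^ (k - m)" "x - 1"] by simp
 ultimately show False using assms(2) by linarith
qed

text \<open>An element of generation m occupies at most the square of \<open>n ^ (k - m)\<close>
  lattice cells. In \<open>cost_sq_sum\<close> this factor cancels against the squared width by
  which \<open>cost\<close> divides, so squared costs add up to at most the squared oscillations,
  with constant 1.\<close>

lemma fib_sum:
 fixes g :: "nat \<times> nat \<times> nat => real"
 assumes Z: "Z \<subseteq> ix k \<times> ix k" and g: "\<And>e. e \<in> (\<lambda>(i, j). lab k i j) ` Z ==> 0 \<le> g e"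
 shows "(\<Sum>(i, j)\<in>Z. g (lab k i j)) \<le> (\<Sum>e\<in>(\<lambda>(i, j). lab k i j) ` Z. (rn (k - fst e))\<^sup>2 * g e)"
proof -
 let ?f = "\<lambda>(i, j). lab k i j"
 have fZ: "finite Z" using Z by (rule finite_subset) auto
 have "(\<Sum>z\<in>Z. g (?f z)) = (\<Sum>e\<in>?f ` Z. \<Sum>z\<in>{z. z \<in> Z \<and> ?f z = e}. g (?f z))"
  by (rule sum.image_gen[OF fZ])
 also have "... \<le> (\<Sum>e\<in>?f ` Z. (rn (k - fst e))\<^sup>2 * g e)"
 proof (rule sum_mono)
  fix e assume e: "e \<in> ?f ` Z"
  obtain m a b where em: "e = (m, a, b)" by (metis prod_cases3)
  define M where "M = n ^ (k - m)"
  have "{z. z \<in> Z \<and> ?f z = e} \<subseteq> {a * M..<(a + 1) * M} \<times> {b * M..<(b + 1) * M}"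
  proof
   fix z assume "z \<in> {z. z \<in> Z \<and> ?f z = e}"
   then obtain i j where z: "z = (i, j)" "(i, j) \<in> Z" "lab k i j = (m, a, b)" using em by (cases z) auto
   hence ij: "i < n ^ k" "j < n ^ k" using Z by auto
   have "a = i div M" "b = j div M" using lab_props[OF ij z(3)] by (auto simp: M_def)
   thus "z \<in> {a * M..<(a + 1) * M} \<times> {b * M..<(b + 1) * M}"
    using div_bounds[of M i] div_bounds[of M j] z by (auto simp: M_def)
  qed
  hence "card {z. z \<in> Z \<and> ?f z = e} \<le> card ({a * M..<(a + 1) * M} \<times> {b * M..<(b + 1) * M})"
   by (intro card_mono) auto
  also have "... = M ^ 2" by (simp add: card_cartesian_product power2_eq_square)
  finally have c: "real (card {z. z \<in> Z \<and> ?f z = e}) \<le> real M ^ 2" by (metis of_nat_le_iff of_nat_power)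
  have "(\<Sum>z\<in>{z. z \<in> Z \<and> ?f z = e}. g (?f z)) = real (card {z. z \<in> Z \<and> ?f z = e}) * g e"
   by simp
  also have "... \<le> real M ^ 2 * g e" using c g[OF e] by (rule mult_right_mono)
  finally show "(\<Sum>z\<in>{z. z \<in> Z \<and> ?f z = e}. g (?f z)) \<le> (rn (k - fst e))\<^sup>2 * g e"
   by (simp add: M_def em)
 qed
 finally show ?thesis by (simp add: case_prod_unfold)
qed

lemma cost_sq_sum:
 assumes Z: "Z \<subseteq> ix k \<times> ix k"
 shows "(\<Sum>(i, j)\<in>Z. (cost k u i j)\<^sup>2) \<le> (\<Sum>e\<in>(\<lambda>(i, j). lab k i j) ` Z. (osc u (elt e))\<^sup>2)"
proof -
 have "(\<Sum>(i, j)\<in>Z. (cost k u i j)\<^sup>2) = (\<Sum>(i, j)\<in>Z. (\<lambda>e. (osc u (elt e) / rn (k - fst e))\<^sup>2) (lab k i j))"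
  by (simp add: cost_def)
 also have "... \<le> (\<Sum>e\<in>(\<lambda>(i, j). lab k i j) ` Z. (rn (k - fst e))\<^sup>2 * (osc u (elt e) / rn (k - fst e))\<^sup>2)"
  by (rule fib_sum[OF Z]) auto
 also have "... = (\<Sum>e\<in>(\<lambda>(i, j). lab k i j) ` Z. (osc u (elt e))\<^sup>2)"
  by (intro sum.cong) (auto simp: power_divide)
 finally show ?thesis .
qed

lemma cost_lin_sum:
 assumes bd: "bounded (u ` F)" and Z: "Z \<subseteq> ix k \<times> ix k"
 shows "(\<Sum>(i, j)\<in>Z. cost k u i j) \<le> (\<Sum>e\<in>(\<lambda>(i, j). lab k i j) ` Z. rn (k - fst e) * osc u (elt e))"
proof -
 have nn: "0 \<le> osc u (elt e)" if "e \<in> (\<lambda>(i, j). lab k i j) ` Z" for e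
  using that Z by (auto intro!: osc_nonneg bounded_elt[OF bd])
 have "(\<Sum>(i, j)\<in>Z. cost k u i j) = (\<Sum>(i, j)\<in>Z. (\<lambda>e. osc u (elt e) / rn (k - fst e)) (lab k i j))"
  by (simp add: cost_def)
 also have "... \<le> (\<Sum>e\<in>(\<lambda>(i, j). lab k i j) ` Z. (rn (k - fst e))\<^sup>2 * (osc u (elt e) / rn (k - fst e)))"
  using nn by (intro fib_sum[OF Z] divide_nonneg_nonneg) auto
 also have "... = (\<Sum>e\<in>(\<lambda>(i, j). lab k i j) ` Z. rn (k - fst e) * osc u (elt e))"
  by (intro sum.cong) (auto simp: power2_eq_square)
 finally show ?thesis .
qed

lemma sum_cs:
 fixes f :: "'a => real"
 shows "(\<Sum>z\<in>Z. f z)\<^sup>2 \<le> real (card Z) * (\<Sum>z\<in>Z. (f z)\<^sup>2)"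
 using Cauchy_Schwarz_ineq_sum[of "\<lambda>_. 1" f Z] by simp

subsection \<open>Peripheral circles\<close>

definition Out :: "plane set" where "Out = circ 0 0 0"
definition Holes :: "plane set set" where "Holes = {circ k i j | k i j. hole k i j}"
definition Per :: "plane set set" where "Per = insert Out Holes"
definition sz :: "plane set => real" where "sz C = osc fst C"

lemma pow_pos [simp]: "rn k > 0" by simp

lemma seg_iff: "seg k i x \<longleftrightarrow> x \<in> {gr k i .. (real i + 1) / rn k}"
 unfolding seg_def by (simp add: field_simps)
lemma oseg_iff: "oseg k i x \<longleftrightarrow> x \<in> {gr k i <..< (real i + 1) / rn k}"
 unfolding oseg_def by (simp add: field_simps)

lemma sq_times: "sq k i j = {gr k i .. (real i + 1) / rn k} \<times> {gr k j .. (real j + 1) / rn k}"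
 unfolding sq_def seg_iff by auto
lemma osq_times: "osq k i j = {gr k i <..< (real i + 1) / rn k} \<times> {gr k j <..< (real j + 1) / rn k}"
 unfolding osq_def oseg_iff by auto

lemma compact_sq: "compact (sq k i j)" unfolding sq_times by (intro compact_Times) auto
lemma convex_sq: "convex (sq k i j)" unfolding sq_times by (intro convex_Times) auto
lemma compact_circ: "compact (circ k i j)"
 unfolding circ_def by (intro compact_diff compact_sq open_osq)
lemma circ_sub_sq: "circ k i j \<subseteq> sq k i j" by (auto simp: circ_def)

lemma circ_horiz: assumes "x \<in> {gr k i .. (real i + 1) / rn k}"
 shows "(x, gr k j) \<in> circ k i j" "(x, (real j + 1) / rn k) \<in> circ k i j"
 using assms unfolding circ_def sq_times osq_times by (auto simp: divide_right_mono)
lemma circ_vert: assumes "y \<in> {gr k j .. (real j + 1) / rn k}"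
 shows "(gr k i, y) \<in> circ k i j" "((real i + 1) / rn k, y) \<in> circ k i j"
 using assms unfolding circ_def sq_times osq_times by (auto simp: divide_right_mono)

lemma circ_corners: 
 "(gr k i, gr k j) \<in> circ k i j"
 "((real i + 1) / rn k, gr k j) \<in> circ k i j"
 "(gr k i, (real j + 1) / rn k) \<in> circ k i j"
 "((real i + 1) / rn k, (real j + 1) / rn k) \<in> circ k i j"
 using circ_horiz[of "gr k i" i k j] circ_horiz[of "(real i + 1) / rn k" i k j]
 by (auto simp: divide_right_mono)

lemma sq_coord_dist: "z \<in> sq k i j ==> w \<in> sq k i j ==> \<bar>fst z - fst w\<bar> \<le> 1 / rn k \<and> \<bar>snd z - snd w\<bar> \<le> 1 / rn k"
proof -
 have e: "(real i + 1) / rn k = gr k i + 1 / rn k" for i by (simp add: add_divide_distrib)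
 assume "z \<in> sq k i j" "w \<in> sq k i j"
 thus ?thesis unfolding sq_times mem_Times_iff e atLeastAtMost_iff by linarith
qed

lemma dist_le_coord: fixes z w :: "plane" shows "dist z w \<le> \<bar>fst z - fst w\<bar> + \<bar>snd z - snd w\<bar>"
 unfolding dist_prod_def dist_real_def using sqrt_sum_squares_le_sum_abs by auto

lemma coord_le_dist: fixes z w :: "plane" shows "\<bar>fst z - fst w\<bar> \<le> dist z w" "\<bar>snd z - snd w\<bar> \<le> dist z w"
 using dist_fst_le[of z w] dist_snd_le[of z w] by (auto simp: dist_real_def)

lemma sq_dist: "z \<in> sq k i j ==> w \<in> sq k i j ==> dist z w \<le> 2 / rn k"
proof -
 assume "z \<in> sq k i j" "w \<in> sq k i j"
 moreover have "2 / rn k = 1 / rn k + 1 / rn k" by simp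
 ultimately show ?thesis using sq_coord_dist[of z k i j w] dist_le_coord[of z w] by linarith
qed

lemma sz_circ: "sz (circ k i j) = 1 / rn k"
proof (rule antisym)
 show "sz (circ k i j) \<le> 1 / rn k"
  unfolding sz_def using sq_coord_dist circ_sub_sq by (intro osc_le) (auto simp: dist_real_def, blast)
 have "bounded (fst ` circ k i j)"
  by (intro compact_imp_bounded compact_continuous_image continuous_intros compact_circ)
 from osc_ge[OF this circ_corners(1) circ_corners(2)]
 show "1 / rn k \<le> sz (circ k i j)" unfolding sz_def by (simp add: dist_real_def add_divide_distrib)
qed

lemma Per_cases: assumes "C \<in> Per" obtains k i j where "C = circ k i j" "hole k i j \<or> (k = 0 \<and> i = 0 \<and> j = 0)"
 using assms by (auto simp: Per_def Holes_def Out_def)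

lemma Per_F: "C \<in> Per ==> C \<subseteq> F"
 using circ_hole_F circ_rem_F[of 0 0 0] by (auto elim!: Per_cases)

lemma Per_compact: "C \<in> Per ==> compact C" by (auto elim!: Per_cases simp: compact_circ)
lemma Per_nonempty: "C \<in> Per ==> C \<noteq> {}" using circ_corners by (elim Per_cases) blast
lemma sz_pos: "C \<in> Per ==> 0 < sz C" by (elim Per_cases) (simp add: sz_circ)
lemma sz_le1: "C \<in> Per ==> sz C \<le> 1" using n_ge1 by (elim Per_cases) (simp add: sz_circ one_le_power)
lemma Holes_Per: "Holes \<subseteq> Per" by (auto simp: Per_def)
lemma Out_Per: "Out \<in> Per" by (simp add: Per_def)
lemma sz_Out: "sz Out = 1" by (simp add: Out_def sz_circ)

lemma Per_dist: "C \<in> Per ==> z \<in> C ==> w \<in> C ==> dist z w \<le> 2 * sz C"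
proof -
 assume C: "C \<in> Per" and zw: "z \<in> C" "w \<in> C"
 obtain k i j where e: "C = circ k i j" using C by (rule Per_cases)
 have "z \<in> sq k i j" "w \<in> sq k i j" using zw circ_sub_sq[of k i j] unfolding e by auto
 from sq_dist[OF this] show ?thesis by (simp add: e sz_circ)
qed

lemma circ_inj: assumes "circ k i j = circ l a b" shows "k = l \<and> i = a \<and> j = b"
proof -
 have "1 / rn k = 1 / rn l" using sz_circ[of k i j] sz_circ[of l a b] assms by simp
 hence "rn k = rn l" by simp
 hence kl: "k = l" using n5 by simp
 have 1: "(gr k i, gr k j) \<in> circ k a b" using circ_corners(1)[of i k j] assms kl by simp
 have 2: "(gr k a, gr k b) \<in> circ k i j" using circ_corners(1)[of a k b] assms kl by simp
 have "gr k i = gr k a" "gr k j = gr k b"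
  using 1 2 unfolding circ_def sq_times by auto
 thus ?thesis using kl by simp
qed

lemma hole_Suc_anc: assumes "hole l a b" "k < l" shows "rem k (a div n ^ (l - k)) (b div n ^ (l - k))"
proof -
 have r: "rem (l - 1) (a div n) (b div n)" using assms by (auto simp: hole_def)
 have e: "l - 1 = k + (l - 1 - k)" "l - k = Suc (l - 1 - k)" using assms by auto
 have "rem k (a div n div n ^ (l - 1 - k)) (b div n div n ^ (l - 1 - k))"
  using rem_anc[of k "l - 1 - k"] r e by auto
 thus ?thesis unfolding e(2) by (simp add: div_mult2_eq)
qed

lemma osq_holes_disj: assumes "hole k i j" "hole l a b" "z \<in> osq k i j" "z \<in> osq l a b" shows "(k, i, j) = (l, a, b)"
proof -
 have *: "(k, i, j) = (l, a, b)" if h: "hole k i j" "hole l a b" "z \<in> osq k i j" "z \<in> osq l a b" "k \<le> l" for k i j l a b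
 proof -
  have "seg l a (fst z)" "seg l b (snd z)" using h osq_sub_sq by (auto simp: osq_def oseg_imp_seg)
  hence d: "a div n ^ (l - k) = i" "b div n ^ (l - k) = j"
   using oseg_anc[OF _ h(5)] h(3) by (auto simp: osq_def)
  show ?thesis
  proof (cases "k = l")
   case True thus ?thesis using d by simp
  next
   case False
   hence "rem k i j" using hole_Suc_anc[OF h(2), of k] h(5) d by simp
   thus ?thesis using h(1) hole_not_rem by blast
  qed
 qed
 show ?thesis
 proof (cases "k \<le> l")
  case True thus ?thesis using * assms by blast
 next
  case False
  hence "(l, a, b) = (k, i, j)" using *[OF assms(2,1,4,3)] by simp
  thus ?thesis by simp
 qed
qed

lemma meas_rect:
 assumes "a \<le> b" "c \<le> d"
 shows "emeasure lborel ({a<..<b} \<times> {c<..<d} :: plane set) = ennreal ((b - a) * (d - c))"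
  "emeasure lborel ({a..b} \<times> {c..d} :: plane set) = ennreal ((b - a) * (d - c))"
proof -
 have "emeasure (lborel \<Otimes>\<^sub>M lborel) ({a<..<b} \<times> {c<..<d}) = emeasure lborel {a<..<b} * emeasure lborel {c<..<d}"
  by (rule lborel.emeasure_pair_measure_Times) auto
 thus "emeasure lborel ({a<..<b} \<times> {c<..<d} :: plane set) = ennreal ((b - a) * (d - c))"
  using assms by (simp add: lborel_prod ennreal_mult)
 have "emeasure (lborel \<Otimes>\<^sub>M lborel) ({a..b} \<times> {c..d}) = emeasure lborel {a..b} * emeasure lborel {c..d}"
  by (rule lborel.emeasure_pair_measure_Times) auto
 thus "emeasure lborel ({a..b} \<times> {c..d} :: plane set) = ennreal ((b - a) * (d - c))"
  using assms by (simp add: lborel_prod ennreal_mult)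
qed

text \<open>Comparison of areas: the open squares bounded by distinct holes are disjoint. All
  convergence statements about sizes of holes come from this bound for finite families.\<close>

lemma packing:
 assumes fin: "finite A" and A: "A \<subseteq> Holes" and sub: "\<And>C. C \<in> A ==> C \<subseteq> {a..a+s} \<times> {b..b+t}" and s: "0 \<le> s" "0 \<le> t"
 shows "(\<Sum>C\<in>A. (sz C)\<^sup>2) \<le> s * t"
proof -
 have "\<forall>C\<in>A. \<exists>e. hole (fst e) (fst (snd e)) (snd (snd e)) \<and> C = circ (fst e) (fst (snd e)) (snd (snd e))"
  using A unfolding Holes_def by fastforce
 then obtain e where e: "\<And>C. C \<in> A ==> hole (fst (e C)) (fst (snd (e C))) (snd (snd (e C)))"
  "\<And>C. C \<in> A ==> C = circ (fst (e C)) (fst (snd (e C))) (snd (snd (e C)))" by (metis (no_types))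
 define U where "U C = osq (fst (e C)) (fst (snd (e C))) (snd (snd (e C)))" for C
 have dis: "disjoint_family_on U A"
  unfolding disjoint_family_on_def
 proof (intro ballI impI)
  fix C D assume CD: "C \<in> A" "D \<in> A" "C \<noteq> D"
  show "U C \<inter> U D = {}"
  proof (rule ccontr)
   assume "U C \<inter> U D \<noteq> {}"
   then obtain z where "z \<in> U C" "z \<in> U D" by blast
   hence "e C = e D" using osq_holes_disj[OF e(1)[OF CD(1)] e(1)[OF CD(2)]] unfolding U_def by (simp add: prod_eq_iff)
   thus False using e(2) CD by metis
  qed
 qed
 have mU: "emeasure lborel (U C) = ennreal ((sz C)\<^sup>2)" if "C \<in> A" for C
 proof -
  have "sz C = 1 / rn (fst (e C))" using e(2)[OF that] sz_circ by metis
  moreover have "(real i + 1) / rn k - real i / rn k = 1 / rn k" for i k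
   by (simp add: add_divide_distrib)
  ultimately show ?thesis unfolding U_def osq_times by (subst meas_rect) (auto simp: divide_right_mono power2_eq_square)
 qed
 have msets: "U ` A \<subseteq> sets lborel" unfolding U_def using open_osq by auto
 have US: "(\<Union>C\<in>A. U C) \<subseteq> {a..a+s} \<times> {b..b+t}"
 proof
  fix z assume "z \<in> (\<Union>C\<in>A. U C)"
  then obtain C where C: "C \<in> A" "z \<in> U C" by blast
  obtain k i j where kij: "e C = (k, i, j)" by (metis prod_cases3)
  have CC: "C = circ k i j" using e(2)[OF C(1)] kij by simp
  have "(gr k i, gr k j) \<in> {a..a+s} \<times> {b..b+t}"
   "((real i + 1) / rn k, (real j + 1) / rn k) \<in> {a..a+s} \<times> {b..b+t}"
   using sub[OF C(1)] circ_corners[of i k j] unfolding CC by blast+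
  moreover have "z \<in> osq k i j" using C(2) kij by (simp add: U_def)
  ultimately show "z \<in> {a..a+s} \<times> {b..b+t}" unfolding osq_times by auto
 qed
 have "ennreal (\<Sum>C\<in>A. (sz C)\<^sup>2) = (\<Sum>C\<in>A. emeasure lborel (U C))"
  using mU by (simp add: sum_ennreal)
 also have "... = emeasure lborel (\<Union>C\<in>A. U C)" by (rule sum_emeasure[OF msets dis fin])
 also have "... \<le> emeasure lborel ({a..a+s} \<times> {b..b+t})" using US by (intro emeasure_mono) (auto simp: closed_Times)
 also have "... = ennreal (s * t)" using s by (subst meas_rect) auto
 finally show ?thesis using s by (simp add: ennreal_le_iff)
qed

lemma Holes_unit: "C \<in> Holes ==> C \<subseteq> {0..0+1} \<times> {0..0+1}"
 using Per_F[of C] Holes_Per F_unit by auto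

lemma packing1: "finite A ==> A \<subseteq> Holes ==> (\<Sum>C\<in>A. (sz C)\<^sup>2) \<le> 1"
proof -
 assume A: "finite A" "A \<subseteq> Holes"
 have "(\<Sum>C\<in>A. (sz C)\<^sup>2) \<le> 1 * 1"
  by (rule packing[OF A, of 0 1 0 1]) (use A Holes_unit in auto)
 thus ?thesis by simp
qed

lemma hole_margin: assumes "hole k i j" shows "1 \<le> i" "1 \<le> j" "i + 2 \<le> n ^ k" "j + 2 \<le> n ^ k"
 using hole_pos[OF assms] rem_bound[OF hole_nbr(2)[OF assms]] rem_bound[OF hole_nbr(4)[OF assms]] by auto

lemma Out_iff: "z \<in> Out \<longleftrightarrow> z \<in> unit_sq \<and> (fst z = 0 \<or> fst z = 1 \<or> snd z = 0 \<or> snd z = 1)"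
 unfolding Out_def circ_alt using sq_zero by auto

text \<open>Lattice cells along the sides of the unit square are never holes, so a hole is separated
  from \<open>Out\<close> by at least one cell of its own size. This relative distance is what the
  logarithmic cutoffs at points of \<open>Out\<close> exploit.\<close>

lemma Out_hole_far:
 assumes C: "C \<in> Holes" and a: "a \<in> Out" and z: "z \<in> C"
 shows "sz C \<le> max \<bar>fst z - fst a\<bar> \<bar>snd z - snd a\<bar>"
proof -
 obtain k i j where h: "hole k i j" "C = circ k i j" using C by (auto simp: Holes_def)
 note m = hole_margin[OF h(1)]
 have zz: "z \<in> sq k i j" using z h circ_sub_sq by auto
 have b: "1 / rn k \<le> gr k i" if "1 \<le> i" for i :: nat using that by (intro divide_right_mono) auto
 have c: "(real i + 1) / rn k \<le> 1 - 1 / rn k" if "i + 2 \<le> n ^ k" for i :: nat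
 proof -
  have "real (i + 2) \<le> real (n ^ k)" using that by (rule of_nat_mono)
  hence "(real i + 1) / rn k \<le> (rn k - 1) / rn k" by (intro divide_right_mono) auto
  thus ?thesis by (simp add: diff_divide_distrib)
 qed
 have "1 / rn k \<le> fst z" "fst z \<le> 1 - 1 / rn k" "1 / rn k \<le> snd z" "snd z \<le> 1 - 1 / rn k"
  using zz b[OF m(1)] b[OF m(2)] c[OF m(3)] c[OF m(4)] unfolding sq_times mem_Times_iff by auto
 thus ?thesis using a unfolding Out_iff h(2) sz_circ by (auto simp: max_def)
qed

lemma connected_circ: "connected (circ k i j)"
proof -
 let ?a = "gr k i" and ?b = "(real i + 1) / rn k"
 let ?c = "gr k j" and ?d = "(real j + 1) / rn k"
 have ab: "?a \<le> ?b" "?c \<le> ?d" by (auto simp: divide_right_mono)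
 have e: "circ k i j = (({?a..?b} \<times> {?c}) \<union> ({?b} \<times> {?c..?d})) \<union> (({?a..?b} \<times> {?d}) \<union> ({?a} \<times> {?c..?d}))"
  unfolding circ_def sq_times osq_times using ab by auto
 have i1: "(?b, ?c) \<in> ({?a..?b} \<times> {?c}) \<inter> ({?b} \<times> {?c..?d})" using ab by simp
 have i2: "(?a, ?d) \<in> ({?a..?b} \<times> {?d}) \<inter> ({?a} \<times> {?c..?d})" using ab by simp
 have i3: "(?a, ?c) \<in> (({?a..?b} \<times> {?c}) \<union> ({?b} \<times> {?c..?d})) \<inter> (({?a..?b} \<times> {?d}) \<union> ({?a} \<times> {?c..?d}))" using ab by simp
 have 1: "connected (({?a..?b} \<times> {?c}) \<union> ({?b} \<times> {?c..?d}))"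
  using i1 by (intro connected_Un connected_Times connected_Icc connected_sing) blast
 have 2: "connected (({?a..?b} \<times> {?d}) \<union> ({?a} \<times> {?c..?d}))"
  using i2 by (intro connected_Un connected_Times connected_Icc connected_sing) blast
 show ?thesis unfolding e using i3 by (intro connected_Un 1 2) blast
qed

lemma Per_connected: "C \<in> Per ==> connected C" by (elim Per_cases) (simp add: connected_circ)

end

section \<open>Topological invariance of the peripheral circles\<close>

lemma connected_square_minus:
 fixes a a' b b' :: real
 assumes "0 < a" "a \<le> a'" "a' < 1" "0 < b" "b \<le> b'" "b' < 1"
 shows "connected (unit_sq - {a..a'} \<times> {b..b'} :: plane set)"
proof -
 let ?L = "{0..<a} \<times> {0..1::real}" and ?T = "{0..1::real} \<times> {b'<..1}" and ?R = "{a'<..1} \<times> {0..1::real}" and ?B = "{0..1::real} \<times> {0..<b}"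
 have e: "unit_sq - {a..a'} \<times> {b..b'} = (?L \<union> ?T) \<union> (?R \<union> ?B)"
  using assms by auto
 have i: "(0, 1) \<in> ?L \<inter> ?T" "(1, 0) \<in> ?R \<inter> ?B" "(0, 0) \<in> (?L \<union> ?T) \<inter> (?R \<union> ?B)" using assms by auto
 have c: "connected ?L" "connected ?T" "connected ?R" "connected ?B"
  by (simp_all add: connected_Times_eq is_interval_connected is_interval_co is_interval_oc is_interval_cc connected_Icc)
 have LT: "connected (?L \<union> ?T)" using i(1) by (intro connected_Un[OF c(1,2)]) blast
 have RB: "connected (?R \<union> ?B)" using i(2) by (intro connected_Un[OF c(3,4)]) blast
 show ?thesis unfolding e using i(3) by (intro connected_Un[OF LT RB]) blast
qed

context carpet_np begin

lemma oseg_parent: assumes "oseg (Suc k) i x" shows "oseg k (i div n) x"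
proof -
 have m: "real (i mod n) + 1 \<le> real n"
 proof -
  have "i mod n < n" by simp
  hence "i mod n + 1 \<le> n" by linarith
  thus ?thesis by (metis of_nat_1 of_nat_add of_nat_le_iff)
 qed
 have e: "x * rn (Suc k) = real n * (x * rn k)" by simp
 have 1: "real n * real (i div n) < real n * (x * rn k)"
  using assms real_div_mod[of i] e of_nat_0_le_iff[of "i mod n", where 'a=real] unfolding oseg_def by linarith
 have e2: "real n * (real (i div n) + 1) = real n * real (i div n) + real n" by (simp add: algebra_simps)
 have 2: "real n * (x * rn k) < real n * (real (i div n) + 1)"
  using assms real_div_mod[of i] m e e2 unfolding oseg_def by linarith
 show ?thesis using 1 2 unfolding oseg_def by simp
qed

lemma seg_inner: assumes "seg (Suc k) i x" "1 \<le> i mod n" "i mod n + 2 \<le> n" shows "oseg k (i div n) x"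
proof -
 have m: "real (i mod n) + 2 \<le> real n" "1 \<le> real (i mod n)" using assms(2,3) by linarith+
 have e: "x * rn (Suc k) = real n * (x * rn k)" by simp
 have 1: "real n * real (i div n) < real n * (x * rn k)"
  using assms(1) real_div_mod[of i] e m unfolding seg_def by linarith
 have e2: "real n * (real (i div n) + 1) = real n * real (i div n) + real n" by (simp add: algebra_simps)
 have 2: "real n * (x * rn k) < real n * (real (i div n) + 1)"
  using assms(1) real_div_mod[of i] m e e2 unfolding seg_def by linarith
 show ?thesis using 1 2 unfolding oseg_def by simp
qed

lemma oseg_anc': "oseg (k + l) i x ==> oseg k (i div n ^ l) x"
proof (induction l arbitrary: i)
 case (Suc l)
 hence "oseg (k + l) (i div n) x" using oseg_parent by simp
 from Suc.IH[OF this] show ?case by (simp add: div_mult2_eq)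
qed simp

text \<open>Disjointness holds even for the closed squares. In one generation, touching indices have
  consecutive digits, or digits n - 1 and 0 across a parent boundary, and neither pair fits into {p,
  q}. Across generations, the younger hole lies in the interior of its parent, whose ancestors all
  survive.\<close>

lemma sq_holes_disj:
 assumes "hole k i j" "hole l a b" "(k, i, j) \<noteq> (l, a, b)"
 shows "sq k i j \<inter> sq l a b = {}"
proof -
 have *: "z \<notin> sq l a b" if h: "hole k i j" "hole l a b" "(k, i, j) \<noteq> (l, a, b)" "k \<le> l" "z \<in> sq k i j" for k i j l a b z
 proof
  assume z: "z \<in> sq l a b"
  obtain l' where l': "l = Suc l'" using h(2) by (cases l) (auto simp: hole_def)
  have ab: "bad (a mod n) (b mod n)" using h(2) by (auto simp: hole_def)
  have dig: "1 \<le> c mod n \<and> c mod n + 2 \<le> n" if "c mod n = p \<or> c mod n = q" for c using that p1 pn q_facts by auto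
  show False
  proof (cases "k = l")
   case True
   have ij: "bad (i mod n) (j mod n)" using h(1) by (auto simp: hole_def)
   have one: "c = d" if c: "c mod n = p \<or> c mod n = q" and d: "d mod n = p \<or> d mod n = q"
    and s: "seg k c x" "seg k d x" for c d x
   proof (rule ccontr)
    assume ne: "c \<noteq> d"
    have "real c \<le> real d + 1" "real d \<le> real c + 1" using s by (auto simp: seg_def)
    hence "c \<le> d + 1" "d \<le> c + 1" by linarith+
    then consider "d = c + 1" | "c = d + 1" using ne by linarith
    thus False
    proof cases
     case 1
     hence "d mod n = c mod n + 1" using dig[OF c] by (simp add: mod_Suc)
     thus False using c d q_facts by auto
    next
     case 2
     hence "c mod n = d mod n + 1" using dig[OF d] by (simp add: mod_Suc)
     thus False using c d q_facts by auto
    qed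
   qed
   have "i = a" "j = b" using one[of i a "fst z"] one[of j b "snd z"] ij ab z h(5) True unfolding bad_def sq_def by auto
   thus False using h True by simp
  next
   case False
   hence kl: "k \<le> l'" using h(4) l' by simp
   have "oseg l' (a div n) (fst z)" "oseg l' (b div n) (snd z)"
    using seg_inner[of l' a "fst z"] seg_inner[of l' b "snd z"] dig[of a] dig[of b] ab z
    unfolding bad_def sq_def l' by auto
   hence o: "oseg k (a div n div n ^ (l' - k)) (fst z)" "oseg k (b div n div n ^ (l' - k)) (snd z)"
    using oseg_anc'[of k "l' - k"] kl by auto
   hence "a div n div n ^ (l' - k) = i" "b div n div n ^ (l' - k) = j"
    using oseg_seg_eq h(5) unfolding sq_def by auto
   moreover have "rem k (a div n div n ^ (l' - k)) (b div n div n ^ (l' - k))"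
    using rem_anc[of k "l' - k" "a div n" "b div n"] h(2) kl l' by (auto simp: hole_def)
   ultimately show False using h(1) hole_not_rem by blast
  qed
 qed
 show ?thesis
 proof (cases "k \<le> l")
  case True thus ?thesis using * assms by blast
 next
  case False thus ?thesis using *[OF assms(2,1)] assms(3) by fastforce
 qed
qed

lemma circ_crossing:
 assumes w: "w \<in> osq k i j" and z: "z \<notin> osq k i j"
 shows "\<exists>y\<in>closed_segment z w. y \<in> circ k i j"
proof -
 have "closed_segment z w \<inter> frontier (osq k i j) \<noteq> {}"
  using w z by (intro connected_Int_frontier) auto
 moreover have "frontier (osq k i j) \<subseteq> circ k i j"
 proof -
  have "closure (osq k i j) \<subseteq> sq k i j" using closure_minimal[OF osq_sub_sq closed_sq] .
  thus ?thesis using open_osq[of k i j] by (auto simp: frontier_def circ_def interior_open)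
 qed
 ultimately show ?thesis by blast
qed

text \<open>A separation of the carpet minus a peripheral circle extends over the holes, since each hole
 boundary is connected.\<close>

lemma fill_connected:
 assumes W: "connected W" and WF: "W \<inter> F = S"
  and cov: "\<And>z. z \<in> W ==> z \<notin> F ==> \<exists>k i j. (k, i, j) \<in> H \<and> z \<in> osq k i j"
  and H: "\<And>k i j. (k, i, j) \<in> H ==> hole k i j \<and> osq k i j \<subseteq> W \<and> circ k i j \<subseteq> S"
 shows "connected S"
proof (rule ccontr)
 assume "\<not> connected S"
 then obtain A B where AB: "openin (top_of_set S) A" "openin (top_of_set S) B" "A \<union> B = S" "A \<inter> B = {}" "A \<noteq> {}" "B \<noteq> {}"
  unfolding connected_openin_eq by blast
 define E where "E A = A \<union> (\<Union>{osq k i j | k i j. (k, i, j) \<in> H \<and> circ k i j \<subseteq> A})" for A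
 have EI: "z \<in> E A" if "(k, i, j) \<in> H" "z \<in> osq k i j" "circ k i j \<subseteq> A" for z k i j A
  unfolding E_def using that by blast
 have EA: "z \<in> E A" if "z \<in> A" for z A unfolding E_def using that by blast
 have EE: "z \<in> A \<or> (\<exists>k i j. (k, i, j) \<in> H \<and> z \<in> osq k i j \<and> circ k i j \<subseteq> A)" if "z \<in> E A" for z A
  using that unfolding E_def by blast
 have SF: "S \<subseteq> F" using WF by blast
 have circAB: "circ k i j \<subseteq> A \<or> circ k i j \<subseteq> B" if that': "(k, i, j) \<in> H" for k i j
 proof (rule ccontr)
  assume n: "\<not> (circ k i j \<subseteq> A \<or> circ k i j \<subseteq> B)"
  have c: "circ k i j \<subseteq> A \<union> B" using H[OF that'] AB by auto
  have "connected (circ k i j)" by (rule connected_circ)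
  moreover have op: "openin (top_of_set (circ k i j)) (circ k i j \<inter> D)" if D: "openin (top_of_set S) D" for D
  proof -
   obtain U where U: "open U" "D = S \<inter> U" using D unfolding openin_open by blast
   have "circ k i j \<inter> D = circ k i j \<inter> U" using U H[OF that'] by blast
   thus ?thesis using openin_open_Int[OF U(1)] by simp
  qed
  moreover have "circ k i j \<subseteq> circ k i j \<inter> A \<union> circ k i j \<inter> B" "circ k i j \<inter> A \<inter> (circ k i j \<inter> B) = {}"
   "circ k i j \<inter> A \<noteq> {}" "circ k i j \<inter> B \<noteq> {}" using n c AB(4) by blast+
  ultimately show False using op[OF AB(1)] op[OF AB(2)] unfolding connected_openin by blast
 qed
 have opn: "openin (top_of_set W) (E A)" if A: "openin (top_of_set S) A" and AB': "A \<union> B = S" "A \<inter> B = {}"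
  and cAB: "\<And>k i j. (k, i, j) \<in> H ==> circ k i j \<subseteq> A \<or> circ k i j \<subseteq> B" for A B
  unfolding openin_contains_ball
 proof (intro conjI ballI)
  show "E A \<subseteq> W" unfolding E_def using AB' WF H by blast
  fix z assume "z \<in> E A"
  then consider "z \<in> A" | k i j where "z \<in> osq k i j" "(k, i, j) \<in> H" "circ k i j \<subseteq> A" unfolding E_def by blast
  thus "\<exists>e>0. ball z e \<inter> W \<subseteq> E A"
  proof cases
   case 1
   obtain e where e: "e > 0" "ball z e \<inter> S \<subseteq> A" using A 1 unfolding openin_contains_ball by blast
   have "ball z e \<inter> W \<subseteq> E A"
   proof
    fix w assume w: "w \<in> ball z e \<inter> W"
    show "w \<in> E A"
    proof (cases "w \<in> F")
     case True thus ?thesis using w e WF unfolding E_def by blast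
    next
     case False
     then obtain k i j where h: "(k, i, j) \<in> H" "w \<in> osq k i j" using cov w by blast
     \<comment> \<open>The segment from z to a nearby point of a hole crosses the circle of the hole
       within the ball. So this circle meets \<open>A\<close>, hence lies in \<open>A\<close>, and
       the hole was added to the same side; this is the openness of the enlarged set.\<close>
     have "z \<notin> osq k i j" using 1 AB' SF F_osq_hole[of k i j] H[OF h(1)] by blast
     then obtain y where y: "y \<in> closed_segment z w" "y \<in> circ k i j" using circ_crossing h(2) by blast
     have "closed_segment z w \<subseteq> ball z e" using w e by (intro closed_segment_subset) auto
     hence "y \<in> A" using y e H[OF h(1)] by blast
     hence "circ k i j \<subseteq> A" using cAB[OF h(1)] y AB' by blast
     thus ?thesis using h unfolding E_def by blast
    qed
   qed
   thus ?thesis using e by blast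
  next
   case 2
   obtain e where "e > 0" "ball z e \<subseteq> osq k i j" using open_osq 2 open_contains_ball by blast
   thus ?thesis using 2 unfolding E_def by blast
  qed
 qed
 have oA: "openin (top_of_set W) (E A)" using opn[OF AB(1,3,4) circAB] by blast
 have oB: "openin (top_of_set W) (E B)" using opn[of B A] AB circAB by blast
 have cov': "W \<subseteq> E A \<union> E B"
 proof
  fix z assume z: "z \<in> W"
  show "z \<in> E A \<union> E B"
  proof (cases "z \<in> F")
   case True thus ?thesis using z WF AB(3) EA by blast
  next
   case False
   then obtain k i j where kij: "(k, i, j) \<in> H" "z \<in> osq k i j" using cov z by blast
   from circAB[OF kij(1)] show ?thesis
   proof
    assume "circ k i j \<subseteq> A" from EI[OF kij this] show ?thesis by simp
   next
    assume "circ k i j \<subseteq> B" from EI[OF kij this] show ?thesis by simp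
   qed
  qed
 qed
 have dis: "E A \<inter> E B = {}"
 proof (rule ccontr)
  assume "E A \<inter> E B \<noteq> {}"
  then obtain z where z: "z \<in> E A" "z \<in> E B" by blast
  show False
  proof (cases "z \<in> F")
   case True
   have no: "z \<notin> osq k i j" if "(k, i, j) \<in> H" for k i j
    using F_osq_hole[of k i j] H[OF that] True by blast
   have "z \<in> A" "z \<in> B" using EE[OF z(1)] EE[OF z(2)] no by blast+
   thus False using AB(4) by blast
  next
   case False
   hence nn: "z \<notin> A" "z \<notin> B" using AB(3) SF by blast+
   obtain k i j where h: "z \<in> osq k i j" "(k, i, j) \<in> H" "circ k i j \<subseteq> A" using EE[OF z(1)] nn by blast
   obtain k' i' j' where h': "z \<in> osq k' i' j'" "(k', i', j') \<in> H" "circ k' i' j' \<subseteq> B" using EE[OF z(2)] nn by blast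
   have "(k, i, j) = (k', i', j')" using osq_holes_disj[OF _ _ h(1) h'(1)] H[OF h(2)] H[OF h'(2)] by blast
   hence "circ k i j \<subseteq> A \<inter> B" using h(3) h'(3) by simp
   thus False using AB(4) circ_corners(1)[of i k j] by blast
  qed
 qed
 have "E A \<noteq> {}" "E B \<noteq> {}" using AB(5,6) EA by blast+
 thus False using W oA oB cov' dis unfolding connected_openin by blast
qed

lemma hole_iv: assumes "1 \<le> i" "i + 2 \<le> n ^ k"
 shows "0 < gr k i" "(real i + 1) / rn k < 1"
proof -
 show "0 < gr k i" using assms(1) by simp
 have "real (i + 2) \<le> real (n ^ k)" using assms(2) by (rule of_nat_mono)
 thus "(real i + 1) / rn k < 1" by simp
qed

lemma hole_sq_unit: assumes "hole k i j" shows "sq k i j \<subseteq> {0<..<1} \<times> {0<..<1}"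
proof -
 note m = hole_margin[OF assms]
 have iv: "{gr k i..(real i + 1) / rn k} \<subseteq> {0<..<1}" if "1 \<le> i" "i + 2 \<le> n ^ k" for i
 proof
  fix x assume "x \<in> {gr k i..(real i + 1) / rn k}"
  thus "x \<in> {0<..<1}" using hole_iv[OF that]
   by (simp only: atLeastAtMost_iff greaterThanLessThan_iff) linarith
 qed
 show ?thesis unfolding sq_times using iv m by (intro Sigma_mono) auto
qed

text \<open>Filling all other holes turns the set into an open square, or into a square without a
  closed subsquare; both are connected, and \<open>fill_connected\<close> transfers this
  back.\<close>

lemma connected_F_minus:
 assumes C: "C \<in> Per" shows "connected (F - C)"
proof (cases "C = Out")
 case True
 let ?W = "{0<..<1::real} \<times> {0<..<1::real}"
 have WO: "?W = unit_sq - Out" using Out_iff by force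
 show ?thesis
 proof (rule fill_connected[of ?W _ "{(k, i, j). hole k i j}"])
  show "connected ?W" by (auto intro!: convex_connected convex_Times)
  show "?W \<inter> F = F - C" using WO True F_unit by blast
  fix z assume "z \<in> ?W" "z \<notin> F"
  thus "\<exists>k i j. (k, i, j) \<in> {(k, i, j). hole k i j} \<and> z \<in> osq k i j" using not_F_hole[of z] by auto
 next
  fix k i j assume "(k, i, j) \<in> {(k, i, j). hole k i j}"
  hence h: "hole k i j" by simp
  have sW: "sq k i j \<subseteq> ?W" by (rule hole_sq_unit[OF h])
  hence "osq k i j \<subseteq> ?W" "circ k i j \<subseteq> ?W" using osq_sub_sq circ_sub_sq by blast+
  moreover have "circ k i j \<subseteq> F" by (rule circ_hole_F[OF h])
  ultimately show "hole k i j \<and> osq k i j \<subseteq> ?W \<and> circ k i j \<subseteq> F - C" using h WO True by blast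
 qed
next
 case False
 then obtain k i j where h: "hole k i j" and Ck: "C = circ k i j" using C by (auto simp: Per_def Holes_def)
 note m = hole_margin[OF h]
 let ?W = "unit_sq - sq k i j"
 show ?thesis
 proof (rule fill_connected[of ?W _ "{(k', i', j'). hole k' i' j' \<and> (k', i', j') \<noteq> (k, i, j)}"])
  show "connected ?W" unfolding sq_times using hole_iv[OF m(1,3)] hole_iv[OF m(2,4)]
   by (intro connected_square_minus) (auto simp: divide_right_mono)
  show WF: "?W \<inter> F = F - C" using F_unit F_osq_hole[OF h] unfolding Ck circ_def by blast
  fix z assume z: "z \<in> ?W" "z \<notin> F"
  then obtain k' i' j' where h': "hole k' i' j'" "z \<in> osq k' i' j'" using not_F_hole[of z] by blast
  moreover have "(k', i', j') \<noteq> (k, i, j)" using z h' osq_sub_sq[of k i j] by auto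
  ultimately show "\<exists>k' i' j'. (k', i', j') \<in> {(k', i', j'). hole k' i' j' \<and> (k', i', j') \<noteq> (k, i, j)} \<and> z \<in> osq k' i' j'"
   by blast
 next
  fix k' i' j' assume "(k', i', j') \<in> {(k', i', j'). hole k' i' j' \<and> (k', i', j') \<noteq> (k, i, j)}"
  hence h': "hole k' i' j'" "(k', i', j') \<noteq> (k, i, j)" by auto
  have F': "circ k' i' j' \<subseteq> F" by (rule circ_hole_F[OF h'(1)])
  have "{0<..<1} \<times> {0<..<1} \<subseteq> {0..1::real} \<times> {0..1::real}" by auto
  hence unit: "sq k' i' j' \<subseteq> unit_sq" using hole_sq_unit[OF h'(1)] by blast
  have d1: "z \<notin> sq k i j" if z: "z \<in> osq k' i' j'" for z
  proof
   assume zz: "z \<in> sq k i j"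
   have "z \<notin> osq k i j" using osq_holes_disj[OF h'(1) h z] h'(2) by blast
   hence "z \<in> circ k i j" using zz by (simp add: circ_def)
   hence "z \<in> F" using circ_hole_F[OF h] by blast
   thus False using F_osq_hole[OF h'(1)] z by blast
  qed
  have d2: "z \<notin> circ k i j" if z: "z \<in> circ k' i' j'" for z
   using sq_holes_disj[OF h'(1) h h'(2)] z circ_sub_sq by blast
  show "hole k' i' j' \<and> osq k' i' j' \<subseteq> ?W \<and> circ k' i' j' \<subseteq> F - C"
   using h' F' unit d1 d2 osq_sub_sq[of k' i' j'] unfolding Ck by blast
 qed
qed

lemma frontier_osq: "frontier (osq k i j) = circ k i j"
proof -
 have "gr k i < (real i + 1) / rn k" for i by (simp add: divide_strict_right_mono)
 hence "closure (osq k i j) = sq k i j" unfolding osq_times sq_times by (simp add: closure_Times)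
 thus ?thesis using open_osq[of k i j] by (simp add: frontier_def circ_def interior_open)
qed

lemma interior_sq: "interior (sq k i j) = osq k i j"
 unfolding sq_times osq_times by (simp add: interior_Times)

lemma frontier_sq: "frontier (sq k i j) = circ k i j"
 unfolding frontier_def using closed_sq[of k i j] interior_sq by (simp add: circ_def)

lemma osq_nonempty: "osq k i j \<noteq> {}"
proof -
 have lt: "gr k i < (real i + 1) / rn k" for i by (simp add: divide_strict_right_mono)
 have "{gr k i <..< (real i + 1) / rn k} \<noteq> {}" for i
  using lt[of i] by (simp only: greaterThanLessThan_empty_iff not_le not_False_eq_True)
 thus ?thesis unfolding osq_times by (simp only: Times_empty) blast
qed

lemma circ_homeo_sphere: "circ k i j homeomorphic sphere (0::plane) 1"
proof -
 have "rel_frontier (sq k i j) homeomorphic rel_frontier (cball (0::plane) 1)"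
 proof (rule homeomorphic_rel_frontiers_convex_bounded_sets)
  have "aff_dim (sq k i j) = DIM(plane)"
   using osq_nonempty[of k i j] interior_sq[of k i j] by (intro aff_dim_nonempty_interior) auto
  moreover have "aff_dim (cball (0::plane) 1) = DIM(plane)" by (simp add: aff_dim_cball)
  ultimately show "aff_dim (sq k i j) = aff_dim (cball (0::plane) 1)" by simp
 qed (auto simp: convex_sq compact_sq compact_imp_bounded)
 moreover have "rel_frontier (sq k i j) = circ k i j"
  using rel_frontier_nonempty_interior[of "sq k i j"] interior_sq osq_nonempty frontier_sq by simp
 moreover have "rel_frontier (cball (0::plane) 1) = sphere 0 1" by simp
 ultimately show ?thesis by simp
qed

text \<open>A circle C of \<open>Per\<close> is a Jordan curve that does not separate
  \<open>F\<close>, and both properties pass to its image. A complementary component of the image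
  curve that misses \<open>F\<close> must then be a whole complementary domain of \<open>F\<close>,
  so the curve is the frontier of such a domain.\<close>

lemma homeo_Per:
 assumes bij: "bij_betw f F F" and cont: "continuous_on F f" and C: "C \<in> Per"
 shows "f ` C \<in> Per"
proof -
 obtain k i j where Ck: "C = circ k i j" using C by (rule Per_cases)
 have CF: "C \<subseteq> F" by (rule Per_F[OF C])
 have inj: "inj_on f F" and im: "f ` F = F" using bij by (auto simp: bij_betw_def)
 have "C homeomorphic f ` C"
  by (rule homeomorphic_compact[OF Per_compact[OF C] continuous_on_subset[OF cont CF] refl inj_on_subset[OF inj CF]])
 hence hs: "f ` C homeomorphic sphere (0::plane) 1"
  using circ_homeo_sphere[of k i j] Ck by (metis homeomorphic_sym homeomorphic_trans)
 have gF: "f ` C \<subseteq> F" using CF im by blast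
 have e: "F - f ` C = f ` (F - C)" using inj_on_image_set_diff[OF inj, of F C] CF im by auto
 have con: "connected (F - f ` C)" unfolding e
  by (intro connected_continuous_image connected_F_minus[OF C] continuous_on_subset[OF cont]) auto
 have ncon: "\<not> connected (- (f ` C))" by (rule Jordan_Brouwer_separation[OF hs]) simp
 have nc: "components (- (f ` C)) \<noteq> {T}" for T
 proof
  assume "components (- (f ` C)) = {T}"
  hence "- (f ` C) = T" "connected T" using Union_components[of "- (f ` C)"] in_components_connected[of T "- (f ` C)"] by auto
  thus False using ncon by simp
 qed
 \<comment> \<open>\<open>F\<close> minus the curve is connected and sits in a single complementary
   component, while a Jordan curve has more than one.\<close>
 have "\<exists>T\<in>components (- (f ` C)). T \<inter> F = {}"
 proof (cases "F - f ` C = {}")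
  case True
  have "components (- (f ` C)) \<noteq> {}"
   using ncon by (metis components_eq_empty connected_empty)
  then obtain T where "T \<in> components (- (f ` C))" by blast
  moreover have "T \<inter> F = {}" using True in_components_subset[OF calculation] by blast
  ultimately show ?thesis by blast
 next
  case False
  have "F - f ` C \<subseteq> - (f ` C)" "- (f ` C) \<noteq> {}" using False by blast+
  then obtain T0 where T0: "T0 \<in> components (- (f ` C))" "F - f ` C \<subseteq> T0"
   using exists_component_superset[of "F - f ` C" "- (f ` C)"] con
   by blast
  obtain T where T: "T \<in> components (- (f ` C))" "T \<noteq> T0" using nc[of T0] T0 by blast
  have "T \<inter> T0 = {}" using components_nonoverlap[OF T(1) T0(1)] T by blast
  hence "T \<inter> F = {}" using T0 in_components_subset[OF T(1)] by blast
  thus ?thesis using T by blast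
 qed
 then obtain T where T: "T \<in> components (- (f ` C))" "T \<inter> F = {}" by blast
 have conT: "connected T" and neT: "T \<noteq> {}" using in_components_connected[OF T(1)] in_components_nonempty[OF T(1)] by auto
 have frT: "frontier T = f ` C" using Jordan_Brouwer_frontier[OF hs T(1)] by simp
 \<comment> \<open>\<open>V\<close> and \<open>T\<close> are connected and meet. The frontier of
   each lies in \<open>F\<close>, which the other misses, so neither can leave the other.\<close>
 have main: "f ` C = frontier V" if V: "open V" "connected V" "frontier V \<subseteq> F" "V \<inter> F = {}" "V \<inter> T \<noteq> {}" for V
 proof -
  have "T \<subseteq> V"
  proof (rule ccontr)
   assume "\<not> T \<subseteq> V"
   hence "T \<inter> frontier V \<noteq> {}" using conT V(5) by (intro connected_Int_frontier) auto
   thus False using V(3) T(2) by blast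
  qed
  moreover have "V \<subseteq> T"
  proof (rule ccontr)
   assume "\<not> V \<subseteq> T"
   hence "V \<inter> frontier T \<noteq> {}" using V(2,5) by (intro connected_Int_frontier) auto
   thus False using frT gF V(4) by blast
  qed
  ultimately have "T = V" by (rule equalityI)
  thus ?thesis using frT by simp
 qed
 obtain z where z: "z \<in> T" using neT by blast
 hence zF: "z \<notin> F" using T by blast
 show ?thesis
 proof (cases "z \<in> unit_sq")
  case True
  then obtain a b c where h: "hole a b c" "z \<in> osq a b c" using not_F_hole zF by blast
  have "f ` C = frontier (osq a b c)"
  proof (rule main)
   show "connected (osq a b c)" unfolding osq_times by (auto intro!: convex_connected convex_Times)
   show "frontier (osq a b c) \<subseteq> F" unfolding frontier_osq by (rule circ_hole_F[OF h(1)])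
  qed (use h z F_osq_hole open_osq in auto)
  thus ?thesis using h by (auto simp: frontier_osq Per_def Holes_def)
 next
  case False
  have "f ` C = frontier (- sq 0 0 0)"
  proof (rule main)
   show "open (- sq 0 0 0)" using closed_sq by (simp add: open_Compl)
   show "connected (- sq 0 0 0)" by (rule connected_complement_bounded_convex) (auto simp: compact_sq convex_sq compact_imp_bounded)
   show "frontier (- sq 0 0 0) \<subseteq> F" using frontier_sq circ_rem_F[of 0 0 0] by (simp add: frontier_complement)
   show "- sq 0 0 0 \<inter> F = {}" using F_unit sq_zero by auto
   show "- sq 0 0 0 \<inter> T \<noteq> {}" using z False sq_zero by auto
  qed
  thus ?thesis by (simp add: frontier_complement frontier_sq Per_def Out_def)
 qed
qed

subsection \<open>Quasisymmetric maps\<close>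

text \<open>Quasisymmetry enters only through these two consequences, which are stable under
 composition and inversion.\<close>

abbreviation ctrl :: "(plane => plane) => real => real => bool" where
 "ctrl f t H \<equiv> \<forall>x\<in>F. \<forall>y\<in>F. \<forall>z\<in>F. dist x y \<le> t * dist x z \<longrightarrow> dist (f x) (f y) \<le> H * dist (f x) (f z)"

definition qs :: "(plane => plane) => bool" where
 "qs f \<longleftrightarrow> (\<forall>t>0. \<exists>H>0. ctrl f t H) \<and>
   (\<forall>e>0. \<exists>s>0. ctrl f s e)"

definition GF :: "(plane => plane) => bool" where
 "GF f \<longleftrightarrow> bij_betw f F F \<and> qs f"

lemma qsI1: "qs f ==> t > 0 ==> \<exists>H>0. ctrl f t H"
 by (simp add: qs_def)
lemma qsI2: "qs f ==> e > 0 ==> \<exists>s>0. ctrl f s e"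
 by (simp add: qs_def)

lemma GF_mem: "GF f ==> x \<in> F ==> f x \<in> F" by (auto simp: GF_def bij_betw_def)
lemma GF_inj: "GF f ==> inj_on f F" by (auto simp: GF_def bij_betw_def)
lemma GF_im: "GF f ==> f ` F = F" by (auto simp: GF_def bij_betw_def)

lemma GF_comp: assumes "GF f" "GF g" shows "GF (f \<circ> g)"
 unfolding GF_def qs_def
proof (intro conjI allI impI)
 show "bij_betw (f \<circ> g) F F" using assms bij_betw_trans unfolding GF_def by blast
 have gF: "g x \<in> F" if "x \<in> F" for x using GF_mem[OF assms(2) that] .
 fix t :: real assume t: "t > 0"
 obtain H where H: "H > 0" "ctrl g t H"
  using qsI1 assms(2) t unfolding GF_def by blast
 obtain H' where H': "H' > 0" "ctrl f H H'"
  using qsI1[OF _ H(1)] assms(1) unfolding GF_def by blast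
 show "\<exists>H>0. ctrl (f \<circ> g) t H"
  by (rule exI[of _ H']) (use H H' gF in auto)
next
 have gF: "g x \<in> F" if "x \<in> F" for x using GF_mem[OF assms(2) that] .
 fix e :: real assume e: "e > 0"
 obtain s where s: "s > 0" "ctrl f s e"
  using qsI2 assms(1) e unfolding GF_def by blast
 obtain s' where s': "s' > 0" "ctrl g s' s"
  using qsI2[OF _ s(1)] assms(2) unfolding GF_def by blast
 show "\<exists>s>0. ctrl (f \<circ> g) s e"
  by (rule exI[of _ s']) (use s s' gF in auto)
qed

text \<open>Inversion exchanges the two halves of \<open>qs\<close>: read contrapositively,
  smallness of f at small ratios bounds the inverse at a given ratio, and boundedness of f yields
  smallness of the inverse. The factors 2 in \<open>e\<close> and \<open>r\<close> make the needed
  inequality strict.\<close>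

lemma GF_inv: assumes "GF f" shows "GF (inv_into F f)"
proof -
 let ?g = "inv_into F f"
 have bij: "bij_betw f F F" using assms by (simp add: GF_def)
 hence bg: "bij_betw ?g F F" by (rule bij_betw_inv_into)
 have gF: "?g x \<in> F" if "x \<in> F" for x using bg that by (auto simp: bij_betw_def)
 have fg: "f (?g x) = x" if "x \<in> F" for x using bij that by (simp add: bij_betw_inv_into_right)
 have key: "dist (?g x) (?g y) \<le> h * dist (?g x) (?g z)"
  if st: "s > 0" "ctrl f s e"
   and r: "0 < r" "e * r < 1" and sh: "1 / s \<le> h" and xyz: "x \<in> F" "y \<in> F" "z \<in> F" and d: "dist x y \<le> r * dist x z" for s e r h x y z
 proof (rule ccontr)
  assume "\<not> ?thesis"
  hence l: "h * dist (?g x) (?g z) < dist (?g x) (?g y)" by simp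
  have "1 / s * dist (?g x) (?g z) \<le> h * dist (?g x) (?g z)" using sh by (intro mult_right_mono) auto
  hence "1 / s * dist (?g x) (?g z) < dist (?g x) (?g y)" using l by linarith
  hence l2: "dist (?g x) (?g z) \<le> s * dist (?g x) (?g y)" using st(1) by (simp add: field_simps)
  have "dist x z \<le> e * dist x y" using st(2) gF xyz l2 fg by metis
  moreover have "dist x y > 0"
  proof -
   have "0 \<le> 1 / s * dist (?g x) (?g z)" using st(1) by simp
   hence "?g x \<noteq> ?g y" using \<open>1 / s * dist (?g x) (?g z) < dist (?g x) (?g y)\<close> by auto
   thus ?thesis by auto
  qed
  ultimately have A: "dist x z \<le> e * dist x y" "dist x y > 0" by auto
  have "0 < r * dist x z" using A d by linarith
  hence pz: "dist x z > 0" using r by (simp add: zero_less_mult_iff)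
  show False
  proof (cases "e \<ge> 0")
   case True
   hence "e * dist x y \<le> e * (r * dist x z)" using d by (intro mult_left_mono)
   hence "dist x z \<le> (e * r) * dist x z" using A by (simp add: mult.assoc)
   moreover have "(e * r) * dist x z < 1 * dist x z" using r pz by (intro mult_strict_right_mono)
   ultimately show False by simp
  next
   case False
   hence "e * dist x y < 0" using A by (simp add: mult_neg_pos)
   thus False using A zero_le_dist[of x z] by linarith
  qed
 qed
 show ?thesis unfolding GF_def qs_def
 proof (intro conjI allI impI)
  show "bij_betw ?g F F" by (rule bg)
  fix t :: real assume t: "t > 0"
  define e where "e = 1 / (2 * t)"
  have e: "e > 0" "e * t < 1" using t by (auto simp: e_def)
  obtain s where s: "s > 0" "ctrl f s e"
   using qsI2[OF _ e(1)] assms unfolding GF_def by blast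
  show "\<exists>H>0. ctrl ?g t H"
   by (rule exI[of _ "1 / s"]) (use s key[OF s t e(2) order_refl] in auto)
 next
  fix h :: real assume h: "h > 0"
  obtain H where H: "H > 0" "ctrl f (1 / h) H"
   using qsI1[of f "1 / h"] h assms unfolding GF_def by auto
  define r where "r = 1 / (2 * H)"
  have r: "r > 0" "H * r < 1" using H by (auto simp: r_def)
  have h': "1 / h > 0" "1 / (1 / h) \<le> h" using h by auto
  show "\<exists>s>0. ctrl ?g s h"
   by (rule exI[of _ r]) (use r key[OF h'(1) H(2) r h'(2)] in auto)
 qed
qed

lemma GF_iso: assumes "bij_betw f F F" "\<And>x y. x \<in> F ==> y \<in> F ==> dist (f x) (f y) = dist x y" shows "GF f"
 unfolding GF_def qs_def using assms by auto

lemma GF_id: "GF id" by (rule GF_iso) auto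

lemma GF_cont: assumes "GF f" shows "continuous_on F f"
 unfolding continuous_on_iff
proof (intro ballI allI impI)
 fix x and e :: real assume x: "x \<in> F" and e: "0 < e"
 have "\<exists>w\<in>F. w \<noteq> x"
 proof -
  have "(0, 0) \<in> F" "(1, 1) \<in> F" using circ_rem_F[of 0 0 0] circ_corners[of 0 0 0] by auto
  thus ?thesis by (metis zero_neq_one prod.inject)
 qed
 then obtain w where w: "w \<in> F" "w \<noteq> x" by blast
 have fw: "dist (f x) (f w) > 0" using GF_inj[OF assms] x w by (auto simp: inj_on_def)
 define e' where "e' = e / (2 * dist (f x) (f w))"
 have e': "e' > 0" using e fw by (simp add: e'_def)
 obtain s where s: "s > 0" "ctrl f s e'"
  using qsI2[OF _ e'] assms unfolding GF_def by blast
 have "dist (f y) (f x) < e" if y: "y \<in> F" "dist y x < s * dist x w" for y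
 proof -
  have "dist x y \<le> s * dist x w" using y(2) by (simp add: dist_commute[of y x])
  hence "dist (f x) (f y) \<le> e' * dist (f x) (f w)" using s(2) x y(1) w by blast
  also have "... = e / 2" using fw by (simp add: e'_def)
  also have "... < e" using e by simp
  finally show ?thesis by (simp add: dist_commute)
 qed
 moreover have "s * dist x w > 0" using s w by simp
 ultimately show "\<exists>d>0. \<forall>x'\<in>F. dist x' x < d \<longrightarrow> dist (f x') (f x) < e" by blast
qed

lemma GF_Per: "GF f ==> C \<in> Per ==> f ` C \<in> Per"
 using homeo_Per GF_cont by (auto simp: GF_def)

lemma GF_bounded: "GF f ==> bounded (f ` F)"
 using compact_continuous_image[OF GF_cont compact_F] compact_imp_bounded by blast

lemma GF_inv_im: "GF f ==> A \<subseteq> F ==> inv_into F f ` (f ` A) = A"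
 using inv_into_image_cancel[OF GF_inj] by blast

lemma GF_im_inv: "GF f ==> A \<subseteq> F ==> f ` (inv_into F f ` A) = A"
 using image_inv_into_cancel[OF GF_im] by blast

lemma GF_inj_im: "GF f ==> A \<subseteq> F ==> B \<subseteq> F ==> f ` A = f ` B ==> A = B"
 using GF_inv_im by metis

lemma GF_Per_bij: assumes "GF f" shows "bij_betw ((`) f) Per Per"
 unfolding bij_betw_def
proof (intro conjI equalityI subsetI)
 show "inj_on ((`) f) Per" using GF_inj_im[OF assms] Per_F by (intro inj_onI) blast
 fix C assume "C \<in> (`) f ` Per" thus "C \<in> Per" using GF_Per[OF assms] by auto
next
 fix C assume C: "C \<in> Per"
 have "inv_into F f ` C \<in> Per" by (rule GF_Per[OF GF_inv[OF assms] C])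
 thus "C \<in> (`) f ` Per" using GF_im_inv[OF assms Per_F[OF C]] by (metis image_eqI)
qed

text \<open>The outer circle contributes 1 and the holes at most 1.\<close>

lemma Per_sum_le2: assumes "finite A" "A \<subseteq> Per" shows "(\<Sum>C\<in>A. (sz C)\<^sup>2) \<le> 2"
proof -
 have "(\<Sum>C\<in>A. (sz C)\<^sup>2) \<le> (\<Sum>C\<in>insert Out (A - {Out}). (sz C)\<^sup>2)" using assms by (intro sum_mono2) auto
 also have "... = 1 + (\<Sum>C\<in>A - {Out}. (sz C)\<^sup>2)" using assms by (subst sum.insert) (auto simp: sz_Out)
 also have "... \<le> 1 + 1" using packing1[of "A - {Out}"] assms by (auto simp: Per_def)
 finally show ?thesis by simp
qed

lemma GF_sum_le2: assumes "GF f" "finite A" "A \<subseteq> Per" shows "(\<Sum>C\<in>A. (sz (f ` C))\<^sup>2) \<le> 2"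
proof -
 have "inj_on ((`) f) A" using GF_Per_bij[OF assms(1)] assms(3) inj_on_subset unfolding bij_betw_def by blast
 hence "(\<Sum>C\<in>A. (sz (f ` C))\<^sup>2) = (\<Sum>D\<in>(`) f ` A. (sz D)\<^sup>2)" by (simp add: sum.reindex)
 also have "... \<le> 2" using assms GF_Per[OF assms(1)] by (intro Per_sum_le2) auto
 finally show ?thesis .
qed

definition Rk :: "nat => (nat \<times> nat) set" where "Rk k = {(i, j). rem k i j}"
definition cell :: "nat => nat \<times> nat => plane set" where "cell k e = sq k (fst e) (snd e) \<inter> F"
text \<open>The hole in position (p, p) represents its cell: its size is comparable to that of the
  cell, and distinct cells, even of different generations, have distinct representatives.\<close>

definition hc :: "nat => nat \<times> nat => plane set" where "hc k e = circ (Suc k) (n * fst e + p) (n * snd e + p)"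
definition tail :: "nat => (plane => 'b::metric_space) => real" where
 "tail k u = (\<Sum>e\<in>Rk k. (osc u (cell k e))\<^sup>2)"

lemma finite_Rk: "finite (Rk k)" unfolding Rk_def by (rule finite_rem)

lemma hc_hole: "e \<in> Rk k ==> hole (Suc k) (n * fst e + p) (n * snd e + p)"
 using q_facts by (auto simp: hole_def Rk_def bad_def)

lemma hc_Holes: "e \<in> Rk k ==> hc k e \<in> Holes"
 unfolding Holes_def hc_def using hc_hole by blast

lemma hc_sub: "e \<in> Rk k ==> hc k e \<subseteq> cell k e"
proof -
 assume e: "e \<in> Rk k"
 have "circ (Suc k) (n * fst e + p) (n * snd e + p) \<subseteq> sq k (fst e) (snd e)"
 proof
  fix z assume "z \<in> circ (Suc k) (n * fst e + p) (n * snd e + p)"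
  hence "z \<in> sq (Suc k) (n * fst e + p) (n * snd e + p)" using circ_sub_sq by blast
  from sq_parent[OF this] show "z \<in> sq k (fst e) (snd e)" using q_facts by simp
 qed
 thus ?thesis using circ_hole_F[OF hc_hole[OF e]] unfolding hc_def cell_def by blast
qed

lemma hc_inj: assumes "hc k e = hc k' e'" shows "k = k' \<and> e = e'"
proof -
 have "Suc k = Suc k' \<and> n * fst e + p = n * fst e' + p \<and> n * snd e + p = n * snd e' + p"
  using circ_inj assms unfolding hc_def by metis
 hence "k = k' \<and> fst e = fst e' \<and> snd e = snd e'" using npos by simp
 thus ?thesis by (simp add: prod_eq_iff)
qed

text \<open>Every point of the cell is at distance at most 2 n times the side of the representative
  hole from a corner of it, and quasisymmetry carries this comparison to the images. The constant 4
  H is the triangle inequality applied to twice the bound H times a diameter of at most 2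
  \<open>sz\<close>.\<close>

lemma diam_cell:
 assumes f: "GF f"
 shows "\<exists>K>0. \<forall>k. \<forall>e\<in>Rk k. osc f (cell k e) \<le> K * sz (f ` hc k e)"
proof -
 obtain H where H: "H > 0" "ctrl f (2 * real n) H"
  using qsI1[of f "2 * real n"] f unfolding GF_def by auto
 have "osc f (cell k e) \<le> (4 * H) * sz (f ` hc k e)" if e: "e \<in> Rk k" for k e
 proof -
  define a where "a = n * fst e + p"
  define b where "b = n * snd e + p"
  have C: "hc k e = circ (Suc k) a b" by (simp add: hc_def a_def b_def)
  define x where "x = (gr (Suc k) a, gr (Suc k) b)"
  define z where "z = ((real a + 1) / rn (Suc k), gr (Suc k) b)"
  have xz: "x \<in> hc k e" "z \<in> hc k e" unfolding C x_def z_def by (rule circ_corners)+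
  hence xzc: "x \<in> cell k e" "z \<in> cell k e" using hc_sub[OF e] by auto
  have dxz: "dist x z = 1 / rn (Suc k)" unfolding x_def z_def by (simp add: dist_prod_def dist_real_def add_divide_distrib)
  have P: "f ` hc k e \<in> Per" using GF_Per[OF f] hc_Holes[OF e] Holes_Per by blast
  have d1: "dist (f x) (f z) \<le> 2 * sz (f ` hc k e)" by (rule Per_dist[OF P]) (use xz in auto)
  have d2: "dist (f x) (f y) \<le> H * (2 * sz (f ` hc k e))" if y: "y \<in> cell k e" for y
  proof -
   have "dist x y \<le> 2 / rn k" using sq_dist[of x k "fst e" "snd e" y] xzc y by (simp add: cell_def)
   also have "... = (2 * real n) * dist x z" unfolding dxz by simp
   finally have "dist (f x) (f y) \<le> H * dist (f x) (f z)" using H(2) xzc y by (simp add: cell_def)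
   also have "... \<le> H * (2 * sz (f ` hc k e))" using d1 H by (intro mult_left_mono) auto
   finally show ?thesis .
  qed
  show ?thesis
  proof (rule osc_le)
   fix y y' assume "y \<in> cell k e" "y' \<in> cell k e"
   thus "dist (f y) (f y') \<le> (4 * H) * sz (f ` hc k e)"
    using d2[of y] d2[of y'] dist_triangle3[of "f y" "f y'" "f x"] by simp
  qed (use H sz_pos[OF P] in auto)
 qed
 thus ?thesis using H by (intro exI[of _ "4 * H"]) auto
qed

lemma tail_nonneg: "0 \<le> tail k u" unfolding tail_def by (intro sum_nonneg) auto

text \<open>The tail is at most a constant times the sum over the images of the representative holes
  of generation k. Over all k these images are distinct circles, so the sums form a convergent
  series and its terms tend to 0.\<close>

lemma GF_tail: assumes f: "GF f" shows "(\<lambda>k. tail k f) \<longlonglongrightarrow> 0"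
proof -
 obtain K where K: "K > 0" "\<And>k e. e \<in> Rk k ==> osc f (cell k e) \<le> K * sz (f ` hc k e)"
  using diam_cell[OF f] by blast
 define b where "b k = (\<Sum>e\<in>Rk k. (sz (f ` hc k e))\<^sup>2)" for k
 have bnn: "0 \<le> b k" for k unfolding b_def by (intro sum_nonneg) auto
 have part: "(\<Sum>k<m. b k) \<le> 2" for m
 proof -
  have "(\<Sum>k<m. b k) = (\<Sum>x\<in>Sigma {..<m} Rk. (sz (f ` hc (fst x) (snd x)))\<^sup>2)"
   unfolding b_def by (subst sum.Sigma) (auto simp: finite_Rk case_prod_unfold)
  also have "... = (\<Sum>C\<in>(\<lambda>x. hc (fst x) (snd x)) ` Sigma {..<m} Rk. (sz (f ` C))\<^sup>2)"
   by (subst sum.reindex) (auto intro!: inj_onI dest: hc_inj simp: prod_eq_iff)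
  also have "... \<le> 2"
  proof (rule GF_sum_le2[OF f])
   show "finite ((\<lambda>x. hc (fst x) (snd x)) ` Sigma {..<m} Rk)" by (intro finite_imageI finite_SigmaI) (auto simp: finite_Rk)
   show "(\<lambda>x. hc (fst x) (snd x)) ` Sigma {..<m} Rk \<subseteq> Per" using hc_Holes Holes_Per by auto
  qed
  finally show ?thesis .
 qed
 have "summable b" by (rule summableI_nonneg_bounded[OF bnn part])
 hence "b \<longlonglongrightarrow> 0" by (rule summable_LIMSEQ_zero)
 hence lim: "(\<lambda>k. K\<^sup>2 * b k) \<longlonglongrightarrow> 0" by (rule tendsto_mult_right_zero)
 have le: "tail k f \<le> K\<^sup>2 * b k" for k
 proof -
  have "tail k f \<le> (\<Sum>e\<in>Rk k. (K * sz (f ` hc k e))\<^sup>2)" unfolding tail_def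
  proof (rule sum_mono)
   fix e assume e: "e \<in> Rk k"
   have "bounded (f ` cell k e)" using GF_bounded[OF f] by (rule bounded_subset) (auto simp: cell_def)
   thus "(osc f (cell k e))\<^sup>2 \<le> (K * sz (f ` hc k e))\<^sup>2" using K(2)[OF e] by (intro power_mono osc_nonneg)
  qed
  also have "... = K\<^sup>2 * b k" by (simp add: b_def power_mult_distrib sum_distrib_left)
  finally show ?thesis .
 qed
 show ?thesis by (rule tendsto_sandwich[OF _ _ tendsto_const lim]) (auto simp: tail_nonneg le)
qed

lemma tail_comp_lip:
 fixes w :: "plane => 'b::metric_space"
 assumes f: "GF f" and L: "L \<ge> 0" "\<And>x y. x \<in> F ==> y \<in> F ==> dist (w x) (w y) \<le> L * dist x y"
 shows "tail k (w \<circ> f) \<le> L\<^sup>2 * tail k f"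
proof -
 have "tail k (w \<circ> f) \<le> (\<Sum>e\<in>Rk k. (L * osc f (cell k e))\<^sup>2)" unfolding tail_def
 proof (rule sum_mono)
  fix e assume e: "e \<in> Rk k"
  have bd: "bounded (f ` cell k e)" using GF_bounded[OF f] by (rule bounded_subset) (auto simp: cell_def)
  have fc: "f x \<in> F" if "x \<in> cell k e" for x using that GF_mem[OF f] by (auto simp: cell_def)
  have le: "osc (w \<circ> f) (cell k e) \<le> L * osc f (cell k e)"
  proof (rule osc_le)
   fix x y assume xy: "x \<in> cell k e" "y \<in> cell k e"
   have "dist (w (f x)) (w (f y)) \<le> L * dist (f x) (f y)" using L fc xy by blast
   also have "... \<le> L * osc f (cell k e)" using osc_ge[OF bd xy] L by (intro mult_left_mono)
   finally show "dist ((w \<circ> f) x) ((w \<circ> f) y) \<le> L * osc f (cell k e)" by simp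
  qed (use L osc_nonneg[OF bd] in auto)
  moreover have "0 \<le> osc (w \<circ> f) (cell k e)"
  proof (rule osc_nonneg)
   have "bounded (w ` F)" unfolding bounded_def
   proof -
    obtain x0 where x0: "x0 \<in> F" using circ_rem_F[of 0 0 0] circ_corners[of 0 0 0] by auto
    have bF: "bounded F" using compact_F compact_imp_bounded by blast
    then obtain B where "\<forall>y\<in>F. dist x0 y \<le> B" by (metis bounded_any_center)
    hence "\<forall>y\<in>w ` F. dist (w x0) y \<le> L * B" using L x0 by (auto intro!: order_trans[OF L(2)] mult_left_mono)
    thus "\<exists>x e. \<forall>y\<in>w ` F. dist x y \<le> e" by blast
   qed
   thus "bounded ((w \<circ> f) ` cell k e)" by (rule bounded_subset) (use fc in auto)
  qed
  ultimately show "(osc (w \<circ> f) (cell k e))\<^sup>2 \<le> (L * osc f (cell k e))\<^sup>2" by (intro power_mono)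
 qed
 also have "... = L\<^sup>2 * tail k f" by (simp add: tail_def power_mult_distrib sum_distrib_left)
 finally show ?thesis .
qed

lemma osc_comp: "osc (u \<circ> f) A = osc u (f ` A)"
 by (simp add: osc_def image_comp)

lemma osc_cong: "(\<And>x. x \<in> A ==> u x = v x) ==> osc u A = osc v A"
 unfolding osc_def by (metis image_cong)

lemma sz_osc: "osc (fst \<circ> f) A = sz (f ` A)"
 by (simp add: osc_comp sz_def)

lemma lab_cases:
 assumes "i < n ^ k" "j < n ^ k"
 obtains "rem k i j" "lab k i j = (k, i, j)" "elt (lab k i j) = cell k (i, j)"
 | m a b where "hole m a b" "m \<le> k" "lab k i j = (m, a, b)" "elt (lab k i j) = circ m a b"
proof -
 obtain m a b where L: "lab k i j = (m, a, b)" by (rule lab_ex)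
 note P = lab_props[OF assms L]
 show thesis
 proof (cases "rem k i j")
  case True
  show ?thesis using that(1) lab_rem[OF True] True by (simp add: cell_def)
 next
  case False
  hence h: "hole m a b" using P by auto
  show ?thesis using that(2)[OF h _ L] P hole_not_rem[OF h] L by simp
 qed
qed

subsection \<open>Length--area estimates and rigidity\<close>

definition HZ :: "nat => (nat \<times> nat) set => plane set set" where
 "HZ k Z = (\<lambda>(m, a, b). circ m a b) ` {(m, a, b). hole m a b \<and> (\<exists>z\<in>Z. lab k (fst z) (snd z) = (m, a, b))}"

lemma HZ_Holes: "HZ k Z \<subseteq> Holes" by (auto simp: HZ_def Holes_def)

lemma finite_HZ_aux: assumes "finite Z" shows "finite {(m, a, b). hole m a b \<and> (\<exists>z\<in>Z. lab k (fst z) (snd z) = (m, a, b))}"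
 by (rule finite_subset[OF _ finite_imageI[OF assms, of "\<lambda>z. lab k (fst z) (snd z)"]]) force

lemma finite_HZ: "finite Z ==> finite (HZ k Z)"
 unfolding HZ_def using finite_HZ_aux by blast

text \<open>Separates the holes, which carry the energy in the limit, from the surviving cells,
  which are absorbed by \<open>tail\<close>.\<close>

lemma label_split:
 fixes g :: "nat \<times> nat \<times> nat => real"
 assumes Z: "Z \<subseteq> ix k \<times> ix k"
  and h: "\<And>m a b. hole m a b ==> m \<le> k ==> circ m a b \<in> HZ k Z ==> g (m, a, b) = h (circ m a b)"
 shows "(\<Sum>e\<in>(\<lambda>(i, j). lab k i j) ` Z. g e) = (\<Sum>C\<in>HZ k Z. h C) + (\<Sum>e\<in>Rk k \<inter> Z. g (k, e))"
proof -
 have fZ: "finite Z" using Z by (rule finite_subset) auto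
 let ?H = "{(m, a, b). hole m a b \<and> (\<exists>z\<in>Z. lab k (fst z) (snd z) = (m, a, b))}"
 let ?R = "Pair k ` (Rk k \<inter> Z)"
 have U: "(\<lambda>(i, j). lab k i j) ` Z = ?H \<union> ?R"
 proof (intro equalityI subsetI)
  fix e assume "e \<in> (\<lambda>(i, j). lab k i j) ` Z"
  then obtain i j where ij: "(i, j) \<in> Z" "e = lab k i j" by auto
  hence b: "i < n ^ k" "j < n ^ k" using Z by auto
  show "e \<in> ?H \<union> ?R"
  proof (rule lab_cases[OF b])
   assume "rem k i j" "lab k i j = (k, i, j)"
   hence "(i, j) \<in> Rk k \<inter> Z" "e = (k, (i, j))" using ij by (auto simp: Rk_def)
   thus ?thesis by blast
  next
   fix m a b assume "hole m a b" "lab k i j = (m, a, b)"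
   hence "\<exists>z\<in>Z. lab k (fst z) (snd z) = (m, a, b)" using ij by (intro bexI[of _ "(i, j)"]) auto
   thus ?thesis using \<open>hole m a b\<close> \<open>lab k i j = (m, a, b)\<close> ij by simp
  qed
 next
  fix e assume "e \<in> ?H \<union> ?R"
  thus "e \<in> (\<lambda>(i, j). lab k i j) ` Z"
  proof
   assume "e \<in> ?H"
   then obtain z where "z \<in> Z" "lab k (fst z) (snd z) = e" by auto
   thus ?thesis by (intro image_eqI[of _ _ z]) (auto simp: case_prod_unfold)
  next
   assume "e \<in> ?R"
   then obtain i j where "rem k i j" "(i, j) \<in> Z" "e = (k, i, j)" by (auto simp: Rk_def)
   thus ?thesis using lab_rem by (intro image_eqI[of _ _ "(i, j)"]) auto
  qed
 qed
 have D: "?H \<inter> ?R = {}" by (auto simp: Rk_def dest: hole_not_rem)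
 have inj: "inj_on (\<lambda>(m, a, b). circ m a b) ?H" by (auto simp: inj_on_def dest!: circ_inj)
 have "(\<Sum>e\<in>?H. g e) = (\<Sum>e\<in>?H. h ((\<lambda>(m, a, b). circ m a b) e))"
 proof (rule sum.cong[OF refl])
  fix e assume e: "e \<in> ?H"
  obtain m a b where em: "e = (m, a, b)" by (metis prod_cases3)
  then obtain z where z: "hole m a b" "z \<in> Z" "lab k (fst z) (snd z) = (m, a, b)" using e by auto
  have "fst z < n ^ k" "snd z < n ^ k" using z Z by auto
  hence "m \<le> k" using lab_props[OF _ _ z(3)] by blast
  moreover have "circ m a b \<in> HZ k Z" unfolding HZ_def using e em by (intro image_eqI[of _ _ e]) auto
  ultimately show "g e = h ((\<lambda>(m, a, b). circ m a b) e)" using h z em by simp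
 qed
 also have "... = (\<Sum>C\<in>HZ k Z. h C)" unfolding HZ_def by (subst sum.reindex[OF inj]) simp
 finally have 1: "(\<Sum>e\<in>?H. g e) = (\<Sum>C\<in>HZ k Z. h C)" .
 have 2: "(\<Sum>e\<in>?R. g e) = (\<Sum>e\<in>Rk k \<inter> Z. g (k, e))" by (subst sum.reindex) (auto simp: inj_on_def)
 have "(\<Sum>e\<in>(\<lambda>(i, j). lab k i j) ` Z. g e) = (\<Sum>e\<in>?H. g e) + (\<Sum>e\<in>?R. g e)"
  unfolding U by (rule sum.union_disjoint[OF finite_HZ_aux[OF fZ] _ D]) (simp add: finite_Rk)
 thus ?thesis using 1 2 by simp
qed

lemma elt_rem: "e \<in> Rk k ==> elt (k, e) = cell k e"
 by (cases e) (simp add: Rk_def cell_def)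

lemma elt_hole: "hole m a b ==> elt (m, a, b) = circ m a b"
 using hole_not_rem by simp

lemma cell_F: "cell k e \<subseteq> F" by (simp add: cell_def)

lemma tail_ge: "Z \<subseteq> Rk k ==> (\<Sum>e\<in>Z. (osc u (cell k e))\<^sup>2) \<le> tail k u"
 unfolding tail_def by (rule sum_mono2[OF finite_Rk]) auto

lemma card_lattice: assumes "Z \<subseteq> ix k \<times> ix k" shows "finite Z" "real (card Z) \<le> (rn k)\<^sup>2"
proof -
 show "finite Z" using assms by (rule finite_subset) auto
 have "card Z \<le> card (ix k \<times> ix k)" by (rule card_mono[OF _ assms]) auto
 hence "card Z \<le> n ^ k * n ^ k" by (simp add: card_cartesian_product)
 hence "real (card Z) \<le> real (n ^ k * n ^ k)" by (simp only: of_nat_le_iff)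
 thus "real (card Z) \<le> (rn k)\<^sup>2" by (simp add: power2_eq_square)
qed

lemma Rk_lattice: "Rk k \<subseteq> ix k \<times> ix k"
 using rem_bound by (auto simp: Rk_def)

lemma cells_lin:
 assumes "Z \<subseteq> Rk k" shows "(\<Sum>e\<in>Z. osc u (cell k e)) \<le> rn k * sqrt (tail k u)"
proof (rule power2_le_imp_le)
 have "(\<Sum>e\<in>Z. osc u (cell k e))\<^sup>2 \<le> real (card Z) * (\<Sum>e\<in>Z. (osc u (cell k e))\<^sup>2)" by (rule sum_cs)
 also have "... \<le> (rn k)\<^sup>2 * tail k u"
  using card_lattice(2)[of Z k] Rk_lattice assms tail_ge[OF assms] by (intro mult_mono) (auto intro: sum_nonneg)
 finally show "(\<Sum>e\<in>Z. osc u (cell k e))\<^sup>2 \<le> (rn k * sqrt (tail k u))\<^sup>2"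
  by (simp add: power_mult_distrib tail_nonneg)
qed (simp add: tail_nonneg)

lemma energy:
 fixes u :: "plane => real"
 assumes Z: "Z \<subseteq> ix k \<times> ix k"
 shows "(\<Sum>(i, j)\<in>Z. (cost k u i j)\<^sup>2) \<le> (\<Sum>C\<in>HZ k Z. (osc u C)\<^sup>2) + (\<Sum>e\<in>Rk k \<inter> Z. (osc u (cell k e))\<^sup>2)"
proof -
 have "(\<Sum>e\<in>(\<lambda>(i, j). lab k i j) ` Z. (osc u (elt e))\<^sup>2)
   = (\<Sum>C\<in>HZ k Z. (osc u C)\<^sup>2) + (\<Sum>e\<in>Rk k \<inter> Z. (osc u (elt (k, e)))\<^sup>2)"
  by (rule label_split[OF Z]) (metis elt_hole)
 also have "(\<Sum>e\<in>Rk k \<inter> Z. (osc u (elt (k, e)))\<^sup>2) = (\<Sum>e\<in>Rk k \<inter> Z. (osc u (cell k e))\<^sup>2)"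
  by (rule sum.cong) (simp_all add: elt_rem del: elt.simps)
 finally show ?thesis using cost_sq_sum[OF Z, of u] by simp
qed

text \<open>A hole of side \<open>sz C\<close> lies in a fraction \<open>sz C\<close> of the rows
  and is paid for once in each, whence the mixed products. This is the form in which Cauchy--Schwarz
  can become an equality.\<close>

lemma cost_lin:
 fixes u :: "plane => real"
 assumes bd: "bounded (u ` F)" and Z: "Z \<subseteq> ix k \<times> ix k"
 shows "(\<Sum>(i, j)\<in>Z. cost k u i j) \<le> rn k * (\<Sum>C\<in>HZ k Z. sz C * osc u C) + rn k * sqrt (tail k u)"
proof -
 have "(\<Sum>e\<in>(\<lambda>(i, j). lab k i j) ` Z. rn (k - fst e) * osc u (elt e))
   = (\<Sum>C\<in>HZ k Z. rn k * (sz C * osc u C)) + (\<Sum>e\<in>Rk k \<inter> Z. rn (k - fst (k, e)) * osc u (elt (k, e)))"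
 proof (rule label_split[OF Z])
  fix m a b assume h: "hole m a b" "m \<le> k"
  have "rn k = rn (k - m) * rn m" using h(2) by (simp add: power_add[symmetric])
  hence "rn (k - m) = rn k * sz (circ m a b)" by (simp add: sz_circ)
  thus "rn (k - fst (m, a, b)) * osc u (elt (m, a, b)) = rn k * (sz (circ m a b) * osc u (circ m a b))"
   unfolding elt_hole[OF h(1)] by simp
 qed
 also have "(\<Sum>e\<in>Rk k \<inter> Z. rn (k - fst (k, e)) * osc u (elt (k, e))) = (\<Sum>e\<in>Rk k \<inter> Z. osc u (cell k e))"
  by (rule sum.cong) (simp_all add: elt_rem del: elt.simps)
 also have "... \<le> rn k * sqrt (tail k u)" by (rule cells_lin) auto
 finally show ?thesis using cost_lin_sum[OF bd Z] by (simp add: sum_distrib_left)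
qed

lemma sqrt_mult_div: assumes "c > 0" "N \<ge> 0" shows "sqrt (N * c) = c * sqrt (N / c)"
proof -
 have "N * c = c\<^sup>2 * (N / c)" using assms by (simp add: power2_eq_square)
 hence "sqrt (N * c) = sqrt (c\<^sup>2) * sqrt (N / c)" by (metis real_sqrt_mult)
 thus ?thesis using assms by simp
qed

lemma exists_le_mean:
 fixes f :: "'a => real"
 assumes "finite J" "J \<noteq> {}" "(\<Sum>j\<in>J. f j) \<le> real (card J) * c"
 shows "\<exists>j\<in>J. f j \<le> c"
proof (rule ccontr)
 assume "\<not> ?thesis"
 hence "(\<Sum>j\<in>J. c) < (\<Sum>j\<in>J. f j)" using assms by (intro sum_strict_mono) auto
 thus False using assms by simp
qed

lemma sum_prod_le:
 fixes f :: "nat => nat => real"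
 assumes J: "finite J" and Z: "Z = I \<times> J"
 shows "(\<Sum>j\<in>J. \<Sum>i\<in>I. f i j) = (\<Sum>(i, j)\<in>Z. f i j)"
 unfolding Z by (simp add: sum.cartesian_product[symmetric] sum.swap[of _ J I])

text \<open>A discrete length--area estimate.\<close>

lemma cross:
 fixes u :: "plane => real"
 assumes bd: "bounded (u ` F)"
  and J: "J \<subseteq> ix k" "J \<noteq> {}" and I: "I \<subseteq> ix k" "I \<noteq> {}"
  and r: "\<And>j. j \<in> J ==> \<exists>i<n ^ k. \<exists>P\<in>elt (lab k i j). u P = s"
  and c: "\<And>i. i \<in> I ==> \<exists>j<n ^ k. \<exists>P\<in>elt (lab k i j). u P = t"
 shows "\<bar>s - t\<bar> \<le> (sqrt (rn k / real (card J)) + sqrt (rn k / real (card I))) *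
   sqrt (\<Sum>(i, j)\<in>ix k \<times> ix k. (cost k u i j)\<^sup>2)"
proof -
 let ?N = "(ix k)"
 define E where "E = (\<Sum>(i, j)\<in>?N \<times> ?N. (cost k u i j)\<^sup>2)"
 define rs where "rs j = (\<Sum>i\<in>?N. cost k u i j)" for j
 define cs where "cs i = (\<Sum>j\<in>?N. cost k u i j)" for i
 have fin: "finite J" "finite I" using J I finite_subset by auto
 have card: "real (card J) > 0" "real (card I) > 0" using fin J I by (auto simp: card_gt_0_iff)
 have E0: "0 \<le> E" unfolding E_def by (intro sum_nonneg) auto
 have sub: "(\<Sum>(i, j)\<in>Z. cost k u i j) \<le> sqrt (real (card Z)) * sqrt E" if Z: "Z \<subseteq> ?N \<times> ?N" for Z
 proof (rule power2_le_imp_le)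
  have "(\<Sum>(i, j)\<in>Z. cost k u i j)\<^sup>2 \<le> real (card Z) * (\<Sum>z\<in>Z. (case z of (i, j) => cost k u i j)\<^sup>2)" by (rule sum_cs)
  also have "(\<Sum>z\<in>Z. (case z of (i, j) => cost k u i j)\<^sup>2) \<le> E"
  proof -
   have "(\<Sum>z\<in>Z. (case z of (i, j) => cost k u i j)\<^sup>2) \<le> (\<Sum>z\<in>?N \<times> ?N. (case z of (i, j) => cost k u i j)\<^sup>2)"
    using Z by (intro sum_mono2) auto
   thus ?thesis unfolding E_def by (simp add: case_prod_unfold)
  qed
  finally show "(\<Sum>(i, j)\<in>Z. cost k u i j)\<^sup>2 \<le> (sqrt (real (card Z)) * sqrt E)\<^sup>2"
   using E0 by (simp add: power_mult_distrib mult_left_mono)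
 qed (use E0 in simp)
 have "(\<Sum>j\<in>J. rs j) = (\<Sum>(i, j)\<in>?N \<times> J. cost k u i j)"
  unfolding rs_def by (rule sum_prod_le[OF fin(1) refl])
 also have "... \<le> sqrt (real (card (?N \<times> J))) * sqrt E" by (rule sub) (use J in auto)
 also have "... = real (card J) * (sqrt (rn k / real (card J)) * sqrt E)"
 proof -
  have "sqrt (real (card (?N \<times> J))) = real (card J) * sqrt (rn k / real (card J))"
   using sqrt_mult_div[OF card(1), of "rn k"] sqrt_mult_div[OF card(2), of "rn k"] by (simp add: card_cartesian_product mult.commute)
  thus ?thesis by simp
 qed
 finally obtain j where j: "j \<in> J" "rs j \<le> sqrt (rn k / real (card J)) * sqrt E"
  using exists_le_mean[OF fin(1) J(2)] by blast
 have "(\<Sum>i\<in>I. cs i) = (\<Sum>(i, j)\<in>I \<times> ?N. cost k u i j)"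
  unfolding cs_def by (simp add: sum.cartesian_product)
 also have "... \<le> sqrt (real (card (I \<times> ?N))) * sqrt E" by (rule sub) (use I in auto)
 also have "... = real (card I) * (sqrt (rn k / real (card I)) * sqrt E)"
 proof -
  have "sqrt (real (card (I \<times> ?N))) = real (card I) * sqrt (rn k / real (card I))"
   using sqrt_mult_div[OF card(1), of "rn k"] sqrt_mult_div[OF card(2), of "rn k"] by (simp add: card_cartesian_product mult.commute)
  thus ?thesis by simp
 qed
 finally obtain i where i: "i \<in> I" "cs i \<le> sqrt (rn k / real (card I)) * sqrt E"
  using exists_le_mean[OF fin(2) I(2)] by blast
 have ij: "i < n ^ k" "j < n ^ k" using i j I J by auto
 obtain i1 P where P: "i1 < n ^ k" "P \<in> elt (lab k i1 j)" "u P = s" using r j by blast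
 obtain j1 Q where Q: "j1 < n ^ k" "Q \<in> elt (lab k i j1)" "u Q = t" using c i by blast
 \<comment> \<open>The cheap row and the cheap column meet in the lattice cell (i, j); any point of
   its element links the value s to the value t.\<close>
 have "elt (lab k i j) \<noteq> {}"
 proof (rule lab_cases[OF ij])
  assume "rem k i j" "elt (lab k i j) = cell k (i, j)"
  moreover have "(i, j) \<in> Rk k" using \<open>rem k i j\<close> by (simp add: Rk_def)
  ultimately show ?thesis using hc_sub[of "(i, j)" k] circ_corners unfolding hc_def by blast
 next
  fix m a b assume "elt (lab k i j) = circ m a b" thus ?thesis using circ_corners(1) by (metis empty_iff)
 qed
 then obtain S where S: "S \<in> elt (lab k i j)" by blast
 have "\<bar>u P - u S\<bar> \<le> rs j"
  using row_le[OF bd ij(2) sat_full, of i1 i P S] P S ij unfolding rs_def by (simp add: lessThan_atLeast0)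
 moreover have "\<bar>u Q - u S\<bar> \<le> cs i"
  using col_le[OF bd ij(1) sat_full, of j1 j Q S] Q S ij unfolding cs_def by (simp add: lessThan_atLeast0)
 ultimately have "\<bar>s - t\<bar> \<le> rs j + cs i" using P(3) Q(3) by linarith
 also have "... \<le> (sqrt (rn k / real (card J)) + sqrt (rn k / real (card I))) * sqrt E"
  using i(2) j(2) by (simp add: distrib_right)
 finally show ?thesis unfolding E_def .
qed

lemma Out_not_hole: "Out \<notin> Holes"
proof
 assume "Out \<in> Holes"
 then obtain k i j where "Out = circ k i j" "hole k i j" unfolding Holes_def by blast
 thus False using circ_inj[of 0 0 0 k i j] hole_pos[of k i j] unfolding Out_def by auto
qed

lemma GF_Holes: assumes "GF g" "g ` Out = Out" "C \<in> Holes" shows "g ` C \<in> Holes"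
proof -
 have C: "C \<in> Per" using assms Holes_Per by blast
 have "g ` C \<noteq> Out"
  using GF_inj_im[OF assms(1) Per_F[OF C] Per_F[OF Out_Per]] assms Out_not_hole by metis
 thus ?thesis using GF_Per[OF assms(1) C] by (auto simp: Per_def)
qed

lemma GF_hole_sum: assumes "GF g" "g ` Out = Out" "finite A" "A \<subseteq> Holes" shows "(\<Sum>C\<in>A. (sz (g ` C))\<^sup>2) \<le> 1"
proof -
 have "A \<subseteq> Per" using assms(4) Holes_Per by (rule order_trans)
 hence "inj_on ((`) g) A" by (rule inj_on_subset[OF bij_betw_imp_inj_on[OF GF_Per_bij[OF assms(1)]]])
 hence "(\<Sum>C\<in>A. (sz (g ` C))\<^sup>2) = (\<Sum>D\<in>(`) g ` A. (sz D)\<^sup>2)" by (simp add: sum.reindex)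
 also have "... \<le> 1"
 proof (rule packing1)
  show "(`) g ` A \<subseteq> Holes" using GF_Holes[OF assms(1,2)] assms(4) by blast
 qed (simp add: assms(3))
 finally show ?thesis .
qed

lemma GF_fst_bounded: "GF g ==> bounded ((fst \<circ> g) ` F)"
 using GF_bounded[of g] bounded_fst by (metis image_comp)

lemma GF_fst_tail: assumes "GF g" shows "(\<lambda>k. tail k (fst \<circ> g)) \<longlonglongrightarrow> 0"
proof (rule tendsto_sandwich[OF _ _ tendsto_const GF_tail[OF assms]])
 have "tail k (fst \<circ> g) \<le> 1\<^sup>2 * tail k g" for k
  by (rule tail_comp_lip[OF assms]) (auto simp: dist_fst_le)
 thus "\<forall>\<^sub>F k in sequentially. tail k (fst \<circ> g) \<le> tail k g" by simp
qed (simp add: tail_nonneg)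

lemma HZ_full: assumes "hole m a b" "m \<le> k" shows "circ m a b \<in> HZ k (ix k \<times> ix k)"
proof -
 define M where "M = n ^ (k - m)"
 have M: "M > 0" by (simp add: M_def)
 have NM: "n ^ m * M = n ^ k" using assms by (simp add: M_def power_add[symmetric])
 have "a < n ^ m" "b < n ^ m" using hole_bound[OF assms(1)] by auto
 hence "a * M < n ^ k" "b * M < n ^ k" using M NM by (metis mult_less_mono1)+
 moreover have "lab k (a * M) (b * M) = (m, a, b)"
  by (rule lab_hole[OF assms]) (use M in \<open>simp_all add: M_def\<close>)
 ultimately have "(a * M, b * M) \<in> ix k \<times> ix k" "lab k (fst (a * M, b * M)) (snd (a * M, b * M)) = (m, a, b)" by auto
 hence "(m, a, b) \<in> {(m, a, b). hole m a b \<and> (\<exists>z\<in>ix k \<times> ix k. lab k (fst z) (snd z) = (m, a, b))}"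
  using assms(1) by blast
 thus ?thesis unfolding HZ_def by (metis (no_types, lifting) case_prod_conv image_eqI)
qed

lemma row_ends:
 assumes "j < n ^ k"
 shows "(0, gr k j) \<in> elt (lab k 0 j)" "(1, gr k j) \<in> elt (lab k (n ^ k - 1) j)"
proof -
 have N: "n ^ k > 0" by simp
 show "(0, gr k j) \<in> elt (lab k 0 j)" using left_pt[of 0 k j j] N assms by simp
 have "(gr k (n ^ k - 1 + 1), gr k j) \<in> elt (lab k (n ^ k - 1) j)"
  by (rule right_pt) (use N assms in auto)
 moreover have "gr k (n ^ k - 1 + 1) = 1" proof -
  have "n ^ k - 1 + 1 = n ^ k" using N by linarith
  thus ?thesis by simp
 qed
 ultimately show "(1, gr k j) \<in> elt (lab k (n ^ k - 1) j)" by simp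
qed

lemma row_ends_Out:
 assumes "j < n ^ k" shows "(0, gr k j) \<in> Out" "(1, gr k j) \<in> Out"
proof -
 have "real j \<le> real (n ^ k)" using assms by (simp only: of_nat_le_iff)
 hence "gr k j \<le> 1" by simp
 thus "(0, gr k j) \<in> Out" "(1, gr k j) \<in> Out" by (auto simp: Out_iff)
qed

lemma rigid_sz:
 assumes g: "GF g" and gO: "\<And>z. z \<in> Out ==> g z = z" and C0: "C0 \<in> Holes"
 shows "sz (g ` C0) = sz C0"
proof -
 have gOut: "g ` Out = Out" using gO by simp
 obtain m a b where m: "C0 = circ m a b" "hole m a b" using C0 unfolding Holes_def by blast
 define u where "u = fst \<circ> g"
 have bd: "bounded (u ` F)" unfolding u_def by (rule GF_fst_bounded[OF g])
 have tl: "(\<lambda>k. tail k u) \<longlonglongrightarrow> 0" unfolding u_def by (rule GF_fst_tail[OF g])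
 have est: "(sz C0 - sz (g ` C0))\<^sup>2 \<le> 2 * sqrt (tail k u)" if k: "m \<le> k" for k
 proof -
  let ?N = "(ix k)"
  let ?H = "HZ k (?N \<times> ?N)"
  have fH: "finite ?H" "?H \<subseteq> Holes" using finite_HZ HZ_Holes by auto
  have row: "1 \<le> (\<Sum>i\<in>?N. cost k u i j)" if j: "j \<in> ?N" for j
  proof -
   have "\<bar>u (0, gr k j) - u (1, gr k j)\<bar> \<le> (\<Sum>i\<in>{0..<n ^ k}. cost k u i j)"
    by (rule row_le[OF bd _ sat_full _ _ row_ends]) (use j in auto)
   moreover have "u (0, gr k j) = 0" "u (1, gr k j) = 1"
    using gO row_ends_Out[of j k] j by (auto simp: u_def)
   ultimately show ?thesis by (simp add: lessThan_atLeast0)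
  qed
  have "rn k = (\<Sum>j\<in>?N. 1)" by simp
  also have "... \<le> (\<Sum>j\<in>?N. \<Sum>i\<in>?N. cost k u i j)" by (intro sum_mono row)
  also have "... = (\<Sum>(i, j)\<in>?N \<times> ?N. cost k u i j)" by (rule sum_prod_le) auto
  also have "... \<le> rn k * (\<Sum>C\<in>?H. sz C * osc u C) + rn k * sqrt (tail k u)"
   by (rule cost_lin[OF bd]) simp
  also have "(\<Sum>C\<in>?H. sz C * osc u C) = (\<Sum>C\<in>?H. sz C * sz (g ` C))" by (simp add: u_def sz_osc)
  finally have "rn k * 1 \<le> rn k * ((\<Sum>C\<in>?H. sz C * sz (g ` C)) + sqrt (tail k u))" by (simp add: distrib_left)
  hence A: "1 \<le> (\<Sum>C\<in>?H. sz C * sz (g ` C)) + sqrt (tail k u)" by (rule mult_left_le_imp_le) simp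
  have "(sz C0 - sz (g ` C0))\<^sup>2 \<le> (\<Sum>C\<in>?H. (sz C - sz (g ` C))\<^sup>2)"
   by (rule member_le_sum[OF _ _ fH(1), of C0 "\<lambda>C. (sz C - sz (g ` C))\<^sup>2"]) (use HZ_full[OF m(2) k] m(1) in auto)
  also have "... = (\<Sum>C\<in>?H. (sz C)\<^sup>2) + (\<Sum>C\<in>?H. (sz (g ` C))\<^sup>2) - 2 * (\<Sum>C\<in>?H. sz C * sz (g ` C))"
   by (simp add: power2_diff sum.distrib sum_subtractf sum_distrib_left mult.assoc)
  also have "... \<le> 2 * sqrt (tail k u)"
  proof -
   have "a + b - 2 * c \<le> 2 * s" if "a \<le> 1" "b \<le> 1" "1 \<le> c + s" for a b c s :: real using that by linarith
   thus ?thesis using packing1[OF fH] GF_hole_sum[OF g gOut fH] A by blast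
  qed
  finally show ?thesis .
 qed
 have "(\<lambda>k. 2 * sqrt (tail k u)) \<longlonglongrightarrow> 2 * sqrt 0" by (intro tendsto_intros tl)
 hence "(sz C0 - sz (g ` C0))\<^sup>2 \<le> 2 * sqrt 0"
  by (rule Lim_bounded2[where N = m]) (use est in auto)
 thus ?thesis by simp
qed

text \<open>Once every hole keeps its size, a lattice cell in a hole costs exactly
  \<open>1 / n ^ k\<close>. Averaged over the rows in J, u therefore changes no faster than the
  first coordinate, apart from the contribution of the surviving cells.\<close>

lemma rigid_part:
 assumes bd: "bounded (u ` F)" and sz: "\<And>C. C \<in> Holes ==> osc u C = sz C"
  and J: "J \<subseteq> ix k" "J \<noteq> {}" and xy: "y \<le> n ^ k"
  and s: "\<And>j. j \<in> J ==> sat k j x y" and i: "i1 \<in> {x..<y}" "i2 \<in> {x..<y}"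
  and P: "\<And>j. j \<in> J ==> P j \<in> elt (lab k i1 j)" and Q: "\<And>j. j \<in> J ==> Q j \<in> elt (lab k i2 j)"
 shows "\<exists>j\<in>J. \<bar>u (P j) - u (Q j)\<bar> \<le> gr k (y - x) + rn k * sqrt (tail k u) / real (card J)"
proof -
 let ?Z = "{x..<y} \<times> J"
 have fJ: "finite J" using J finite_subset by auto
 have cJ: "real (card J) > 0" using fJ J by (simp add: card_gt_0_iff)
 have Z: "?Z \<subseteq> ix k \<times> ix k" using J xy by auto
 have fZ: "finite ?Z" using fJ by simp
 define t where "t e = (if e \<in> Rk k then osc u (cell k e) else 0)" for e
 have c: "cost k u i j \<le> 1 / rn k + t (i, j)" if ij: "i < n ^ k" "j < n ^ k" for i j
 proof (rule lab_cases[OF ij])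
  assume h: "rem k i j" "lab k i j = (k, i, j)" "elt (lab k i j) = cell k (i, j)"
  have "cost k u i j = osc u (cell k (i, j))" unfolding cost_def unfolding h(3) unfolding h(2) by simp
  thus ?thesis using h(1) by (simp add: t_def Rk_def)
 next
  fix m a b assume h: "hole m a b" "m \<le> k" "lab k i j = (m, a, b)" "elt (lab k i j) = circ m a b"
  have H: "circ m a b \<in> Holes" using h by (auto simp: Holes_def)
  have "rn k = rn (k - m) * rn m" using h(2) by (simp add: power_add[symmetric])
  hence "cost k u i j = 1 / rn k"
   unfolding cost_def h(4) using h(3) sz[OF H] by (simp add: sz_circ)
  moreover have "t (i, j) \<ge> 0" unfolding t_def by (simp add: osc_nonneg[OF bounded_subset[OF bd image_mono[OF cell_F]]])
  ultimately show ?thesis by simp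
 qed
 have "(\<Sum>j\<in>J. \<bar>u (P j) - u (Q j)\<bar>) \<le> (\<Sum>j\<in>J. \<Sum>i\<in>{x..<y}. cost k u i j)"
 proof (rule sum_mono)
  fix j assume j: "j \<in> J"
  show "\<bar>u (P j) - u (Q j)\<bar> \<le> (\<Sum>i\<in>{x..<y}. cost k u i j)"
   by (rule row_le[OF bd _ s[OF j] i P[OF j] Q[OF j]]) (use j J in auto)
 qed
 also have "... = (\<Sum>(i, j)\<in>?Z. cost k u i j)" by (rule sum_prod_le[OF fJ refl])
 also have "... \<le> (\<Sum>(i, j)\<in>?Z. 1 / rn k + t (i, j))"
  by (rule sum_mono) (use c Z in \<open>auto simp del: atLeastLessThan_iff\<close>)
 also have "... = gr k (card ?Z) + (\<Sum>e\<in>?Z. t e)"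
  by (simp add: case_prod_unfold sum.distrib)
 also have "(\<Sum>e\<in>?Z. t e) = (\<Sum>e\<in>?Z \<inter> Rk k. osc u (cell k e))"
  unfolding t_def by (rule sum.inter_restrict[OF fZ, symmetric])
 also have "... \<le> rn k * sqrt (tail k u)" by (rule cells_lin) auto
 finally have "(\<Sum>j\<in>J. \<bar>u (P j) - u (Q j)\<bar>) \<le> real (card J) * (gr k (y - x) + rn k * sqrt (tail k u) / real (card J))"
  using cJ by (simp add: card_cartesian_product distrib_left mult.commute)
 thus ?thesis by (rule exists_le_mean[OF fJ J(2)])
qed

text \<open>Prepares rows that start at the left side of the unit square, or end at its right side,
  and stop at a side of a given surviving cell.\<close>

lemma cell_rows:
 assumes r: "rem l a b" and lk: "l \<le> k" and j: "j \<in> {b * n ^ (k - l)..<(b + 1) * n ^ (k - l)}"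
 defines "M \<equiv> n ^ (k - l)"
 shows "j < n ^ k" "(a + 1) * M \<le> n ^ k" "sat k j 0 ((a + 1) * M)" "sat k j (a * M) (n ^ k)"
  "(gr l (a + 1), gr k j) \<in> elt (lab k ((a + 1) * M - 1) j)"
  "(gr l a, gr k j) \<in> elt (lab k (a * M) j)"
  "(gr l (a + 1), gr k j) \<in> sq l a b"
  "(gr l a, gr k j) \<in> sq l a b"
proof -
 have M: "M > 0" by (simp add: M_def)
 have NM: "n ^ l * M = n ^ k" using lk by (simp add: M_def power_add[symmetric])
 have rNM: "rn k = rn l * real M" using NM by (metis of_nat_mult of_nat_power)
 have ab: "a < n ^ l" "b < n ^ l" using rem_bound[OF r] by auto
 have aN: "(a + 1) * M \<le> n ^ k" "(b + 1) * M \<le> n ^ k" using ab NM by (metis Suc_eq_plus1 Suc_leI mult_le_mono1)+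
 thus jN: "j < n ^ k" "(a + 1) * M \<le> n ^ k" using j by (auto simp: M_def)
 have aM: "a * M < (a + 1) * M" using M by simp
 have aMN: "a * M < n ^ k" using aM aN by linarith
 have jd: "j div M = b" using j div_eqI[of b M j] by (simp add: M_def)
 have id: "i div M = a" if "a * M \<le> i" "i < (a + 1) * M" for i using div_eqI that by blast
 have L: "l \<le> fst (lab k i j)" if "a * M \<le> i" "i < (a + 1) * M" for i
  by (rule lab_ge) (use lk that jN aN jd id[OF that] r in \<open>auto simp: M_def\<close>)
 have L1: "l \<le> fst (lab k ((a + 1) * M - 1) j)" using L[of "(a + 1) * M - 1"] aM by simp
 have L2: "l \<le> fst (lab k (a * M) j)" using L[of "a * M"] aM by simp
 have S1: "(a + 1) * M = n ^ k \<or> lab k ((a + 1) * M - 1) j \<noteq> lab k ((a + 1) * M) j"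
 proof (cases "(a + 1) * M = n ^ k")
  case False
  have "lab k ((a + 1) * M - 1) j \<noteq> lab k ((a + 1) * M) j"
   by (rule lab_sep[of l]) (use False aN jN lk L1 M in \<open>auto simp: M_def\<close>)
  thus ?thesis ..
 qed simp
 have S2: "a * M = 0 \<or> lab k (a * M - 1) j \<noteq> lab k (a * M) j"
 proof (cases "a * M = 0")
  case False
  have "lab k (a * M - 1) j \<noteq> lab k (a * M) j"
   by (rule lab_sep[of l]) (use False aMN jN lk L2 in \<open>auto simp: M_def\<close>)
  thus ?thesis ..
 qed simp
 show "sat k j 0 ((a + 1) * M)" using S1 aN by (auto simp: sat_def)
 show "sat k j (a * M) (n ^ k)" using S2 by (auto simp: sat_def)
 have fr: "gr k (c * M) = gr l c" for c :: nat using M unfolding rNM of_nat_mult by simp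
 have "(a + 1) * M - 1 + 1 = (a + 1) * M" using M by simp
 hence e1: "gr k ((a + 1) * M - 1 + 1) = gr l (a + 1)" using fr[of "a + 1"] by metis
 have "(gr k ((a + 1) * M - 1 + 1), gr k j) \<in> elt (lab k ((a + 1) * M - 1) j)"
  by (rule right_pt) (use S1 aN aM jN M in auto)
 thus "(gr l (a + 1), gr k j) \<in> elt (lab k ((a + 1) * M - 1) j)" unfolding e1 .
 have e2: "gr k (a * M) = gr l a" by (rule fr)
 have "(gr k (a * M), gr k j) \<in> elt (lab k (a * M) j)"
  by (rule left_pt) (use S2 aN aM jN M in auto)
 thus "(gr l a, gr k j) \<in> elt (lab k (a * M) j)" unfolding e2 .
 have jb: "b * n ^ (k - l) \<le> j" "j \<le> (b + 1) * n ^ (k - l)" using j by auto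
 have e3: "gr k ((a + 1) * M) = gr l (a + 1)" by (rule fr)
 show "(gr l (a + 1), gr k j) \<in> sq l a b"
  using lat_mem_sq[OF lk, of a "(a + 1) * M" b j] jb unfolding e3 by (simp add: M_def)
 show "(gr l a, gr k j) \<in> sq l a b"
  using lat_mem_sq[OF lk, of a "a * M" b j] jb unfolding e2 by (simp add: M_def)
qed

text \<open>Rows followed from the left side, where u = 0, bound u from above by the first
  coordinate; rows followed to the right side, where u = 1, bound it from below. Each bound holds
  for some row through a small cell around z, and continuity moves it to z.\<close>

lemma rigid_fst:
 assumes g: "GF g" and gO: "\<And>z. z \<in> Out ==> g z = z" and z: "z \<in> F"
 shows "fst (g z) = fst z"
proof -
 define u where "u = fst \<circ> g"
 have bd: "bounded (u ` F)" unfolding u_def by (rule GF_fst_bounded[OF g])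
 have tl: "(\<lambda>k. tail k u) \<longlonglongrightarrow> 0" unfolding u_def by (rule GF_fst_tail[OF g])
 have sz: "osc u C = sz C" if "C \<in> Holes" for C
  unfolding u_def sz_osc by (rule rigid_sz[OF g gO that])
 have cu: "continuous_on F u" unfolding u_def by (intro continuous_on_compose GF_cont[OF g] continuous_intros)
 have near: "(\<exists>P\<in>F. dist P z \<le> 2 / rn l \<and> u P \<le> fst z + 1 / rn l + e) \<and>
   (\<exists>P\<in>F. dist P z \<le> 2 / rn l \<and> u P \<ge> fst z - 1 / rn l - e)" if e: "e > 0" for l e
 proof -
  obtain a b where ab: "rem l a b" "z \<in> sq l a b" using z unfolding F_def mem_Collect_eq by blast
  have za: "gr l a \<le> fst z" "fst z \<le> (real a + 1) / rn l" using ab(2) by (auto simp: sq_times)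
  have "(\<lambda>k. rn l * sqrt (tail k u)) \<longlonglongrightarrow> rn l * sqrt 0" by (intro tendsto_intros tl)
  hence "\<forall>\<^sub>F k in sequentially. rn l * sqrt (tail k u) < e" using e by (intro order_tendstoD(2)) auto
  then obtain k where k: "l \<le> k" "rn l * sqrt (tail k u) < e"
   by (metis (mono_tags, lifting) eventually_sequentially nle_le)
  define M where "M = n ^ (k - l)"
  define J where "J = {b * M..<(b + 1) * M}"
  have M: "M > 0" by (simp add: M_def)
  have rNM: "rn k = rn l * real M" using k by (simp add: M_def power_add[symmetric])
  have fr: "gr k (c * M) = gr l c" for c :: nat using M unfolding rNM of_nat_mult by simp
  have J: "J \<noteq> {}" "card J = M" using M by (auto simp: J_def)
  note R = cell_rows[OF ab(1) k(1), folded M_def, folded J_def]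
  have JN: "J \<subseteq> ix k" using R(1) by blast
  have aN: "(a + 1) * M \<le> n ^ k" using R(2) J by blast
  have aM: "a * M < (a + 1) * M" using M by simp
  have q: "rn k * sqrt (tail k u) / real (card J) < e" using k(2) M unfolding J rNM by simp
  have eF: "P \<in> F" if "P \<in> elt (lab k i j)" "i < n ^ k" "j \<in> J" for P i j using elt_lab_F[of i k j] JN that by blast
  have "\<exists>j\<in>J. \<bar>u (0, gr k j) - u (gr l (a + 1), gr k j)\<bar> \<le> gr k ((a + 1) * M - 0) + rn k * sqrt (tail k u) / real (card J)"
  proof (rule rigid_part[OF bd sz JN J(1) aN, of 0 0 "(a + 1) * M - 1"])
   show "sat k j 0 ((a + 1) * M)" if "j \<in> J" for j using R(3)[OF that] .
   show "(0, gr k j) \<in> elt (lab k 0 j)" if "j \<in> J" for j using row_ends(1) that JN by blast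
   show "(gr l (a + 1), gr k j) \<in> elt (lab k ((a + 1) * M - 1) j)" if "j \<in> J" for j using R(5)[OF that] .
  qed (use M in auto)
  then obtain j where j: "j \<in> J" "\<bar>u (0, gr k j) - u (gr l (a + 1), gr k j)\<bar> \<le> gr k ((a + 1) * M) + e"
   using q by force
  have "u (0, gr k j) = 0" using gO row_ends_Out(1)[of j k] j(1) JN by (auto simp: u_def)
  moreover have "gr k ((a + 1) * M) = (real a + 1) / rn l" using fr[of "a + 1"] by (simp only: of_nat_add of_nat_1)
  moreover have "(real a + 1) / rn l = gr l a + 1 / rn l" by (simp add: add_divide_distrib)
  ultimately have 1: "u (gr l (a + 1), gr k j) \<le> fst z + 1 / rn l + e" using j(2) za by linarith
  have 2: "(gr l (a + 1), gr k j) \<in> F" using eF[OF R(5)[OF j(1)]] j(1) aN M by simp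
  have 3: "dist (gr l (a + 1), gr k j) z \<le> 2 / rn l" by (rule sq_dist[OF R(7)[OF j(1)] ab(2)])
  have "\<exists>j\<in>J. \<bar>u (gr l a, gr k j) - u (1, gr k j)\<bar> \<le> gr k (n ^ k - a * M) + rn k * sqrt (tail k u) / real (card J)"
  proof (rule rigid_part[OF bd sz JN J(1) order_refl, of "a * M" "a * M" "n ^ k - 1"])
   show "sat k j (a * M) (n ^ k)" if "j \<in> J" for j using R(4)[OF that] .
   show "(1, gr k j) \<in> elt (lab k (n ^ k - 1) j)" if "j \<in> J" for j using row_ends(2) that JN by blast
   show "(gr l a, gr k j) \<in> elt (lab k (a * M) j)" if "j \<in> J" for j using R(6)[OF that] .
   show "a * M \<in> {a * M..<n ^ k}" "n ^ k - 1 \<in> {a * M..<n ^ k}" using aM aN by auto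
  qed
  then obtain i where i: "i \<in> J" "\<bar>u (gr l a, gr k i) - u (1, gr k i)\<bar> \<le> gr k (n ^ k - a * M) + e"
   using q by force
  have "u (1, gr k i) = 1" using gO row_ends_Out(2)[of i k] i(1) JN by (auto simp: u_def)
  moreover have "gr k (n ^ k - a * M) = 1 - real a / rn l"
  proof -
   have "real (n ^ k - a * M) = rn k - real a * real M" using aM aN by (simp add: of_nat_diff)
   thus ?thesis using M unfolding rNM by (simp add: diff_divide_distrib)
  qed
  moreover have "(real a + 1) / rn l = gr l a + 1 / rn l" by (simp add: add_divide_distrib)
  ultimately have 4: "u (gr l a, gr k i) \<ge> fst z - 1 / rn l - e" using i(2) za by linarith
  have 5: "(gr l a, gr k i) \<in> F" using eF[OF R(6)[OF i(1)]] i(1) aN aM by simp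
  have 6: "dist (gr l a, gr k i) z \<le> 2 / rn l" by (rule sq_dist[OF R(8)[OF i(1)] ab(2)])
  show ?thesis using 1 2 3 4 5 6 by blast
 qed
 have lim: "(\<lambda>l. 2 / rn l) \<longlonglongrightarrow> 0"
  using LIMSEQ_inverse_realpow_zero[of "real n"] n5 tendsto_mult_right_zero[of "\<lambda>l. inverse (rn l)" sequentially 2]
  by (simp add: divide_inverse)
 have bd2: "\<bar>u z - fst z\<bar> \<le> 3 * e" if e: "e > 0" for e
 proof -
  obtain d where d: "d > 0" "\<And>P. P \<in> F ==> dist P z < d ==> dist (u P) (u z) < e"
   using cu z e unfolding continuous_on_iff by metis
  have "\<forall>\<^sub>F l in sequentially. 2 / rn l < min d e" using d e by (intro order_tendstoD(2)[OF lim]) auto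
  then obtain l where l: "2 / rn l < d" "2 / rn l < e" by (metis (mono_tags, lifting) eventually_sequentially min_less_iff_conj order_refl)
  have l2: "1 / rn l \<le> 2 / rn l" by (intro divide_right_mono) auto
  obtain P where P: "P \<in> F" "dist P z \<le> 2 / rn l" "u P \<le> fst z + 1 / rn l + e" using near[OF e] by blast
  obtain P' where P': "P' \<in> F" "dist P' z \<le> 2 / rn l" "u P' \<ge> fst z - 1 / rn l - e" using near[OF e] by blast
  have "dist (u P) (u z) < e" "dist (u P') (u z) < e" using d(2)[OF P(1) le_less_trans[OF P(2) l(1)]] d(2)[OF P'(1) le_less_trans[OF P'(2) l(1)]] by blast+
  thus ?thesis using P P' l l2 by (simp add: dist_real_def)
 qed
 have "\<bar>u z - fst z\<bar> \<le> e" if "e > 0" for e using bd2[of "e / 3"] that by simp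
 hence "\<bar>u z - fst z\<bar> \<le> 0" by (rule field_le_epsilon[of _ 0, simplified])
 thus ?thesis by (simp add: u_def)
qed

subsection \<open>Symmetries and the outer circle\<close>

definition rx :: "plane => plane" where "rx z = (1 - fst z, snd z)"
definition rot :: "plane => plane" where "rot z = (1 - snd z, fst z)"

lemma rot_rx: "rot z = rx (prod.swap z)" by (simp add: rot_def rx_def)
lemma rx_rx [simp]: "rx (rx z) = z" by (simp add: rx_def)
lemma rot4: "rot (rot (rot (rot z))) = z" by (simp add: rot_def)

lemma seg_reflect: assumes "i < n ^ k" shows "seg k (n ^ k - 1 - i) (1 - x) \<longleftrightarrow> seg k i x"
proof -
 have "real (n ^ k - 1 - i) = rn k - 1 - real i" using assms by (simp add: of_nat_diff)
 thus ?thesis unfolding seg_def by (auto simp: algebra_simps)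
qed

lemma oseg_reflect: assumes "i < n ^ k" shows "oseg k (n ^ k - 1 - i) (1 - x) \<longleftrightarrow> oseg k i x"
proof -
 have "real (n ^ k - 1 - i) = rn k - 1 - real i" using assms by (simp add: of_nat_diff)
 thus ?thesis unfolding oseg_def by (auto simp: algebra_simps)
qed

lemma reflect_div_mod: assumes "i < n ^ Suc k"
 shows "(n ^ Suc k - 1 - i) div n = n ^ k - 1 - i div n" "(n ^ Suc k - 1 - i) mod n = n - 1 - i mod n"
proof -
 define a where "a = i div n"
 define b where "b = i mod n"
 have i: "i = a * n + b" by (simp add: a_def b_def)
 have b: "b < n" by (simp add: b_def)
 have a: "a < n ^ k" using assms div_less_pow[of i k] by (simp add: a_def)
 have e: "n ^ Suc k - 1 - i = (n ^ k - 1 - a) * n + (n - 1 - b)"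
 proof -
  have "(n ^ k - 1 - a) * n + a * n + n = n ^ Suc k"
  proof -
   have "(n ^ k - 1 - a) * n + a * n + n = (n ^ k - 1 - a + a + 1) * n" by (simp add: algebra_simps)
   also have "n ^ k - 1 - a + a + 1 = n ^ k" using a by linarith
   finally show ?thesis by simp
  qed
  thus ?thesis unfolding i using b by linarith
 qed
 show "(n ^ Suc k - 1 - i) div n = n ^ k - 1 - i div n" "(n ^ Suc k - 1 - i) mod n = n - 1 - i mod n"
 proof -
  define X where "X = n ^ k - 1 - a"
  define c where "c = n - 1 - b"
  have "c < n" using b by (simp add: c_def)
  hence "(X * n + c) div n = X" "(X * n + c) mod n = c" by simp_all
  thus "(n ^ Suc k - 1 - i) div n = n ^ k - 1 - i div n" "(n ^ Suc k - 1 - i) mod n = n - 1 - i mod n"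
   unfolding e X_def c_def a_def b_def by auto
 qed
qed

lemma bad_reflect: "a < n ==> bad (n - 1 - a) b = bad a b"
 using q_facts unfolding bad_def by auto

lemma rem_reflect: "i < n ^ k ==> rem k (n ^ k - 1 - i) j = rem k i j"
proof (induction k arbitrary: i j)
 case (Suc k)
 have "i div n < n ^ k" using Suc.prems div_less_pow by blast
 thus ?case unfolding rem.simps reflect_div_mod[OF Suc.prems] using Suc.IH bad_reflect[of "i mod n"] by simp
qed simp

lemma rx_circ: assumes "i < n ^ k" shows "rx ` circ k i j = circ k (n ^ k - 1 - i) j"
proof -
 have 1: "rx z \<in> circ k (n ^ k - 1 - i) j" if "z \<in> circ k i j" "i < n ^ k" for z i
  using that(1) unfolding circ_def sq_def osq_def rx_def mem_Collect_eq Diff_iff fst_conv snd_conv seg_reflect[OF that(2)] oseg_reflect[OF that(2)] .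
 show ?thesis
 proof (intro equalityI subsetI)
  fix z assume z: "z \<in> circ k (n ^ k - 1 - i) j"
  have "n ^ k - 1 - (n ^ k - 1 - i) = i" "n ^ k - 1 - i < n ^ k" using assms by auto
  hence "rx z \<in> circ k i j" using 1[OF z] by simp
  thus "z \<in> rx ` circ k i j" by (intro image_eqI[of _ _ "rx z"]) auto
 qed (use 1 assms in auto)
qed

lemma rx_F: "z \<in> F ==> rx z \<in> F"
 unfolding F_def mem_Collect_eq
proof
 fix k assume "\<forall>k. \<exists>i j. rem k i j \<and> z \<in> sq k i j"
 then obtain i j where ij: "rem k i j" "z \<in> sq k i j" by blast
 hence i: "i < n ^ k" using rem_bound by blast
 have "rem k (n ^ k - 1 - i) j" using rem_reflect[OF i] ij by simp
 moreover have "rx z \<in> sq k (n ^ k - 1 - i) j" using ij(2) seg_reflect[OF i] by (simp add: sq_def rx_def)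
 ultimately show "\<exists>i j. rem k i j \<and> rx z \<in> sq k i j" by blast
qed

lemma rx_im: "rx ` F = F"
proof (intro equalityI subsetI)
 fix z assume "z \<in> F" thus "z \<in> rx ` F" by (intro image_eqI[of _ _ "rx z"]) (auto simp: rx_F)
qed (auto simp: rx_F)

lemma GF_isoI: assumes "\<And>z w. dist (f z) (f w) = dist z w" "f ` F = F" shows "GF f"
proof (rule GF_iso)
 have "inj f"
 proof (rule injI)
  fix x y assume "f x = f y" thus "x = y" using assms(1)[of x y] by simp
 qed
 thus "bij_betw f F F" unfolding bij_betw_def using assms(2) by (auto intro: inj_on_subset)
qed (rule assms)

lemma dist_rx: "dist (rx z) (rx w) = dist z w"
 by (simp add: rx_def dist_prod_def dist_real_def power2_commute[of "fst w"])
lemma dist_swap: "dist (prod.swap z) (prod.swap w) = dist z (w :: plane)"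
 by (simp add: dist_prod_def add.commute)

lemma GF_rx: "GF rx" by (rule GF_isoI[OF dist_rx rx_im])
lemma GF_swap: "GF prod.swap" by (rule GF_isoI[OF dist_swap swap_image_F])
lemma rot_comp: "rot = rx \<circ> prod.swap" by (auto simp: rot_rx)
lemma GF_rot: "GF rot" unfolding rot_comp by (rule GF_comp[OF GF_rx GF_swap])
lemma dist_rot: "dist (rot z) (rot w) = dist z w" by (simp add: rot_rx dist_rx dist_swap)

lemma rot_circ: assumes "j < n ^ k" shows "rot ` circ k i j = circ k (n ^ k - 1 - j) i"
 unfolding rot_comp image_comp[symmetric] swap_image_circ rx_circ[OF assms] ..

lemma GF_rots: "GF (rot ^^ s)" by (induction s) (auto simp: GF_id[unfolded id_def] intro: GF_comp[OF GF_rot, unfolded comp_def])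

text \<open>The four largest holes are numbered counterclockwise modulo 4, starting at the lower
  left. Rotation then adds 1 (\<open>rot_Mc\<close>) and the swap multiplies by 3
  (\<open>swap_Mc\<close>), so symmetries act by arithmetic modulo 4.\<close>

definition ma :: "nat => nat" where "ma i = (if i mod 4 = 0 \<or> i mod 4 = 3 then p else q)"
definition mb :: "nat => nat" where "mb i = (if i mod 4 = 0 \<or> i mod 4 = 1 then p else q)"
definition Mc :: "nat => plane set" where "Mc i = circ 1 (ma i) (mb i)"

lemma ma_q: "ma i < n" "mb i < n" "ma i < q + 1" "ma i = p \<or> ma i = q" "mb i = p \<or> mb i = q" using q_facts by (auto simp: ma_def mb_def)

lemma mod4: fixes i :: nat obtains "i mod 4 = 0" | "i mod 4 = 1" | "i mod 4 = 2" | "i mod 4 = 3" by linarith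

lemma Mc_mod: "Mc (i mod 4) = Mc i" by (simp add: Mc_def ma_def mb_def)

lemma Mc_hole: "hole 1 (ma i) (mb i)"
 using q_facts ma_q[of i] by (auto simp: hole_def bad_def)

lemma Mc_Holes: "Mc i \<in> Holes" unfolding Mc_def Holes_def using Mc_hole by blast
lemma Mc_Per: "Mc i \<in> Per" using Mc_Holes Holes_Per by blast
lemma Mc_neq_Out: "Mc i \<noteq> Out" using Mc_Holes Out_not_hole by metis
lemma sz_Mc: "sz (Mc i) = 1 / real n" by (simp add: Mc_def sz_circ)

lemma Mc_eq: "Mc i = Mc j \<longleftrightarrow> i mod 4 = j mod 4"
proof
 assume "Mc i = Mc j"
 hence e: "ma i = ma j \<and> mb i = mb j" unfolding Mc_def using circ_inj by blast
 have pq: "p \<noteq> q" using q_facts by auto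
 show "i mod 4 = j mod 4" using e pq
  by (cases i rule: mod4; cases j rule: mod4) (simp_all add: ma_def mb_def)
next
 assume "i mod 4 = j mod 4" thus "Mc i = Mc j" by (metis Mc_mod)
qed

lemma rot_Mc: "rot ` Mc i = Mc (Suc i)"
proof -
 have b: "mb i < n ^ 1" using ma_q by simp
 have e: "n ^ 1 - 1 - mb i = ma (Suc i)" "ma i = mb (Suc i)"
  using q_facts by (cases i rule: mod4; simp add: ma_def mb_def mod_Suc)+
 show ?thesis unfolding Mc_def rot_circ[OF b] using e by simp
qed

lemma rots_Mc: "(rot ^^ s) ` Mc i = Mc (s + i)"
proof (induction s)
 case (Suc s)
 have "(rot ^^ Suc s) ` Mc i = rot ` (rot ^^ s) ` Mc i" by (simp add: image_comp)
 thus ?case using Suc rot_Mc by simp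
qed simp

lemma swap_Mc: "prod.swap ` Mc i = Mc (3 * i)"
proof -
 have e: "ma (3 * i) = mb i" "mb (3 * i) = ma i"
 proof -
  have "3 * i mod 4 = (3 * (i mod 4)) mod 4" by (simp add: mod_mult_right_eq)
  thus "ma (3 * i) = mb i" "mb (3 * i) = ma i" by (cases i rule: mod4; simp add: ma_def mb_def)+
 qed
 show ?thesis unfolding Mc_def swap_image_circ e ..
qed

lemma swap_Out: "prod.swap ` Out = Out" unfolding Out_def swap_image_circ ..
lemma rot_Out: "rot ` Out = Out" unfolding Out_def using rot_circ[of 0 0 0] by simp
lemma rots_Out: "(rot ^^ s) ` Out = Out"
proof (induction s)
 case (Suc s)
 have "(rot ^^ Suc s) ` Out = rot ` (rot ^^ s) ` Out" by (simp add: image_comp)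
 thus ?case using Suc rot_Out by simp
qed simp

text \<open>Conjugation by the swap exchanges the coordinates, so \<open>rigid_fst\<close> also
  settles the second one.\<close>

lemma rigid:
 assumes g: "GF g" and gO: "\<And>z. z \<in> Out ==> g z = z" and z: "z \<in> F"
 shows "g z = z"
proof -
 define h where "h = prod.swap \<circ> g \<circ> prod.swap"
 have h: "GF h" unfolding h_def by (intro GF_comp GF_swap g)
 have sO: "prod.swap w \<in> Out" if "w \<in> Out" for w using that swap_Out by blast
 have hO: "h w = w" if "w \<in> Out" for w using gO[OF sO[OF that]] by (simp add: h_def)
 have sF: "prod.swap z \<in> F" using z F_swap by blast
 have "fst (h (prod.swap z)) = fst (prod.swap z)" by (rule rigid_fst[OF h hO sF])
 hence "snd (g z) = snd z" by (simp add: h_def)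
 thus ?thesis using rigid_fst[OF g gO z] by (simp add: prod_eq_iff)
qed

text \<open>Central parametrisation of the boundary of the unit square.\<close>

definition om :: "real => plane" where
 "om a = (1 / 2 + cos a / (2 * max \<bar>cos a\<bar> \<bar>sin a\<bar>), 1 / 2 + sin a / (2 * max \<bar>cos a\<bar> \<bar>sin a\<bar>))"

definition toC :: "plane => complex" where "toC z = Complex (fst z) (snd z)"
definition ofC :: "complex => plane" where "ofC w = (Re w, Im w)"
definition c0 :: complex where "c0 = Complex (1 / 2) (1 / 2)"

lemma ofC_toC [simp]: "ofC (toC z) = z" by (simp add: ofC_def toC_def)
lemma toC_ofC [simp]: "toC (ofC z) = z" by (simp add: ofC_def toC_def)
lemma toC_inj: "toC z = toC w \<longleftrightarrow> z = w" by (metis ofC_toC)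
lemma cont_toC: "continuous_on A toC" unfolding toC_def by (intro continuous_intros)
lemma cont_ofC: "continuous_on A ofC" unfolding ofC_def by (intro continuous_intros)
lemma dist_toC: "dist (toC z) (toC w) = dist z w"
 by (simp add: toC_def dist_complex_def cmod_def dist_prod_def dist_real_def)

lemma om_max_pos: "max \<bar>cos a\<bar> \<bar>sin a\<bar> > (0::real)"
proof (rule ccontr)
 assume "\<not> ?thesis"
 hence "cos a = 0" "sin a = 0" by (auto simp: less_max_iff_disj)
 thus False using sin_cos_squared_add[of a] by (simp del: sin_cos_squared_add sin_cos_squared_add2)
qed

lemma cont_om: "continuous_on A om"
 unfolding om_def using om_max_pos by (intro continuous_intros) (auto simp: less_le)

lemma om_Out: "om a \<in> Out"
proof -
 define M where "M = max \<bar>cos a\<bar> \<bar>sin a\<bar>"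
 have M: "M > 0" using om_max_pos by (simp add: M_def)
 have b: "-M \<le> cos a" "cos a \<le> M" "-M \<le> sin a" "sin a \<le> M" by (auto simp: M_def)
 have e: "cos a = M \<or> cos a = -M \<or> sin a = M \<or> sin a = -M" by (auto simp: M_def max_def abs_if)
 have b': "-1/2 \<le> cos a / (2 * M)" "cos a / (2 * M) \<le> 1/2" "-1/2 \<le> sin a / (2 * M)" "sin a / (2 * M) \<le> 1/2"
  using b M by (simp_all add: field_simps)
 have e': "cos a / (2 * M) = 1/2 \<or> cos a / (2 * M) = -1/2 \<or> sin a / (2 * M) = 1/2 \<or> sin a / (2 * M) = -1/2"
  using e M by auto
 show ?thesis unfolding Out_iff om_def M_def[symmetric] using b' e' by auto
qed

lemma Out_om:
 assumes w: "w \<in> Out" and r: "r > 0" and e: "toC w - c0 = of_real r * cis t"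
 shows "w = om t"
proof -
 have x: "fst w = 1 / 2 + r * cos t" "snd w = 1 / 2 + r * sin t"
  using e by (auto simp: toC_def c0_def complex_eq_iff)
 define M where "M = max \<bar>cos t\<bar> \<bar>sin t\<bar>"
 have M: "M > 0" using om_max_pos by (simp add: M_def)
 have "r * M = 1 / 2"
 proof -
  have "r * M = max \<bar>fst w - 1 / 2\<bar> \<bar>snd w - 1 / 2\<bar>"
   unfolding x M_def using r by (simp add: abs_mult max_mult_distrib_left)
  also have "... = 1 / 2" using w unfolding Out_iff by (auto simp: max_def abs_if mem_Times_iff)
  finally show ?thesis .
 qed
 hence "r = 1 / (2 * M)" using M by (simp add: field_simps)
 thus ?thesis using x unfolding om_def M_def[symmetric] by (simp add: prod_eq_iff)
qed

lemma om_polar: "toC (om t) - c0 = of_real (1 / (2 * max \<bar>cos t\<bar> \<bar>sin t\<bar>)) * cis t"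
 by (simp add: toC_def om_def c0_def complex_eq_iff)

lemma om_eq: "om a = om b \<longleftrightarrow> (\<exists>k::int. a = b + 2 * pi * of_int k)"
proof
 assume e: "om a = om b"
 define A where "A = 1 / (2 * max \<bar>cos a\<bar> \<bar>sin a\<bar>)"
 define B where "B = 1 / (2 * max \<bar>cos b\<bar> \<bar>sin b\<bar>)"
 have AB: "A > 0" "B > 0" using om_max_pos by (auto simp: A_def B_def)
 have 1: "of_real A * cis a = of_real B * cis b" using om_polar[of a] om_polar[of b] e unfolding A_def B_def by simp
 hence "cmod (of_real A * cis a) = cmod (of_real B * cis b)" by simp
 hence "A = B" using AB by (simp add: norm_mult)
 hence "cis a = cis b" using 1 AB by simp
 hence "sin a = sin b" "cos a = cos b" by (auto simp: complex_eq_iff)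
 then obtain k :: int where "a = b + 2 * of_int k * pi" using sin_cos_eq_iff[of a b] by (auto simp: mult.commute mult.left_commute)
 thus "\<exists>k::int. a = b + 2 * pi * of_int k" by (auto simp: mult_ac)
next
 assume "\<exists>k::int. a = b + 2 * pi * of_int k"
 then obtain k :: int where k: "a = b + 2 * pi * of_int k" by blast
 have "sin a = sin b \<and> cos a = cos b" unfolding sin_cos_eq_iff k by (auto simp: mult_ac)
 thus "om a = om b" by (simp add: om_def)
qed

lemma om_surj: assumes "w \<in> Out" shows "\<exists>t. w = om t"
proof -
 have "toC w - c0 \<noteq> 0"
 proof
  assume "toC w - c0 = 0"
  hence "fst w = 1 / 2" "snd w = 1 / 2" by (auto simp: toC_def c0_def complex_eq_iff)
  thus False using assms by (auto simp: Out_iff)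
 qed
 moreover have "toC w - c0 = of_real (cmod (toC w - c0)) * cis (Arg (toC w - c0))"
  using rcis_cmod_Arg[of "toC w - c0"] by (simp add: rcis_def)
 ultimately show ?thesis using Out_om[OF assms, of "cmod (toC w - c0)"] by auto
qed

lemma rot_om: "rot (om a) = om (a + pi / 2)"
 by (simp add: om_def rot_def cos_add sin_add max.commute)
lemma swap_om: "prod.swap (om a) = om (pi / 2 - a)"
 by (simp add: om_def cos_diff sin_diff max.commute)

text \<open>A lift of the boundary map to the universal cover of \<open>Out\<close>; strict
  monotonicity encodes preservation of orientation.\<close>

definition lift :: "(plane => plane) => (real => real) => bool" where
 "lift g l \<longleftrightarrow> continuous_on UNIV l \<and> strict_mono l \<and> (\<forall>a. g (om a) = om (l a))"
definition pos :: "(plane => plane) => bool" where "pos g \<longleftrightarrow> (\<exists>l. lift g l)"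

lemma lift_comp: "lift g l ==> lift h m ==> lift (g \<circ> h) (l \<circ> m)"
 unfolding lift_def by (auto intro!: continuous_on_compose2[of UNIV l UNIV m] strict_mono_compose simp: strict_mono_def comp_def)

lemma pos_comp: "pos g ==> pos h ==> pos (g \<circ> h)"
 unfolding pos_def using lift_comp by blast

lemma lift_rot: "lift rot (\<lambda>a. a + pi / 2)"
 unfolding lift_def by (auto simp: rot_om strict_mono_def intro!: continuous_intros)

lemma pos_rots: "pos (rot ^^ s)"
proof (induction s)
 case 0
 have "lift (rot ^^ 0) (\<lambda>a. a)" by (auto simp: lift_def strict_mono_def)
 thus ?case unfolding pos_def by blast
next
 case (Suc s)
 have "pos (rot \<circ> (rot ^^ s))" by (rule pos_comp[OF _ Suc]) (use lift_rot in \<open>auto simp: pos_def\<close>)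
 thus ?case by (simp add: comp_def)
qed

lemma lift_shift: assumes "lift g l" shows "lift g (\<lambda>a. l a + 2 * pi * of_int k)"
proof -
 have "om (l a + 2 * pi * of_int k) = om (l a)" for a using om_eq by blast
 thus ?thesis using assms unfolding lift_def by (auto intro!: continuous_intros simp: strict_mono_def)
qed

text \<open>Near an interior extremum a continuous function takes equal values on the two sides, at
  distance below d. If l took the same value at both ends of an interval, its extrema could thus lie
  at the ends only, and l would be constant.\<close>

lemma locally_inj_imp_inj:
 fixes l :: "real => real"
 assumes c: "continuous_on UNIV l" and d: "d > 0" and inj: "\<And>a b. a < b ==> b - a < d ==> l a \<noteq> l b"
 shows "inj l"
proof -
 have c': "continuous_on A l" for A using c continuous_on_subset by blast
 \<comment> \<open>The sign s treats maxima and minima at once.\<close>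
 have nomax: False if s: "s = 1 \<or> s = - 1" and x: "a < x" "x < b" and m: "\<And>y. y \<in> {a..b} ==> s * l y \<le> s * l x" for s a b x
 proof -
  define e where "e = min (d / 3) (min (x - a) (b - x))"
  have e: "e > 0" using d x by (auto simp: e_def)
  have "e \<le> d / 3" unfolding e_def by (rule min.cobounded1)
  have "e \<le> x - a" "e \<le> b - x" unfolding e_def by (simp_all add: min.coboundedI2)
  note e = e \<open>e \<le> d / 3\<close>
  have e: "e > 0" "e \<le> d / 3" "a \<le> x - e" "x + e \<le> b" using e \<open>e \<le> x - a\<close> \<open>e \<le> b - x\<close> by auto
  define h where "h y = s * l y" for y
  have ch: "continuous_on A h" for A unfolding h_def by (intro continuous_intros c')
  have neq: "h y \<noteq> h z" if "y < z" "z - y < d" for y z using inj[OF that] s by (auto simp: h_def)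
  have 1: "h (x - e) < h x" using m[of "x - e"] e x neq[of "x - e" x] d by (auto simp: h_def less_le)
  have 2: "h (x + e) < h x" using m[of "x + e"] e x neq[of x "x + e"] d by (auto simp: h_def less_le)
  show False
  proof (cases "h (x - e) \<le> h (x + e)")
   case True
   obtain y where y: "x - e \<le> y" "y \<le> x" "h y = h (x + e)"
    using IVT'[of h "x - e" "h (x + e)" x] True 2 e ch by auto
   thus False using neq[of y "x + e"] e d by auto
  next
   case False
   obtain y where y: "x \<le> y" "y \<le> x + e" "h y = h (x - e)"
    using IVT2'[of h "x + e" "h (x - e)" x] False 1 e ch by auto
   thus False using neq[of "x - e" y] e d by auto
  qed
 qed
 have "l a \<noteq> l b" if ab: "a < b" for a b
 proof
  assume eq: "l a = l b"
  obtain x where x: "x \<in> {a..b}" "\<And>y. y \<in> {a..b} ==> l y \<le> l x"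
   using continuous_attains_sup[OF compact_Icc _ c'[of "{a..b}"]] ab by auto
  obtain x' where x': "x' \<in> {a..b}" "\<And>y. y \<in> {a..b} ==> l x' \<le> l y"
   using continuous_attains_inf[OF compact_Icc _ c'[of "{a..b}"]] ab by auto
  show False
  proof (cases "a < x \<and> x < b \<or> a < x' \<and> x' < b")
   case True
   thus False using nomax[of 1 a x b] x nomax[of "-1" a x' b] x' by auto
  next
   case False
   hence "l x = l a" "l x' = l a" using x(1) x'(1) eq by (auto simp: less_le)
   hence const: "l y = l a" if "y \<in> {a..b}" for y using x(2)[OF that] x'(2)[OF that] by simp
   define y where "y = a + min (b - a) (d / 2)"
   have "y \<in> {a..b}" "a < y" "y - a < d" using ab d by (auto simp: y_def)
   thus False using inj[of a y] const[of y] by simp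
  qed
 qed
 thus ?thesis by (intro injI) (metis linorder_neqE)
qed

text \<open>The polar angle of the boundary map about the centre of the square has a continuous
  branch on the line. Injectivity on \<open>Out\<close> makes this branch injective on intervals
  shorter than 2 pi, hence globally, hence monotone; precomposing with the swap reverses its
  direction.\<close>

lemma pos_or:
 assumes g: "continuous_on Out g" "inj_on g Out" "g ` Out \<subseteq> Out"
 shows "pos g \<or> pos (g \<circ> prod.swap)"
proof -
 have gO: "g (om a) \<in> Out" for a using g(3) om_Out by blast
 have nz: "toC w - c0 \<noteq> 0" if "w \<in> Out" for w
 proof
  assume "toC w - c0 = 0"
  hence "fst w = 1 / 2" "snd w = 1 / 2" by (auto simp: toC_def c0_def complex_eq_iff)
  thus False using that by (auto simp: Out_iff)
 qed
 have "continuous_on UNIV (\<lambda>a. toC (g (om a)) - c0)"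
  by (intro continuous_on_diff continuous_on_const continuous_on_compose2[OF cont_toC[of UNIV]] continuous_on_compose2[OF g(1) cont_om]) (use om_Out in auto)
 then obtain L where L: "continuous_on UNIV L" "\<And>a. toC (g (om a)) - c0 = exp (L a)"
  using continuous_logarithm_on_contractible[of UNIV "\<lambda>a. toC (g (om a)) - c0"] nz gO convex_imp_contractible[OF convex_UNIV] by auto
 define l where "l a = Im (L a)" for a
 have cl: "continuous_on UNIV l" unfolding l_def by (intro continuous_intros L(1))
 have gl: "g (om a) = om (l a)" for a
 proof (rule Out_om[OF gO])
  show "toC (g (om a)) - c0 = of_real (exp (Re (L a))) * cis (l a)"
   unfolding L(2) l_def by (simp add: exp_eq_polar)
 qed simp
 have "l a \<noteq> l b" if "a < b" "b - a < 2 * pi" for a b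
 proof
  assume "l a = l b"
  hence "g (om a) = g (om b)" by (simp add: gl)
  hence "om a = om b" using g(2) om_Out by (auto simp: inj_on_def)
  then obtain k :: int where k: "a = b + 2 * pi * of_int k" using om_eq by blast
  hence "2 * pi * of_int k < 0" "2 * pi * of_int k > 2 * pi * (-1)" using that by auto
  hence "of_int k < (0::real)" "(-1::real) < of_int k"
   using mult_less_cancel_left_pos[of "2 * pi" "of_int k" 0] mult_less_cancel_left_pos[of "2 * pi" "-1" "of_int k"] pi_gt_zero by auto
  hence "k < 0" "real_of_int (-1) < of_int k" by simp_all
  hence "k < 0" "-1 < k" by (simp_all only: of_int_less_iff)
  thus False by linarith
 qed
 hence "inj l" using locally_inj_imp_inj[OF cl, of "2 * pi"] pi_gt_zero by simp
 hence "strict_mono_on UNIV l \<or> strict_antimono_on UNIV l"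
  using injective_eq_monotone_map[of UNIV l] cl by auto
 thus ?thesis
 proof
  assume "strict_mono_on UNIV l"
  hence "lift g l" unfolding lift_def using cl gl by auto
  thus ?thesis unfolding pos_def by blast
 next
  assume m: "strict_antimono_on UNIV l"
  have "lift (g \<circ> prod.swap) (\<lambda>a. l (pi / 2 - a))" unfolding lift_def
  proof (intro conjI allI)
   show "continuous_on UNIV (\<lambda>a. l (pi / 2 - a))" by (intro continuous_on_compose2[OF cl] continuous_intros) auto
   show "strict_mono (\<lambda>a. l (pi / 2 - a))"
    using m by (auto simp: strict_mono_def monotone_on_def)
   show "(g \<circ> prod.swap) (om a) = om (l (pi / 2 - a))" for a by (simp only: comp_apply swap_om gl)
  qed
  thus ?thesis unfolding pos_def by blast
 qed
qed

text \<open>The increment over a period is a multiple k of 2 pi, positive by monotonicity. For k > 1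
  the value l a + 2 pi would be attained strictly inside the period, against injectivity on
  \<open>Out\<close>.\<close>

lemma lift_period:
 assumes l: "lift g l" and inj: "inj_on g Out"
 shows "l (a + 2 * pi) = l a + 2 * pi"
proof -
 have m: "strict_mono l" and gl: "\<And>a. g (om a) = om (l a)" and c: "continuous_on UNIV l" using l by (auto simp: lift_def)
 have "om (a + 2 * pi) = om a" unfolding om_eq by (rule exI[of _ 1]) simp
 hence "om (l (a + 2 * pi)) = om (l a)" using gl by metis
 then obtain k :: int where k: "l (a + 2 * pi) = l a + 2 * pi * of_int k" using om_eq by blast
 have "l a < l (a + 2 * pi)" using m by (simp add: strict_mono_def)
 hence "k > 0" using k by (simp add: zero_less_mult_iff)
 moreover have "\<not> k > 1"
 proof
  assume "k > 1"
  hence "2 * pi * 1 < 2 * pi * of_int k" by (intro mult_strict_left_mono) auto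
  hence k1: "l a + 2 * pi < l (a + 2 * pi)" using k by simp
  have "continuous_on {a..a + 2 * pi} l" using c continuous_on_subset by blast
  then obtain b where b: "a \<le> b" "b \<le> a + 2 * pi" "l b = l a + 2 * pi"
   using IVT'[of l a "l a + 2 * pi" "a + 2 * pi"] k1 by auto
  have "b \<noteq> a" "b \<noteq> a + 2 * pi" using b k1 by auto
  have "om (l b) = om (l a)" unfolding om_eq b(3) by (rule exI[of _ 1]) simp
  hence "g (om b) = g (om a)" by (simp add: gl)
  hence "om b = om a" using inj om_Out by (auto simp: inj_on_def)
  then obtain j :: int where j: "b = a + 2 * pi * of_int j" using om_eq by blast
  have "2 * pi * 0 < 2 * pi * of_int j" "2 * pi * of_int j < 2 * pi * 1"
   using j b(1,2) \<open>b \<noteq> a\<close> \<open>b \<noteq> a + 2 * pi\<close> by linarith+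
  hence "of_int j > (0::real)" "of_int j < (1::real)"
   using mult_less_cancel_left_pos[of "2 * pi" 0 "of_int j"] mult_less_cancel_left_pos[of "2 * pi" "of_int j" 1] pi_gt_zero by auto
  hence "0 < j" "j < 1" by simp_all
  thus False by linarith
 qed
 ultimately have "k = 1" by linarith
 thus ?thesis using k by simp
qed

section \<open>Logarithmic cutoffs and fixed points of the boundary map\<close>

lemma hole_coord: assumes "C \<in> Holes" "z \<in> C" "w \<in> C"
 shows "\<bar>fst z - fst w\<bar> \<le> sz C" "\<bar>snd z - snd w\<bar> \<le> sz C"
proof -
 obtain k i j where C: "C = circ k i j" using assms(1) unfolding Holes_def by blast
 have "z \<in> sq k i j" "w \<in> sq k i j" using assms C circ_sub_sq by auto
 thus "\<bar>fst z - fst w\<bar> \<le> sz C" "\<bar>snd z - snd w\<bar> \<le> sz C"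
  unfolding C sz_circ using sq_coord_dist by blast+
qed

text \<open>The cutoff averages N ramps at the scales \<open>8 ^ j * r\<close>, j < N. A hole is no
  closer to z0 than its own side, so the distance varies on it by a factor of at most 2, and it
  meets the transition annulus of at most one ramp. Each annulus contributes at most 64 by packing,
  and dividing N such terms by the square of N leaves 64 / N.\<close>

lemma cutoff:
 assumes z0: "z0 \<in> Out" and N: "N > 0" and r: "r > 0"
 obtains w :: "plane => real" and L where "L \<ge> 0" "\<And>x y. dist (w x) (w y) \<le> L * dist x y"
  "\<And>z. 0 \<le> w z \<and> w z \<le> 1" "\<And>z. dist z z0 \<le> r ==> w z = 1" "\<And>z. 4 * 8 ^ N * r \<le> dist z z0 ==> w z = 0"
  "\<And>A. finite A ==> A \<subseteq> Holes ==> (\<Sum>C\<in>A. (osc w C)\<^sup>2) \<le> 64 / real N"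
proof -
 define \<delta> where "\<delta> z = max \<bar>fst z - fst z0\<bar> \<bar>snd z - snd z0\<bar>" for z :: "plane"
 define s where "s j = 8 ^ j * r" for j :: nat
 define \<rho> where "\<rho> j z = max 0 (min 1 (2 - \<delta> z / s j))" for j z
 define w where "w z = (\<Sum>j<N. \<rho> j z) / real N" for z
 have s: "s j > 0" for j using r by (simp add: s_def)
 have dl: "\<bar>\<delta> x - \<delta> y\<bar> \<le> max \<bar>fst x - fst y\<bar> \<bar>snd x - snd y\<bar>" for x y
  unfolding \<delta>_def by (auto simp: max_def abs_if split: if_splits)
 have dd: "\<delta> z \<le> dist z z0" "dist z z0 \<le> 2 * \<delta> z" for z
 proof -
  have "\<bar>fst z - fst z0\<bar> \<le> \<delta> z" "\<bar>snd z - snd z0\<bar> \<le> \<delta> z" by (auto simp: \<delta>_def)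
  thus "dist z z0 \<le> 2 * \<delta> z" using dist_le_coord[of z z0] by linarith
  show "\<delta> z \<le> dist z z0" using coord_le_dist[of z z0] by (simp add: \<delta>_def)
 qed
 have rl: "\<bar>\<rho> j x - \<rho> j y\<bar> \<le> \<bar>\<delta> x - \<delta> y\<bar> / s j" for j x y
 proof -
  have "\<bar>\<rho> j x - \<rho> j y\<bar> \<le> \<bar>\<delta> x / s j - \<delta> y / s j\<bar>" unfolding \<rho>_def by (auto simp: max_def min_def abs_if split: if_splits)
  also have "\<delta> x / s j - \<delta> y / s j = (\<delta> x - \<delta> y) / s j" by (simp add: diff_divide_distrib)
  finally show ?thesis using s[of j] by (simp add: abs_divide)
 qed
 have r01: "0 \<le> \<rho> j z" "\<rho> j z \<le> 1" for j z by (auto simp: \<rho>_def)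
 define L where "L = (\<Sum>j<N. 1 / s j) / real N"
 have L: "L \<ge> 0" unfolding L_def using s by (intro divide_nonneg_nonneg sum_nonneg) (auto simp: less_imp_le)
 have "dist (w x) (w y) \<le> L * dist x y" for x y
 proof -
  have "\<bar>w x - w y\<bar> = \<bar>\<Sum>j<N. \<rho> j x - \<rho> j y\<bar> / real N"
   unfolding w_def by (simp add: sum_subtractf diff_divide_distrib[symmetric] abs_divide)
  also have "... \<le> (\<Sum>j<N. 1 / s j * dist x y) / real N"
  proof (intro divide_right_mono order_trans[OF sum_abs] sum_mono)
   fix j
   have "\<bar>\<delta> x - \<delta> y\<bar> \<le> dist x y" using dl[of x y] coord_le_dist[of x y] by auto
   hence "\<bar>\<delta> x - \<delta> y\<bar> / s j \<le> dist x y / s j" using s[of j] by (intro divide_right_mono) auto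
   thus "\<bar>\<rho> j x - \<rho> j y\<bar> \<le> 1 / s j * dist x y" using rl[of j x y] by simp
  qed simp
  finally show ?thesis by (simp add: dist_real_def L_def sum_distrib_right)
 qed
 moreover have "0 \<le> w z \<and> w z \<le> 1" for z
 proof -
  have "(\<Sum>j<N. \<rho> j z) \<le> (\<Sum>j<N. 1)" by (intro sum_mono r01)
  thus ?thesis using N r01 by (simp add: w_def sum_nonneg)
 qed
 moreover have "w z = 1" if "dist z z0 \<le> r" for z
 proof -
  have "\<rho> j z = 1" for j
  proof -
   have "r \<le> s j" unfolding s_def using r by simp
   hence "\<delta> z / s j \<le> 1" using dd(1)[of z] that s[of j] by simp
   thus ?thesis by (simp add: \<rho>_def)
  qed
  thus ?thesis using N by (simp add: w_def)
 qed
 moreover have "w z = 0" if z: "dist z z0 \<ge> 4 * 8 ^ N * r" for z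
 proof -
  have "\<rho> j z = 0" if "j < N" for j
  proof -
   have "s j \<le> 8 ^ N * r" unfolding s_def using r that by (intro mult_right_mono power_increasing) auto
   hence "2 * s j \<le> \<delta> z" using dd(2)[of z] z by linarith
   hence "2 \<le> \<delta> z / s j" using s[of j] by (simp add: pos_le_divide_eq)
   thus ?thesis by (simp add: \<rho>_def)
  qed
  thus ?thesis by (simp add: w_def)
 qed
 moreover have "(\<Sum>C\<in>A. (osc w C)\<^sup>2) \<le> 64 / real N" if A: "finite A" "A \<subseteq> Holes" for A
 proof -
  \<comment> \<open>A bound for the oscillation of the j-th ramp on C; it vanishes unless C enters
    the annulus where this ramp varies.\<close>
  define a where "a j C = (if \<exists>z\<in>C. s j < \<delta> z \<and> \<delta> z < 2 * s j then sz C / s j else 0)" for j C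
  have szp: "sz C > 0" if "C \<in> A" for C using that A Holes_Per sz_pos by blast
  have a0: "a j C \<ge> 0" if "C \<in> A" for j C using szp[OF that] s[of j] by (simp add: a_def)
  have far: "sz C \<le> \<delta> z" if "C \<in> A" "z \<in> C" for C z
   using Out_hole_far[OF _ z0 that(2)] that A unfolding \<delta>_def by blast
  have dC: "\<bar>\<delta> x - \<delta> y\<bar> \<le> sz C" if "C \<in> A" "x \<in> C" "y \<in> C" for x y C
   using dl[of x y] hole_coord[of C x y] that A by force
  have ro: "\<bar>\<rho> j x - \<rho> j y\<bar> \<le> a j C" if C: "C \<in> A" "x \<in> C" "y \<in> C" for j x y C
  proof (cases "\<exists>z\<in>C. s j < \<delta> z \<and> \<delta> z < 2 * s j")
   case True
   have "\<bar>\<delta> x - \<delta> y\<bar> / s j \<le> sz C / s j" using dC[OF C] s[of j] by (intro divide_right_mono) auto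
   thus ?thesis using rl[of j x y] True by (simp add: a_def)
  next
   case False
   have c\<delta>: "continuous_on C \<delta>" unfolding \<delta>_def by (intro continuous_intros)
   have con: "connected (\<delta> ` C)" by (rule connected_continuous_image[OF c\<delta>]) (use C A Holes_Per Per_connected in blast)
   have F: "\<delta> z \<le> s j \<or> 2 * s j \<le> \<delta> z" if "z \<in> C" for z using False that by (meson not_le)
   have "(\<forall>z\<in>C. \<delta> z \<le> s j) \<or> (\<forall>z\<in>C. \<delta> z \<ge> 2 * s j)"
   proof (rule ccontr)
    assume "\<not> ?thesis"
    then obtain z1 z2 where z: "z1 \<in> C" "z2 \<in> C" "\<delta> z1 > s j" "\<delta> z2 < 2 * s j" by (auto simp: not_le)
    have "\<delta> z1 \<ge> 2 * s j" "\<delta> z2 \<le> s j" using F[OF z(1)] F[OF z(2)] z(3,4) by linarith+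
    hence "3 / 2 * s j \<in> \<delta> ` C" using s[of j] z
     by (intro connectedD_interval[OF con imageI[OF z(2)] imageI[OF z(1)]]) linarith+
    then obtain z where "z \<in> C" "\<delta> z = 3 / 2 * s j" by auto
    thus False using F[of z] s[of j] by linarith
   qed
   hence "\<rho> j x = \<rho> j y"
   proof
    assume "\<forall>z\<in>C. \<delta> z \<le> s j"
    hence "\<delta> x / s j \<le> 1" "\<delta> y / s j \<le> 1" using C s[of j] by auto
    thus ?thesis by (simp add: \<rho>_def)
   next
    assume "\<forall>z\<in>C. \<delta> z \<ge> 2 * s j"
    hence "2 \<le> \<delta> x / s j" "2 \<le> \<delta> y / s j" using C s[of j] by (auto simp: pos_le_divide_eq)
    thus ?thesis by (simp add: \<rho>_def)
   qed
   thus ?thesis using a0[OF C(1)] by simp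
  qed
  have one: "i = j" if C: "C \<in> A" and h: "a i C \<noteq> 0" "a j C \<noteq> 0" for C i j
  proof -
   have *: "\<not> i < j" if h: "a i C \<noteq> 0" "a j C \<noteq> 0" for i j
   proof
    assume ij: "i < j"
    obtain x where x: "x \<in> C" "\<delta> x < 2 * s i" using h(1) by (auto simp: a_def split: if_splits)
    obtain y where y: "y \<in> C" "s j < \<delta> y" using h(2) by (auto simp: a_def split: if_splits)
    have "8 ^ Suc i * r \<le> s j" unfolding s_def using r ij by (intro mult_right_mono power_increasing) auto
    hence "8 * s i \<le> s j" by (simp add: s_def)
    moreover have "\<delta> y \<le> 2 * \<delta> x" using dC[OF C y(1) x(1)] far[OF C x(1)] by linarith
    ultimately show False using x y s[of i] by linarith
   qed
   show ?thesis using *[OF h] *[OF h(2,1)] by linarith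
  qed
  have ow: "(osc w C)\<^sup>2 \<le> (\<Sum>j<N. (a j C)\<^sup>2) / (real N)\<^sup>2" if C: "C \<in> A" for C
  proof -
   have bdC: "bounded (w ` C)" using \<open>\<And>z. 0 \<le> w z \<and> w z \<le> 1\<close> by (intro boundedI[of _ 1]) auto
   have "osc w C \<le> (\<Sum>j<N. a j C) / real N"
   proof (rule osc_le)
    fix x y assume xy: "x \<in> C" "y \<in> C"
    have "\<bar>w x - w y\<bar> = \<bar>\<Sum>j<N. \<rho> j x - \<rho> j y\<bar> / real N"
     unfolding w_def by (simp add: sum_subtractf diff_divide_distrib[symmetric] abs_divide)
    also have "... \<le> (\<Sum>j<N. a j C) / real N"
     by (intro divide_right_mono order_trans[OF sum_abs] sum_mono ro[OF C xy]) simp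
    finally show "dist (w x) (w y) \<le> (\<Sum>j<N. a j C) / real N" by (simp add: dist_real_def)
   qed (use a0[OF C] in \<open>auto intro!: divide_nonneg_nonneg sum_nonneg\<close>)
   hence "(osc w C)\<^sup>2 \<le> ((\<Sum>j<N. a j C) / real N)\<^sup>2" by (intro power_mono osc_nonneg[OF bdC])
   also have "... = (\<Sum>j<N. a j C)\<^sup>2 / (real N)\<^sup>2" by (simp add: power_divide)
   \<comment> \<open>At most one summand is nonzero, so squaring commutes with the sum.\<close>
   also have "(\<Sum>j<N. a j C)\<^sup>2 = (\<Sum>j<N. (a j C)\<^sup>2)"
   proof (cases "\<exists>j<N. a j C \<noteq> 0")
    case True
    then obtain j where j: "j < N" "a j C \<noteq> 0" by blast
    have z: "a i C = 0" if "i \<noteq> j" for i using one[OF C j(2)] that by metis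
    have "(\<Sum>i<N. a i C) = a j C" "(\<Sum>i<N. (a i C)\<^sup>2) = (a j C)\<^sup>2"
     using j z by (auto intro!: sum.remove[of "{..<N}" j, THEN trans] simp: sum.neutral)
    thus ?thesis by simp
   next
    case False thus ?thesis by (simp add: sum.neutral)
   qed
   finally show ?thesis .
  qed
  have aj: "(\<Sum>C\<in>A. (a j C)\<^sup>2) \<le> 64" for j
  proof -
   \<comment> \<open>These holes stay within sup-distance \<open>4 * s j\<close> of z0, that is, in
     a square of side \<open>8 * s j\<close>: the origin of the constant 64.\<close>
   define B where "B = {C \<in> A. \<exists>z\<in>C. s j < \<delta> z \<and> \<delta> z < 2 * s j}"
   have B: "finite B" "B \<subseteq> Holes" using A by (auto simp: B_def)
   have "(\<Sum>C\<in>B. (sz C)\<^sup>2) \<le> (8 * s j) * (8 * s j)"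
   proof (rule packing[OF B])
    fix C assume "C \<in> B"
    then obtain z where z: "C \<in> A" "z \<in> C" "\<delta> z < 2 * s j" by (auto simp: B_def)
    show "C \<subseteq> {fst z0 - 4 * s j..fst z0 - 4 * s j + 8 * s j} \<times> {snd z0 - 4 * s j..snd z0 - 4 * s j + 8 * s j}"
    proof
     fix y assume y: "y \<in> C"
     have "\<delta> y \<le> 2 * \<delta> z" using dC[OF z(1) y z(2)] far[OF z(1,2)] by linarith
     hence "\<delta> y \<le> 4 * s j" using z by linarith
     hence "\<bar>fst y - fst z0\<bar> \<le> 4 * s j" "\<bar>snd y - snd z0\<bar> \<le> 4 * s j" by (auto simp: \<delta>_def)
     thus "y \<in> {fst z0 - 4 * s j..fst z0 - 4 * s j + 8 * s j} \<times> {snd z0 - 4 * s j..snd z0 - 4 * s j + 8 * s j}"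
      by (auto simp: mem_Times_iff abs_le_iff)
    qed
   qed (use s[of j] in auto)
   hence *: "(\<Sum>C\<in>B. (sz C)\<^sup>2) \<le> 64 * (s j)\<^sup>2" by (simp add: power2_eq_square)
   have "(\<Sum>C\<in>A. (a j C)\<^sup>2) = (\<Sum>C\<in>B. (sz C / s j)\<^sup>2)"
    unfolding B_def by (rule sum.mono_neutral_cong_right) (auto simp: A a_def)
   also have "... = (\<Sum>C\<in>B. (sz C)\<^sup>2) / (s j)\<^sup>2" by (simp add: power_divide sum_divide_distrib)
   also have "... \<le> 64" using * s[of j] by (simp add: pos_divide_le_eq)
   finally show ?thesis .
  qed
  have "(\<Sum>C\<in>A. (osc w C)\<^sup>2) \<le> (\<Sum>C\<in>A. (\<Sum>j<N. (a j C)\<^sup>2) / (real N)\<^sup>2)" by (intro sum_mono ow)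
  also have "... = (\<Sum>j<N. \<Sum>C\<in>A. (a j C)\<^sup>2) / (real N)\<^sup>2" by (simp add: sum_divide_distrib[symmetric] sum.swap[of _ A])
  also have "... \<le> (\<Sum>j<N. 64) / (real N)\<^sup>2" by (intro divide_right_mono sum_mono aj) simp
  also have "... = 64 / real N" using N by (simp add: power2_eq_square)
  finally show ?thesis .
 qed
 ultimately show thesis by (rule that[OF L])
qed

lemma card_between:
 assumes "0 \<le> x" "x < y" "y \<le> 1" "2 \<le> (y - x) * real N" and N: "N > 0"
 shows "(y - x) / 2 * real N \<le> real (card {i. i < N \<and> x < real i / real N \<and> real i / real N < y})"
proof -
 define a where "a = nat \<lfloor>x * real N\<rfloor> + 1"
 define b where "b = nat \<lceil>y * real N\<rceil>"
 have x0: "0 \<le> x * real N" "0 \<le> y * real N" using assms by auto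
 have a: "x * real N < real a" "real a \<le> x * real N + 1" unfolding a_def using x0 by linarith+
 have b: "y * real N \<le> real b" "real b < y * real N + 1" unfolding b_def using x0 by linarith+
 have yN: "y * real N \<le> real N" using assms by (simp add: mult_le_cancel_right1)
 have sub: "{a..<b} \<subseteq> {i. i < N \<and> x < real i / real N \<and> real i / real N < y}"
 proof
  fix i assume i: "i \<in> {a..<b}"
  hence "real i \<ge> real a" "real i + 1 \<le> real b" by auto
  hence "x * real N < real i" "real i < y * real N" using a b by linarith+
  moreover from this have "real i < real N" using yN by linarith
  ultimately show "i \<in> {i. i < N \<and> x < real i / real N \<and> real i / real N < y}" using N by (simp add: field_simps)
 qed
 have "card {a..<b} \<le> card {i. i < N \<and> x < real i / real N \<and> real i / real N < y}"
  by (rule card_mono[OF _ sub]) (rule finite_subset[of _ "{..<N}"], auto)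
 moreover have "real b - real a \<le> real (card {a..<b})" by (simp add: of_nat_diff_real)
 moreover have "(y - x) * real N = y * real N - x * real N" by (simp add: algebra_simps)
 ultimately show ?thesis using a b assms(4) by (simp add: field_simps)
qed

lemma Mc_line:
 assumes k: "1 \<le> k"
 shows "\<exists>I\<subseteq>ix k. real (card I) = rn k / real n \<and> I \<noteq> {} \<and> (\<forall>i\<in>I. \<exists>j<n ^ k. elt (lab k i j) = Mc m)"
  "\<exists>J\<subseteq>ix k. real (card J) = rn k / real n \<and> J \<noteq> {} \<and> (\<forall>j\<in>J. \<exists>i<n ^ k. elt (lab k i j) = Mc m)"
proof -
 define M where "M = n ^ (k - 1)"
 have M: "M > 0" by (simp add: M_def)
 have NM: "n ^ k = n * M" using k by (simp add: M_def power_eq_if)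
 have L: "lab k i j = (1, ma m, mb m)" if "i div M = ma m" "j div M = mb m" for i j
  by (rule lab_hole[OF Mc_hole k]) (use that in \<open>auto simp: M_def\<close>)
 have E: "elt (lab k i j) = Mc m" if "i div M = ma m" "j div M = mb m" for i j
  unfolding L[OF that] elt_hole[OF Mc_hole] Mc_def ..
 have b: "ma m < n" "mb m < n" using ma_q by auto
 have lt: "i < n ^ k" if "i < (c + 1) * M" "c < n" for i c
 proof -
  have "(c + 1) * M \<le> n * M" using that by (intro mult_le_mono1) simp
  thus ?thesis using that NM by linarith
 qed
 have *: "{c * M..<(c + 1) * M} \<subseteq> ix k \<and> real (card {c * M..<(c + 1) * M}) = rn k / real n \<and> {c * M..<(c + 1) * M} \<noteq> {} \<and> c * M < n ^ k \<and> (\<forall>i\<in>{c * M..<(c + 1) * M}. i div M = c)"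
  if "c < n" for c
 proof (intro conjI)
  show "{c * M..<(c + 1) * M} \<subseteq> ix k" using lt[OF _ that] by auto
  have "rn k = real n * real M" using NM by (metis of_nat_mult of_nat_power)
  thus "real (card {c * M..<(c + 1) * M}) = rn k / real n" by simp
  show "{c * M..<(c + 1) * M} \<noteq> {}" using M by simp
  show "c * M < n ^ k" using lt[OF _ that, of "c * M"] M by simp
  show "\<forall>i\<in>{c * M..<(c + 1) * M}. i div M = c" using div_eqI by simp
 qed
 have cd: "c * M div M = c" for c using M by simp
 show "\<exists>I\<subseteq>ix k. real (card I) = rn k / real n \<and> I \<noteq> {} \<and> (\<forall>i\<in>I. \<exists>j<n ^ k. elt (lab k i j) = Mc m)"
  using *[OF b(1)] *[OF b(2)] E cd by meson
 show "\<exists>J\<subseteq>ix k. real (card J) = rn k / real n \<and> J \<noteq> {} \<and> (\<forall>j\<in>J. \<exists>i<n ^ k. elt (lab k i j) = Mc m)"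
  using *[OF b(2)] *[OF b(1)] E cd by meson
qed

lemma Out_cols:
 assumes S: "connected S" "S \<subseteq> Out" and x: "x \<in> S" "y \<in> S" "fst x < fst y" and k: "2 \<le> (fst y - fst x) * real (n ^ k)"
 shows "cols_dense S ((fst y - fst x) / 2) k"
proof -
 let ?I = "{i. i < n ^ k \<and> fst x < real i / real (n ^ k) \<and> real i / real (n ^ k) < fst y}"
 have "x \<in> Out" "y \<in> Out" using x S by blast+
 hence xy: "0 \<le> fst x" "fst y \<le> 1" by (auto simp: Out_iff mem_Times_iff)
 have 1: "?I \<subseteq> ix k" by auto
 have 2: "(fst y - fst x) / 2 * rn k \<le> real (card ?I)"
  using card_between[OF xy(1) x(3) xy(2) k] by simp
 have 3: "col_hit S k i" if i: "i \<in> ?I" for i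
 proof -
 have con: "connected (fst ` S)" by (intro connected_continuous_image continuous_intros S)
 have "gr k i \<in> fst ` S"
  by (rule connectedD_interval[OF con, of "fst x" "fst y"]) (use x i in auto)
 then obtain P where P: "P \<in> S" "fst P = gr k i" by auto
 have "P \<in> Out" "0 < fst P" "fst P < 1" using P S xy i by auto
 hence s: "snd P = 0 \<or> snd P = 1" by (auto simp: Out_iff)
 have ik: "i < n ^ k" using i by simp
 have N: "n ^ k > 0" by simp
 have e: "(gr k i, 0) \<in> elt (lab k i 0)" "(gr k i, 1) \<in> elt (lab k i (n ^ k - 1))"
  using row_ends[OF ik] unfolding elt_swap'[of _ k i] by simp_all
 have "P = (gr k i, 0) \<or> P = (gr k i, 1)" using s P by (auto simp: prod_eq_iff)
 thus ?thesis
  using e P(1) N by (metis diff_less zero_less_one)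
 qed
 show ?thesis by (rule exI[of _ ?I]) (use 1 2 3 in blast)
qed

lemma Out_rows:
 assumes S: "connected S" "S \<subseteq> Out" and x: "x \<in> S" "y \<in> S" "snd x < snd y" and k: "2 \<le> (snd y - snd x) * real (n ^ k)"
 shows "rows_dense S ((snd y - snd x) / 2) k"
proof -
 let ?S = "prod.swap ` S"
 have c: "connected ?S" by (intro connected_continuous_image S continuous_on_swap)
 have O: "?S \<subseteq> Out" using S(2) swap_Out by blast
 have "prod.swap x \<in> ?S" "prod.swap y \<in> ?S" using x by auto
 from Out_cols[OF c O this, of k] x k
 obtain I where I: "I \<subseteq> ix k" "(snd y - snd x) / 2 * rn k \<le> real (card I)" "\<forall>i\<in>I. col_hit ?S k i"
  by auto
 have "row_hit S k j" if j: "j \<in> I" for j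
 proof -
  obtain i P where "i < n ^ k" "P \<in> elt (lab k j i)" "P \<in> ?S" using I(3) j by blast
  thus ?thesis using elt_swap'[of P k j i] swap_image_iff[of P S] by blast
 qed
 thus ?thesis using I by blast
qed

text \<open>One coordinate projection of S has positive length, so a fixed proportion of the
  columns, or of the rows, meets S. A proportion 1 / n of the perpendicular lines meets the hole,
  and \<open>cross\<close> turns this into a lower energy bound that does not depend on u.\<close>

lemma no_cross:
 assumes S: "connected S" "S \<subseteq> Out" and x: "x \<in> S" "y \<in> S" "x \<noteq> y"
 shows "\<exists>c>0. \<forall>(u :: plane => real) E. bounded (u ` F) \<longrightarrow> (\<forall>P\<in>S. u P = 1) \<longrightarrow> (\<forall>P\<in>Mc m. u P = 0) \<longrightarrow>
   (\<lambda>k. tail k u) \<longlonglongrightarrow> 0 \<longrightarrow> (\<forall>A. finite A \<longrightarrow> A \<subseteq> Holes \<longrightarrow> (\<Sum>C\<in>A. (osc u C)\<^sup>2) \<le> E) \<longrightarrow> c \<le> E"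
proof -
 have wlog: "\<exists>\<tau>>0. \<exists>k0. (\<forall>k\<ge>k0. cols_dense S \<tau> k)
    \<or> (\<forall>k\<ge>k0. rows_dense S \<tau> k)"
 proof -
  have large: "\<exists>k0. \<forall>k\<ge>k0. 2 \<le> d * real (n ^ k)" if d: "d > 0" for d :: real
  proof -
   obtain k0 where k0: "2 / d < rn k0" using real_arch_pow[of "real n" "2 / d"] n5 by auto
   have "2 \<le> d * real (n ^ k)" if "k \<ge> k0" for k
   proof -
    have "rn k0 \<le> rn k" using that n_ge1 by (rule power_increasing)
    hence "2 / d \<le> rn k" using k0 by linarith
    thus ?thesis using d by (simp add: field_simps)
   qed
   thus ?thesis by blast
  qed
  have *: ?thesis if xy: "a \<in> S" "b \<in> S" "fst a < fst b" for a b
  proof -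
   obtain k0 where k0: "\<forall>k\<ge>k0. 2 \<le> (fst b - fst a) * real (n ^ k)" using large[of "fst b - fst a"] xy by auto
   show ?thesis by (rule exI[of _ "(fst b - fst a) / 2"], rule conjI, use xy in simp, rule exI[of _ k0], rule disjI1)
    (use Out_cols[OF S xy] k0 in blast)
  qed
  have **: ?thesis if xy: "a \<in> S" "b \<in> S" "snd a < snd b" for a b
  proof -
   obtain k0 where k0: "\<forall>k\<ge>k0. 2 \<le> (snd b - snd a) * real (n ^ k)" using large[of "snd b - snd a"] xy by auto
   show ?thesis by (rule exI[of _ "(snd b - snd a) / 2"], rule conjI, use xy in simp, rule exI[of _ k0], rule disjI2)
    (use Out_rows[OF S xy] k0 in blast)
  qed
  have "fst x < fst y \<or> fst y < fst x \<or> snd x < snd y \<or> snd y < snd x" using x(3) by (auto simp: prod_eq_iff)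
  thus ?thesis using *[OF x(1,2)] *[OF x(2,1)] **[OF x(1,2)] **[OF x(2,1)] by argo
 qed
 then obtain \<tau> k0 where tk: "\<tau> > 0" "(\<forall>k\<ge>k0. cols_dense S \<tau> k)
    \<or> (\<forall>k\<ge>k0. rows_dense S \<tau> k)" by blast
 \<comment> \<open>The two summands belong to the proportions \<tau> and 1 / n of lines that meet S
   and the hole.\<close>
 define C where "C = sqrt (1 / \<tau>) + sqrt (real n)"
 have C: "C > 0" using tk by (simp add: C_def add_pos_pos)
 have "1 / C\<^sup>2 \<le> E" if bd: "bounded (u ` F)" and u1: "\<forall>P\<in>S. u P = 1" and u0: "\<forall>P\<in>Mc m. u P = 0"
  and tl: "(\<lambda>k. tail k u) \<longlonglongrightarrow> 0" and E: "\<forall>A. finite A \<longrightarrow> A \<subseteq> Holes \<longrightarrow> (\<Sum>C\<in>A. (osc u C)\<^sup>2) \<le> E" for u :: "plane => real" and E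
 proof -
  have est: "1 \<le> C * sqrt (E + tail k u)" if k: "k \<ge> max 1 k0" for k
  proof -
   let ?Z = "ix k \<times> ix k"
   have en: "(\<Sum>(i, j)\<in>?Z. (cost k u i j)\<^sup>2) \<le> E + tail k u"
    using energy[of ?Z k u] E finite_HZ[of ?Z k] HZ_Holes[of k ?Z] tail_ge[of "Rk k \<inter> ?Z" k u] by force
   have fin: "sqrt (rn k / real (card I)) \<le> sqrt (1 / t)" if "t * rn k \<le> real (card I)" "t > 0" for I :: "nat set" and t
   proof -
    have "real (card I) > 0" using that by (meson less_le_trans mult_pos_pos pow_pos)
    thus ?thesis using that by (simp add: field_simps)
   qed
   have ne: "I \<noteq> {}" if "\<tau> * rn k \<le> real (card I)" for I :: "nat set"
   proof -
    have "0 < \<tau> * rn k" using tk(1) by simp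
    thus ?thesis using that by auto
   qed
   have sqn: "sqrt (1 / (1 / real n)) = sqrt (real n)" by simp
   obtain I where I: "I \<subseteq> ix k" "real (card I) = rn k / real n" "I \<noteq> {}" "\<forall>i\<in>I. \<exists>j<n ^ k. elt (lab k i j) = Mc m"
    using Mc_line(1)[of k m] k by auto
   obtain J where J: "J \<subseteq> ix k" "real (card J) = rn k / real n" "J \<noteq> {}" "\<forall>j\<in>J. \<exists>i<n ^ k. elt (lab k i j) = Mc m"
    using Mc_line(2)[of k m] k by auto
   obtain P0 where P0: "P0 \<in> Mc m" using Per_nonempty[OF Mc_Per] by blast
   have fI: "sqrt (rn k / real (card I)) \<le> sqrt (real n)" using fin[of "1 / real n" I] I(2) unfolding sqn by simp
   have fJ: "sqrt (rn k / real (card J)) \<le> sqrt (real n)" using fin[of "1 / real n" J] J(2) unfolding sqn by simp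
   have fini: "a * sqrt (\<Sum>(i, j)\<in>?Z. (cost k u i j)\<^sup>2) \<le> C * sqrt (E + tail k u)" if "a \<le> C" for a
    using en that C by (intro mult_mono) (auto intro: sum_nonneg)
   from tk(2) show ?thesis
   proof
    assume "\<forall>k\<ge>k0. cols_dense S \<tau> k"
    then obtain K where K: "K \<subseteq> ix k" "\<tau> * rn k \<le> real (card K)" "\<forall>i\<in>K. col_hit S k i"
     using k by force
    have "\<bar>0 - 1\<bar> \<le> (sqrt (rn k / real (card J)) + sqrt (rn k / real (card K))) * sqrt (\<Sum>(i, j)\<in>?Z. (cost k u i j)\<^sup>2)"
    proof (rule cross[OF bd J(1,3) K(1) ne[OF K(2)]])
     show "\<exists>i<n ^ k. \<exists>P\<in>elt (lab k i j). u P = 0" if "j \<in> J" for j using J(4) that P0 u0 by metis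
     show "\<exists>j<n ^ k. \<exists>P\<in>elt (lab k i j). u P = 1" if "i \<in> K" for i using K(3) that u1 by metis
    qed
    also have "... \<le> C * sqrt (E + tail k u)" by (rule fini) (use fin[OF K(2) tk(1)] fJ C_def in linarith)
    finally show ?thesis by simp
   next
    assume "\<forall>k\<ge>k0. rows_dense S \<tau> k"
    then obtain K where K: "K \<subseteq> ix k" "\<tau> * rn k \<le> real (card K)" "\<forall>j\<in>K. row_hit S k j"
     using k by force
    have "\<bar>1 - 0\<bar> \<le> (sqrt (rn k / real (card K)) + sqrt (rn k / real (card I))) * sqrt (\<Sum>(i, j)\<in>?Z. (cost k u i j)\<^sup>2)"
    proof (rule cross[OF bd K(1) ne[OF K(2)] I(1,3)])
     show "\<exists>i<n ^ k. \<exists>P\<in>elt (lab k i j). u P = 1" if "j \<in> K" for j using K(3) that u1 by metis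
     show "\<exists>j<n ^ k. \<exists>P\<in>elt (lab k i j). u P = 0" if "i \<in> I" for i using I(4) that P0 u0 by metis
    qed
    also have "... \<le> C * sqrt (E + tail k u)" by (rule fini) (use fin[OF K(2) tk(1)] fI C_def in linarith)
    finally show ?thesis by simp
   qed
  qed
  have "(\<lambda>k. C * sqrt (E + tail k u)) \<longlonglongrightarrow> C * sqrt (E + 0)" by (intro tendsto_intros tl)
  hence "1 \<le> C * sqrt (E + 0)" by (rule Lim_bounded2[where N = "max 1 k0"]) (use est in auto)
  moreover have E0: "E \<ge> 0" using E[rule_format, of "{}"] by simp
  ultimately have "1\<^sup>2 \<le> (C * sqrt E)\<^sup>2" by (intro power_mono) auto
  hence "1 \<le> C\<^sup>2 * E" using E0 by (simp add: power_mult_distrib)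
  thus ?thesis using C by (simp add: field_simps)
 qed
 thus ?thesis using C by (intro exI[of _ "1 / C\<^sup>2"]) auto
qed

lemma GF_pow: assumes "GF g" shows "GF (g ^^ k)"
proof (induction k)
 case 0 thus ?case using GF_id by (simp add: id_def)
next
 case (Suc k) thus ?case using GF_comp[OF assms Suc] by (simp add: comp_def)
qed

lemma pow_im: "g ` C = C ==> (g ^^ k) ` C = C"
proof (induction k)
 case (Suc k)
 have "(g ^^ Suc k) ` C = g ` (g ^^ k) ` C" by (simp add: image_comp)
 thus ?case using Suc by simp
qed simp

lemma lift_pow: assumes "lift g l" shows "(g ^^ k) (om a) = om ((l ^^ k) a)"
 using assms by (induction k) (auto simp: lift_def)

lemma GF_hole_energy:
 assumes g: "GF g" "g ` Out = Out" and w: "\<And>A. finite A ==> A \<subseteq> Holes ==> (\<Sum>C\<in>A. (osc w C)\<^sup>2) \<le> E"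
  and A: "finite A" "A \<subseteq> Holes"
 shows "(\<Sum>C\<in>A. (osc (w \<circ> g) C)\<^sup>2) \<le> E"
proof -
 have AP: "A \<subseteq> Per" using A(2) Holes_Per by (rule order_trans)
 have inj: "inj_on ((`) g) A" by (rule inj_on_subset[OF bij_betw_imp_inj_on[OF GF_Per_bij[OF g(1)]] AP])
 have "(\<Sum>C\<in>A. (osc (w \<circ> g) C)\<^sup>2) = (\<Sum>D\<in>(`) g ` A. (osc w D)\<^sup>2)" by (simp add: sum.reindex[OF inj] osc_comp)
 also have "... \<le> E"
 proof (rule w)
  show "(`) g ` A \<subseteq> Holes" using GF_Holes[OF g] A(2) by blast
 qed (simp add: A)
 finally show ?thesis .
qed

text \<open>Consecutive translates of the fixed point a0 by 2 pi are fixed as well and trap the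
  orbit of a between them; the orbit is monotone, hence converges.\<close>

lemma shrink_interval:
 assumes m: "strict_mono (l :: real => real)" and per: "\<And>a. l (a + 2 * pi) = l a + 2 * pi" and f: "l a0 = a0"
 shows "\<exists>\<alpha>. (\<lambda>k. (l ^^ k) a) \<longlonglongrightarrow> \<alpha>" "\<bar>l a - a\<bar> < 2 * pi"
proof -
 have fixm: "l (a0 + 2 * pi * of_nat m) = a0 + 2 * pi * of_nat m \<and> l (a0 - 2 * pi * of_nat m) = a0 - 2 * pi * of_nat m" for m
 proof (induction m)
  case (Suc m)
  have "l (a0 + 2 * pi * of_nat m + 2 * pi) = a0 + 2 * pi * of_nat m + 2 * pi" using per Suc by simp
  moreover have "l (a0 - 2 * pi * of_nat (Suc m) + 2 * pi) = l (a0 - 2 * pi * of_nat (Suc m)) + 2 * pi" by (rule per)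
  moreover have "a0 - 2 * pi * of_nat (Suc m) + 2 * pi = a0 - 2 * pi * of_nat m" by (simp add: algebra_simps)
  ultimately show ?case using Suc by (simp add: algebra_simps)
 qed (simp add: f)
 have fixi: "l (a0 + 2 * pi * of_int m) = a0 + 2 * pi * of_int m" for m
  using fixm[of "nat m"] fixm[of "nat (- m)"] by (cases "m \<ge> 0") auto
 define m where "m = \<lfloor>(a - a0) / (2 * pi)\<rfloor>"
 define c where "c = a0 + 2 * pi * of_int m"
 have lc: "l c = c" "l (c + 2 * pi) = c + 2 * pi" using fixi per by (auto simp: c_def)
 have "of_int m \<le> (a - a0) / (2 * pi)" "(a - a0) / (2 * pi) < of_int m + 1" unfolding m_def by linarith+
 hence ca: "c \<le> a" "a < c + 2 * pi"
  using pi_gt_zero by (auto simp: c_def pos_le_divide_eq pos_divide_less_eq algebra_simps)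
 have mo: "x \<le> y ==> l x \<le> l y" for x y using m by (simp add: strict_mono_less_eq)
 have ms: "x < y ==> l x < l y" for x y using m by (simp add: strict_mono_def)
 show "\<bar>l a - a\<bar> < 2 * pi" using mo[OF ca(1)] ms[OF ca(2)] lc ca by linarith
 have bnd: "c \<le> (l ^^ k) a \<and> (l ^^ k) a \<le> c + 2 * pi" for k
 proof (induction k)
  case (Suc k)
  thus ?case using mo[of c "(l ^^ k) a"] mo[of "(l ^^ k) a" "c + 2 * pi"] lc by simp
 qed (use ca in auto)
 have "monoseq (\<lambda>k. (l ^^ k) a)"
 proof (cases "a \<le> l a")
  case True
  have "(l ^^ k) a \<le> (l ^^ Suc k) a" for k by (induction k) (use True mo in auto)
  thus ?thesis unfolding monoseq_Suc by blast
 next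
  case False
  have "(l ^^ Suc k) a \<le> (l ^^ k) a" for k by (induction k) (use False mo in auto)
  thus ?thesis unfolding monoseq_Suc by blast
 qed
 moreover have "Bseq (\<lambda>k. (l ^^ k) a)"
 proof (rule BseqI')
  show "norm ((l ^^ k) a) \<le> \<bar>c\<bar> + 2 * pi" for k using bnd[of k] by auto
 qed
 ultimately show "\<exists>\<alpha>. (\<lambda>k. (l ^^ k) a) \<longlonglongrightarrow> \<alpha>" using Bseq_monoseq_convergent unfolding convergent_def by blast
qed

text \<open>If a moved, the iterates of the arc S from a to l a would shrink to a point. A cutoff
  there, pulled back by a high iterate, is 1 on S and 0 on \<open>Mc m\<close>, and its energy over
  the holes, being invariant, is as small as desired. This contradicts \<open>no_cross\<close>,
  whose constant depends on S and the hole alone.\<close>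

lemma Out_fixed:
 assumes g: "GF g" and gO: "g ` Out = Out" and gM: "g ` Mc m = Mc m" and l: "lift g l" and f: "l a0 = a0" and z: "z \<in> Out"
 shows "g z = z"
proof -
 have inj: "inj_on g Out" using GF_inj[OF g] Per_F[OF Out_Per] inj_on_subset by blast
 have per: "l (a + 2 * pi) = l a + 2 * pi" for a by (rule lift_period[OF l inj])
 have sm: "strict_mono l" and gl: "\<And>a. g (om a) = om (l a)" using l by (auto simp: lift_def)
 obtain a where a: "z = om a" using om_surj[OF z] by blast
 have "l a = a"
 proof (rule ccontr)
  assume na: "l a \<noteq> a"
  obtain \<alpha> where \<alpha>: "(\<lambda>k. (l ^^ k) a) \<longlonglongrightarrow> \<alpha>" using shrink_interval(1)[OF sm per f] by blast
  have d2: "\<bar>l a - a\<bar> < 2 * pi" by (rule shrink_interval(2)[OF sm per f])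
  define S where "S = om ` closed_segment a (l a)"
  have con: "connected S" unfolding S_def by (intro connected_continuous_image cont_om connected_segment)
  have SO: "S \<subseteq> Out" using om_Out by (auto simp: S_def)
  have oS: "om a \<in> S" "om (l a) \<in> S" by (auto simp: S_def)
  have "om a \<noteq> om (l a)"
  proof
   assume "om a = om (l a)"
   then obtain k :: int where k: "a = l a + 2 * pi * of_int k" using om_eq by blast
   hence "\<bar>2 * pi * of_int k\<bar> < 2 * pi * 1" using d2 by linarith
   hence "2 * pi * \<bar>of_int k\<bar> < 2 * pi * 1" by (simp add: abs_mult)
   hence "\<bar>of_int k :: real\<bar> < 1" using mult_less_cancel_left_pos[of "2 * pi" "\<bar>of_int k\<bar>" 1] pi_gt_zero by auto
   hence "k = 0" by linarith
   thus False using k na by simp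
  qed
  from no_cross[OF con SO oS this, of m] obtain c where c: "c > 0" and
   nc: "\<And>(u :: plane => real) E. bounded (u ` F) ==> \<forall>P\<in>S. u P = 1 ==> \<forall>P\<in>Mc m. u P = 0 ==>
     (\<lambda>k. tail k u) \<longlonglongrightarrow> 0 ==> \<forall>A. finite A \<longrightarrow> A \<subseteq> Holes \<longrightarrow> (\<Sum>C\<in>A. (osc u C)\<^sup>2) \<le> E ==> c \<le> E" by blast
  obtain N :: nat where N: "64 / c < real N" using reals_Archimedean2 by blast
  have "64 / c > 0" using c by simp
  hence N0: "N > 0" using N by (metis gr0I less_trans of_nat_0 order_less_irrefl)
  have N1: "64 / real N < c" using N N0 c by (simp add: field_simps)
  \<comment> \<open>The cutoff then vanishes at distance 1 / n from its centre, which is the least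
    separation of \<open>Mc m\<close> from \<open>Out\<close> given by
    \<open>Out_hole_far\<close>.\<close>
  define r where "r = 1 / (real n * (4 * 8 ^ N))"
  have r: "r > 0" "4 * 8 ^ N * r = 1 / real n" by (auto simp: r_def)
  obtain L and w :: "plane => real" where w: "L \<ge> 0" "\<And>x y. dist (w x) (w y) \<le> L * dist x y" "\<And>z. 0 \<le> w z \<and> w z \<le> 1" "\<And>z. dist z (om \<alpha>) \<le> r ==> w z = 1"
    "\<And>z. 4 * 8 ^ N * r \<le> dist z (om \<alpha>) ==> w z = 0"
    "\<And>A. finite A ==> A \<subseteq> Holes ==> (\<Sum>C\<in>A. (osc w C)\<^sup>2) \<le> 64 / real N"
   by (rule cutoff[OF om_Out[of \<alpha>] N0 r(1)], rule that, assumption+)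
  note w = w(1-4) w(5)[unfolded r(2)] w(6)
  have "isCont om \<alpha>" using cont_om[of UNIV] by (simp add: continuous_on_eq_continuous_at)
  then obtain d where d: "d > 0" "\<And>t. dist t \<alpha> < d ==> dist (om t) (om \<alpha>) < r"
   using r(1) unfolding continuous_at_eps_delta by metis
  have "\<forall>\<^sub>F k in sequentially. dist ((l ^^ k) a) \<alpha> < d" using \<alpha> d(1) by (rule tendstoD)
  then obtain k0 where k0: "\<And>k. k \<ge> k0 ==> dist ((l ^^ k) a) \<alpha> < d" unfolding eventually_sequentially by blast
  define h where "h = g ^^ k0"
  have h: "GF h" "h ` Out = Out" "h ` Mc m = Mc m" unfolding h_def by (simp_all add: GF_pow g pow_im gO gM)
  have mono: "mono (l ^^ k0)"
  proof (induction k0)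
   case (Suc k) thus ?case using sm by (auto simp: mono_def strict_mono_less_eq)
  qed (simp add: mono_def)
  have hS: "w (h P) = 1" if "P \<in> S" for P
  proof -
   obtain t where t: "t \<in> closed_segment a (l a)" "P = om t" using \<open>P \<in> S\<close> by (auto simp: S_def)
   have "(l ^^ k0) t \<in> closed_segment ((l ^^ k0) a) ((l ^^ k0) (l a))"
   proof (cases "a \<le> l a")
    case True
    hence "a \<le> t" "t \<le> l a" using t(1) by (auto simp: closed_segment_eq_real_ivl)
    hence "(l ^^ k0) a \<le> (l ^^ k0) t" "(l ^^ k0) t \<le> (l ^^ k0) (l a)" by (auto intro: monoD[OF mono])
    thus ?thesis by (simp add: closed_segment_eq_real_ivl)
   next
    case False
    hence "t \<le> a" "l a \<le> t" using t(1) by (auto simp: closed_segment_eq_real_ivl)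
    hence "(l ^^ k0) t \<le> (l ^^ k0) a" "(l ^^ k0) (l a) \<le> (l ^^ k0) t" by (auto intro: monoD[OF mono])
    thus ?thesis by (simp add: closed_segment_eq_real_ivl)
   qed
   moreover have "(l ^^ k0) (l a) = (l ^^ Suc k0) a" by (simp add: funpow_swap1)
   ultimately have "(l ^^ k0) t \<in> closed_segment ((l ^^ k0) a) ((l ^^ Suc k0) a)" by simp
   moreover have "closed_segment ((l ^^ k0) a) ((l ^^ Suc k0) a) \<subseteq> ball \<alpha> d"
    using k0[of k0] k0[of "Suc k0"] by (intro closed_segment_subset convex_ball) (auto simp: dist_commute)
   ultimately have "dist ((l ^^ k0) t) \<alpha> < d" by (auto simp: dist_commute)
   hence "dist (om ((l ^^ k0) t)) (om \<alpha>) \<le> r" using d(2) less_imp_le by blast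
   thus ?thesis using w(4) lift_pow[OF l] t(2) by (simp add: h_def)
  qed
  have hM: "w (h P) = 0" if "P \<in> Mc m" for P
  proof -
   have "h P \<in> Mc m" using h(3) that by blast
   hence "sz (Mc m) \<le> max \<bar>fst (h P) - fst (om \<alpha>)\<bar> \<bar>snd (h P) - snd (om \<alpha>)\<bar>" by (rule Out_hole_far[OF Mc_Holes om_Out])
   hence "1 / real n \<le> dist (h P) (om \<alpha>)" unfolding sz_Mc using coord_le_dist[of "h P" "om \<alpha>"] by linarith
   thus ?thesis by (rule w(5))
  qed
  have "c \<le> 64 / real N"
  proof (rule nc[of "w \<circ> h"])
   show "bounded ((w \<circ> h) ` F)"
   proof (rule boundedI)
    fix x assume "x \<in> (w \<circ> h) ` F"
    then obtain z where "x = w z" by (metis comp_apply imageE)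
    thus "norm x \<le> 1" using w(3)[of z] by simp
   qed
   show "\<forall>P\<in>S. (w \<circ> h) P = 1" using hS by simp
   show "\<forall>P\<in>Mc m. (w \<circ> h) P = 0" using hM by simp
   have "(\<lambda>k. L\<^sup>2 * tail k h) \<longlonglongrightarrow> L\<^sup>2 * 0" by (intro tendsto_intros GF_tail h(1))
   hence lim: "(\<lambda>k. L\<^sup>2 * tail k h) \<longlonglongrightarrow> 0" by simp
   show "(\<lambda>k. tail k (w \<circ> h)) \<longlonglongrightarrow> 0"
    by (rule tendsto_sandwich[OF _ _ tendsto_const lim]) (simp_all add: tail_nonneg tail_comp_lip[OF h(1) w(1,2)])
   show "\<forall>A. finite A \<longrightarrow> A \<subseteq> Holes \<longrightarrow> (\<Sum>C\<in>A. (osc (w \<circ> h) C)\<^sup>2) \<le> 64 / real N"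
    using GF_hole_energy[OF h(1,2) w(6)] by blast
  qed
  thus False using N1 by linarith
 qed
 thus ?thesis using a gl by simp
qed

lemma Ln_lip:
 assumes "d > 0" "d \<le> Re a" "d \<le> Re b" shows "norm (Ln a - Ln b) \<le> norm (a - b) / d"
proof -
 have "norm (Ln a - Ln b) \<le> 1 / d * norm (a - b)"
 proof (rule field_differentiable_bound[of "{z. d \<le> Re z}" Ln inverse])
  show "convex {z. d \<le> Re z}" by (simp add: convex_halfspace_Re_ge)
  fix z assume z: "z \<in> {z. d \<le> Re z}"
  hence "Re z > 0" using assms(1) by simp
  hence "z \<notin> \<real>\<^sub>\<le>\<^sub>0" by (auto simp: complex_nonpos_Reals_iff)
  thus "(Ln has_field_derivative inverse z) (at z within {z. d \<le> Re z})" by (rule has_field_derivative_Ln[THEN has_field_derivative_at_within])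
  have "d \<le> norm z" using z complex_Re_le_cmod[of z] by simp
  thus "norm (inverse z) \<le> 1 / d" using le_imp_inverse_le[of d "norm z"] assms(1) by (simp add: norm_inverse divide_inverse)
 qed (use assms in auto)
 thus ?thesis by simp
qed

text \<open>The difference of two branches takes values in a discrete set, hence is constant on a
  connected set.\<close>

lemma log_diff:
 fixes A B :: "'a::topological_space => complex"
 assumes X: "connected X" and c: "continuous_on X A" "continuous_on X B" and e: "\<And>x. x \<in> X ==> exp (A x) = exp (B x)"
 shows "\<exists>m::int. \<forall>x\<in>X. A x = B x + 2 * pi * of_int m * \<i>"
proof -
 define f where "f x = A x - B x" for x
 have f1: "\<exists>m::int. f x = 2 * pi * of_int m * \<i>" if "x \<in> X" for x
 proof -
  have "exp (f x) = 1" using e[OF that] by (simp add: f_def exp_diff)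
  then obtain m :: int where "Re (f x) = 0" "Im (f x) = of_int (2 * m) * pi" unfolding exp_eq_1 by blast
  hence "f x = 2 * pi * of_int m * \<i>" by (simp add: complex_eq_iff)
  thus ?thesis by blast
 qed
 have "f constant_on X"
 proof (rule continuous_discrete_range_constant[OF X])
  show "continuous_on X f" unfolding f_def by (intro continuous_intros c)
  fix x assume x: "x \<in> X"
  have "2 * pi \<le> norm (f y - f x)" if y: "y \<in> X" "f y \<noteq> f x" for y
  proof -
   obtain i j :: int where ij: "f x = 2 * pi * of_int i * \<i>" "f y = 2 * pi * of_int j * \<i>" using f1 x y by meson
   hence "f y - f x = of_real (2 * pi * of_int (j - i)) * \<i>" by (simp add: algebra_simps)
   hence "norm (f y - f x) = 2 * pi * \<bar>of_int (j - i)\<bar>" by (simp add: norm_mult abs_mult del: of_real_mult of_int_diff)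
   moreover have "j - i \<noteq> 0" using ij y(2) by auto
   hence "1 \<le> \<bar>of_int (j - i) :: real\<bar>" by linarith
   ultimately show ?thesis using mult_left_mono[of 1 "\<bar>of_int (j - i) :: real\<bar>" "2 * pi"] pi_gt_zero by simp
  qed
  thus "\<exists>e>0. \<forall>y. y \<in> X \<and> f y \<noteq> f x \<longrightarrow> e \<le> norm (f y - f x)" using pi_gt_zero by (intro exI[of _ "2 * pi"]) auto
 qed
 then obtain k where k: "\<And>x. x \<in> X ==> f x = k" unfolding constant_on_def by blast
 show ?thesis
 proof (cases "X = {}")
  case False
  then obtain x where x: "x \<in> X" by blast
  obtain m :: int where "f x = 2 * pi * of_int m * \<i>" using f1[OF x] by blast
  hence "A y = B y + 2 * pi * of_int m * \<i>" if "y \<in> X" for y using k[OF that] k[OF x] by (simp add: f_def algebra_simps)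
  thus ?thesis by blast
 qed simp
qed

text \<open>Let u be the direction from cc to the nearest point of the convex set Y. After division
  by u, the set Y - cc lies in a half-plane with real part at least d, where \<open>Ln\<close> has
  Lipschitz constant 1 / d; on the connected set X, \<phi> differs from this branch by a
  constant.\<close>

lemma log_osc:
 fixes h \<phi> :: "'a::topological_space => complex"
 assumes X: "connected X" and c: "continuous_on X h" "continuous_on X \<phi>" and e: "\<And>x. x \<in> X ==> exp (\<phi> x) = h x - cc"
  and Y: "convex Y" "closed Y" "h ` X \<subseteq> Y" and d: "d > 0" "\<And>y. y \<in> Y ==> d \<le> norm (y - cc)" and x: "x \<in> X" "y \<in> X"
 shows "norm (\<phi> x - \<phi> y) \<le> norm (h x - h y) / d"
proof -
 have "Y \<noteq> {}" using Y x by auto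
 then obtain y0 where y0: "y0 \<in> Y" "\<And>z. z \<in> Y ==> dist cc y0 \<le> dist cc z"
  using distance_attains_inf[OF Y(2)] by metis
 define r where "r = norm (y0 - cc)"
 have r: "d \<le> r" using d(2)[OF y0(1)] by (simp add: r_def)
 have rp: "r > 0" using r d by simp
 define u where "u = (y0 - cc) / of_real r"
 have nu: "norm u = 1" using rp by (simp add: u_def norm_divide r_def)
 have u0: "u \<noteq> 0" using nu by auto
 have Re: "r \<le> Re ((z - cc) / u)" if "z \<in> Y" for z
 proof -
  have "inner (cc - y0) (z - y0) \<le> 0" by (rule any_closest_point_dot[OF Y(1,2) y0(1) that]) (use y0 in blast)
  hence "inner (y0 - cc) (y0 - cc) \<le> inner (y0 - cc) (z - cc)" by (simp add: algebra_simps inner_diff_left inner_diff_right)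
  moreover have "inner (y0 - cc) (y0 - cc) = r\<^sup>2" by (simp add: r_def power2_norm_eq_inner)
  ultimately have A: "r\<^sup>2 \<le> inner (y0 - cc) (z - cc)" by simp
  have "(z - cc) / u = (z - cc) * cnj u" using complex_div_cnj[of "z - cc" u] nu by simp
  also have "... = (z - cc) * cnj (y0 - cc) / of_real r" by (simp add: u_def)
  also have "Re ... = inner (y0 - cc) (z - cc) / r"
  proof -
   have "Re ((z - cc) * cnj (y0 - cc)) = inner (y0 - cc) (z - cc)" by (simp add: inner_complex_def algebra_simps)
   thus ?thesis by (simp only: Re_divide_of_real)
  qed
  finally have "Re ((z - cc) / u) = inner (y0 - cc) (z - cc) / r" .
  moreover have "r \<le> inner (y0 - cc) (z - cc) / r" using A rp by (simp add: pos_le_divide_eq power2_eq_square)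
  ultimately show ?thesis by simp
 qed
 define L where "L z = Ln ((h z - cc) / u) + Ln u" for z
 have nz: "(h z - cc) / u \<notin> \<real>\<^sub>\<le>\<^sub>0" if "z \<in> X" for z
 proof -
  have "Re ((h z - cc) / u) > 0" using Re[of "h z"] that Y(3) rp by force
  thus ?thesis by (auto simp: complex_nonpos_Reals_iff)
 qed
 have nz': "(h z - cc) / u \<noteq> 0" if "z \<in> X" for z using nz[OF that] by auto
 have "continuous_on X L" unfolding L_def by (intro continuous_intros c nz) (use u0 in auto)
 moreover have "exp (\<phi> z) = exp (L z)" if "z \<in> X" for z
  unfolding L_def exp_add using e[OF that] nz'[OF that] u0 by simp
 ultimately obtain m :: int where m: "\<forall>z\<in>X. \<phi> z = L z + 2 * pi * of_int m * \<i>" using log_diff[OF X c(2)] by blast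
 have "norm (\<phi> x - \<phi> y) = norm (Ln ((h x - cc) / u) - Ln ((h y - cc) / u))" using m x by (simp add: L_def)
 also have "... \<le> norm ((h x - cc) / u - (h y - cc) / u) / r"
  by (rule Ln_lip[OF rp Re Re]) (use x Y(3) in auto)
 also have "(h x - cc) / u - (h y - cc) / u = (h x - h y) / u" by (simp add: diff_divide_distrib[symmetric])
 also have "norm ((h x - h y) / u) / r \<le> norm (h x - h y) / d" using nu r d by (simp add: norm_divide frac_le)
 finally show ?thesis .
qed

subsection \<open>The argument around a large hole\<close>

definition cen :: "nat => plane" where
 "cen b = ((real (ma b) + 1 / 2) / real n, (real (mb b) + 1 / 2) / real n)"

lemma cen_osq: "cen b \<in> osq 1 (ma b) (mb b)"
 by (simp add: cen_def osq_def oseg_def)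

lemma cen_far: assumes "z \<notin> osq 1 (ma b) (mb b)" shows "1 / (2 * real n) \<le> dist z (cen b)"
proof -
 have *: "1 / (2 * real n) \<le> \<bar>x - (real a + 1 / 2) / real n\<bar>" if "\<not> oseg 1 a x" for a x
 proof -
  have "x * real n \<le> real a \<or> real a + 1 \<le> x * real n" using that by (auto simp: oseg_def)
  hence "1 / 2 \<le> \<bar>x * real n - (real a + 1 / 2)\<bar>" by auto
  also have "x * real n - (real a + 1 / 2) = (x - (real a + 1 / 2) / real n) * real n" by (simp add: field_simps)
  finally have "1 / 2 \<le> \<bar>x - (real a + 1 / 2) / real n\<bar> * real n" by (simp add: abs_mult)
  thus ?thesis by (simp add: field_simps)
 qed
 have "\<not> oseg 1 (ma b) (fst z) \<or> \<not> oseg 1 (mb b) (snd z)" using assms by (auto simp: osq_def)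
 thus ?thesis
 proof
  assume "\<not> oseg 1 (ma b) (fst z)"
  thus ?thesis using *[of "ma b" "fst z"] coord_le_dist(1)[of z "cen b"] by (simp add: cen_def)
 next
  assume "\<not> oseg 1 (mb b) (snd z)"
  thus ?thesis using *[of "mb b" "snd z"] coord_le_dist(2)[of z "cen b"] by (simp add: cen_def)
 qed
qed

lemma F_not_osq: "z \<in> F ==> z \<notin> osq 1 (ma b) (mb b)"
 using F_osq_hole[OF Mc_hole] by blast

lemma F_ne_cen: "z \<in> F ==> z \<noteq> cen b"
 using F_not_osq cen_osq by metis

lemma St_cover:
 assumes "z \<in> unit_sq" "z \<notin> St K"
 shows "\<exists>k i j. k \<le> K \<and> hole k i j \<and> z \<in> osq k i j"
 using assms(2)
proof (induction K)
 case 0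
 have "rem 0 0 0 \<and> z \<in> sq 0 0 0" using assms(1) by (simp add: sq_zero)
 thus ?case using 0 unfolding St_def by blast
next
 case (Suc K)
 show ?case
 proof (cases "z \<in> St K")
  case False thus ?thesis using Suc.IH le_SucI by meson
 next
  case True
  then obtain i j where ij: "rem K i j" "z \<in> sq K i j" unfolding St_def by blast
  obtain a where a: "a < n" "seg (Suc K) (n * i + a) (fst z)" using seg_child[of K i "fst z"] ij(2) by (auto simp: sq_def)
  obtain b where b: "b < n" "seg (Suc K) (n * j + b) (snd z)" using seg_child[of K j "snd z"] ij(2) by (auto simp: sq_def)
  have zs: "z \<in> sq (Suc K) (n * i + a) (n * j + b)" using a b by (simp add: sq_def)
  have "bad a b"
  proof (rule ccontr)
   assume "\<not> bad a b"
   hence "rem (Suc K) (n * i + a) (n * j + b)" using a b ij by simp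
   thus False using zs Suc.prems unfolding St_def by blast
  qed
  hence h: "hole (Suc K) (n * i + a) (n * j + b)" using a b ij by (simp add: hole_def)
  have "z \<in> osq (Suc K) (n * i + a) (n * j + b)"
  proof (rule ccontr)
   assume "z \<notin> osq (Suc K) (n * i + a) (n * j + b)"
   hence "z \<in> circ (Suc K) (n * i + a) (n * j + b)" using zs by (simp add: circ_def)
   hence "z \<in> F" using circ_hole_F[OF h] by blast
   thus False using Suc.prems F_St by blast
  qed
  thus ?thesis using h by blast
 qed
qed

lemma F_sub_St: "F \<subseteq> St K" using F_St by blast

lemma compact_St: "compact (St K)"
proof -
 have "St K \<subseteq> sq 0 0 0"
 proof (induction K)
  case 0 show ?case unfolding St_def by auto
 next
  case (Suc K) thus ?case using St_mono by blast
 qed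
 thus ?thesis using compact_sq closed_St by (metis compact_Int_closed inf.absorb_iff2)
qed

text \<open>Compactness of the decreasing stages: an extension that is good near \<open>F\<close> is
  good on a whole stage, leaving finitely many holes to be treated separately.\<close>

lemma St_shrink:
 assumes "open V" "F \<subseteq> V" shows "\<exists>K. St K \<subseteq> V"
proof (rule ccontr)
 assume c: "\<nexists>K. St K \<subseteq> V"
 have "\<Inter> (range (\<lambda>K. St K - V)) \<noteq> {}"
 proof (rule compact_nest)
  show "compact (St K - V)" for K using compact_St assms(1) by (simp add: compact_diff)
  show "St K - V \<noteq> {}" for K using c by blast
  fix a b :: nat assume "a \<le> b"
  hence "St b \<subseteq> St a" by (rule lift_Suc_antimono_le[of St, rotated]) (rule St_mono)
  thus "St b - V \<subseteq> St a - V" by blast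
 qed
 thus False using assms(2) unfolding F_St by blast
qed

lemma ext_into:
 fixes f :: "plane => plane"
 assumes "convex C" "C \<noteq> {}" "closed S" "continuous_on S f" "f ` S \<subseteq> C"
 shows "\<exists>g. continuous_on UNIV g \<and> g ` UNIV \<subseteq> C \<and> (\<forall>x\<in>S. g x = f x)"
proof (rule Dugundji[OF assms(1,2) _ assms(4,5)])
 show "closedin (top_of_set UNIV) S" using assms(3) by simp
 fix g assume "continuous_on UNIV g" "g ` UNIV \<subseteq> C" "\<And>x. x \<in> S ==> g x = f x"
 thus ?thesis by (intro exI[of _ g]) simp
qed

text \<open>An arbitrary continuous extension still avoids \<open>cen b\<close> on some stage. Each
  of the finitely many older holes is then filled with values in the convex square of its image
  hole, which misses \<open>cen b\<close> because only \<open>Mc b\<close> is mapped to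
  \<open>Mc b\<close>.\<close>

lemma fill_holes:
 assumes g: "GF g" "g ` Out = Out" "g ` Mc b = Mc b"
 shows "\<exists>G. continuous_on (unit_sq - osq 1 (ma b) (mb b)) G \<and>
   (\<forall>z\<in>unit_sq - osq 1 (ma b) (mb b). G z \<noteq> cen b) \<and> (\<forall>z\<in>F. G z = g z)"
proof -
 define c where "c = cen b"
 have cg: "continuous_on F g" by (rule GF_cont[OF g(1)])
 have gc: "g z \<noteq> c" if "z \<in> F" for z unfolding c_def by (rule F_ne_cen) (rule GF_mem[OF g(1) that])
 obtain g1 where g1: "continuous_on UNIV g1" "\<And>x. x \<in> F ==> g1 x = g x"
  using ext_into[OF convex_UNIV UNIV_not_empty closed_F cg subset_UNIV] by metis
 define V where "V = {z. g1 z \<noteq> c}"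
 have "open V" unfolding V_def by (rule open_Collect_neq[OF g1(1) continuous_on_const])
 moreover have "F \<subseteq> V"
 proof
  fix z assume "z \<in> F" thus "z \<in> V" using g1(2)[of z] gc[of z] by (simp add: V_def)
 qed
 ultimately obtain K where K: "St K \<subseteq> V" using St_shrink by blast
 define T where "T = {(k, i, j). k \<le> K \<and> hole k i j \<and> (k, i, j) \<noteq> (1, ma b, mb b)}"
 have "T \<subseteq> Sigma {..K} (\<lambda>k. ix k \<times> ix k)" using hole_bound by (auto simp: T_def)
 hence finT: "finite T" by (rule finite_subset) auto
 have ext: "\<exists>G. continuous_on (St K \<union> (\<Union>(k, i, j)\<in>S. sq k i j)) G \<and> (\<forall>z\<in>St K \<union> (\<Union>(k, i, j)\<in>S. sq k i j). G z \<noteq> c) \<and> (\<forall>z\<in>F. G z = g z)"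
  if "S \<subseteq> T" for S
  using finite_subset[OF that finT] that
 proof (induction S rule: finite_induct)
  case empty
  have "continuous_on (St K) g1" using g1(1) continuous_on_subset by blast
  moreover have "\<forall>z\<in>St K. g1 z \<noteq> c" using K by (auto simp: V_def)
  ultimately have "continuous_on (St K) g1 \<and> (\<forall>z\<in>St K. g1 z \<noteq> c) \<and> (\<forall>z\<in>F. g1 z = g z)" using g1(2) by simp
  thus ?case by auto
 next
  case (insert h S)
  obtain k i j where h: "h = (k, i, j)" by (metis prod_cases3)
  hence kij: "k \<le> K" "hole k i j" "(k, i, j) \<noteq> (1, ma b, mb b)" using insert.prems by (auto simp: T_def)
  let ?U = "St K \<union> (\<Union>(k, i, j)\<in>S. sq k i j)"
  obtain G where G: "continuous_on ?U G" "\<And>z. z \<in> ?U ==> G z \<noteq> c" "\<And>z. z \<in> F ==> G z = g z"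
   using insert.IH insert.prems by blast
  have CH: "circ k i j \<in> Holes" using kij by (auto simp: Holes_def)
  obtain k' i' j' where im: "g ` circ k i j = circ k' i' j'" "hole k' i' j'"
   using GF_Holes[OF g(1,2) CH] unfolding Holes_def by blast
  have ne: "(k', i', j') \<noteq> (1, ma b, mb b)"
  proof
   assume "(k', i', j') = (1, ma b, mb b)"
   hence "g ` circ k i j = g ` Mc b" using im(1) g(3) by (simp add: Mc_def)
   hence "circ k i j = Mc b"
    using GF_inj_im[OF g(1) Per_F Per_F[OF Mc_Per]] CH Holes_Per by blast
   thus False using circ_inj kij(3) unfolding Mc_def by blast
  qed
  have cn: "c \<notin> sq k' i' j'"
   using sq_holes_disj[OF im(2) Mc_hole ne] cen_osq[of b] osq_sub_sq unfolding c_def by blast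
  have cF: "circ k i j \<subseteq> F" by (rule circ_hole_F[OF kij(2)])
  have ne': "sq k' i' j' \<noteq> {}" using circ_sub_sq[of k' i' j'] circ_corners(1)[of i' k' j'] by blast
  have c1: "continuous_on (circ k i j) g" using cg cF continuous_on_subset by blast
  have c2: "g ` circ k i j \<subseteq> sq k' i' j'" using im(1) circ_sub_sq by simp
  obtain e where e: "continuous_on UNIV e" "e ` UNIV \<subseteq> sq k' i' j'" "\<And>x. x \<in> circ k i j ==> e x = g x"
   using ext_into[OF convex_sq ne' compact_imp_closed[OF compact_circ] c1 c2] by metis
  define G' where "G' z = (if z \<in> sq k i j then e z else G z)" for z
  have int: "G z = e z" if zq: "z \<in> sq k i j" and zU: "z \<in> ?U" for z
  proof -
   have "z \<in> circ k i j"
   proof (rule ccontr)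
    assume "z \<notin> circ k i j"
    hence zo: "z \<in> osq k i j" using zq by (simp add: circ_def)
    hence "z \<notin> St K" using osq_hole_disj[OF kij(2) zo _ kij(1)] unfolding St_def by blast
    then obtain k2 i2 j2 where z2: "(k2, i2, j2) \<in> S" "z \<in> sq k2 i2 j2" using zU by auto
    hence "hole k2 i2 j2" using insert.prems by (auto simp: T_def)
    moreover have "(k, i, j) \<noteq> (k2, i2, j2)" using z2(1) insert.hyps(2) h by auto
    ultimately show False using sq_holes_disj[OF kij(2)] z2(2) zq by blast
   qed
   thus ?thesis using e(3) G(3) cF by (metis subsetD)
  qed
  have clU: "closed ?U"
  proof (intro closed_Un closed_St closed_UN)
   show "finite S" by (rule insert.hyps)
   show "\<forall>x\<in>S. closed (case x of (k, i, j) => sq k i j)" using closed_sq by auto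
  qed
  have "continuous_on (sq k i j \<union> ?U) G'" unfolding G'_def
  proof (rule continuous_on_cases[OF closed_sq clU continuous_on_subset[OF e(1) subset_UNIV] G(1)])
   show "\<forall>x. x \<in> sq k i j \<and> x \<notin> sq k i j \<or> x \<in> ?U \<and> x \<in> sq k i j \<longrightarrow> e x = G x" using int by metis
  qed
  moreover have "G' z \<noteq> c" if "z \<in> sq k i j \<union> ?U" for z
   using that G(2)[of z] e(2) cn unfolding G'_def by (cases "z \<in> sq k i j") auto
  moreover have "G' z = g z" if "z \<in> F" for z
  proof (cases "z \<in> sq k i j")
   case True
   thus ?thesis using int[OF True] F_sub_St[of K] that G(3)[OF that] by (auto simp: G'_def)
  qed (simp add: G'_def G(3)[OF that])
  moreover have "St K \<union> (\<Union>(k, i, j)\<in>insert h S. sq k i j) = sq k i j \<union> ?U" unfolding h by auto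
  ultimately show ?case by (intro exI[of _ G']) simp
 qed
 from ext[OF order_refl] obtain G where G: "continuous_on (St K \<union> (\<Union>(k, i, j)\<in>T. sq k i j)) G"
  "\<forall>z\<in>St K \<union> (\<Union>(k, i, j)\<in>T. sq k i j). G z \<noteq> c" "\<forall>z\<in>F. G z = g z" by blast
 have "unit_sq - osq 1 (ma b) (mb b) \<subseteq> St K \<union> (\<Union>(k, i, j)\<in>T. sq k i j)"
 proof
  fix z assume z: "z \<in> unit_sq - osq 1 (ma b) (mb b)"
  show "z \<in> St K \<union> (\<Union>(k, i, j)\<in>T. sq k i j)"
  proof (cases "z \<in> St K")
   case False
   then obtain k i j where k: "k \<le> K" "hole k i j" "z \<in> osq k i j" using St_cover z by blast
   hence "(k, i, j) \<noteq> (1, ma b, mb b)" using z by blast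
   hence "(k, i, j) \<in> T" using k by (simp add: T_def)
   thus ?thesis using k(3) osq_sub_sq by blast
  qed simp
 qed
 thus ?thesis using G continuous_on_subset unfolding c_def by blast
qed

text \<open>Inside the hole points are first retracted from its centre to its boundary; outside the
  unit square the coordinates are first clamped. Both reduce to the extension from
  \<open>fill_holes\<close>.\<close>

lemma extend_plane:
 assumes g: "GF g" "g ` Out = Out" "g ` Mc b = Mc b"
 shows "\<exists>G. continuous_on (- {cen b}) G \<and> (\<forall>z. z \<noteq> cen b \<longrightarrow> G z \<noteq> cen b) \<and> (\<forall>z\<in>F. G z = g z)"
proof -
 let ?Q = "sq 1 (ma b) (mb b)"
 let ?O = "osq 1 (ma b) (mb b)"
 let ?U = "unit_sq - ?O"
 obtain G1 where G1: "continuous_on ?U G1" "\<And>z. z \<in> ?U ==> G1 z \<noteq> cen b" "\<And>z. z \<in> F ==> G1 z = g z"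
  using fill_holes[OF g] by blast
 have "frontier ?Q retract_of (- {cen b})"
  by (rule frontier_retract_of_punctured_universe[OF convex_sq compact_imp_bounded[OF compact_sq]]) (unfold interior_sq, rule cen_osq)
 then obtain r where r: "continuous_on (- {cen b}) r" "r ` (- {cen b}) \<subseteq> circ 1 (ma b) (mb b)" "\<And>z. z \<in> circ 1 (ma b) (mb b) ==> r z = z"
  unfolding retract_of_def retraction_def frontier_sq by auto
 define cl where "cl z = (max 0 (min 1 (fst z)), max 0 (min 1 (snd z)))" for z :: "plane"
 have clc: "continuous_on A cl" for A unfolding cl_def by (intro continuous_intros)
 have cl1: "cl z = z" if "z \<in> unit_sq" for z using that by (auto simp: cl_def mem_Times_iff prod_eq_iff)
 have Qs: "?O \<subseteq> {0<..<1} \<times> {0<..<1}" using hole_sq_unit[OF Mc_hole] osq_sub_sq by blast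
 have clU: "cl z \<in> ?U" if "z \<notin> ?O" for z
 proof -
  have "cl z \<notin> ?O"
  proof
   assume a: "cl z \<in> ?O"
   hence "cl z \<in> {0<..<1} \<times> {0<..<1}" using Qs by blast
   hence "cl z = z" by (auto simp: cl_def mem_Times_iff prod_eq_iff max_def min_def split: if_splits)
   thus False using a that by simp
  qed
  thus ?thesis by (auto simp: cl_def)
 qed
 have rU: "r z \<in> ?U" if "z \<noteq> cen b" for z
 proof -
  have "r z \<in> circ 1 (ma b) (mb b)" using r(2) that by blast
  moreover from this have "r z \<in> F" using circ_hole_F[OF Mc_hole] by blast
  ultimately show ?thesis using F_unit by (auto simp: circ_def)
 qed
 define G where "G z = (if z \<in> ?Q then G1 (r z) else G1 (cl z))" for z
 have "continuous_on ((?Q - {cen b}) \<union> - ?O) G" unfolding G_def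
 proof (rule continuous_on_cases_local)
  have e: "(?Q - {cen b}) \<union> - ?O = - {cen b}" using cen_osq[of b] osq_sub_sq by (auto simp: circ_def)
  have "?Q - {cen b} = ((?Q - {cen b}) \<union> - ?O) \<inter> ?Q" unfolding e by auto
  thus "closedin (top_of_set ((?Q - {cen b}) \<union> - ?O)) (?Q - {cen b})" using closed_sq by (metis closedin_closed_Int)
  have "- ?O = ((?Q - {cen b}) \<union> - ?O) \<inter> - ?O" by auto
  thus "closedin (top_of_set ((?Q - {cen b}) \<union> - ?O)) (- ?O)" using open_osq by (metis closedin_closed_Int closed_Compl)
  show "continuous_on (?Q - {cen b}) (\<lambda>z. G1 (r z))"
   by (rule continuous_on_compose2[OF G1(1) continuous_on_subset[OF r(1)]], blast, use rU in blast)
  show "continuous_on (- ?O) (\<lambda>z. G1 (cl z))"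
   by (rule continuous_on_compose2[OF G1(1) clc]) (use clU in blast)
  fix z assume z: "z \<in> ?Q - {cen b} \<and> z \<notin> ?Q \<or> z \<in> - ?O \<and> z \<in> ?Q"
  hence zc: "z \<in> circ 1 (ma b) (mb b)" by (auto simp: circ_def)
  hence "z \<in> F" using circ_hole_F[OF Mc_hole] by blast
  hence "cl z = z" using cl1 F_unit by blast
  thus "G1 (r z) = G1 (cl z)" using r(3)[OF zc] by simp
 qed
 moreover have "(?Q - {cen b}) \<union> - ?O = - {cen b}" using cen_osq[of b] osq_sub_sq by (auto simp: circ_def)
 ultimately have "continuous_on (- {cen b}) G" by simp
 moreover have "G z \<noteq> cen b" if "z \<noteq> cen b" for z
  using G1(2)[OF rU[OF that]] G1(2)[OF clU[of z]] osq_sub_sq unfolding G_def by auto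
 moreover have "G z = g z" if z: "z \<in> F" for z
 proof (cases "z \<in> ?Q")
  case True
  hence "z \<in> circ 1 (ma b) (mb b)" using F_not_osq[OF z] by (simp add: circ_def)
  thus ?thesis using True r(3) G1(3)[OF z] by (simp add: G_def)
 next
  case False
  have "cl z = z" using cl1 F_unit z by blast
  thus ?thesis using False G1(3)[OF z] by (simp add: G_def)
 qed
 ultimately show ?thesis by blast
qed

text \<open>A lift of the extended map to the logarithmic cover of the plane punctured at
  \<open>cen b\<close>. Its iterates provide compatible branches of the argument for all iterates of
  g at once.\<close>

lemma log_lift:
 assumes g: "GF g" "g ` Out = Out" "g ` Mc b = Mc b"
 shows "\<exists>\<Lambda>. continuous_on UNIV \<Lambda> \<and> (\<forall>\<zeta>. \<forall>z\<in>F. exp \<zeta> = toC z - toC (cen b) \<longrightarrow> exp (\<Lambda> \<zeta>) = toC (g z) - toC (cen b))"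
proof -
 obtain G where G: "continuous_on (- {cen b}) G" "\<And>z. z \<noteq> cen b ==> G z \<noteq> cen b" "\<And>z. z \<in> F ==> G z = g z"
  using extend_plane[OF g] by blast
 define p where "p \<zeta> = ofC (toC (cen b) + exp \<zeta>)" for \<zeta>
 have pc: "p \<zeta> \<noteq> cen b" for \<zeta>
 proof
  assume "p \<zeta> = cen b"
  hence "toC (cen b) + exp \<zeta> = toC (cen b)" unfolding p_def by (metis toC_ofC)
  thus False by simp
 qed
 have cp: "continuous_on UNIV p" unfolding p_def
  by (rule continuous_on_compose2[OF cont_ofC[of UNIV]]) (auto intro!: continuous_intros)
 define f where "f \<zeta> = toC (G (p \<zeta>)) - toC (cen b)" for \<zeta>
 have "continuous_on UNIV (\<lambda>\<zeta>. G (p \<zeta>))" by (rule continuous_on_compose2[OF G(1) cp]) (metis ComplI image_subsetI pc singletonD)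
 hence "continuous_on UNIV f" unfolding f_def
  by (intro continuous_on_diff continuous_on_const continuous_on_compose2[OF cont_toC[of UNIV]]) auto
 moreover have "f \<zeta> \<noteq> 0" for \<zeta> unfolding f_def using G(2)[OF pc] toC_inj by auto
 ultimately obtain \<Lambda> where L: "continuous_on UNIV \<Lambda>" "\<And>\<zeta>. f \<zeta> = exp (\<Lambda> \<zeta>)"
  using continuous_logarithm_on_contractible[of UNIV f] convex_imp_contractible[OF convex_UNIV] by auto
 have "exp (\<Lambda> \<zeta>) = toC (g z) - toC (cen b)" if "z \<in> F" "exp \<zeta> = toC z - toC (cen b)" for \<zeta> z
 proof -
  have "p \<zeta> = z" unfolding p_def that(2) by simp
  thus ?thesis using L(2)[of \<zeta>] G(3)[OF that(1)] by (simp add: f_def)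
 qed
 thus ?thesis using L(1) by blast
qed

lemma sq_anc: "z \<in> sq (l + t) a b ==> z \<in> sq l (a div n ^ t) (b div n ^ t)"
proof (induction t arbitrary: a b)
 case (Suc t)
 hence "z \<in> sq (l + t) (a div n) (b div n)" using sq_parent[of z "l + t" a b] by simp
 from Suc.IH[OF this] show ?case by (simp add: div_mult2_eq)
qed simp

lemma elt_sub_sq:
 assumes ij: "i < n ^ k" "j < n ^ k" and l: "l \<le> fst (lab k i j)"
 shows "elt (lab k i j) \<subseteq> sq l (i div n ^ (k - l)) (j div n ^ (k - l))"
proof
 fix z assume z: "z \<in> elt (lab k i j)"
 obtain m a b where L: "lab k i j = (m, a, b)" by (rule lab_ex)
 have P: "m \<le> k" "a = i div n ^ (k - m)" "b = j div n ^ (k - m)" using lab_props[OF ij L] by auto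
 have "l \<le> m" using l L by simp
 have "z \<in> sq m a b" using z circ_sub_sq unfolding L by (auto split: if_splits)
 hence "z \<in> sq l (a div n ^ (m - l)) (b div n ^ (m - l))" using sq_anc[of z l "m - l" a b] \<open>l \<le> m\<close> by simp
 moreover have "n ^ (k - l) = n ^ (k - m) * n ^ (m - l)" using \<open>l \<le> m\<close> P(1) by (simp add: power_add[symmetric])
 ultimately show "z \<in> sq l (i div n ^ (k - l)) (j div n ^ (k - l))" unfolding P(2,3) by (simp add: div_mult2_eq)
qed

text \<open>Without fixed points all points move in the same direction. Comparison with points that
  start and end in [-B, B] bounds the orbit of the appropriate end, and the limit of this monotone
  orbit would be fixed.\<close>

lemma no_drift:
 fixes l :: "real => real"
 assumes c: "continuous_on UNIV l" and m: "strict_mono l" and nf: "\<And>a. l a \<noteq> a"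
  and B: "\<And>k. \<exists>a. \<bar>a\<bar> \<le> B \<and> \<bar>(l ^^ k) a\<bar> \<le> B"
 shows False
proof -
 have mk: "mono (l ^^ k)" for k
 proof (induction k)
  case (Suc k) thus ?case using m by (auto simp: mono_def strict_mono_less_eq)
 qed (simp add: mono_def)
 have lim: False if mono: "monoseq (\<lambda>k. (l ^^ k) x)" and bd: "\<And>k. \<bar>(l ^^ k) x\<bar> \<le> C" for x C
 proof -
  have "Bseq (\<lambda>k. (l ^^ k) x)" by (rule BseqI'[of _ C]) (use bd in simp)
  then obtain \<alpha> where \<alpha>: "(\<lambda>k. (l ^^ k) x) \<longlonglongrightarrow> \<alpha>"
   using Bseq_monoseq_convergent mono unfolding convergent_def by blast
  have "isCont l \<alpha>" using c by (simp add: continuous_on_eq_continuous_at)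
  hence "(\<lambda>k. l ((l ^^ k) x)) \<longlonglongrightarrow> l \<alpha>" using \<alpha> by (rule isCont_tendsto_compose)
  moreover have "(\<lambda>k. (l ^^ Suc k) x) \<longlonglongrightarrow> \<alpha>" using \<alpha> by (rule LIMSEQ_Suc)
  ultimately have "l \<alpha> = \<alpha>" using LIMSEQ_unique by simp
  thus False using nf by blast
 qed
 have sign: "(\<forall>a. a < l a) \<or> (\<forall>a. l a < a)"
 proof (rule ccontr)
  assume "\<not> ?thesis"
  then obtain a b where ab: "l a < a" "b < l b" using nf by (metis linorder_neqE)
  have "connected ((\<lambda>x. l x - x) ` UNIV)" by (intro connected_continuous_image continuous_intros c) simp
  hence "0 \<in> (\<lambda>x. l x - x) ` UNIV"
   by (rule connectedD_interval[of _ "l a - a" "l b - b"]) (use ab in auto)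
  thus False using nf by (auto simp: image_iff)
 qed
 from sign show False
 proof
  assume s: "\<forall>a. a < l a"
  let ?x = "- \<bar>B\<bar>"
  have inc: "(l ^^ k) ?x \<le> (l ^^ Suc k) ?x" for k
  proof -
   have "(l ^^ k) ?x < l ((l ^^ k) ?x)" using s by blast
   thus ?thesis by simp
  qed
  have lo: "?x \<le> (l ^^ k) ?x" for k
  proof (induction k)
   case (Suc k) thus ?case using inc[of k] by linarith
  qed simp
  have "\<bar>(l ^^ k) ?x\<bar> \<le> \<bar>B\<bar>" for k
  proof -
   obtain a where a: "\<bar>a\<bar> \<le> B" "\<bar>(l ^^ k) a\<bar> \<le> B" using B by blast
   have "(l ^^ k) ?x \<le> (l ^^ k) a" using a(1) by (intro monoD[OF mk]) linarith
   thus ?thesis using lo[of k] a(2) by linarith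
  qed
  thus False using lim[of ?x] inc unfolding monoseq_Suc by blast
 next
  assume s: "\<forall>a. l a < a"
  let ?x = "\<bar>B\<bar>"
  have inc: "(l ^^ Suc k) ?x \<le> (l ^^ k) ?x" for k
  proof -
   have "l ((l ^^ k) ?x) < (l ^^ k) ?x" using s by blast
   thus ?thesis by simp
  qed
  have lo: "(l ^^ k) ?x \<le> ?x" for k
  proof (induction k)
   case (Suc k) thus ?case using inc[of k] by linarith
  qed simp
  have "\<bar>(l ^^ k) ?x\<bar> \<le> \<bar>B\<bar>" for k
  proof -
   obtain a where a: "\<bar>a\<bar> \<le> B" "\<bar>(l ^^ k) a\<bar> \<le> B" using B by blast
   have "(l ^^ k) a \<le> (l ^^ k) ?x" using a(1) by (intro monoD[OF mk]) linarith
   thus ?thesis using lo[of k] a(2) by linarith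
  qed
  thus False using lim[of ?x] inc unfolding monoseq_Suc by blast
 qed
qed

text \<open>A strip from the left side of the unit square to the hole \<open>Mc 0\<close>, including
  that hole. It contains no centre of another large hole (\<open>cen_W0\<close>), so the logarithm
  about such a centre has a branch on it.\<close>

definition W0 :: "plane set" where
 "W0 = {0..(real p + 1) / real n} \<times> {real p / real n..(real p + 1) / real n}"

lemma compact_W0: "compact W0" and convex_W0: "convex W0"
 unfolding W0_def by (auto intro: compact_Times convex_Times)

lemma cen_W0: assumes "b mod 4 \<noteq> 0" shows "cen b \<notin> W0"
proof -
 have pq: "real p + 1 < real q + 1 / 2" using q_facts(2) by linarith
 have "ma b = q \<or> mb b = q" using assms by (cases b rule: mod4) (auto simp: ma_def mb_def)
 moreover have "(real p + 1) / real n < (real q + 1 / 2) / real n" using pq by (intro divide_strict_right_mono) auto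
 ultimately show ?thesis unfolding W0_def cen_def by auto
qed

lemma sq_W0: assumes "a \<le> p" shows "sq 1 a p \<subseteq> W0"
proof -
 have "(real a + 1) / real n \<le> (real p + 1) / real n" using assms by (intro divide_right_mono) auto
 moreover have "0 \<le> real a / real n" by simp
 ultimately show ?thesis unfolding sq_times W0_def by (intro Sigma_mono) (auto simp: atLeastatMost_subset_iff)
qed

lemma Mc0_W0: "Mc 0 \<subseteq> W0"
 using sq_W0[of p] circ_sub_sq[of 1 p p] by (auto simp: Mc_def ma_def mb_def)

lemma norm_toC_cen: assumes "z \<in> F" shows "1 / (2 * real n) \<le> norm (toC z - toC (cen b))"
 using cen_far[OF F_not_osq[OF assms]] by (metis dist_norm dist_toC)

text \<open>For small increments this converts a bound on a map into a bound on its logarithm, with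
  a constant independent of the map.\<close>

lemma exp_lower:
 "\<exists>\<eta>>0. \<forall>d::complex. norm d < \<eta> \<longrightarrow> norm d \<le> 2 * norm (exp d - 1)"
proof -
 have "isCont exp (0::complex)" by simp
 then obtain s where s: "s > 0" "\<And>d::complex. dist d 0 < s ==> dist (exp d) (exp 0) < 1 / 2"
  unfolding continuous_at_eps_delta by (metis half_gt_zero zero_less_one)
 have "norm d \<le> 2 * norm (exp d - 1)" if d: "norm d < min s 1" for d :: complex
 proof -
  have e: "norm (exp d - 1) < 1 / 2" using s(2)[of d] d by (simp add: dist_norm)
  have "1 / 2 \<le> Re (exp d)" using e complex_Re_le_cmod[of "1 - exp d"] by (simp add: norm_minus_commute)
  hence "norm (Ln (exp d) - Ln 1) \<le> norm (exp d - 1) / (1 / 2)" by (intro Ln_lip) auto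
  moreover have "\<bar>Im d\<bar> < pi" using d abs_Im_le_cmod[of d] pi_gt3 by linarith
  hence "Ln (exp d) = d" by (intro Ln_exp) auto
  ultimately show ?thesis by simp
 qed
 thus ?thesis using s(1) by (intro exI[of _ "min s 1"]) auto
qed

lemma linear_ofC: "linear ofC" by (rule linearI) (auto simp: ofC_def)

text \<open>The bound is independent of \<open>h\<close>, so that it applies uniformly to the iterates of a map.\<close>

lemma strip_est:
 assumes h: "GF h" "h ` Out = Out" "h ` Mc b = Mc b" 
  and c: "continuous_on W0 \<phi>" and e: "\<And>z. z \<in> F ==> z \<in> W0 ==> exp (\<phi> z) = toC (h z) - toC (cen b)"
 shows "\<exists>y\<in>{real p / real n..(real p + 1) / real n}.
  \<bar>Im (\<phi> (0, y)) - Im (\<phi> (real p / real n, y))\<bar> \<le> sqrt (real p) * sqrt (16 * (real n)\<^sup>2 + 1)"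
proof -
 let ?c = "toC (cen b)"
 \<comment> \<open>The value 0 off the strip is a default making u bounded on all of
   \<open>F\<close>; the estimate itself involves only elements inside the strip.\<close>
 define u where "u z = (if z \<in> W0 then Im (\<phi> z) else 0)" for z
 have cI: "continuous_on W0 (\<lambda>z. Im (\<phi> z))" by (intro continuous_intros c)
 have bd: "bounded (u ` F)"
 proof -
  obtain B where B: "\<forall>z\<in>W0. norm (Im (\<phi> z)) \<le> B"
   using compact_imp_bounded[OF compact_continuous_image[OF cI compact_W0]] by (auto simp: bounded_iff)
  show ?thesis by (rule boundedI[of _ "\<bar>B\<bar>"]) (use B in \<open>force simp: u_def\<close>)
 qed
 \<comment> \<open>The image hole differs from \<open>Mc b\<close>, so its closed square stays at
   distance at least 1 / (2 n) from \<open>cen b\<close> and \<open>log_osc\<close> applies,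
   whatever h is.\<close>
 have hole_osc: "osc u C \<le> 4 * real n * sz (h ` C)" if C: "C \<in> Holes" "C \<subseteq> W0" "C \<noteq> Mc b" for C
 proof -
  have CP: "C \<in> Per" using C Holes_Per by blast
  have CF: "C \<subseteq> F" by (rule Per_F[OF CP])
  have hC: "h ` C \<in> Holes" by (rule GF_Holes[OF h(1,2) C(1)])
  obtain k' i' j' where im: "h ` C = circ k' i' j'" "hole k' i' j'" using hC unfolding Holes_def by blast
  have ne: "(k', i', j') \<noteq> (1, ma b, mb b)"
  proof
   assume "(k', i', j') = (1, ma b, mb b)"
   hence "h ` C = h ` Mc b" using im(1) h(3) by (simp add: Mc_def)
   thus False using GF_inj_im[OF h(1) CF Per_F[OF Mc_Per]] C(3) by blast
  qed
  define Y where "Y = ofC -` sq k' i' j'"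
  have Y: "convex Y" "closed Y" unfolding Y_def
   by (rule convex_linear_vimage[OF linear_ofC convex_sq], rule closed_vimage[OF closed_sq cont_ofC])
  have Yc: "1 / (2 * real n) \<le> norm (y - ?c)" if "y \<in> Y" for y
  proof -
   have "ofC y \<notin> osq 1 (ma b) (mb b)"
    using sq_holes_disj[OF im(2) Mc_hole ne] that osq_sub_sq unfolding Y_def by blast
   from cen_far[OF this] have "1 / (2 * real n) \<le> dist (toC (ofC y)) ?c" by (simp only: dist_toC)
   thus ?thesis by (simp add: dist_norm)
  qed
  have ch: "continuous_on C (\<lambda>z. toC (h z))"
   by (rule continuous_on_compose2[OF cont_toC[of UNIV] continuous_on_subset[OF GF_cont[OF h(1)] CF]]) simp
  have hY: "(\<lambda>z. toC (h z)) ` C \<subseteq> Y"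
  proof
   fix y assume "y \<in> (\<lambda>z. toC (h z)) ` C"
   then obtain z where z: "z \<in> C" "y = toC (h z)" by blast
   hence "h z \<in> circ k' i' j'" using im(1) by blast
   thus "y \<in> Y" unfolding Y_def z(2) using circ_sub_sq by auto
  qed
  show ?thesis
  proof (rule osc_le)
   fix x y assume xy: "x \<in> C" "y \<in> C"
   have "norm (\<phi> x - \<phi> y) \<le> norm (toC (h x) - toC (h y)) / (1 / (2 * real n))"
    by (rule log_osc[where cc = ?c, OF Per_connected[OF CP] ch continuous_on_subset[OF c C(2)] _ Y hY _ Yc xy])
     (use e C(2) CF in auto)
   also have "norm (toC (h x) - toC (h y)) = dist (h x) (h y)" by (metis dist_norm dist_toC)
   also have "dist (h x) (h y) / (1 / (2 * real n)) \<le> 2 * sz (h ` C) / (1 / (2 * real n))"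
    using Per_dist[of "h ` C" "h x" "h y"] hC Holes_Per xy by (intro divide_right_mono) auto
   finally have "norm (\<phi> x - \<phi> y) \<le> 4 * real n * sz (h ` C)" by (simp add: mult_ac)
   moreover have "\<bar>Im (\<phi> x) - Im (\<phi> y)\<bar> \<le> norm (\<phi> x - \<phi> y)" using abs_Im_le_cmod[of "\<phi> x - \<phi> y"] by simp
   ultimately show "dist (u x) (u y) \<le> 4 * real n * sz (h ` C)" using xy C(2) by (auto simp: u_def dist_real_def)
  qed (use sz_pos[of "h ` C"] hC Holes_Per in auto)
 qed
 obtain \<eta> where \<eta>: "\<eta> > 0" "\<And>d::complex. norm d < \<eta> ==> norm d \<le> 2 * norm (exp d - 1)" using exp_lower by blast
 obtain \<delta> where \<delta>: "\<delta> > 0" "\<And>x y. x \<in> W0 ==> y \<in> W0 ==> dist x y < \<delta> ==> dist (\<phi> x) (\<phi> y) < \<eta>"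
  using compact_uniformly_continuous[OF c compact_W0] \<eta>(1) unfolding uniformly_continuous_on_def by metis
 \<comment> \<open>The image of a cell is not confined to a convex set avoiding
   \<open>cen b\<close>. Instead the increments of \<phi> on small cells are small by uniform
   continuity, where the exponential can be inverted by \<open>exp_lower\<close>.\<close>
 have cell_osc: "osc u (cell k x) \<le> 4 * real n * osc h (cell k x)" if k: "2 / rn k < \<delta>" and W: "cell k x \<subseteq> W0" for k x
 proof -
  have bh: "bounded (h ` cell k x)" using GF_bounded[OF h(1)] by (rule bounded_subset) (auto simp: cell_def)
  show ?thesis
  proof (rule osc_le)
   fix z z' assume z: "z \<in> cell k x" "z' \<in> cell k x"
   have zF: "z \<in> F" "z' \<in> F" "z \<in> W0" "z' \<in> W0" using z cell_F[of k x] W by blast+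
   have "dist z z' \<le> 2 / rn k" by (rule sq_dist) (use z in \<open>auto simp: cell_def\<close>)
   hence "norm (\<phi> z - \<phi> z') < \<eta>" using \<delta>(2)[OF zF(3,4)] k by (simp add: dist_norm)
   hence 1: "norm (\<phi> z - \<phi> z') \<le> 2 * norm (exp (\<phi> z - \<phi> z') - 1)" by (rule \<eta>(2))
   have "norm (toC (h z) - toC (h z')) = norm (exp (\<phi> z) - exp (\<phi> z'))" using e zF by simp
   also have "exp (\<phi> z) - exp (\<phi> z') = exp (\<phi> z') * (exp (\<phi> z - \<phi> z') - 1)" by (simp add: exp_diff field_simps)
   also have "norm ... = norm (toC (h z') - ?c) * norm (exp (\<phi> z - \<phi> z') - 1)" using e zF by (simp add: norm_mult)
   also have "... \<ge> 1 / (2 * real n) * norm (exp (\<phi> z - \<phi> z') - 1)"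
    using norm_toC_cen[OF GF_mem[OF h(1) zF(2)]] by (intro mult_right_mono) auto
   finally have 2: "1 / (2 * real n) * norm (exp (\<phi> z - \<phi> z') - 1) \<le> dist (h z) (h z')" by (metis dist_norm dist_toC)
   hence "norm (exp (\<phi> z - \<phi> z') - 1) \<le> 2 * real n * dist (h z) (h z')" by (simp add: field_simps)
   also have "... \<le> 2 * real n * osc h (cell k x)" using osc_ge[OF bh z] by (intro mult_left_mono) auto
   finally have "norm (\<phi> z - \<phi> z') \<le> 4 * real n * osc h (cell k x)" using 1 by linarith
   moreover have "\<bar>Im (\<phi> z) - Im (\<phi> z')\<bar> \<le> norm (\<phi> z - \<phi> z')" using abs_Im_le_cmod[of "\<phi> z - \<phi> z'"] by simp
   ultimately show "dist (u z) (u z') \<le> 4 * real n * osc h (cell k x)" using zF by (auto simp: u_def dist_real_def)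
  qed (use osc_nonneg[OF bh] in auto)
 qed
 have lim: "(\<lambda>l. 2 / rn l) \<longlonglongrightarrow> 0"
  using LIMSEQ_inverse_realpow_zero[of "real n"] n5 tendsto_mult_right_zero[of "\<lambda>l. inverse (rn l)" sequentially 2]
  by (simp add: divide_inverse)
 \<comment> \<open>The generation k depends on h, but the resulting bound does not: the cells
   contribute less than 1, the second summand under the root in the final constant.\<close>
 have "(\<lambda>k. 16 * (real n)\<^sup>2 * tail k h) \<longlonglongrightarrow> 16 * (real n)\<^sup>2 * 0" by (intro tendsto_intros GF_tail h(1))
 hence "\<forall>\<^sub>F k in sequentially. 16 * (real n)\<^sup>2 * tail k h < 1" by (rule order_tendstoD(2)) simp
 moreover have "\<forall>\<^sub>F k in sequentially. 2 / rn k < \<delta>" by (rule order_tendstoD(2)[OF lim \<delta>(1)])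
 moreover have "\<forall>\<^sub>F k in sequentially. k \<ge> (1::nat)" by (rule eventually_ge_at_top)
 ultimately have "\<forall>\<^sub>F k in sequentially. 16 * (real n)\<^sup>2 * tail k h < 1 \<and> 2 / rn k < \<delta> \<and> 1 \<le> k" by eventually_elim simp
 then obtain k where k: "16 * (real n)\<^sup>2 * tail k h < 1" "2 / rn k < \<delta>" "1 \<le> k"
  by (metis (mono_tags, lifting) eventually_sequentially order_refl)
 define M where "M = n ^ (k - 1)"
 have M: "M > 0" by (simp add: M_def)
 have NM: "n ^ k = n * M" using k(3) by (simp add: M_def power_eq_if)
 define J where "J = {p * M..<(p + 1) * M}"
 define Z where "Z = {0..<p * M} \<times> J"
 have pn': "(p + 1) * M \<le> n * M" using q_facts by (intro mult_le_mono1) simp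
 have ZN: "Z \<subseteq> ix k \<times> ix k" "J \<subseteq> ix k" using pn' unfolding NM by (auto simp: Z_def J_def)
 have cJ: "card J = M" "finite J" "J \<noteq> {}" "card Z = p * M * M" using M by (auto simp: J_def Z_def card_cartesian_product)
 have Zlab: "1 \<le> fst (lab k i j)" "elt (lab k i j) \<subseteq> W0" if ij: "(i, j) \<in> Z" for i j
 proof -
  have ijN: "i < n ^ k" "j < n ^ k" using ij ZN by auto
  have jd: "j div M = p" using ij div_eqI[of p M j] by (auto simp: Z_def J_def)
  have "i < p * M" using ij by (simp add: Z_def)
  hence id: "i div M < p" by (simp add: less_mult_imp_div_less)
  have "i div M \<noteq> p" "i div M \<noteq> q" "i div M < n" using id q_facts by linarith+
  hence "rem 1 (i div M) (j div M)" unfolding jd using q_facts by (simp add: bad_def)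
  thus f: "1 \<le> fst (lab k i j)" using lab_ge[OF k(3) ijN] by (simp add: M_def)
  show "elt (lab k i j) \<subseteq> W0" using elt_sub_sq[OF ijN f] sq_W0[of "i div M"] id unfolding M_def[symmetric] jd by auto
 qed
 have pM: "p * M < n ^ k" using q_facts M unfolding NM by simp
 have pM0: "p * M > 0" using M p1 by simp
 have labp: "lab k (p * M) j = (1, p, p)" if "j \<in> J" for j
 proof (rule lab_hole[OF _ k(3)])
  show "hole 1 p p" using Mc_hole[of 0] by (simp add: ma_def mb_def)
  show "p * M div n ^ (k - 1) = p" using M by (simp add: M_def)
  show "j div n ^ (k - 1) = p" using that div_eqI[of p M j] by (auto simp: J_def M_def)
 qed
 have sep: "lab k (p * M - 1) j \<noteq> lab k (p * M) j" if j: "j \<in> J" for j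
  by (rule lab_sep[of 1]) (use k(3) pM pM0 j ZN labp[OF j] in \<open>auto simp: M_def\<close>)
 have S: "sat k j 0 (p * M)" if j: "j \<in> J" for j using sep[OF j] pM by (simp add: sat_def)
 have endp: "(real p / real n, gr k j) \<in> elt (lab k (p * M - 1) j)" if j: "j \<in> J" for j
 proof -
  have pp: "p * M - 1 + 1 = p * M" using pM0 by simp
  have "(gr k (p * M - 1 + 1), gr k j) \<in> elt (lab k (p * M - 1) j)"
   by (rule right_pt) (use pM pM0 j ZN sep[OF j] pp in auto)
  moreover have "gr k (p * M - 1 + 1) = real p / real n"
  proof -
   have "rn k = real n * real M" using NM by (metis of_nat_mult of_nat_power)
   thus ?thesis using M unfolding pp by simp
  qed
  ultimately show ?thesis by simp
 qed
 define rs where "rs j = (\<Sum>i\<in>{0..<p * M}. cost k u i j)" for j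
 have row: "\<bar>u (0, gr k j) - u (real p / real n, gr k j)\<bar> \<le> rs j" if j: "j \<in> J" for j
  unfolding rs_def by (rule row_le[OF bd _ S[OF j] _ _ row_ends(1) endp[OF j]]) (use j ZN pM0 in auto)
 have E: "(\<Sum>(i, j)\<in>Z. (cost k u i j)\<^sup>2) \<le> 16 * (real n)\<^sup>2 + 1"
 proof -
  let ?H = "HZ k Z"
  have fH: "finite ?H" "?H \<subseteq> Holes" using finite_HZ HZ_Holes card_lattice(1)[OF ZN(1)] by auto
  have HW: "C \<subseteq> W0" if C: "C \<in> ?H" for C
  proof -
   obtain m a b z where C: "C = circ m a b" "hole m a b" "z \<in> Z" "lab k (fst z) (snd z) = (m, a, b)"
    using C unfolding HZ_def by auto
   have "elt (m, a, b) \<subseteq> W0" using Zlab(2)[of "fst z" "snd z"] C by simp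
   thus ?thesis unfolding elt_hole[OF C(2)] C(1) .
  qed
  have nb: "C \<noteq> Mc b" if C: "C \<in> ?H" for C
  proof
   assume "C = Mc b"
   then obtain m a b' z where C: "Mc b = circ m a b'" "hole m a b'" "z \<in> Z" "lab k (fst z) (snd z) = (m, a, b')"
    using C unfolding HZ_def by auto
   have zN: "fst z < n ^ k" "snd z < n ^ k" using C(3) ZN by auto
   have "m = 1" "a = ma b" using C(1) circ_inj unfolding Mc_def by blast+
   moreover have "a = fst z div n ^ (k - m)" using lab_props[OF zN C(4)] by blast
   ultimately have "ma b = fst z div M" by (simp add: M_def)
   moreover have "fst z div M < p" using C(3) by (auto simp: Z_def less_mult_imp_div_less)
   ultimately show False using ma_q(4)[of b] q_facts by linarith
  qed
  have "(\<Sum>C\<in>?H. (osc u C)\<^sup>2) \<le> (\<Sum>C\<in>?H. (4 * real n * sz (h ` C))\<^sup>2)"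
  proof (rule sum_mono)
   fix C assume C: "C \<in> ?H"
   have CH: "C \<in> Holes" using C fH(2) by blast
   have "bounded (u ` C)" using bd by (rule bounded_subset) (use CH Holes_Per Per_F in blast)
   thus "(osc u C)\<^sup>2 \<le> (4 * real n * sz (h ` C))\<^sup>2"
    using hole_osc[OF CH HW[OF C] nb[OF C]] by (intro power_mono osc_nonneg)
  qed
  also have "... = 16 * (real n)\<^sup>2 * (\<Sum>C\<in>?H. (sz (h ` C))\<^sup>2)" by (simp add: power_mult_distrib sum_distrib_left)
  also have "... \<le> 16 * (real n)\<^sup>2 * 1" by (intro mult_left_mono GF_hole_sum[OF h(1,2) fH]) simp
  finally have 1: "(\<Sum>C\<in>?H. (osc u C)\<^sup>2) \<le> 16 * (real n)\<^sup>2" by simp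
  have "(\<Sum>x\<in>Rk k \<inter> Z. (osc u (cell k x))\<^sup>2) \<le> (\<Sum>x\<in>Rk k \<inter> Z. (4 * real n * osc h (cell k x))\<^sup>2)"
  proof (rule sum_mono)
   fix x assume x: "x \<in> Rk k \<inter> Z"
   obtain i j where ij: "x = (i, j)" by (cases x)
   have "lab k i j = (k, i, j)" using x ij by (intro lab_rem) (simp add: Rk_def)
   hence "cell k x \<subseteq> W0" using Zlab(2)[of i j] x ij elt_rem[of x k] by simp
   moreover have "bounded (u ` cell k x)" using bd by (rule bounded_subset) (use cell_F in blast)
   ultimately show "(osc u (cell k x))\<^sup>2 \<le> (4 * real n * osc h (cell k x))\<^sup>2"
    using cell_osc[OF k(2)] by (intro power_mono osc_nonneg) auto
  qed
  also have "... = 16 * (real n)\<^sup>2 * (\<Sum>x\<in>Rk k \<inter> Z. (osc h (cell k x))\<^sup>2)" by (simp add: power_mult_distrib sum_distrib_left)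
  also have "... \<le> 16 * (real n)\<^sup>2 * tail k h" by (intro mult_left_mono tail_ge) auto
  finally show ?thesis using energy[OF ZN(1), of u] 1 k(1) by linarith
 qed
 have "(\<Sum>j\<in>J. rs j) = (\<Sum>(i, j)\<in>Z. cost k u i j)" unfolding rs_def Z_def by (rule sum_prod_le[OF cJ(2) refl])
 also have "... \<le> real (card J) * (sqrt (real p) * sqrt (16 * (real n)\<^sup>2 + 1))"
 proof (rule power2_le_imp_le)
  have "(\<Sum>(i, j)\<in>Z. cost k u i j)\<^sup>2 \<le> real (card Z) * (\<Sum>z\<in>Z. (case z of (i, j) => cost k u i j)\<^sup>2)" by (rule sum_cs)
  also have "(\<Sum>z\<in>Z. (case z of (i, j) => cost k u i j)\<^sup>2) = (\<Sum>(i, j)\<in>Z. (cost k u i j)\<^sup>2)" by (simp add: case_prod_unfold)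
  also have "real (card Z) * ... \<le> real (card Z) * (16 * (real n)\<^sup>2 + 1)" by (intro mult_left_mono E) simp
  also have "... = (real (card J) * (sqrt (real p) * sqrt (16 * (real n)\<^sup>2 + 1)))\<^sup>2"
   using cJ by (simp add: power_mult_distrib power2_eq_square[of "real M"])
  finally show "(\<Sum>(i, j)\<in>Z. cost k u i j)\<^sup>2 \<le> (real (card J) * (sqrt (real p) * sqrt (16 * (real n)\<^sup>2 + 1)))\<^sup>2" .
 qed simp
 finally obtain j where j: "j \<in> J" "rs j \<le> sqrt (real p) * sqrt (16 * (real n)\<^sup>2 + 1)"
  using exists_le_mean[OF cJ(2,3)] by blast
 define y where "y = gr k j"
 have rNM: "rn k = real n * real M" using NM by (metis of_nat_mult of_nat_power)
 have jr: "real (p * M) \<le> real j" "real j \<le> real ((p + 1) * M)" using j(1) by (auto simp only: J_def of_nat_le_iff atLeastLessThan_iff less_imp_le)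
 have y: "y \<in> {real p / real n..(real p + 1) / real n}"
 proof -
  have "real p / real n = gr k (p * M)" "(real p + 1) / real n = gr k ((p + 1) * M)"
   using M unfolding rNM of_nat_mult by (simp_all add: add.commute)
  thus ?thesis unfolding y_def using jr by (simp add: divide_right_mono)
 qed
 have "(0, y) \<in> W0" "(real p / real n, y) \<in> W0" using y by (auto simp: W0_def divide_right_mono)
 hence "\<bar>Im (\<phi> (0, y)) - Im (\<phi> (real p / real n, y))\<bar> \<le> rs j" using row[OF j(1)] by (simp add: u_def y_def)
 thus ?thesis using y j(2) by (intro bexI[of _ y]) linarith
qed

lemma cen_unit: "0 < fst (cen b)" "fst (cen b) < 1" "0 < snd (cen b)" "snd (cen b) < 1"
proof -
 have "cen b \<in> {0<..<1} \<times> {0<..<1}" using hole_sq_unit[OF Mc_hole] osq_sub_sq cen_osq by blast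
 thus "0 < fst (cen b)" "fst (cen b) < 1" "0 < snd (cen b)" "snd (cen b) < 1" by (auto simp: mem_Times_iff)
qed

text \<open>Compares the angle about \<open>cen b\<close> with the angle about the centre of the
  square: both points lie inside, so the two angles differ by the argument of a ratio that avoids
  the negative axis.\<close>

lemma boundary_log:
 "\<exists>\<zeta>. continuous_on UNIV \<zeta> \<and> (\<forall>a. exp (\<zeta> a) = toC (om a) - toC (cen b)) \<and>
   (\<forall>a (m::int). \<zeta> (a + 2 * pi * of_int m) = \<zeta> a + 2 * pi * of_int m * \<i>) \<and> (\<forall>a. \<bar>Im (\<zeta> a) - a\<bar> \<le> pi)"
proof -
 define A where "A a = 1 / (2 * max \<bar>cos a\<bar> \<bar>sin a\<bar>)" for a :: real
 define \<rho> where "\<rho> a = (toC (om a) - toC (cen b)) / (toC (om a) - c0)" for a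
 define \<zeta> where "\<zeta> a = of_real (ln (A a)) + \<i> * of_real a + Ln (\<rho> a)" for a
 have A: "A a > 0" for a using om_max_pos[of a] by (simp add: A_def)
 have pol: "toC (om a) - c0 = of_real (A a) * cis a" for a unfolding A_def by (rule om_polar)
 have nz: "toC (om a) - c0 \<noteq> 0" for a unfolding pol using A[of a] by simp
 have cA: "continuous_on UNIV A" unfolding A_def
  by (intro continuous_intros) (use om_max_pos in \<open>auto simp: less_le\<close>)
 have co: "continuous_on UNIV (\<lambda>a. toC (om a))" by (rule continuous_on_compose2[OF cont_toC[of UNIV] cont_om]) simp
 have c\<rho>: "continuous_on UNIV \<rho>" unfolding \<rho>_def by (intro continuous_intros co) (use nz in auto)
 \<comment> \<open>A nonpositive ratio would put \<open>om a\<close> on the segment between the two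
   centres, in the open square.\<close>
 have rn: "\<rho> a \<notin> \<real>\<^sub>\<le>\<^sub>0" for a
 proof
  assume "\<rho> a \<in> \<real>\<^sub>\<le>\<^sub>0"
  then obtain t where t: "t \<le> 0" "\<rho> a = of_real t" by (auto elim: nonpos_Reals_cases)
  hence "toC (om a) - toC (cen b) = of_real t * (toC (om a) - c0)" using nz[of a] by (simp add: \<rho>_def field_simps)
  hence x: "fst (om a) - fst (cen b) = t * (fst (om a) - 1 / 2)" "snd (om a) - snd (cen b) = t * (snd (om a) - 1 / 2)"
   by (simp_all add: toC_def c0_def complex_eq_iff)
  have 1: "0 < X \<and> X < 1" if h: "X - C = t * (X - 1 / 2)" "0 < C" "C < 1" for X C :: real
  proof -
   have "X * (1 - t) = C + (- t) * (1 / 2)" using h(1) by (simp add: algebra_simps)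
   moreover have "0 < C + (- t) * (1 / 2)" "C + (- t) * (1 / 2) < 1 * (1 - t)" using h t(1) by auto
   ultimately have "0 < X * (1 - t)" "X * (1 - t) < 1 * (1 - t)" by auto
   thus ?thesis using t(1) by (simp add: zero_less_mult_iff)
  qed
  have "0 < fst (om a) \<and> fst (om a) < 1" "0 < snd (om a) \<and> snd (om a) < 1"
   by (rule 1[OF x(1) cen_unit(1,2)], rule 1[OF x(2) cen_unit(3,4)])
  thus False using om_Out[of a] by (auto simp: Out_iff)
 qed
 hence rz: "\<rho> a \<noteq> 0" for a by (metis nonpos_Reals_zero_I)
 have "continuous_on UNIV \<zeta>" unfolding \<zeta>_def
  by (intro continuous_intros cA c\<rho> rn) (use A in \<open>auto simp: less_le\<close>)
 moreover have "exp (\<zeta> a) = toC (om a) - toC (cen b)" for a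
 proof -
  have "exp (\<zeta> a) = of_real (A a) * cis a * \<rho> a"
   unfolding \<zeta>_def exp_add using A[of a] rz[of a] by (simp add: cis_conv_exp exp_of_real)
  also have "... = toC (om a) - toC (cen b)" unfolding pol[symmetric] \<rho>_def using nz[of a] by simp
  finally show ?thesis .
 qed
 moreover have "\<zeta> (a + 2 * pi * of_int m) = \<zeta> a + 2 * pi * of_int m * \<i>" for a and m :: int
 proof -
  have "om (a + 2 * pi * of_int m) = om a" unfolding om_eq by blast
  moreover have "A (a + 2 * pi * of_int m) = A a"
  proof -
   have "sin (a + 2 * pi * of_int m) = sin a \<and> cos (a + 2 * pi * of_int m) = cos a"
    unfolding sin_cos_eq_iff by (intro exI[of _ m]) (simp add: mult_ac)
   thus ?thesis by (simp add: A_def)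
  qed
  ultimately show ?thesis by (simp add: \<zeta>_def \<rho>_def algebra_simps)
 qed
 moreover have "\<bar>Im (\<zeta> a) - a\<bar> \<le> pi" for a
  using Im_Ln_le_pi[OF rz[of a]] mpi_less_Im_Ln[OF rz[of a]] by (simp add: \<zeta>_def)
 ultimately show ?thesis by blast
qed

text \<open>Otherwise iterating the lift would push the outer circle arbitrarily far in logarithmic
  coordinates about \<open>cen b\<close>, while the branch over \<open>Mc 0\<close> stays bounded.
  The strip between them allows only a bounded change of argument, uniformly over all iterates, so
  \<open>no_drift\<close> applies.\<close>

lemma twist_fixed:
 assumes g: "GF g" "g ` Out = Out" "g ` Mc 0 = Mc 0" "g ` Mc b = Mc b" and b: "b mod 4 \<noteq> 0" and l: "lift g l"
 shows "\<exists>a. \<exists>m::int. l a = a + 2 * pi * of_int m"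
proof (rule ccontr)
 assume nf: "\<not> ?thesis"
 let ?c = "toC (cen b)"
 have gl: "\<And>a. g (om a) = om (l a)" using l by (simp add: lift_def)
 have OF': "z \<in> F" if "z \<in> Out" for z using that Per_F[OF Out_Per] by blast
 have MF: "z \<in> F" if "z \<in> Mc 0" for z using that Per_F[OF Mc_Per] by blast
 obtain \<Lambda>0 where \<Lambda>0: "continuous_on UNIV \<Lambda>0" "\<And>\<zeta> z. z \<in> F ==> exp \<zeta> = toC z - ?c ==> exp (\<Lambda>0 \<zeta>) = toC (g z) - ?c"
  using log_lift[OF g(1,2,4)] by metis
 have c1: "continuous_on W0 (\<lambda>z. toC z - ?c)" by (intro continuous_intros cont_toC)
 have c2: "toC z - ?c \<noteq> 0" if "z \<in> W0" for z
 proof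
  assume "toC z - ?c = 0"
  hence "toC z = ?c" by simp
  hence "z = cen b" by (simp only: toC_inj)
  thus False using that cen_W0[OF b] by blast
 qed
 obtain \<zeta> where \<zeta>: "continuous_on W0 \<zeta>" "\<And>z. z \<in> W0 ==> toC z - ?c = exp (\<zeta> z)"
  using continuous_logarithm_on_contractible[OF c1 convex_imp_contractible[OF convex_W0] c2] by blast
 have gM: "g z \<in> Mc 0" if "z \<in> Mc 0" for z using g(3) that by blast
 obtain m1 :: int where m1: "\<forall>z\<in>Mc 0. \<Lambda>0 (\<zeta> z) = \<zeta> (g z) + 2 * pi * of_int m1 * \<i>"
 proof -
  have "\<exists>m::int. \<forall>z\<in>Mc 0. \<Lambda>0 (\<zeta> z) = \<zeta> (g z) + 2 * pi * of_int m * \<i>"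
  proof (rule log_diff[OF Per_connected[OF Mc_Per]])
   have cz: "continuous_on (Mc 0) \<zeta>" by (rule continuous_on_subset[OF \<zeta>(1) Mc0_W0])
   show "continuous_on (Mc 0) (\<lambda>z. \<Lambda>0 (\<zeta> z))" by (rule continuous_on_compose2[OF \<Lambda>0(1) cz]) simp
   have "continuous_on (Mc 0) g" by (rule continuous_on_subset[OF GF_cont[OF g(1)] Per_F[OF Mc_Per]])
   thus "continuous_on (Mc 0) (\<lambda>z. \<zeta> (g z))" by (rule continuous_on_compose2[OF cz]) (use gM in blast)
   fix z assume z: "z \<in> Mc 0"
   have "exp (\<Lambda>0 (\<zeta> z)) = toC (g z) - ?c" by (rule \<Lambda>0(2)[OF MF[OF z]]) (use \<zeta>(2)[of z] Mc0_W0 z in auto)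
   thus "exp (\<Lambda>0 (\<zeta> z)) = exp (\<zeta> (g z))" using \<zeta>(2)[of "g z"] gM[OF z] Mc0_W0 by auto
  qed
  thus ?thesis using that by blast
 qed
 \<comment> \<open>Subtracting this constant normalises the lift so that over \<open>Mc 0\<close> it
   acts as g itself on the chosen branch \<zeta>. As g preserves \<open>Mc 0\<close>, the
   normalisation survives iteration.\<close>
 define \<Lambda> where "\<Lambda> w = \<Lambda>0 w - 2 * pi * of_int m1 * \<i>" for w
 have \<Lambda>c: "continuous_on UNIV \<Lambda>" unfolding \<Lambda>_def by (intro continuous_intros \<Lambda>0(1))
 have e1: "exp (2 * of_real pi * of_int m1 * \<i>) = 1" unfolding exp_eq_1 by (auto intro: exI[of _ m1])
 have \<Lambda>: "exp (\<Lambda> w) = toC (g z) - ?c" if "z \<in> F" "exp w = toC z - ?c" for w z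
  using \<Lambda>0(2)[OF that] e1 by (simp add: \<Lambda>_def exp_diff)
 have \<Lambda>M: "\<Lambda> (\<zeta> z) = \<zeta> (g z)" if "z \<in> Mc 0" for z using m1 that by (simp add: \<Lambda>_def)
 have \<Lambda>Mk: "(\<Lambda> ^^ k) (\<zeta> z) = \<zeta> ((g ^^ k) z) \<and> (g ^^ k) z \<in> Mc 0" if "z \<in> Mc 0" for z k
  by (induction k) (use that \<Lambda>M gM in auto)
 have \<Lambda>k: "exp ((\<Lambda> ^^ k) w) = toC ((g ^^ k) z) - ?c \<and> (g ^^ k) z \<in> F" if "z \<in> F" "exp w = toC z - ?c" for w z k
  by (induction k) (use that \<Lambda> GF_mem[OF g(1)] in auto)
 have \<Lambda>kc: "continuous_on UNIV (\<Lambda> ^^ k)" for k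
 proof (induction k)
  case (Suc k) thus ?case using continuous_on_compose2[OF \<Lambda>c Suc] by (simp add: comp_def)
 qed (simp add: id_def)
 obtain \<beta> where \<beta>: "continuous_on UNIV \<beta>" "\<And>a. exp (\<beta> a) = toC (om a) - ?c"
  "\<And>a (m::int). \<beta> (a + 2 * pi * of_int m) = \<beta> a + 2 * pi * of_int m * \<i>" "\<And>a. \<bar>Im (\<beta> a) - a\<bar> \<le> pi"
  using boundary_log[of b] by metis
 obtain m2 :: int where m2: "\<forall>a\<in>UNIV. \<Lambda> (\<beta> a) = \<beta> (l a) + 2 * pi * of_int m2 * \<i>"
 proof -
  have "\<exists>m::int. \<forall>a\<in>UNIV. \<Lambda> (\<beta> a) = \<beta> (l a) + 2 * pi * of_int m * \<i>"
  proof (rule log_diff)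
   show "continuous_on UNIV (\<lambda>a. \<Lambda> (\<beta> a))" by (rule continuous_on_compose2[OF \<Lambda>c \<beta>(1)]) simp
   show "continuous_on UNIV (\<lambda>a. \<beta> (l a))" by (rule continuous_on_compose2[OF \<beta>(1)]) (use l in \<open>auto simp: lift_def\<close>)
   fix a
   show "exp (\<Lambda> (\<beta> a)) = exp (\<beta> (l a))" using \<Lambda>[OF OF'[OF om_Out] \<beta>(2)] \<beta>(2) gl by simp
  qed simp
  thus ?thesis using that by blast
 qed
 define l' where "l' a = l a + 2 * pi * of_int m2" for a
 have l': "lift g l'" unfolding l'_def by (rule lift_shift[OF l])
 have \<Lambda>\<beta>: "\<Lambda> (\<beta> a) = \<beta> (l' a)" for a using m2 \<beta>(3) by (simp add: l'_def)
 have \<Lambda>\<beta>k: "(\<Lambda> ^^ k) (\<beta> a) = \<beta> ((l' ^^ k) a)" for k a by (induction k) (simp_all add: \<Lambda>\<beta>)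
 have nf': "l' a \<noteq> a" for a
 proof
  assume "l' a = a"
  hence "l a = a + 2 * pi * of_int (- m2)" by (simp add: l'_def)
  thus False using nf by blast
 qed
 obtain B where B: "\<And>z. z \<in> W0 ==> norm (\<zeta> z) \<le> B"
  using compact_imp_bounded[OF compact_continuous_image[OF \<zeta>(1) compact_W0]] by (auto simp: bounded_iff)
 \<comment> \<open>The three terms bound the logarithm on the strip, the gap between the two angles
   of \<open>boundary_log\<close>, and the change of argument of \<open>strip_est\<close>.\<close>
 define D where "D = B + pi + sqrt (real p) * sqrt (16 * (real n)\<^sup>2 + 1)"
 have "\<exists>a. \<bar>a\<bar> \<le> D \<and> \<bar>(l' ^^ k) a\<bar> \<le> D" for k
 proof -
  define h where "h = g ^^ k"
  have h: "GF h" "h ` Out = Out" "h ` Mc b = Mc b" unfolding h_def by (simp_all add: GF_pow g pow_im)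
  define \<phi> where "\<phi> z = (\<Lambda> ^^ k) (\<zeta> z)" for z
  have "continuous_on W0 \<phi>" unfolding \<phi>_def by (rule continuous_on_compose2[OF \<Lambda>kc \<zeta>(1)]) simp
  moreover have "exp (\<phi> z) = toC (h z) - ?c" if "z \<in> F" "z \<in> W0" for z
   unfolding \<phi>_def h_def using \<Lambda>k[OF that(1)] \<zeta>(2)[OF that(2)] by simp
  ultimately obtain y where y: "y \<in> {real p / real n..(real p + 1) / real n}"
   "\<bar>Im (\<phi> (0, y)) - Im (\<phi> (real p / real n, y))\<bar> \<le> sqrt (real p) * sqrt (16 * (real n)\<^sup>2 + 1)"
   using strip_est[OF h] by blast
  have yM: "(real p / real n, y) \<in> Mc 0"
   using circ_vert(1)[of y p 1 p] y(1) by (simp add: Mc_def ma_def mb_def)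
  have yW: "(0, y) \<in> W0" using y(1) by (auto simp: W0_def)
  have pn1: "(real p + 1) / real n \<le> 1" using q_facts by simp
  have "0 \<le> real p / real n" by simp
  hence "0 \<le> y" "y \<le> 1" using y(1) pn1 unfolding atLeastAtMost_iff by linarith+
  hence yO: "(0, y) \<in> Out" by (simp add: Out_iff)
  obtain a0 where a0: "(0, y) = om a0" using om_surj[OF yO] by blast
  have "exp (\<zeta> (0, y)) = exp (\<beta> a0)" using \<zeta>(2)[OF yW] \<beta>(2) a0 by simp
  then obtain m :: int where m: "\<zeta> (0, y) = \<beta> a0 + 2 * pi * of_int m * \<i>" unfolding exp_eq by (auto simp: mult_ac)
  define a where "a = a0 + 2 * pi * of_int m"
  have za: "\<zeta> (0, y) = \<beta> a" using m \<beta>(3) by (simp add: a_def)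
  have "norm (\<beta> a) \<le> B" using B[OF yW] za by simp
  hence a1: "\<bar>a\<bar> \<le> B + pi" using \<beta>(4)[of a] abs_Im_le_cmod[of "\<beta> a"] by linarith
  have "\<phi> (real p / real n, y) = \<zeta> (h (real p / real n, y))" "h (real p / real n, y) \<in> W0"
   using \<Lambda>Mk[OF yM, of k] Mc0_W0 by (auto simp: \<phi>_def h_def)
  hence "\<bar>Im (\<phi> (real p / real n, y))\<bar> \<le> B" using B abs_Im_le_cmod order_trans by metis
  moreover have "\<phi> (0, y) = \<beta> ((l' ^^ k) a)" using \<Lambda>\<beta>k za by (simp add: \<phi>_def)
  ultimately have "\<bar>Im (\<beta> ((l' ^^ k) a))\<bar> \<le> B + sqrt (real p) * sqrt (16 * (real n)\<^sup>2 + 1)" using y(2) by simp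
  hence "\<bar>(l' ^^ k) a\<bar> \<le> D" using \<beta>(4)[of "(l' ^^ k) a"] unfolding D_def by linarith
  moreover have "\<bar>a\<bar> \<le> D" using a1 unfolding D_def by (simp add: add_increasing2)
  ultimately show ?thesis by blast
 qed
 thus False using no_drift[of l' D] l' nf' unfolding lift_def by blast
qed

text \<open>\<open>twist_fixed\<close> provides a fixed point up to a multiple of 2 pi; shifting the
  lift by that multiple makes it a true fixed point, as \<open>Out_fixed\<close> requires.\<close>

lemma core0:
 assumes g: "GF g" "g ` Out = Out" "g ` Mc 0 = Mc 0" "g ` Mc b = Mc b" and b: "b mod 4 \<noteq> 0" and p: "pos g" and z: "z \<in> F"
 shows "g z = z"
proof -
 obtain l where l: "lift g l" using p unfolding pos_def by blast
 obtain a and m :: int where am: "l a = a + 2 * pi * of_int m" using twist_fixed[OF g b l] by blast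
 have l2: "lift g (\<lambda>a. l a + 2 * pi * of_int (- m))" by (rule lift_shift[OF l])
 have "g z = z" if "z \<in> Out" for z by (rule Out_fixed[OF g(1,2,3) l2 _ that, of a]) (simp add: am)
 thus ?thesis using rigid[OF g(1) _ z] by blast
qed

lemma rots4: "(rot ^^ (4 * t)) z = z"
proof (induction t)
 case (Suc t)
 have "(rot ^^ 4) w = w" for w by (simp add: eval_nat_numeral rot4)
 thus ?case using Suc by (simp only: mult_Suc_right funpow_add comp_apply)
qed simp

text \<open>Conjugation by a rotation moves the first of the two fixed holes to
  \<open>Mc 0\<close>.\<close>

lemma core:
 assumes g: "GF g" "g ` Out = Out" "g ` Mc a = Mc a" "g ` Mc b = Mc b" and ab: "a mod 4 \<noteq> b mod 4" and p: "pos g" and z: "z \<in> F"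
 shows "g z = z"
proof -
 define t where "t = a mod 4"
 define s where "s = 4 - t"
 have t: "t < 4" "s + t = 4" by (auto simp: t_def s_def)
 define h where "h = (rot ^^ s) \<circ> g \<circ> (rot ^^ t)"
 have ts: "(rot ^^ t) ((rot ^^ s) w) = w" "(rot ^^ s) ((rot ^^ t) w) = w" for w
 proof -
  have "(rot ^^ t) ((rot ^^ s) w) = (rot ^^ (t + s)) w" "(rot ^^ s) ((rot ^^ t) w) = (rot ^^ (s + t)) w"
   by (simp_all only: funpow_add comp_apply)
  thus "(rot ^^ t) ((rot ^^ s) w) = w" "(rot ^^ s) ((rot ^^ t) w) = w"
   using rots4[of 1 w] t(2) by (simp_all add: add.commute)
 qed
 have im: "h ` C = (rot ^^ s) ` g ` (rot ^^ t) ` C" for C unfolding h_def by (simp add: image_comp)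
 have h1: "GF h" unfolding h_def by (intro GF_comp GF_rots g(1))
 have h2: "h ` Out = Out" unfolding im rots_Out g(2) ..
 have ma: "Mc (t + 0) = Mc a" unfolding Mc_eq t_def by simp
 have "Mc (s + a) = Mc 0" unfolding Mc_eq
 proof -
  have "(s + a) mod 4 = (s + t) mod 4" unfolding t_def by (simp add: mod_add_right_eq)
  thus "(s + a) mod 4 = 0 mod 4" using t(2) by simp
 qed
 hence h3: "h ` Mc 0 = Mc 0" unfolding im rots_Mc ma g(3) by simp
 have tsb: "t + (s + b) = 4 + b" using t(2) by simp
 have mb: "Mc (t + (s + b)) = Mc b" unfolding tsb Mc_eq by simp
 have h4: "h ` Mc (s + b) = Mc (s + b)" unfolding im rots_Mc mb g(4) ..
 have h5: "(s + b) mod 4 \<noteq> 0"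
 proof
  assume "(s + b) mod 4 = 0"
  hence "(t + (s + b)) mod 4 = t mod 4" by presburger
  hence "b mod 4 = t mod 4" using mb Mc_eq by metis
  thus False using ab by (simp add: t_def)
 qed
 have h6: "pos h" unfolding h_def by (intro pos_comp pos_rots p)
 have "(rot ^^ s) z \<in> F" using GF_mem[OF GF_rots z] .
 from core0[OF h1 h2 h3 h4 h5 h6 this] have "(rot ^^ s) (g z) = (rot ^^ s) z" by (simp add: h_def ts)
 hence "(rot ^^ t) ((rot ^^ s) (g z)) = (rot ^^ t) ((rot ^^ s) z)" by simp
 thus ?thesis by (simp only: ts)
qed

subsection \<open>Capacities\<close>

definition Lip :: "(plane => real) => bool" where
 "Lip u \<longleftrightarrow> (\<exists>L\<ge>0. \<forall>x\<in>F. \<forall>y\<in>F. \<bar>u x - u y\<bar> \<le> L * dist x y)"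

text \<open>Only upper bounds for the energy occur, which avoids infinite sums.\<close>

definition ener :: "(plane => real) => real => bool" where
 "ener u c \<longleftrightarrow> (\<forall>A. finite A \<longrightarrow> A \<subseteq> Per \<longrightarrow> (\<Sum>C\<in>A. (osc u C)\<^sup>2) \<le> c)"

text \<open>Lipschitz functions have finite energy (\<open>Lip_ener\<close>) and vanishing tails
  (\<open>Lip_tail\<close>), so the circles alone control them, and they are stable under the
  truncations used below.\<close>

definition adm :: "plane set => plane set set => (plane => real) => bool" where
 "adm C B u \<longleftrightarrow> Lip u \<and> (\<forall>x\<in>C. u x = 1) \<and> (\<forall>D\<in>B. \<forall>x\<in>D. u x = 0)"

text \<open>A condenser capacity in which the squared oscillations on peripheral circles replace the
  Dirichlet integral.\<close>

definition cap :: "plane set => plane set set => real" where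
 "cap C B = Inf {c. \<exists>u. adm C B u \<and> ener u c}"

lemma LipE: assumes "Lip u" obtains L where "L \<ge> 0" "\<And>x y. x \<in> F ==> y \<in> F ==> \<bar>u x - u y\<bar> \<le> L * dist x y"
 using assms unfolding Lip_def by blast

lemma LipI: "L \<ge> 0 ==> (\<And>x y. x \<in> F ==> y \<in> F ==> \<bar>u x - u y\<bar> \<le> L * dist x y) ==> Lip u"
 unfolding Lip_def by blast

lemma adm_Lip: "adm C B u ==> Lip u" by (simp add: adm_def)

lemma F_dist2: "x \<in> F ==> y \<in> F ==> dist x y \<le> 2"
proof -
 assume "x \<in> F" "y \<in> F"
 hence "x \<in> unit_sq" "y \<in> unit_sq" using F_unit by blast+
 hence "\<bar>fst x - fst y\<bar> \<le> 1" "\<bar>snd x - snd y\<bar> \<le> 1" by (auto simp: mem_Times_iff abs_le_iff)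
 thus "dist x y \<le> 2" using dist_le_coord[of x y] by linarith
qed

lemma Lip_bounded: assumes "Lip u" shows "bounded (u ` F)"
proof -
 obtain L where L: "L \<ge> 0" "\<And>x y. x \<in> F ==> y \<in> F ==> \<bar>u x - u y\<bar> \<le> L * dist x y" by (rule LipE[OF assms]) (rule that)
 obtain x0 where x0: "x0 \<in> F" using circ_rem_F[of 0 0 0] circ_corners(1)[of 0 0 0] by auto
 show ?thesis
 proof (rule boundedI)
  fix y assume "y \<in> u ` F"
  then obtain x where x: "x \<in> F" "y = u x" by blast
  have "L * dist x x0 \<le> L * 2" using F_dist2[OF x(1) x0] L(1) by (intro mult_left_mono)
  hence "\<bar>u x - u x0\<bar> \<le> L * 2" using L(2)[OF x(1) x0] by linarith
  thus "norm y \<le> \<bar>u x0\<bar> + L * 2" using x(2) by (simp add: abs_le_iff) linarith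
 qed
qed

lemma Lip_cont: assumes "Lip u" shows "continuous_on F u"
proof -
 obtain L where L: "L \<ge> 0" "\<And>x y. x \<in> F ==> y \<in> F ==> \<bar>u x - u y\<bar> \<le> L * dist x y" by (rule LipE[OF assms]) (rule that)
 have "L-lipschitz_on F u" unfolding lipschitz_on_def using L by (auto simp: dist_real_def)
 thus ?thesis by (rule lipschitz_on_continuous_on)
qed

lemma Lip_bdC: "Lip u ==> A \<subseteq> F ==> bounded (u ` A)"
 by (rule bounded_subset[OF Lip_bounded image_mono])

lemma Lip_bdP: "Lip u ==> C \<in> Per ==> bounded (u ` C)"
 by (rule Lip_bdC[OF _ Per_F])

lemma Lip_tail: assumes "Lip u" shows "(\<lambda>k. tail k u) \<longlonglongrightarrow> 0"
proof -
 obtain L where L: "L \<ge> 0" "\<And>x y. x \<in> F ==> y \<in> F ==> \<bar>u x - u y\<bar> \<le> L * dist x y" by (rule LipE[OF assms]) (rule that)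
 have "(\<lambda>k. L\<^sup>2 * tail k id) \<longlonglongrightarrow> L\<^sup>2 * 0" by (intro tendsto_intros GF_tail GF_id)
 hence lim: "(\<lambda>k. L\<^sup>2 * tail k id) \<longlonglongrightarrow> 0" by simp
 have "tail k u \<le> L\<^sup>2 * tail k id" for k
  using tail_comp_lip[OF GF_id L(1), of u k] L(2) by (simp add: dist_real_def)
 thus ?thesis by (intro tendsto_sandwich[OF _ _ tendsto_const lim]) (simp_all add: tail_nonneg)
qed

lemma Lip_osc:
 assumes "\<And>x y. x \<in> F ==> y \<in> F ==> \<bar>u x - u y\<bar> \<le> L * dist x y" "L \<ge> 0" "C \<in> Per"
 shows "osc u C \<le> L * (2 * sz C)"
proof (rule osc_le)
 fix x y assume xy: "x \<in> C" "y \<in> C"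
 hence "\<bar>u x - u y\<bar> \<le> L * dist x y" using assms(1) Per_F[OF assms(3)] by blast
 also have "... \<le> L * (2 * sz C)" using Per_dist[OF assms(3) xy] assms(2) by (intro mult_left_mono)
 finally show "dist (u x) (u y) \<le> L * (2 * sz C)" by (simp add: dist_real_def)
qed (use assms sz_pos[OF assms(3)] in auto)

lemma Lip_ener: assumes "Lip u" shows "\<exists>c. ener u c"
proof -
 obtain L where L: "L \<ge> 0" "\<And>x y. x \<in> F ==> y \<in> F ==> \<bar>u x - u y\<bar> \<le> L * dist x y" by (rule LipE[OF assms]) (rule that)
 have "(\<Sum>C\<in>A. (osc u C)\<^sup>2) \<le> (2 * L)\<^sup>2 * 2" if A: "finite A" "A \<subseteq> Per" for A
 proof -
  have "(\<Sum>C\<in>A. (osc u C)\<^sup>2) \<le> (\<Sum>C\<in>A. (L * (2 * sz C))\<^sup>2)"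
  proof (intro sum_mono power_mono)
   fix C assume "C \<in> A"
   hence C: "C \<in> Per" using A by blast
   show "osc u C \<le> L * (2 * sz C)" by (rule Lip_osc[OF L(2,1) C])
   show "0 \<le> osc u C" by (rule osc_nonneg[OF Lip_bdP[OF assms C]])
  qed
  also have "... = (2 * L)\<^sup>2 * (\<Sum>C\<in>A. (sz C)\<^sup>2)" by (simp add: power_mult_distrib sum_distrib_left mult_ac)
  also have "... \<le> (2 * L)\<^sup>2 * 2" using Per_sum_le2[OF A] by (intro mult_left_mono) auto
  finally show ?thesis .
 qed
 hence "ener u ((2 * L)\<^sup>2 * 2)" by (simp add: ener_def)
 thus ?thesis by blast
qed

lemma enerD: "ener u c ==> finite A ==> A \<subseteq> Per ==> (\<Sum>C\<in>A. (osc u C)\<^sup>2) \<le> c"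
 by (simp add: ener_def)

lemma ener_pos: "ener u c ==> 0 \<le> c"
 unfolding ener_def by (drule spec[of _ "{}"]) simp

lemma ener_mono: "ener u c ==> c \<le> d ==> ener u d"
 unfolding ener_def by (meson order_trans)

lemma ener_comp: assumes f: "GF f" and u: "ener u c" shows "ener (u \<circ> f) c"
 unfolding ener_def
proof (intro allI impI)
 fix A assume A: "finite A" "A \<subseteq> Per"
 have inj: "inj_on ((`) f) A" by (rule inj_on_subset[OF bij_betw_imp_inj_on[OF GF_Per_bij[OF f]] A(2)])
 have "(\<Sum>C\<in>A. (osc (u \<circ> f) C)\<^sup>2) = (\<Sum>D\<in>(`) f ` A. (osc u D)\<^sup>2)" by (simp add: sum.reindex[OF inj] osc_comp)
 also have "... \<le> c"
 proof (rule enerD[OF u finite_imageI[OF A(1)]])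
  show "(`) f ` A \<subseteq> Per" using GF_Per[OF f] A(2) by blast
 qed
 finally show "(\<Sum>C\<in>A. (osc (u \<circ> f) C)\<^sup>2) \<le> c" .
qed

lemma Per_disj: assumes "C \<in> Per" "D \<in> Per" "C \<noteq> D" shows "C \<inter> D = {}"
proof -
 have hh: "C \<inter> D = {}" if CD: "C \<in> Holes" "D \<in> Holes" "C \<noteq> D" for C D
 proof -
  obtain k i j l a b where C: "C = circ k i j" "hole k i j" "D = circ l a b" "hole l a b" using CD unfolding Holes_def by blast
  hence "(k, i, j) \<noteq> (l, a, b)" using CD(3) by auto
  thus ?thesis using sq_holes_disj[OF C(2,4)] circ_sub_sq C(1,3) by blast
 qed
 have oh: "Out \<inter> C = {}" if CH: "C \<in> Holes" for C
 proof -
  obtain k i j where C: "C = circ k i j" "hole k i j" using CH unfolding Holes_def by blast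
  have "C \<subseteq> {0<..<1} \<times> {0<..<1}" using hole_sq_unit[OF C(2)] circ_sub_sq C(1) by blast
  thus ?thesis by (auto simp: Out_iff)
 qed
 show ?thesis using assms hh oh unfolding Per_def by blast
qed

lemma osc_eqI: assumes "\<And>x y. dist (v x) (v y) = dist (u x) (u y)" shows "osc v A = osc u A"
proof -
 have *: "(\<lambda>(x, y). dist x y) ` (w ` A \<times> w ` A) = (\<lambda>(x, y). dist (w x) (w y)) ` (A \<times> A)" for w :: "'a => 'd::metric_space" by force
 have "(\<lambda>(x, y). dist (v x) (v y)) ` (A \<times> A) = (\<lambda>(x, y). dist (u x) (u y)) ` (A \<times> A)" using assms by simp
 thus ?thesis unfolding osc_def diameter_def * by simp
qed

text \<open>Finitely many circles disjoint from the compact set P keep a positive distance d from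
  it; the function decreases linearly with the distance to P and vanishes from d on.\<close>

lemma cutoff_function:
 assumes P: "P \<subseteq> F" "closed P" "P \<noteq> {}" and B: "finite B" "B \<subseteq> Per" "\<And>D. D \<in> B ==> D \<inter> P = {}"
 shows "\<exists>\<eta>. Lip \<eta> \<and> (\<forall>x. \<eta> x \<le> 1) \<and> (\<forall>x\<in>P. \<eta> x = 1) \<and> (\<forall>D\<in>B. \<forall>x\<in>D. \<eta> x = 0)"
proof -
 have cP: "compact P" using P(1,2) compact_F by (metis compact_Int_closed inf.absorb_iff2)
 have cB: "closed (\<Union>B)" by (rule closed_Union[OF B(1)]) (use B(2) Per_compact compact_imp_closed in \<open>meson subsetD\<close>)
 have "P \<inter> \<Union>B = {}" using B(3) by blast
 then obtain d where d: "d > 0" "\<And>x y. x \<in> P ==> y \<in> \<Union>B ==> d \<le> dist x y"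
  using separate_compact_closed[OF cP cB] by blast
 define u where "u x = max 0 (1 - infdist x P / d)" for x
 have "Lip u"
 proof (rule LipI[of "1 / d"])
  fix x y assume "x \<in> F" "y \<in> F"
  have "\<bar>infdist x P - infdist y P\<bar> / d \<le> dist x y / d"
   using infdist_triangle_abs[of x P y] d(1) by (intro divide_right_mono) auto
  moreover have "infdist x P / d - infdist y P / d = (infdist x P - infdist y P) / d" by (simp add: diff_divide_distrib)
  ultimately have 1: "\<bar>infdist x P / d - infdist y P / d\<bar> \<le> dist x y / d" using d(1) by (simp add: abs_divide)
  have "\<bar>max 0 (1 - a) - max 0 (1 - b)\<bar> \<le> \<bar>a - b\<bar>" for a b :: real by (simp add: max_def abs_if)
  from order_trans[OF this 1] show "\<bar>u x - u y\<bar> \<le> 1 / d * dist x y" unfolding u_def by simp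
 qed (use d in simp)
 moreover have "u x \<le> 1" for x
 proof -
  have "0 \<le> infdist x P / d" by (intro divide_nonneg_pos infdist_nonneg d(1))
  thus ?thesis by (simp add: u_def)
 qed
 moreover have "u x = 1" if "x \<in> P" for x using that by (simp add: u_def)
 moreover have "u y = 0" if yD: "D \<in> B" "y \<in> D" for y D
 proof -
  have "d \<le> infdist y P" unfolding infdist_notempty[OF P(3)]
  proof (rule cINF_greatest[OF P(3)])
   fix x assume "x \<in> P"
   hence "d \<le> dist x y" using d(2)[of x y] yD by blast
   thus "d \<le> dist y x" by (simp add: dist_commute)
  qed
  thus ?thesis using d(1) by (simp add: u_def)
 qed
 ultimately have "Lip u \<and> (\<forall>x. u x \<le> 1) \<and> (\<forall>x\<in>P. u x = 1) \<and> (\<forall>D\<in>B. \<forall>x\<in>D. u x = 0)" by simp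
 thus ?thesis by blast
qed

lemma adm_ex:
 assumes C: "C \<in> Per" and B: "finite B" "B \<subseteq> Per" "C \<notin> B"
 shows "\<exists>u c. adm C B u \<and> ener u c"
proof -
 have "D \<inter> C = {}" if "D \<in> B" for D using Per_disj[of D C] C B that by blast
 then obtain u where u: "Lip u" "\<And>x. x \<in> C ==> u x = 1" "\<And>D x. D \<in> B ==> x \<in> D ==> u x = 0"
  using cutoff_function[OF Per_F[OF C] compact_imp_closed[OF Per_compact[OF C]] Per_nonempty[OF C] B(1,2)] by meson
 hence "adm C B u" unfolding adm_def by simp
 thus ?thesis using Lip_ener[OF u(1)] by blast
qed

lemma cap_bdd: "bdd_below {c. \<exists>u. adm C B u \<and> ener u c}"
 using ener_pos by (intro bdd_belowI[of _ 0]) blast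

lemma cap_le: "adm C B u ==> ener u c ==> cap C B \<le> c"
 unfolding cap_def by (rule cInf_lower[OF _ cap_bdd]) blast

lemma cap_near:
 assumes "C \<in> Per" "finite B" "B \<subseteq> Per" "C \<notin> B" "e > 0"
 shows "\<exists>u. adm C B u \<and> ener u (cap C B + e)"
proof -
 have ne: "{c. \<exists>u. adm C B u \<and> ener u c} \<noteq> {}" using adm_ex[OF assms(1-4)] by blast
 have "Inf {c. \<exists>u. adm C B u \<and> ener u c} < cap C B + e" using assms(5) by (simp add: cap_def)
 from cInf_lessD[OF ne this] obtain c u where "adm C B u" "ener u c" "c < cap C B + e" by auto
 thus ?thesis using ener_mono[of u c "cap C B + e"] by (intro exI[of _ u]) simp
qed

lemma cap_mono:
 assumes "C \<in> Per" "finite B" "B \<subseteq> Per" "C \<notin> B" "A \<subseteq> B" shows "cap C A \<le> cap C B"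
proof (rule field_le_epsilon)
 fix e :: real assume "e > 0"
 then obtain u where u: "adm C B u" "ener u (cap C B + e)" using cap_near[OF assms(1-4)] by blast
 hence "adm C A u" using assms(5) unfolding adm_def by blast
 thus "cap C A \<le> cap C B + e" using cap_le u(2) by blast
qed

text \<open>\<open>1 - u\<close> has the energy of \<open>u\<close>.\<close>

lemma cap_sym:
 assumes "C \<in> Per" "D \<in> Per" "C \<noteq> D" shows "cap C {D} = cap D {C}"
proof -
 have *: "cap C {D} \<le> cap D {C}" if CD: "C \<in> Per" "D \<in> Per" "C \<noteq> D" for C D
 proof (rule field_le_epsilon)
  fix e :: real assume "e > 0"
  then obtain u where u: "adm D {C} u" "ener u (cap D {C} + e)" using cap_near[of D "{C}" e] CD by auto
  define v where "v x = 1 - u x" for x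
  have o: "osc v A = osc u A" for A
  proof -
   have "\<bar>v x - v y\<bar> = \<bar>u x - u y\<bar>" for x y by (simp add: v_def)
   thus ?thesis by (intro osc_eqI) (simp add: dist_real_def)
  qed
  have "adm C {D} v" proof -
   obtain L where L: "L \<ge> 0" "\<And>x y. x \<in> F ==> y \<in> F ==> \<bar>u x - u y\<bar> \<le> L * dist x y" by (rule LipE[OF adm_Lip[OF u(1)]]) (rule that)
   have "Lip v" by (rule LipI[OF L(1)]) (use L(2) in \<open>simp add: v_def abs_minus_commute\<close>)
   thus ?thesis using u(1) unfolding adm_def by (simp add: v_def)
  qed
  moreover have "ener v (cap D {C} + e)" using u(2) unfolding ener_def o .
  ultimately show "cap C {D} \<le> cap D {C} + e" by (rule cap_le)
 qed
 show ?thesis using *[OF assms] *[OF assms(2,1)] assms(3) by simp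
qed

section \<open>Interpolation on the grid and invariance of capacities\<close>

definition hat :: "real => real" where "hat t = max 0 (1 - \<bar>t\<bar>)"

text \<open>Bilinear interpolation of the values at the lattice points of generation k. Lattice
  points in the interior of holes carry arbitrary values, but a point of \<open>F\<close> lies in a
  surviving cell, whose four corners belong to \<open>F\<close>.\<close>

definition itp :: "nat => (plane => real) => plane => real" where
 "itp k v z = (\<Sum>i\<le>n ^ k. \<Sum>j\<le>n ^ k. v (gr k i, gr k j) *
   (hat (rn k * fst z - real i) * hat (rn k * snd z - real j)))"

lemma hat_sum:
 assumes i: "i < N" and s: "0 \<le> s" "s \<le> 1"
 shows "(\<Sum>l\<le>N. g l * hat (real i + s - real l)) = (1 - s) * g i + s * g (Suc i)"
proof -
 have z: "g l * hat (real i + s - real l) = 0" if "l \<in> {..N} - {i, Suc i}" for l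
 proof -
  have "l < i \<or> l > Suc i" using that by auto
  hence "real l \<le> real i - 1 \<or> real i + 2 \<le> real l" by auto
  hence "1 \<le> \<bar>real i + s - real l\<bar>" using s by auto
  thus ?thesis by (simp add: hat_def)
 qed
 have "(\<Sum>l\<le>N. g l * hat (real i + s - real l)) = (\<Sum>l\<in>{i, Suc i}. g l * hat (real i + s - real l))"
  by (rule sum.mono_neutral_right) (use i z in auto)
 also have "... = g i * hat s + g (Suc i) * hat (s - 1)" by (simp add: algebra_simps)
 also have "... = (1 - s) * g i + s * g (Suc i)"
 proof -
  have "hat s = 1 - s" "hat (s - 1) = s" using s by (auto simp: hat_def)
  thus ?thesis by (simp add: mult.commute)
 qed
 finally show ?thesis .
qed

lemma itp_cell:
 fixes v :: "plane => real"
 assumes ij: "i < n ^ k" "j < n ^ k" and z: "z \<in> sq k i j"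
 defines "s \<equiv> rn k * fst z - real i" and "t \<equiv> rn k * snd z - real j"
 defines "V \<equiv> \<lambda>i j. v (gr k i, gr k j)"
 shows "0 \<le> s" "s \<le> 1" "0 \<le> t" "t \<le> 1"
  "itp k v z = (1 - s) * ((1 - t) * V i j + t * V i (Suc j)) + s * ((1 - t) * V (Suc i) j + t * V (Suc i) (Suc j))"
proof -
 show st: "0 \<le> s" "s \<le> 1" "0 \<le> t" "t \<le> 1" using z by (auto simp: sq_def seg_def s_def t_def mult.commute)
 have "itp k v z = (\<Sum>l\<le>n ^ k. (\<Sum>m\<le>n ^ k. V l m * hat (real j + t - real m)) * hat (real i + s - real l))"
  unfolding itp_def V_def s_def t_def by (simp add: sum_distrib_right sum_distrib_left mult_ac)
 also have "... = (\<Sum>l\<le>n ^ k. ((1 - t) * V l j + t * V l (Suc j)) * hat (real i + s - real l))"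
  by (simp add: hat_sum[OF ij(2) st(3,4)])
 also have "... = (1 - s) * ((1 - t) * V i j + t * V i (Suc j)) + s * ((1 - t) * V (Suc i) j + t * V (Suc i) (Suc j))"
  by (rule hat_sum[OF ij(1) st(1,2)])
 finally show "itp k v z = (1 - s) * ((1 - t) * V i j + t * V i (Suc j)) + s * ((1 - t) * V (Suc i) j + t * V (Suc i) (Suc j))" .
qed

lemma itp_swap: "itp k (v \<circ> prod.swap) (prod.swap z) = itp k v z"
 unfolding itp_def by (subst sum.swap) (simp add: mult.commute)

lemma seg_desc: "seg m a x ==> \<exists>i. seg (m + t) i x \<and> i div n ^ t = a"
proof (induction t)
 case (Suc t)
 then obtain i where i: "seg (m + t) i x" "i div n ^ t = a" by blast
 obtain c where c: "c < n" "seg (Suc (m + t)) (n * i + c) x" using seg_child[OF i(1)] by blast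
 have "(n * i + c) div n ^ Suc t = a" using c(1) i(2) by (simp add: div_mult2_eq)
 thus ?case using c(2) by (intro exI[of _ "n * i + c"]) simp
qed auto

text \<open>For m at most k the side of the square is a union of grid edges, and on an edge the
  interpolation is linear between two lattice points of the same side.\<close>

lemma itp_horiz:
 assumes mk: "m \<le> k" and ab: "a < n ^ m" "b < n ^ m" and x: "seg m a (fst z)"
  and y: "snd z * rn m = real b \<or> snd z * rn m = real b + 1"
 shows "\<exists>P\<in>circ m a b. \<exists>Q\<in>circ m a b. \<exists>s. 0 \<le> s \<and> s \<le> 1 \<and> itp k v z = (1 - s) * v P + s * v Q"
proof -
 define M where "M = n ^ (k - m)"
 have M: "M > 0" by (simp add: M_def)
 have NM: "n ^ k = n ^ m * M" using mk by (simp add: M_def power_add[symmetric])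
 have rNM: "rn k = rn m * real M" using NM by (metis of_nat_mult of_nat_power)
 obtain i where i: "seg k i (fst z)" "i div M = a" using seg_desc[OF x, of "k - m"] mk by (auto simp: M_def)
 have iM: "a * M \<le> i" "i < (a + 1) * M" using div_bounds[OF M, of i] i(2) by auto
 have up: "(c + 1) * M \<le> n ^ k" if "c < n ^ m" for c unfolding NM using that by (intro mult_le_mono1) simp
 have iN: "i < n ^ k" using iM up[OF ab(1)] by linarith
 define d where "d = (if snd z * rn m = real b then b else b + 1)"
 have d: "snd z * rn m = real d" "d = b \<or> d = Suc b" using y by (auto simp: d_def)
 have zd: "snd z * rn k = real (d * M)" using d(1) unfolding rNM by (simp add: mult.assoc[symmetric])
 have dd: "gr k (d * M) = gr m d" using M unfolding rNM by simp
 \<comment> \<open>The side is viewed from the grid row inside the square, the bottom from above and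
   the top from below, so that j stays a valid index even on the top side of the unit
   square.\<close>
 define j where "j = (if d = b then b * M else d * M - 1)"
 have jN: "j < n ^ k" using up[OF ab(2)] d(2) M by (auto simp: j_def)
 have jt: "rn k * snd z - real j = (if d = b then 0 else 1)"
 proof (cases "d = b")
  case True thus ?thesis using zd by (simp add: j_def mult.commute)
 next
  case False
  hence "d * M \<ge> 1" using d(2) M by simp
  thus ?thesis using zd False by (simp add: j_def mult.commute of_nat_diff)
 qed
 have zs: "z \<in> sq k i j" using i(1) jt by (auto simp: sq_def seg_def mult.commute split: if_splits)
 define s where "s = rn k * fst z - real i"
 define P where "P = (gr k i, gr k (d * M))"
 define Q where "Q = (gr k (Suc i), gr k (d * M))"
 note I14 = itp_cell(1-4)[OF iN jN zs, folded s_def]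
 note I5 = itp_cell(5)[OF iN jN zs, of v, folded s_def, unfolded jt]
 have s01: "0 \<le> s" "s \<le> 1" using I14(1,2) .
 have "itp k v z = (1 - s) * v P + s * v Q"
 proof (cases "d = b")
  case True thus ?thesis using I5 by (simp add: P_def Q_def j_def)
 next
  case False
  hence "Suc j = d * M" using d(2) M by (simp add: j_def)
  thus ?thesis using I5 False by (simp add: P_def Q_def)
 qed
 moreover have C: "(gr k l, gr k (d * M)) \<in> circ m a b" if l: "a * M \<le> l" "l \<le> (a + 1) * M" for l
 proof -
  have "gr k (a * M) \<le> gr k l" "gr k l \<le> gr k ((a + 1) * M)"
   using l by (intro divide_right_mono; simp only: of_nat_le_iff; simp)+
  moreover have fr: "gr k (c * M) = gr m c" for c using M unfolding rNM of_nat_mult by simp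
  ultimately have "gr k l \<in> {gr m a..(real a + 1) / rn m}" unfolding fr by (simp add: add.commute)
  from circ_horiz[OF this, of b] show ?thesis unfolding dd using d(2) by (auto simp: add.commute)
 qed
 have "P \<in> circ m a b" "Q \<in> circ m a b" unfolding P_def Q_def by (rule C; use iM in simp)+
 ultimately show ?thesis using s01 by blast
qed

lemma itp_circ:
 assumes mk: "m \<le> k" and ab: "a < n ^ m" "b < n ^ m" and z: "z \<in> circ m a b"
 shows "\<exists>P\<in>circ m a b. \<exists>Q\<in>circ m a b. \<exists>s. 0 \<le> s \<and> s \<le> 1 \<and> itp k v z = (1 - s) * v P + s * v Q"
proof (cases "snd z * rn m = real b \<or> snd z * rn m = real b + 1")
 case True
 have "seg m a (fst z)" using z by (simp add: circ_alt sq_def)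
 thus ?thesis using itp_horiz[OF mk ab _ True] by blast
next
 case False
 hence y: "snd (prod.swap z) * rn m = real a \<or> snd (prod.swap z) * rn m = real a + 1"
  and x: "seg m b (fst (prod.swap z))" using z by (auto simp: circ_alt sq_def)
 obtain P Q s where P: "P \<in> circ m b a" "Q \<in> circ m b a" "0 \<le> s" "s \<le> 1"
  "itp k (v \<circ> prod.swap) (prod.swap z) = (1 - s) * (v \<circ> prod.swap) P + s * (v \<circ> prod.swap) Q"
  using itp_horiz[OF mk ab(2,1) x y] by blast
 have "itp k v z = (1 - s) * v (prod.swap P) + s * v (prod.swap Q)" using P(5) unfolding itp_swap by simp
 moreover have "prod.swap P \<in> circ m a b" "prod.swap Q \<in> circ m a b" using P(1,2) circ_swap by blast+
 ultimately show ?thesis using P(3,4) by blast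
qed

lemma conv_le:
 fixes g h y d s :: real
 assumes "\<bar>g - y\<bar> \<le> d" "\<bar>h - y\<bar> \<le> d" "0 \<le> s" "s \<le> 1"
 shows "\<bar>(1 - s) * g + s * h - y\<bar> \<le> d"
proof -
 have "(1 - s) * g + s * h - y = (1 - s) * (g - y) + s * (h - y)" by (simp add: algebra_simps)
 also have "\<bar>...\<bar> \<le> (1 - s) * \<bar>g - y\<bar> + s * \<bar>h - y\<bar>" using assms by (intro order_trans[OF abs_triangle_ineq]) (simp add: abs_mult)
 also have "... \<le> (1 - s) * d + s * d" using assms by (intro add_mono mult_left_mono) auto
 finally show ?thesis by (simp add: algebra_simps)
qed

lemma itp_osc:
 assumes mk: "m \<le> k" and ab: "a < n ^ m" "b < n ^ m" and bd: "bounded (v ` circ m a b)"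
 shows "osc (itp k v) (circ m a b) \<le> osc v (circ m a b)"
proof (rule osc_le)
 let ?d = "osc v (circ m a b)"
 have pq: "\<bar>v P - v Q\<bar> \<le> ?d" if "P \<in> circ m a b" "Q \<in> circ m a b" for P Q
  using osc_ge[OF bd that] by (simp add: dist_real_def)
 fix x y assume xy: "x \<in> circ m a b" "y \<in> circ m a b"
 obtain P Q s where P: "P \<in> circ m a b" "Q \<in> circ m a b" "0 \<le> s" "s \<le> 1" "itp k v x = (1 - s) * v P + s * v Q"
  using itp_circ[OF mk ab xy(1), of v] by blast
 obtain P' Q' s' where P': "P' \<in> circ m a b" "Q' \<in> circ m a b" "0 \<le> s'" "s' \<le> 1" "itp k v y = (1 - s') * v P' + s' * v Q'"
  using itp_circ[OF mk ab xy(2), of v] by blast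
 have 1: "\<bar>itp k v x - v R\<bar> \<le> ?d" if "R \<in> circ m a b" for R
  unfolding P(5) by (rule conv_le[OF pq[OF P(1) that] pq[OF P(2) that] P(3,4)])
 have 2: "\<bar>itp k v y - itp k v x\<bar> \<le> ?d" unfolding P'(5)
  by (rule conv_le[OF _ _ P'(3,4)]) (use 1[OF P'(1)] 1[OF P'(2)] in \<open>auto simp: abs_minus_commute\<close>)
 thus "dist (itp k v x) (itp k v y) \<le> ?d" by (simp add: dist_real_def abs_minus_commute)
qed (rule osc_nonneg[OF bd])

lemma itp_const:
 assumes mk: "m \<le> k" and ab: "a < n ^ m" "b < n ^ m" and c: "\<And>x. x \<in> circ m a b ==> v x = r" and z: "z \<in> circ m a b"
 shows "itp k v z = r"
proof -
 obtain P Q s where P: "P \<in> circ m a b" "Q \<in> circ m a b" "itp k v z = (1 - s) * v P + s * v Q"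
  using itp_circ[OF mk ab z, of v] by blast
 thus ?thesis using c by (simp add: algebra_simps)
qed

lemma sq_lat: "(gr k i, gr k j) \<in> sq k i j" "(gr k (Suc i), gr k j) \<in> sq k i j"
 "(gr k i, gr k (Suc j)) \<in> sq k i j" "(gr k (Suc i), gr k (Suc j)) \<in> sq k i j"
 by (simp_all add: sq_def seg_def)

lemma rem_corners:
 assumes r: "rem k i j"
 shows "(gr k i, gr k j) \<in> cell k (i, j)" "(gr k (Suc i), gr k j) \<in> cell k (i, j)"
  "(gr k i, gr k (Suc j)) \<in> cell k (i, j)" "(gr k (Suc i), gr k (Suc j)) \<in> cell k (i, j)"
 unfolding cell_def using sq_lat edge_in_F_x[OF r] by auto

text \<open>Changing one variable at a time, the increment of a bilinear function is a convex
  combination of the differences along parallel sides, each at most the oscillation on the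
  cell.\<close>

lemma itp_cell_lip:
 assumes r: "rem k i j" and bd: "bounded (v ` F)" and z: "z \<in> sq k i j" "z' \<in> sq k i j"
 shows "\<bar>itp k v z - itp k v z'\<bar> \<le> osc v (cell k (i, j)) * (rn k * (\<bar>fst z - fst z'\<bar> + \<bar>snd z - snd z'\<bar>))"
proof -
 have ij: "i < n ^ k" "j < n ^ k" using rem_bound[OF r] by auto
 let ?D = "osc v (cell k (i, j))"
 have bc: "bounded (v ` cell k (i, j))" by (rule bounded_subset[OF bd image_mono[OF cell_F]])
 define V where "V = (\<lambda>i j. v (gr k i, gr k j))"
 define s t s' t' where "s = rn k * fst z - real i" and "t = rn k * snd z - real j"
  and "s' = rn k * fst z' - real i" and "t' = rn k * snd z' - real j"
 note I = itp_cell(1-4)[OF ij z(1), folded s_def t_def]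
 note I' = itp_cell(1-4)[OF ij z(2), folded s'_def t'_def]
 have I5: "itp k v z = (1 - s) * ((1 - t) * V i j + t * V i (Suc j)) + s * ((1 - t) * V (Suc i) j + t * V (Suc i) (Suc j))"
  using itp_cell(5)[OF ij z(1), of v] by (simp add: s_def t_def V_def)
 have I5': "itp k v z' = (1 - s') * ((1 - t') * V i j + t' * V i (Suc j)) + s' * ((1 - t') * V (Suc i) j + t' * V (Suc i) (Suc j))"
  using itp_cell(5)[OF ij z(2), of v] by (simp add: s'_def t'_def V_def)
 have D: "\<bar>V i1 j1 - V i2 j2\<bar> \<le> ?D" if "i1 = i \<or> i1 = Suc i" "i2 = i \<or> i2 = Suc i" "j1 = j \<or> j1 = Suc j" "j2 = j \<or> j2 = Suc j" for i1 i2 j1 j2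
  using osc_ge[OF bc, of "(gr k i1, gr k j1)" "(gr k i2, gr k j2)"] rem_corners[OF r] that
  unfolding V_def by (auto simp: dist_real_def)
 have cv: "\<bar>(1 - a) * x + a * y\<bar> \<le> d" if "\<bar>x\<bar> \<le> d" "\<bar>y\<bar> \<le> d" "0 \<le> a" "a \<le> 1" for a x y d :: real
  using conv_le[of x 0 d y a] that by simp
 define X where "X = (1 - t) * (V (Suc i) j - V i j) + t * (V (Suc i) (Suc j) - V i (Suc j))"
 define Y where "Y = (1 - s') * (V i (Suc j) - V i j) + s' * (V (Suc i) (Suc j) - V (Suc i) j)"
 have X: "\<bar>X\<bar> \<le> ?D" unfolding X_def by (rule cv[OF _ _ I(3,4)]) (rule D; simp)+
 have Y: "\<bar>Y\<bar> \<le> ?D" unfolding Y_def by (rule cv[OF _ _ I'(1,2)]) (rule D; simp)+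
 have "itp k v z - itp k v z' = (s - s') * X + (t - t') * Y"
  unfolding I5 I5' X_def Y_def by (simp add: algebra_simps)
 also have "\<bar>...\<bar> \<le> \<bar>s - s'\<bar> * \<bar>X\<bar> + \<bar>t - t'\<bar> * \<bar>Y\<bar>" by (metis abs_mult abs_triangle_ineq)
 also have "... \<le> \<bar>s - s'\<bar> * ?D + \<bar>t - t'\<bar> * ?D" using X Y by (intro add_mono mult_left_mono) auto
 also have "\<bar>s - s'\<bar> = rn k * \<bar>fst z - fst z'\<bar>" by (simp add: s_def s'_def abs_mult right_diff_distrib[symmetric] del: power_abs)
 also have "\<bar>t - t'\<bar> = rn k * \<bar>snd z - snd z'\<bar>" by (simp add: t_def t'_def abs_mult right_diff_distrib[symmetric] del: power_abs)
 finally show ?thesis by (simp add: algebra_simps)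
qed

lemma Lip_itp: "Lip (itp k v)"
proof -
 define N where "N = rn k"
 define L where "L = (\<Sum>i\<le>n ^ k. \<Sum>j\<le>n ^ k. \<bar>v (real i / N, real j / N)\<bar> * (2 * N))"
 have N: "N > 0" by (simp add: N_def)
 have h01: "0 \<le> hat t" "hat t \<le> 1" for t by (auto simp: hat_def)
 have hl: "\<bar>hat a - hat b\<bar> \<le> \<bar>a - b\<bar>" for a b by (auto simp: hat_def max_def abs_if split: if_splits)
 have hh: "\<bar>hat a * hat b - hat a' * hat b'\<bar> \<le> \<bar>a - a'\<bar> + \<bar>b - b'\<bar>" for a b a' b'
 proof -
  have "hat a * hat b - hat a' * hat b' = (hat a - hat a') * hat b + hat a' * (hat b - hat b')" by (simp add: algebra_simps)
  also have "\<bar>...\<bar> \<le> \<bar>hat a - hat a'\<bar> * hat b + hat a' * \<bar>hat b - hat b'\<bar>"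
   using h01 by (intro order_trans[OF abs_triangle_ineq]) (simp add: abs_mult)
  also have "... \<le> \<bar>a - a'\<bar> * 1 + 1 * \<bar>b - b'\<bar>" by (intro add_mono mult_mono hl h01) auto
  finally show ?thesis by simp
 qed
 have lip: "\<bar>itp k v x - itp k v y\<bar> \<le> L * dist x y" for x y
 proof -
  have eq: "itp k v x - itp k v y = (\<Sum>i\<le>n ^ k. \<Sum>j\<le>n ^ k. v (real i / N, real j / N) *
    (hat (N * fst x - real i) * hat (N * snd x - real j) - hat (N * fst y - real i) * hat (N * snd y - real j)))"
   unfolding itp_def N_def by (simp add: sum_subtractf right_diff_distrib)
  have "\<bar>itp k v x - itp k v y\<bar> \<le> (\<Sum>i\<le>n ^ k. \<Sum>j\<le>n ^ k. \<bar>v (real i / N, real j / N)\<bar> * (2 * N) * dist x y)"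
   unfolding eq
  proof (intro order_trans[OF sum_abs] sum_mono)
   fix i j
   have "\<bar>(N * fst x - real i) - (N * fst y - real i)\<bar> + \<bar>(N * snd x - real j) - (N * snd y - real j)\<bar>
     = N * \<bar>fst x - fst y\<bar> + N * \<bar>snd x - snd y\<bar>" using N by (simp add: right_diff_distrib[symmetric] abs_mult)
   also have "... \<le> N * dist x y + N * dist x y" using coord_le_dist[of x y] N by (intro add_mono mult_left_mono) auto
   finally have "\<bar>hat (N * fst x - real i) * hat (N * snd x - real j) - hat (N * fst y - real i) * hat (N * snd y - real j)\<bar> \<le> (2 * N) * dist x y"
    using hh[of "N * fst x - real i" "N * snd x - real j" "N * fst y - real i" "N * snd y - real j"] by linarith
   thus "\<bar>v (real i / N, real j / N) * (hat (N * fst x - real i) * hat (N * snd x - real j) - hat (N * fst y - real i) * hat (N * snd y - real j))\<bar>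
     \<le> \<bar>v (real i / N, real j / N)\<bar> * (2 * N) * dist x y"
    unfolding abs_mult mult.assoc by (rule mult_left_mono) simp
  qed
  thus ?thesis unfolding L_def sum_distrib_right .
 qed
 have L0: "L \<ge> 0" unfolding L_def by (rule sum_nonneg, rule sum_nonneg) (simp add: less_imp_le[OF N])
 show ?thesis by (rule LipI[OF L0 lip])
qed

text \<open>Circles of generation at most k take convex combinations of their own values and gain no
  oscillation. A smaller circle lies in one cell, where the slope is controlled by the oscillation
  of v there; by packing, all small circles together cost at most a multiple of the tail.\<close>

lemma itp_ener:
 assumes bd: "bounded (v ` F)" and e: "ener v c"
 shows "ener (itp k v) (c + 8 * tail k v)"
 unfolding ener_def
proof (intro allI impI)
 fix A assume A: "finite A" "A \<subseteq> Per"
 define N where "N = rn k"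
 have N: "N > 0" by (simp add: N_def)
 define A1 where "A1 = {C\<in>A. 1 / N \<le> sz C}"
 define A2 where "A2 = {C\<in>A. sz C < 1 / N}"
 have A12: "A = A1 \<union> A2" "A1 \<inter> A2 = {}" "finite A1" "finite A2" "A1 \<subseteq> Per" "A2 \<subseteq> Per" using A by (auto simp: A1_def A2_def)
 have bdC: "bounded (v ` C)" if "C \<in> Per" for C by (rule bounded_subset[OF bd image_mono[OF Per_F[OF that]]])
 have bdI: "bounded (itp k v ` C)" if "C \<in> Per" for C by (rule Lip_bdP[OF Lip_itp that])
 have lvl: "1 / rn m < 1 / N \<longleftrightarrow> k < m" for m
  using n5 by (simp add: N_def frac_less2 field_simps)
 have "(\<Sum>C\<in>A1. (osc (itp k v) C)\<^sup>2) \<le> (\<Sum>C\<in>A1. (osc v C)\<^sup>2)"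
 proof (intro sum_mono power_mono)
  fix C assume C: "C \<in> A1"
  hence CP: "C \<in> Per" using A12 by blast
  obtain m a b where m: "C = circ m a b" "hole m a b \<or> (m = 0 \<and> a = 0 \<and> b = 0)" using Per_cases[OF CP] .
  have "\<not> 1 / rn m < 1 / N" using C sz_circ[of m a b] m(1) by (simp add: A1_def)
  hence "m \<le> k" using lvl by simp
  moreover have "a < n ^ m" "b < n ^ m" using m(2) hole_bound by auto
  ultimately show "osc (itp k v) C \<le> osc v C" unfolding m(1) using itp_osc bdC[OF CP] m(1) by blast
  show "0 \<le> osc (itp k v) C" by (rule osc_nonneg[OF bdI[OF CP]])
 qed
 also have "... \<le> c" by (rule enerD[OF e A12(3,5)])
 finally have 1: "(\<Sum>C\<in>A1. (osc (itp k v) C)\<^sup>2) \<le> c" .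
 \<comment> \<open>The charge of the small circle C to the cell x: oscillation of v on the cell
   times the relative size of C.\<close>
 define g where "g x C = (if C \<subseteq> sq k (fst x) (snd x) then (osc v (cell k x) * (N * (2 * sz C)))\<^sup>2 else 0)" for x C
 have "(\<Sum>C\<in>A2. (osc (itp k v) C)\<^sup>2) \<le> (\<Sum>C\<in>A2. \<Sum>x\<in>Rk k. g x C)"
 proof (rule sum_mono)
  fix C assume C: "C \<in> A2"
  hence CP: "C \<in> Per" using A12 by blast
  obtain m a b where m: "C = circ m a b" "hole m a b \<or> (m = 0 \<and> a = 0 \<and> b = 0)" using Per_cases[OF CP] .
  have "1 / rn m < 1 / N" using C sz_circ[of m a b] m(1) by (simp add: A2_def)
  hence km: "k < m" using lvl by simp
  hence h: "hole m a b" using m(2) by auto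
  define x where "x = (a div n ^ (m - k), b div n ^ (m - k))"
  have x: "x \<in> Rk k" using hole_Suc_anc[OF h km] by (simp add: Rk_def x_def)
  have CH: "C \<in> Holes" using h m(1) by (auto simp: Holes_def)
  have sub: "C \<subseteq> sq k (fst x) (snd x)"
  proof
   fix z assume "z \<in> C"
   hence "z \<in> sq (k + (m - k)) a b" using circ_sub_sq m(1) km by auto
   from sq_anc[OF this] show "z \<in> sq k (fst x) (snd x)" by (simp add: x_def)
  qed
  have r: "rem k (fst x) (snd x)" using x by (auto simp: Rk_def)
  have o0: "0 \<le> osc v (cell k x)" by (rule osc_nonneg[OF bounded_subset[OF bd image_mono[OF cell_F]]])
  have "osc (itp k v) C \<le> osc v (cell k x) * (N * (2 * sz C))"
  proof (rule osc_le)
   fix z w assume zw: "z \<in> C" "w \<in> C"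
   have "\<bar>itp k v z - itp k v w\<bar> \<le> osc v (cell k x) * (N * (\<bar>fst z - fst w\<bar> + \<bar>snd z - snd w\<bar>))"
    using itp_cell_lip[OF r bd, of z w] zw sub by (auto simp: N_def)
   also have "... \<le> osc v (cell k x) * (N * (2 * sz C))"
    using hole_coord[OF CH zw] N o0 by (intro mult_left_mono) auto
   finally show "dist (itp k v z) (itp k v w) \<le> osc v (cell k x) * (N * (2 * sz C))" by (simp add: dist_real_def)
  qed (use o0 N sz_pos[OF CP] in auto)
  hence "(osc (itp k v) C)\<^sup>2 \<le> g x C" unfolding g_def using sub by (simp add: power_mono osc_nonneg[OF bdI[OF CP]])
  also have "... \<le> (\<Sum>x\<in>Rk k. g x C)" by (rule member_le_sum[OF x _ finite_Rk]) (simp add: g_def)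
  finally show "(osc (itp k v) C)\<^sup>2 \<le> (\<Sum>x\<in>Rk k. g x C)" .
 qed
 also have "... = (\<Sum>x\<in>Rk k. \<Sum>C\<in>A2. g x C)" by (rule sum.swap)
 also have "... \<le> (\<Sum>x\<in>Rk k. 4 * (osc v (cell k x))\<^sup>2)"
 proof (rule sum_mono)
  fix x assume x: "x \<in> Rk k"
  define S where "S = {C\<in>A2. C \<subseteq> sq k (fst x) (snd x)}"
  have SH: "S \<subseteq> Holes"
  proof
   fix C assume C: "C \<in> S"
   have "1 \<le> N" unfolding N_def by (rule one_le_power[OF n_ge1])
   hence "1 / N \<le> 1" by simp
   moreover have "sz C < 1 / N" using C by (simp add: S_def A2_def)
   ultimately have "C \<noteq> Out" using sz_Out by auto
   thus "C \<in> Holes" using C A12(6) by (auto simp: S_def Per_def)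
  qed
  have fS: "finite S" using A12 by (simp add: S_def)
  have "(\<Sum>C\<in>S. (sz C)\<^sup>2) \<le> (1 / N) * (1 / N)"
  proof (rule packing[OF fS SH])
   fix C assume "C \<in> S"
   thus "C \<subseteq> {real (fst x) / N..real (fst x) / N + 1 / N} \<times> {real (snd x) / N..real (snd x) / N + 1 / N}"
    by (simp add: S_def sq_times N_def add_divide_distrib)
  qed (use N in auto)
  hence p: "N\<^sup>2 * (\<Sum>C\<in>S. (sz C)\<^sup>2) \<le> 1" using N by (simp add: power2_eq_square field_simps)
  have "(\<Sum>C\<in>A2. g x C) = (\<Sum>C\<in>S. (osc v (cell k x) * (N * (2 * sz C)))\<^sup>2)"
   unfolding S_def g_def by (rule sum.mono_neutral_cong_right) (use A12 in auto)
  also have "... = 4 * (osc v (cell k x))\<^sup>2 * (N\<^sup>2 * (\<Sum>C\<in>S. (sz C)\<^sup>2))"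
   by (simp add: power_mult_distrib sum_distrib_left mult_ac)
  also have "... \<le> 4 * (osc v (cell k x))\<^sup>2 * 1" using p by (intro mult_left_mono) auto
  finally show "(\<Sum>C\<in>A2. g x C) \<le> 4 * (osc v (cell k x))\<^sup>2" by simp
 qed
 also have "... = 4 * tail k v" by (simp add: tail_def sum_distrib_left)
 also have "... \<le> 8 * tail k v" using tail_nonneg[of k v] by simp
 finally show "(\<Sum>C\<in>A. (osc (itp k v) C)\<^sup>2) \<le> c + 8 * tail k v"
  using 1 unfolding A12(1) by (simp add: sum.union_disjoint[OF A12(3,4,2)])
qed

text \<open>\<open>u \<circ> f\<close> need not be Lipschitz; it is replaced by an interpolation with nearly the same energy.\<close>

lemma cap_GF:
 assumes f: "GF f" and C: "C \<in> Per" and B: "finite B" "B \<subseteq> Per" "C \<notin> B"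
 shows "cap C B \<le> cap (f ` C) ((`) f ` B)"
proof (rule field_le_epsilon)
 fix e :: real assume e: "e > 0"
 have n: "f ` C \<notin> (`) f ` B"
 proof
  assume "f ` C \<in> (`) f ` B"
  then obtain D where D: "D \<in> B" "f ` C = f ` D" by blast
  hence "C = D" using GF_inj_im[OF f Per_F Per_F] C B(2) by blast
  thus False using D(1) B(3) by simp
 qed
 have s: "(`) f ` B \<subseteq> Per" using GF_Per[OF f] B(2) by blast
 obtain w where w: "adm (f ` C) ((`) f ` B) w" "ener w (cap (f ` C) ((`) f ` B) + e / 2)"
  using cap_near[OF GF_Per[OF f C] finite_imageI[OF B(1)] s n, of "e / 2"] e by auto
 define v where "v = w \<circ> f"
 have Lw: "Lip w" using w(1) by (simp add: adm_def)
 have ev: "ener v (cap (f ` C) ((`) f ` B) + e / 2)" unfolding v_def by (rule ener_comp[OF f w(2)])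
 have bv: "bounded (v ` F)" unfolding v_def using Lip_bounded[OF Lw] GF_im[OF f] by (metis image_comp)
 obtain L where L: "L \<ge> 0" "\<And>x y. x \<in> F ==> y \<in> F ==> \<bar>w x - w y\<bar> \<le> L * dist x y" by (rule LipE[OF Lw]) (rule that)
 have tl: "tail k v \<le> L\<^sup>2 * tail k f" for k unfolding v_def by (rule tail_comp_lip[OF f L(1)]) (use L(2) in \<open>simp add: dist_real_def\<close>)
 have "(\<lambda>k. 8 * (L\<^sup>2 * tail k f)) \<longlonglongrightarrow> 8 * (L\<^sup>2 * 0)" by (intro tendsto_intros GF_tail f)
 hence "\<forall>\<^sub>F k in sequentially. 8 * (L\<^sup>2 * tail k f) < e / 2" by (rule order_tendstoD(2)) (use e in simp)
 then obtain k0 where k0: "\<And>k. k \<ge> k0 ==> 8 * (L\<^sup>2 * tail k f) < e / 2" unfolding eventually_sequentially by blast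
 \<comment> \<open>From the largest generation among C and B on, all these circles are unions of
   grid edges, so the interpolation keeps the prescribed values 1 and 0 exactly.\<close>
 have lev: "\<exists>m. \<forall>D\<in>insert C B. \<exists>l a b. l \<le> m \<and> D = circ l a b \<and> a < n ^ l \<and> b < n ^ l"
 proof -
  have "\<exists>l. \<exists>a b. D = circ l a b \<and> a < n ^ l \<and> b < n ^ l" if "D \<in> insert C B" for D
  proof -
   have "D \<in> Per" using that C B by blast
   from Per_cases[OF this] obtain l a b where "D = circ l a b" "hole l a b \<or> (l = 0 \<and> a = 0 \<and> b = 0)" .
   thus ?thesis using hole_bound by (intro exI[of _ l] exI[of _ a] exI[of _ b]) auto
  qed
  then obtain l where l: "\<And>D. D \<in> insert C B ==> \<exists>a b. D = circ (l D) a b \<and> a < n ^ l D \<and> b < n ^ l D" by metis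
  show ?thesis
  proof (rule exI[of _ "Max (l ` insert C B)"], rule ballI)
   fix D assume D: "D \<in> insert C B"
   have "l D \<le> Max (l ` insert C B)" using D B(1) by (intro Max_ge) auto
   moreover obtain a b where "D = circ (l D) a b" "a < n ^ l D" "b < n ^ l D" using l[OF D] by blast
   ultimately show "\<exists>la a b. la \<le> Max (l ` insert C B) \<and> D = circ la a b \<and> a < n ^ la \<and> b < n ^ la"
    by blast
  qed
 qed
 then obtain m where m: "\<forall>D\<in>insert C B. \<exists>l a b. l \<le> m \<and> D = circ l a b \<and> a < n ^ l \<and> b < n ^ l" by (elim exE)
 define k where "k = max k0 m"
 have const: "itp k v x = r" if D: "D \<in> insert C B" and c: "\<And>x. x \<in> D ==> v x = r" and x: "x \<in> D" for D r x
 proof -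
  obtain l a b where l: "l \<le> m" "D = circ l a b" "a < n ^ l" "b < n ^ l" using bspec[OF m D] by (elim exE conjE)
  have "l \<le> k" using l(1) by (simp add: k_def)
  thus ?thesis using itp_const[OF _ l(3,4)] c x l(2) by blast
 qed
 have "itp k v x = 1" if "x \<in> C" for x by (rule const[OF _ _ that]) (use w(1) in \<open>auto simp: adm_def v_def\<close>)
 moreover have "itp k v x = 0" if "D \<in> B" "x \<in> D" for x D
  by (rule const[OF _ _ that(2)]) (use w(1) that(1) in \<open>auto simp: adm_def v_def\<close>)
 ultimately have a: "adm C B (itp k v)" unfolding adm_def using Lip_itp by blast
 have "8 * tail k v \<le> e / 2" using tl[of k] k0[of k] by (simp add: k_def)
 hence "ener (itp k v) (cap (f ` C) ((`) f ` B) + e)" by (intro ener_mono[OF itp_ener[OF bv ev]]) simp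
 thus "cap C B \<le> cap (f ` C) ((`) f ` B) + e" by (rule cap_le[OF a])
qed

subsection \<open>Capacities inside a cell\<close>

text \<open>Blow-up of the cell (i, j) of generation k to the unit square; by self-similarity it
  carries the part of \<open>F\<close> in a surviving cell into \<open>F\<close>
  (\<open>bi_F\<close>).\<close>

definition bi :: "nat => nat => nat => plane => plane" where
 "bi k i j z = (rn k * fst z - real i, rn k * snd z - real j)"

lemma seg_bi: "seg (k + m) (i * n ^ m + a) x \<longleftrightarrow> seg m a (rn k * x - real i)"
 unfolding seg_def by (simp add: power_add algebra_simps)
lemma oseg_bi: "oseg (k + m) (i * n ^ m + a) x \<longleftrightarrow> oseg m a (rn k * x - real i)"
 unfolding oseg_def by (simp add: power_add algebra_simps)
lemma circ_bi: "z \<in> circ (k + m) (i * n ^ m + a) (j * n ^ m + b) \<longleftrightarrow> bi k i j z \<in> circ m a b"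
 unfolding circ_def sq_def osq_def bi_def by (simp add: seg_bi oseg_bi)
lemma osq_bi: "z \<in> osq (k + m) (i * n ^ m + a) (j * n ^ m + b) \<longleftrightarrow> bi k i j z \<in> osq m a b"
 unfolding osq_def bi_def by (simp add: oseg_bi)
lemma sq_bi: "z \<in> sq k i j \<longleftrightarrow> bi k i j z \<in> unit_sq"
 unfolding sq_zero[symmetric] sq_def bi_def using seg_bi[of k 0 i 0] seg_bi[of k 0 j 0] by simp
lemma circ_bi0: "z \<in> circ k i j \<longleftrightarrow> bi k i j z \<in> Out"
 unfolding Out_def using circ_bi[of z k 0 i 0 j 0] by simp

lemma bi_inj: "bi k i j z = bi k i j w ==> z = w"
 by (simp add: bi_def prod_eq_iff)

lemma bi_dist: "dist (bi k i j z) (bi k i j w) = rn k * dist z w"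
proof -
 have "dist (bi k i j z) (bi k i j w) = sqrt ((rn k)\<^sup>2 * ((fst z - fst w)\<^sup>2 + (snd z - snd w)\<^sup>2))"
  unfolding bi_def dist_prod_def dist_real_def by (simp add: right_diff_distrib[symmetric] power_mult_distrib distrib_left)
 also have "... = rn k * sqrt ((fst z - fst w)\<^sup>2 + (snd z - snd w)\<^sup>2)" by (simp add: real_sqrt_mult)
 finally show ?thesis by (simp add: dist_prod_def dist_real_def)
qed

lemma rem_bi: "a < n ^ m ==> b < n ^ m ==> rem (k + m) (i * n ^ m + a) (j * n ^ m + b) \<longleftrightarrow> rem k i j \<and> rem m a b"
proof (induction m arbitrary: a b)
 case (Suc m)
 have d: "(x * n ^ Suc m + c) div n = x * n ^ m + c div n" "(x * n ^ Suc m + c) mod n = c mod n" for x c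
 proof -
  have e: "x * n ^ Suc m + c = n * (x * n ^ m) + c" by simp
  show "(x * n ^ Suc m + c) div n = x * n ^ m + c div n" "(x * n ^ Suc m + c) mod n = c mod n" unfolding e by simp_all
 qed
 have "a div n < n ^ m" "b div n < n ^ m" using Suc.prems div_less_pow by blast+
 thus ?case using Suc.IH[of "a div n" "b div n"] d by simp
qed auto

lemma hole_bi:
 assumes "a < n ^ m" "b < n ^ m" "m > 0"
 shows "hole (k + m) (i * n ^ m + a) (j * n ^ m + b) \<longleftrightarrow> rem k i j \<and> hole m a b"
proof -
 obtain l where m: "m = Suc l" using assms(3) gr0_implies_Suc by blast
 have d: "(x * n ^ Suc l + c) div n = x * n ^ l + c div n" "(x * n ^ Suc l + c) mod n = c mod n" for x c
 proof -
  have e: "x * n ^ Suc l + c = n * (x * n ^ l) + c" by simp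
  show "(x * n ^ Suc l + c) div n = x * n ^ l + c div n" "(x * n ^ Suc l + c) mod n = c mod n" unfolding e by simp_all
 qed
 have "a div n < n ^ l" "b div n < n ^ l" using assms div_less_pow m by blast+
 thus ?thesis using rem_bi[of "a div n" l "b div n" k i j] d unfolding m hole_def by simp
qed

lemma bi_F: assumes r: "rem k i j" and z: "z \<in> F" "z \<in> sq k i j" shows "bi k i j z \<in> F"
proof -
 have "bi k i j z \<notin> osq m a b" if h: "hole m a b" for m a b
 proof
  assume "bi k i j z \<in> osq m a b"
  hence "z \<in> osq (k + m) (i * n ^ m + a) (j * n ^ m + b)" by (simp add: osq_bi)
  moreover have "hole (k + m) (i * n ^ m + a) (j * n ^ m + b)"
   using hole_bi[of a m b k i j] hole_bound[OF h] hole_pos[OF h] h r by blast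
  ultimately show False using F_osq_hole z(1) by blast
 qed
 thus ?thesis using sq_bi[of z k i j] z(2) not_F_hole by metis
qed

lemma Per_cell:
 assumes Q: "Q \<in> Per" and r: "rem k i j"
 shows "(\<exists>m a b. hole m a b \<and> Q = circ (k + m) (i * n ^ m + a) (j * n ^ m + b)) \<or> Q \<inter> osq k i j = {}"
proof -
 obtain l a b where l: "Q = circ l a b" "hole l a b \<or> (l = 0 \<and> a = 0 \<and> b = 0)" using Per_cases[OF Q] .
 show ?thesis
 proof (cases "k < l")
  case False
  hence t: "k = l + (k - l)" by simp
  have "z \<notin> osq k i j" if z: "z \<in> Q" for z
  proof
   assume o: "z \<in> osq k i j"
   hence o2: "oseg l (i div n ^ (k - l)) (fst z)" "oseg l (j div n ^ (k - l)) (snd z)"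
    using oseg_anc'[of l "k - l"] t by (auto simp: osq_def)
   have "seg l a (fst z)" "seg l b (snd z)" using z l(1) by (auto simp: circ_def sq_def)
   hence "i div n ^ (k - l) = a" "j div n ^ (k - l) = b" using oseg_seg_eq o2 by blast+
   hence "z \<in> osq l a b" using o2 by (simp add: osq_def)
   thus False using z l(1) by (simp add: circ_def)
  qed
  thus ?thesis by blast
 next
  case True
  hence h: "hole l a b" using l(2) by auto
  define m where "m = l - k"
  have m: "l = k + m" "m > 0" using True by (auto simp: m_def)
  define i' j' where "i' = a div n ^ m" and "j' = b div n ^ m"
  show ?thesis
  proof (cases "i' = i \<and> j' = j")
   case True
   have e: "a = i * n ^ m + a mod n ^ m" "b = j * n ^ m + b mod n ^ m"
    using True unfolding i'_def j'_def by (metis div_mult_mod_eq)+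
   have "hole (k + m) (i * n ^ m + a mod n ^ m) (j * n ^ m + b mod n ^ m)" using h e m by simp
   hence "hole m (a mod n ^ m) (b mod n ^ m)" using hole_bi[of "a mod n ^ m" m "b mod n ^ m" k i j] m(2) by simp
   thus ?thesis using l(1) e m(1) by metis
  next
   case False
   have "z \<notin> osq k i j" if z: "z \<in> Q" for z
   proof
    assume o: "z \<in> osq k i j"
    have "z \<in> sq (k + m) a b" using z l(1) m(1) by (simp add: circ_def)
    hence "z \<in> sq k i' j'" unfolding i'_def j'_def by (rule sq_anc)
    hence "i = i'" "j = j'" using o oseg_seg_eq unfolding sq_def osq_def by blast+
    thus False using False by blast
   qed
   thus ?thesis by blast
  qed
 qed
qed

text \<open>Transplants a function on the carpet into a cell and extends it by 0. The two parts fit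
  together when u vanishes on \<open>Out\<close>, which is why \<open>Out\<close> belongs to the
  constraint set \<open>B0\<close> in \<open>strict\<close>.\<close>

definition tp :: "nat => nat => nat => (plane => real) => plane => real" where
 "tp k i j u z = (if z \<in> sq k i j then u (bi k i j z) else 0)"

lemma tp_out: assumes "\<And>x. x \<in> Out ==> u x = 0" "z \<notin> osq k i j" shows "tp k i j u z = 0"
proof (cases "z \<in> sq k i j")
 case True
 hence "z \<in> circ k i j" using assms(2) by (simp add: circ_def)
 hence "bi k i j z \<in> Out" using circ_bi0 by blast
 thus ?thesis using assms(1) by (simp add: tp_def)
qed (simp add: tp_def)

text \<open>A segment leaving the cell crosses its boundary, where the function is already 0; the
  estimate inside the cell up to the crossing point suffices.\<close>

lemma Lip_tp:
 assumes r: "rem k i j" and u: "Lip u" "\<And>x. x \<in> Out ==> u x = 0"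
 shows "Lip (tp k i j u)"
proof -
 obtain L where L: "L \<ge> 0" "\<And>x y. x \<in> F ==> y \<in> F ==> \<bar>u x - u y\<bar> \<le> L * dist x y" by (rule LipE[OF u(1)]) (rule that)
 let ?t = "tp k i j u"
 have both: "\<bar>?t z - ?t w\<bar> \<le> L * rn k * dist z w" if zw: "z \<in> F" "w \<in> F" "z \<in> sq k i j" "w \<in> sq k i j" for z w
  using L(2)[OF bi_F[OF r zw(1,3)] bi_F[OF r zw(2,4)]] zw unfolding tp_def bi_dist by (simp add: mult.assoc)
 have one: "\<bar>?t z - ?t w\<bar> \<le> L * rn k * dist z w" if zw: "z \<in> F" "w \<in> F" "w \<notin> sq k i j" for z w
 proof (cases "z \<in> osq k i j")
  case True
  have w: "w \<notin> osq k i j" using zw(3) osq_sub_sq by blast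
  obtain y where y: "y \<in> closed_segment w z" "y \<in> circ k i j" using circ_crossing[OF True w] by blast
  have yF: "y \<in> F" "y \<in> sq k i j" "y \<notin> osq k i j" using y(2) circ_rem_F[OF r] by (auto simp: circ_def)
  have "?t w = ?t y" using tp_out[of u, OF u(2)] w yF(3) by simp
  hence "\<bar>?t z - ?t w\<bar> \<le> L * rn k * dist z y" using both[OF zw(1) yF(1) _ yF(2)] True osq_sub_sq by auto
  also have "... \<le> L * rn k * dist z w"
   using dist_in_closed_segment[OF y(1)] L(1) by (intro mult_left_mono) (auto simp: dist_commute)
  finally show ?thesis .
 next
  case False
  have "w \<notin> osq k i j" using zw(3) osq_sub_sq by blast
  thus ?thesis using tp_out[of u, OF u(2)] False L(1) by simp
 qed
 have lip: "\<bar>?t z - ?t w\<bar> \<le> L * rn k * dist z w" if zw: "z \<in> F" "w \<in> F" for z w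
 proof (cases "w \<in> sq k i j")
  case w: True
  show ?thesis
  proof (cases "z \<in> sq k i j")
   case True thus ?thesis using both zw w by blast
  next
   case False thus ?thesis using one[OF zw(2,1) False] by (simp add: abs_minus_commute dist_commute)
  qed
 next
  case False thus ?thesis using one[OF zw] by blast
 qed
 have L0: "0 \<le> L * rn k" using L(1) by simp
 show ?thesis by (rule LipI[OF L0 lip])
qed

lemma bi_im: "bi k i j ` circ (k + m) (i * n ^ m + a) (j * n ^ m + b) = circ m a b"
proof (intro equalityI subsetI)
 fix y assume y: "y \<in> circ m a b"
 define z where "z = ((fst y + real i) / rn k, (snd y + real j) / rn k)"
 have "bi k i j z = y" by (simp add: bi_def z_def)
 thus "y \<in> bi k i j ` circ (k + m) (i * n ^ m + a) (j * n ^ m + b)" using y circ_bi by (metis image_eqI)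
qed (use circ_bi in auto)

text \<open>Circles that avoid the open cell do not oscillate, and the blow-up sends the remaining
  ones to distinct circles, so self-similarity preserves the energy bound.\<close>

lemma ener_tp:
 assumes r: "rem k i j" and u: "\<And>x. x \<in> Out ==> u x = 0" and e: "ener u c"
 shows "ener (tp k i j u) c"
 unfolding ener_def
proof (intro allI impI)
 fix A assume A: "finite A" "A \<subseteq> Per"
 define A' where "A' = {C \<in> A. \<exists>m a b. hole m a b \<and> C = circ (k + m) (i * n ^ m + a) (j * n ^ m + b)}"
 have z: "osc (tp k i j u) C = 0" if C: "C \<in> A - A'" for C
 proof -
  have "C \<inter> osq k i j = {}" using Per_cell[OF _ r, of C] C A by (auto simp: A'_def)
  hence "tp k i j u x = 0" if "x \<in> C" for x using tp_out[of u, OF u] that by blast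
  hence "osc (tp k i j u) C = osc (\<lambda>_. 0 :: real) C" by (rule osc_cong)
  also have "... = 0" unfolding osc_def by (cases "C = {}") (auto simp: image_constant_conv)
  finally show ?thesis .
 qed
 have o: "osc (tp k i j u) C = osc u (bi k i j ` C) \<and> bi k i j ` C \<in> Per" if C: "C \<in> A'" for C
 proof -
  obtain m a b where m: "hole m a b" "C = circ (k + m) (i * n ^ m + a) (j * n ^ m + b)" using C by (auto simp: A'_def)
  have "x \<in> sq k i j" if "x \<in> C" for x
  proof -
   have "bi k i j x \<in> F" using that m circ_bi circ_hole_F by blast
   thus ?thesis using sq_bi F_unit by blast
  qed
  hence "osc (tp k i j u) C = osc (u \<circ> bi k i j) C" by (intro osc_cong) (simp add: tp_def)
  moreover have "bi k i j ` C \<in> Per" unfolding m(2) bi_im Per_def Holes_def using m(1) by blast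
  ultimately show ?thesis by (simp add: osc_comp)
 qed
 have inj: "inj_on ((`) (bi k i j)) A'"
  using bi_inj by (intro inj_onI) (metis inj_image_eq_iff injI)
 have "(\<Sum>C\<in>A. (osc (tp k i j u) C)\<^sup>2) = (\<Sum>C\<in>A'. (osc u (bi k i j ` C))\<^sup>2)"
  by (rule sum.mono_neutral_cong_right[OF A(1)]) (use z o in \<open>auto simp: A'_def\<close>)
 also have "... = (\<Sum>D\<in>(`) (bi k i j) ` A'. (osc u D)\<^sup>2)" by (simp add: sum.reindex[OF inj])
 also have "... \<le> c"
 proof (rule enerD[OF e])
  show "finite ((`) (bi k i j) ` A')" using A by (simp add: A'_def)
  show "(`) (bi k i j) ` A' \<subseteq> Per" using o by blast
 qed
 finally show "(\<Sum>C\<in>A. (osc (tp k i j u) C)\<^sup>2) \<le> c" .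
qed

text \<open>\<open>C\<close> and \<open>T\<close> are joined through small holes inside \<open>P\<close>, in a form bounding the drop of a function from below.\<close>

definition conn :: "real => plane set => plane set => plane set => bool" where
 "conn c P C T \<longleftrightarrow> (\<forall>v e d. Lip v \<longrightarrow> (\<forall>x\<in>C. v x = e) \<longrightarrow> (\<forall>x\<in>T. v x = 0) \<longrightarrow> 0 < d \<longrightarrow>
   (\<exists>A. finite A \<and> A \<subseteq> Holes \<and> (\<forall>Q\<in>A. Q \<subseteq> P) \<and> e \<le> c * (\<Sum>Q\<in>A. sz Q * osc v Q) + d))"

text \<open>The circles not smaller than C are those on which a competitor may be forced to vanish.
  Since P avoids them, a function can be raised along P without violating the constraints.\<close>

definition path :: "plane set => plane set => plane set => bool" where
 "path P C T \<longleftrightarrow> P \<subseteq> F \<and> closed P \<and> P \<noteq> {} \<and> (\<forall>D\<in>Per. sz C \<le> sz D \<longrightarrow> D \<noteq> C \<longrightarrow> D \<inter> P = {}) \<and> (\<exists>c>0. conn c P C T)"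

lemma connD:
 assumes "conn c P C T" "Lip v" "\<forall>x\<in>C. v x = e" "\<forall>x\<in>T. v x = 0" "0 < d"
 shows "\<exists>A. finite A \<and> A \<subseteq> Holes \<and> (\<forall>Q\<in>A. Q \<subseteq> P) \<and> e \<le> c * (\<Sum>Q\<in>A. sz Q * osc v Q) + d"
 using assms(1)[unfolded conn_def, rule_format, of v e d] assms(2-5) by simp

lemma connI:
 assumes "\<And>v e d. Lip v ==> \<forall>x\<in>C. v x = e ==> \<forall>x\<in>T. v x = 0 ==> 0 < d ==>
  \<exists>A. finite A \<and> A \<subseteq> Holes \<and> (\<forall>Q\<in>A. Q \<subseteq> P) \<and> e \<le> c * (\<Sum>Q\<in>A. sz Q * osc v Q) + d"
 shows "conn c P C T"
 unfolding conn_def by (intro allI impI) (rule assms)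

lemma lab_ge_Suc:
 assumes "l < k" "i < n ^ k" "j < n ^ k" "rem l (i div n ^ (k - l)) (j div n ^ (k - l))"
 shows "Suc l \<le> fst (lab k i j)"
proof -
 obtain m a b where L: "lab k i j = (m, a, b)" by (rule lab_ex)
 have lm: "l \<le> m" using lab_ge[of l k i j] assms L by simp
 have "m \<noteq> l"
 proof
  assume "m = l"
  hence "hole l (i div n ^ (k - l)) (j div n ^ (k - l))" using lab_props[OF assms(2,3) L] assms(1) by auto
  thus False using assms(4) hole_not_rem by blast
 qed
 thus ?thesis using lm L by simp
qed

text \<open>If an open set met such a circle, it would also contain points inside the hole, or
  points outside the unit square when the circle is \<open>Out\<close>; the stage
  \<open>St l\<close> contains neither.\<close>

lemma open_St_disj:
 assumes U: "open U" "U \<subseteq> St l" and D: "D \<in> Per" "1 / rn l \<le> sz D"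
 shows "D \<inter> U = {}"
proof -
 obtain m a b where m: "D = circ m a b" "hole m a b \<or> (m = 0 \<and> a = 0 \<and> b = 0)" using Per_cases[OF D(1)] .
 have "1 / rn l \<le> 1 / rn m" using D(2) m(1) sz_circ by simp
 hence "rn m \<le> rn l" by (simp add: field_simps)
 hence ml: "m \<le> l" using n5 by simp
 show ?thesis
 proof (intro equals0I)
  fix z assume z: "z \<in> D \<inter> U"
  from m(2) show False
  proof
   assume h: "hole m a b"
   have "z \<in> closure (osq m a b)" using z m(1) frontier_osq[of m a b] by (auto simp: frontier_def)
   hence "U \<inter> closure (osq m a b) \<noteq> {}" using z by blast
   hence "U \<inter> osq m a b \<noteq> {}" using open_Int_closure_eq_empty[OF U(1)] by simp
   then obtain w where w: "w \<in> osq m a b" "w \<in> U" by blast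
   then obtain s t where "rem l s t" "w \<in> sq l s t" using U(2) unfolding St_def by blast
   thus False using osq_hole_disj[OF h w(1) _ ml] by blast
  next
   assume o: "m = 0 \<and> a = 0 \<and> b = 0"
   have "St l \<subseteq> sq 0 0 0"
   proof (induction l)
    case 0 show ?case unfolding St_def by auto
   next
    case (Suc k) thus ?case using St_mono by blast
   qed
   hence "U \<subseteq> interior (sq 0 0 0)" using U by (intro interior_maximal) auto
   hence "z \<in> osq 0 0 0" using z interior_sq by blast
   thus False using z m(1) o by (auto simp: circ_def)
  qed
 qed
qed

text \<open>The path starts on the top side of C, rises within the columns of C, and turns right to
  the right side of the cell. The row above C has digit b + 1, which is neither p nor q, so it
  contains no hole of the generation of C. Survival of the right neighbour guarantees that the
  common side at the end of the path is not part of a large circle.\<close>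

lemma path_right:
 assumes r: "rem k i j" and rR: "rem k (Suc i) j" and ab: "a = p \<or> a = q" "b = p \<or> b = q"
 shows "\<exists>P. path P (circ (Suc k) (n * i + a) (n * j + b)) (circ k i j)"
proof -
 define l1 l2 A0 B1 R2 E0 where "l1 = Suc k" and "l2 = Suc (Suc k)" and "A0 = n * i + a" and "B1 = n * j + b + 1"
  and "R2 = B1 * n + 1" and "E0 = n * i + n"
 define N1 N2 where "N1 = rn l1" and "N2 = rn l2"
 have N: "N1 > 0" "N2 > 0" "N2 = N1 * real n" by (auto simp: N1_def N2_def l1_def l2_def)
 have ab': "1 \<le> a" "a + 2 \<le> n" "b + 2 \<le> n" "b + 1 \<noteq> p" "b + 1 \<noteq> q" using ab q_facts p1 by auto
 have bR: "B1 = n * j + (b + 1)" "b + 1 < n" using ab' by (auto simp: B1_def)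
 have remB: "rem l1 s B1" if s: "n * i \<le> s" "s \<le> E0" for s
 proof -
  have "(n * j + c) div n = j" "(n * j + c) mod n = c" if "c < n" for c using that by simp_all
  from this[OF bR(2)] have B: "B1 div n = j" "B1 mod n = b + 1" unfolding bR(1) .
  have nb: "\<not> bad x (b + 1)" for x using ab' by (simp add: bad_def)
  have "s div n = i \<or> s div n = Suc i"
  proof (cases "s = E0")
   case True thus ?thesis by (simp add: E0_def)
  next
   case False
   hence "i * n \<le> s" "s < (i + 1) * n" using s by (auto simp: E0_def algebra_simps)
   thus ?thesis using div_eqI by blast
  qed
  thus ?thesis unfolding l1_def rem.simps B using nb r rR by auto
 qed
 define C where "C = circ l1 A0 (n * j + b)"
 \<comment> \<open>The path minus the top side of C lies in this open part of stage
   \<open>l1\<close>, to which \<open>open_St_disj\<close> applies; the remaining points lie on C,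
   which is disjoint from the other circles.\<close>
 define U where "U = {z :: plane. (real A0 - 1 < fst z * N1 \<and> fst z * N1 < real E0 + 1) \<and> (real B1 < snd z * N1 \<and> snd z * N1 < real B1 + 1)}"
 have oU: "open U" unfolding U_def by (intro open_Collect_conj open_Collect_less continuous_intros)
 have US: "U \<subseteq> St l1"
 proof
  fix z assume z: "z \<in> U"
  define s where "s = nat \<lfloor>fst z * N1\<rfloor>"
  have "1 \<le> A0" using ab' by (simp add: A0_def)
  hence A1: "real A0 - 1 \<ge> 0" by simp
  have f: "fst z * N1 \<ge> 0" using z A1 by (auto simp: U_def)
  have s: "real s \<le> fst z * N1" "fst z * N1 < real s + 1" using f by (simp_all add: s_def)
  have "real A0 - 1 < real s + 1" "real s < real E0 + 1" using s z by (auto simp: U_def)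
  hence "real A0 < real (s + 2)" "real s < real (E0 + 1)" by simp_all
  hence "A0 < s + 2" "s < E0 + 1" unfolding of_nat_less_iff .
  hence "n * i \<le> s" "s \<le> E0" using ab' unfolding A0_def by linarith+
  hence "rem l1 s B1" by (rule remB)
  moreover have "z \<in> sq l1 s B1" using s z by (simp add: sq_def seg_def U_def N1_def)
  ultimately show "z \<in> St l1" unfolding St_def by blast
 qed
 \<comment> \<open>The horizontal part uses subrow 1 of the n subrows. This keeps it off the lower
   line of the row, where the top of another hole of the size of C may lie, and off the upper line,
   which may be the side of the cell.\<close>
 define P where "P = F \<inter> ({z. (real A0 \<le> fst z * N1 \<and> fst z * N1 \<le> real A0 + 1) \<and> (real B1 \<le> snd z * N1 \<and> snd z * N2 \<le> real R2 + 1)}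
   \<union> {z. (real A0 \<le> fst z * N1 \<and> fst z * N1 \<le> real E0) \<and> (real R2 \<le> snd z * N2 \<and> snd z * N2 \<le> real R2 + 1)})"
 have clP: "closed P" unfolding P_def
  by (intro closed_Int closed_F closed_Un closed_Collect_conj closed_Collect_le continuous_intros)
 have PF: "P \<subseteq> F" by (simp add: P_def)
 have hC: "hole l1 A0 (n * j + b)" using r ab q_facts ab' by (simp add: hole_def l1_def A0_def bad_def)
 have PU: "z \<in> C \<or> z \<in> U" if z: "z \<in> P" for z
 proof -
  have xr: "real A0 \<le> fst z * N1" "fst z * N1 \<le> real E0" using z ab' by (auto simp: P_def A0_def E0_def)
  have y2: "snd z * N2 \<le> real R2 + 1" using z by (auto simp: P_def)
  have e: "snd z * N2 = (snd z * N1) * real n" using N(3) by simp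
  have "(snd z * N1) * real n \<le> real B1 * real n + 2" using y2 unfolding e by (simp add: R2_def)
  also have "... < (real B1 + 1) * real n" using n5 by (simp add: distrib_right)
  finally have yu: "snd z * N1 < real B1 + 1" by simp
  show ?thesis
  proof (cases "real B1 < snd z * N1")
   case True thus ?thesis using xr yu by (simp add: U_def)
  next
   case False
   have "\<not> (real R2 \<le> snd z * N2)"
   proof
    assume "real R2 \<le> snd z * N2"
    also have "snd z * N2 \<le> real B1 * real n" unfolding e using False by (intro mult_right_mono) auto
    finally show False by (simp add: R2_def)
   qed
   hence 1: "fst z * N1 \<le> real A0 + 1" "real B1 \<le> snd z * N1" using z by (auto simp: P_def)
   hence "snd z * N1 = real (n * j + b) + 1" using False by (simp add: B1_def)
   hence "z \<in> C" unfolding C_def circ_alt using 1 xr by (simp add: sq_def seg_def N1_def)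
   thus ?thesis by blast
  qed
 qed
 have szC: "sz C = 1 / rn l1" by (simp add: C_def sz_circ)
 have CP: "C \<in> Per" using hC by (auto simp: C_def Per_def Holes_def)
 have dis: "D \<inter> P = {}" if D: "D \<in> Per" "sz C \<le> sz D" "D \<noteq> C" for D
  using open_St_disj[OF oU US D(1)] D(2) szC Per_disj[OF D(1) CP D(3)] PU by fastforce
 \<comment> \<open>Averaging over the columns of C, of total width 1 / N1, costs a factor N1;
   averaging over a subrow of height 1 / N2 costs N2, which is at least N1.\<close>
 define cc where "cc = 2 * N2"
 have chain: "\<exists>A. finite A \<and> A \<subseteq> Holes \<and> (\<forall>Q\<in>A. Q \<subseteq> P) \<and> e \<le> cc * (\<Sum>Q\<in>A. sz Q * osc v Q) + d"
  if v: "Lip v" "\<forall>x\<in>C. v x = e" "\<forall>x\<in>circ k i j. v x = 0" and d: "0 < d" for v e d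
 proof -
  have bd: "bounded (v ` F)" by (rule Lip_bounded[OF v(1)])
  have "(\<lambda>K. cc * sqrt (tail K v)) \<longlonglongrightarrow> cc * sqrt 0" by (intro tendsto_intros Lip_tail v)
  hence "\<forall>\<^sub>F K in sequentially. cc * sqrt (tail K v) < d" by (rule order_tendstoD(2)) (use d in simp)
  then obtain K0 where K0: "\<And>K. K \<ge> K0 ==> cc * sqrt (tail K v) < d" unfolding eventually_sequentially by blast
  define K where "K = max K0 l2"
  have K: "l2 \<le> K" "cc * sqrt (tail K v) < d" using K0 by (auto simp: K_def)
  have l1K: "l1 < K" "l1 \<le> K" using K(1) by (auto simp: l1_def l2_def)
  define m1 m2 where "m1 = n ^ (K - l1)" and "m2 = n ^ (K - l2)"
  have m: "m1 > 0" "m2 > 0" by (auto simp: m1_def m2_def)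
  have "K - l1 = Suc (K - l2)" using K(1) by (auto simp: l1_def l2_def)
  hence m12: "m1 = n * m2" by (simp add: m1_def m2_def)
  have NK: "n ^ K = n ^ l1 * m1" using l1K by (simp add: m1_def power_add[symmetric])
  have rNK: "real n ^ K = N1 * real m1" using NK unfolding N1_def by (metis of_nat_mult of_nat_power)
  have rNK2: "real n ^ K = N2 * real m2" unfolding rNK N(3) m12 by simp
  have fr: "real (c * m1) / real n ^ K = real c / N1" for c using m(1) unfolding rNK of_nat_mult by simp
  have rb: "Suc i < n ^ k" "j < n ^ k" using rem_bound[OF rR] by auto
  have E0n: "E0 < n ^ l1"
  proof -
   have "n * (Suc i + 1) \<le> n * n ^ k" using rb by (intro mult_le_mono2) simp
   hence "n * i + n + n \<le> n ^ l1" by (simp add: l1_def algebra_simps)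
   thus ?thesis unfolding E0_def using n5 by linarith
  qed
  have B1n: "B1 < n ^ l1"
  proof -
   have "n * (j + 1) \<le> n * n ^ k" using rb by (intro mult_le_mono2) simp
   thus ?thesis using bR by (simp add: l1_def)
  qed
  have below: "(c + 1) * m1 \<le> n ^ K" if "c < n ^ l1" for c unfolding NK using that by (intro mult_le_mono1) simp
  have AE: "A0 + 1 \<le> E0" "n * i \<le> A0" using ab' by (auto simp: A0_def E0_def)
  \<comment> \<open>I and J1 are the lattice columns and rows of the vertical part, X and J2 those
    of the horizontal part; \<open>m1\<close> and \<open>m2\<close> convert the generations
    \<open>l1\<close> and \<open>l2\<close> to K.\<close>
  define I J1 X J2 where "I = {A0 * m1..<(A0 + 1) * m1}" and "J1 = {B1 * m1..<(R2 + 1) * m2}"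
   and "X = {A0 * m1..<E0 * m1}" and "J2 = {R2 * m2..<(R2 + 1) * m2}"
  have R2b: "B1 * m1 < R2 * m2" "(R2 + 1) * m2 \<le> (B1 + 1) * m1"
  proof -
   show "B1 * m1 < R2 * m2" using m(2) unfolding R2_def m12 by (simp add: algebra_simps)
   have "(B1 * n + 2) * m2 \<le> (B1 * n + n) * m2" using n5 by (intro mult_le_mono1) simp
   thus "(R2 + 1) * m2 \<le> (B1 + 1) * m1" unfolding R2_def m12 by (simp add: algebra_simps)
  qed
  have J21: "J2 \<subseteq> J1" using R2b by (auto simp: J1_def J2_def)
  have IX: "I \<subseteq> X" using mult_le_mono1[OF AE(1), of m1] by (auto simp: I_def X_def)
  have XN: "x < n ^ K" if "x \<in> X" for x
  proof -
   have "E0 * m1 \<le> n ^ l1 * m1" using E0n by (intro mult_le_mono1) simp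
   moreover have "x < E0 * m1" using that by (simp add: X_def)
   ultimately show ?thesis unfolding NK by linarith
  qed
  have JN: "y < n ^ K" if "y \<in> J1" for y using that R2b below[OF B1n] by (simp add: J1_def)
  have jd: "y div m1 = B1" if "y \<in> J1" for y
   by (rule div_eqI) (use that R2b in \<open>auto simp: J1_def\<close>)
  have xd: "n * i \<le> x div m1" "x div m1 < E0" if "x \<in> X" for x
  proof -
   have "A0 \<le> x div m1" using that m(1) by (simp add: X_def less_eq_div_iff_mult_less_eq)
   thus "n * i \<le> x div m1" using AE by linarith
   show "x div m1 < E0" using that by (simp add: X_def less_mult_imp_div_less)
  qed
  have remX: "rem l1 (x div m1) (y div m1)" if "x \<in> X" "y \<in> J1" for x y
   using remB[OF xd(1)[OF that(1)]] xd(2)[OF that(1)] jd[OF that(2)] by simp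
  \<comment> \<open>All elements met here are strictly younger than C, because the row above C
    survives entirely in generation \<open>l1\<close>.\<close>
  have lv: "l2 \<le> fst (lab K x y)" if "x \<in> X" "y \<in> J1" for x y
   using lab_ge_Suc[OF l1K(1) XN[OF that(1)] JN[OF that(2)]] remX[OF that] by (simp add: m1_def l1_def l2_def)
  have lv': "l2 \<le> fst (lab K y x)" if "x \<in> X" "y \<in> J1" for x y
   using lab_ge_Suc[OF l1K(1) JN[OF that(2)] XN[OF that(1)]] remX[OF that] rem_swap by (simp add: m1_def l1_def l2_def)
  have l12: "l1 \<le> l2" by (simp add: l1_def l2_def)
  have A0m: "A0 * m1 \<in> X" "E0 * m1 - 1 \<in> X"
  proof -
   have "(A0 + 1) * m1 \<le> E0 * m1" using AE by (intro mult_le_mono1) simp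
   thus "A0 * m1 \<in> X" "E0 * m1 - 1 \<in> X" using m(1) AE by (auto simp: X_def)
  qed
  have B1m: "B1 * m1 \<in> J1" "(R2 + 1) * m2 - 1 \<in> J1" using R2b m by (auto simp: J1_def)
  have E0N: "E0 * m1 < n ^ K" unfolding NK using E0n m(1) by simp
  have B1p: "0 < B1 * m1" using m(1) by (simp add: B1_def)
  have A0p: "0 < A0 * m1" using m(1) ab' by (simp add: A0_def)
  have R2N: "(R2 + 1) * m2 < n ^ K"
  proof -
   have "(B1 * n + 2) * m2 < (B1 * n + n) * m2" using n5 m(2) by (intro mult_less_mono1) auto
   hence "(R2 + 1) * m2 < (B1 + 1) * m1" unfolding R2_def m12 by (simp add: algebra_simps)
   thus ?thesis using below[OF B1n] by linarith
  qed
  have colsep1: "lab K (B1 * m1 - 1) x \<noteq> lab K (B1 * m1) x" if x: "x \<in> X" for x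
   by (rule lab_sep[of l1]) (use l1K B1p JN[OF B1m(1)] XN[OF x] lv'[OF x B1m(1)] l12 in \<open>auto simp: m1_def\<close>)
  have colsep2: "lab K ((R2 + 1) * m2 - 1) x \<noteq> lab K ((R2 + 1) * m2) x" if x: "x \<in> X" for x
   by (rule lab_sep[of l2]) (use K(1) R2N m XN[OF x] lv'[OF x B1m(2)] in \<open>auto simp: m2_def\<close>)
  have rowsep1: "lab K (A0 * m1 - 1) y \<noteq> lab K (A0 * m1) y" if y: "y \<in> J1" for y
   by (rule lab_sep[of l1]) (use l1K A0p XN[OF A0m(1)] JN[OF y] lv[OF A0m(1) y] l12 in \<open>auto simp: m1_def\<close>)
  have rowsep2: "lab K (E0 * m1 - 1) y \<noteq> lab K (E0 * m1) y" if y: "y \<in> J1" for y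
   by (rule lab_sep[of l1]) (use l1K E0N m AE JN[OF y] lv[OF A0m(2) y] l12 in \<open>auto simp: m1_def\<close>)
  have satc: "sat K x (B1 * m1) ((R2 + 1) * m2)" if x: "x \<in> X" for x
   using colsep1[OF x] colsep2[OF x] R2N by (simp add: sat_def)
  have satr: "sat K y (A0 * m1) (E0 * m1)" if y: "y \<in> J1" for y
   using rowsep1[OF y] rowsep2[OF y] E0N by (simp add: sat_def)
  have start: "(real x / real n ^ K, real (B1 * m1) / real n ^ K) \<in> elt (lab K x (B1 * m1))" if x: "x \<in> I" for x
  proof -
   have xX: "x \<in> X" using x IX by blast
   have "(real (B1 * m1) / real n ^ K, real x / real n ^ K) \<in> elt (lab K (B1 * m1) x)"
    by (rule left_pt) (use JN[OF B1m(1)] XN[OF xX] colsep1[OF xX] in auto)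
   thus ?thesis unfolding elt_swap'[of _ K x] by simp
  qed
  have startC: "(real x / real n ^ K, real (B1 * m1) / real n ^ K) \<in> C" if x: "x \<in> I" for x
  proof -
   have "A0 * m1 \<le> x" "x \<le> (A0 + 1) * m1" using x by (auto simp: I_def)
   hence "real (A0 * m1) / real n ^ K \<le> real x / real n ^ K" "real x / real n ^ K \<le> real ((A0 + 1) * m1) / real n ^ K"
    by (intro divide_right_mono; simp only: of_nat_le_iff; simp)+
   hence "real x / real n ^ K \<in> {real A0 / rn l1..(real A0 + 1) / rn l1}" unfolding fr N1_def by (simp add: add.commute)
   from circ_horiz(2)[OF this, of "n * j + b"] show ?thesis unfolding C_def fr N1_def B1_def by (simp add: add.commute add.left_commute)
  qed
  have stop: "(real E0 / N1, real y / real n ^ K) \<in> elt (lab K (E0 * m1 - 1) y)" if y: "y \<in> J1" for y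
  proof -
   have s: "E0 * m1 - 1 + 1 = E0 * m1" using m(1) AE by simp
   have "(real (E0 * m1 - 1 + 1) / real n ^ K, real y / real n ^ K) \<in> elt (lab K (E0 * m1 - 1) y)"
    by (rule right_pt) (use XN[OF A0m(2)] JN[OF y] rowsep2[OF y] s in auto)
   thus ?thesis unfolding s fr .
  qed
  have stopT: "(real E0 / N1, real y / real n ^ K) \<in> circ k i j" if y: "y \<in> J1" for y
  proof -
   have "B1 * m1 \<le> y" "y \<le> (B1 + 1) * m1" using y R2b by (auto simp: J1_def)
   hence yb: "real (B1 * m1) / real n ^ K \<le> real y / real n ^ K" "real y / real n ^ K \<le> real ((B1 + 1) * m1) / real n ^ K"
    by (intro divide_right_mono; simp only: of_nat_le_iff; simp)+
   have N1k: "N1 = real n * rn k" by (simp add: N1_def l1_def)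
   have "gr k j = real (n * j) / N1" "(real j + 1) / rn k = real (n * j + n) / N1"
    unfolding N1k by (simp_all add: field_simps)
   moreover have "real (n * j) / N1 \<le> real B1 / N1" "real (B1 + 1) / N1 \<le> real (n * j + n) / N1"
    using N(1) ab' by (intro divide_right_mono; simp add: B1_def)+
   ultimately have "real y / real n ^ K \<in> {gr k j..(real j + 1) / rn k}" using yb unfolding fr by simp
   moreover have "real E0 / N1 = (real i + 1) / rn k" using n5 unfolding N1k E0_def by (simp add: field_simps)
   ultimately show ?thesis using circ_vert(2)[of _ j k i] by simp
  qed
  define CC where "CC x = (\<Sum>y\<in>J1. cost K v x y)" for x
  define RR where "RR y = (\<Sum>x\<in>X. cost K v x y)" for y
  \<comment> \<open>Every column in I crosses every row in J2 within both ranges, so the drop from e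
    on C to 0 on the side of the cell splits at the crossing.\<close>
  have key: "e \<le> CC x + RR y" if xy: "x \<in> I" "y \<in> J2" for x y
  proof -
   have xX: "x \<in> X" and yJ: "y \<in> J1" using xy IX J21 by auto
   have "elt (lab K x y) \<noteq> {}"
   proof (rule lab_cases[OF XN[OF xX] JN[OF yJ]])
    assume "rem K x y" "elt (lab K x y) = cell K (x, y)"
    thus ?thesis using rem_corners(1) by blast
   next
    fix m a b assume "elt (lab K x y) = circ m a b" thus ?thesis using circ_corners(1) by (metis empty_iff)
   qed
   then obtain S where S: "S \<in> elt (lab K x y)" by blast
   have "\<bar>v (real x / real n ^ K, real (B1 * m1) / real n ^ K) - v S\<bar> \<le> CC x"
    unfolding CC_def J1_def
    by (rule col_le[OF bd XN[OF xX] satc[OF xX] _ _ start[OF xy(1)] S]) (use B1m(1) yJ in \<open>auto simp: J1_def\<close>)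
   moreover have "\<bar>v S - v (real E0 / N1, real y / real n ^ K)\<bar> \<le> RR y"
    unfolding RR_def X_def
    by (rule row_le[OF bd JN[OF yJ] satr[OF yJ] _ _ S stop[OF yJ]]) (use A0m(2) xX in \<open>auto simp: X_def\<close>)
   ultimately show ?thesis using v(2,3) startC[OF xy(1)] stopT[OF yJ] by fastforce
  qed
  define Zc Zr where "Zc = I \<times> J1" and "Zr = X \<times> J2"
  have Z: "Zc \<subseteq> X \<times> J1" "Zr \<subseteq> X \<times> J1" using IX J21 by (auto simp: Zc_def Zr_def)
  have ZN: "X \<times> J1 \<subseteq> ix K \<times> ix K" using XN JN by auto
  have fin: "finite I" "finite J1" "finite X" "finite J2" by (auto simp: I_def J1_def X_def J2_def)
  define A where "A = HZ K Zc \<union> HZ K Zr"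
  have A: "finite A" "A \<subseteq> Holes" unfolding A_def using finite_HZ HZ_Holes fin by (auto simp: Zc_def Zr_def)
  have AP: "Q \<subseteq> P" if Q: "Q \<in> A" for Q
  proof -
   obtain Z0 where Z0: "Q \<in> HZ K Z0" "Z0 \<subseteq> Zc \<union> Zr" using Q unfolding A_def by blast
   obtain m' a' b' z where z: "Q = circ m' a' b'" "hole m' a' b'" "z \<in> Z0" "lab K (fst z) (snd z) = (m', a', b')"
    using Z0(1) unfolding HZ_def by auto
   define x y where "x = fst z" and "y = snd z"
   have h: "Q = circ m' a' b'" "hole m' a' b'" "(x, y) \<in> Zc \<union> Zr" "lab K x y = (m', a', b')"
    using z Z0(2) subsetD[OF Z0(2) z(3)] unfolding x_def y_def by simp_all
   have xy: "x \<in> X" "y \<in> J1" using h(3) Z by auto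
   have QF: "Q \<subseteq> F" using circ_hole_F[OF h(2)] h(1) by blast
   have "Q \<subseteq> sq l2 (x div m2) (y div m2)"
    using elt_sub_sq[OF XN[OF xy(1)] JN[OF xy(2)] lv[OF xy]] unfolding h(4) elt_hole[OF h(2)] h(1) m2_def .
   hence Qs: "real (x div m2) \<le> fst z * N2" "fst z * N2 \<le> real (x div m2) + 1"
     "real (y div m2) \<le> snd z * N2" "snd z * N2 \<le> real (y div m2) + 1" if "z \<in> Q" for z
    using that by (auto simp: sq_def seg_def N2_def)
   have dv: "c * n \<le> w div m2" if "c * m1 \<le> w" for c w
    using that m(2) unfolding m12 by (simp add: less_eq_div_iff_mult_less_eq mult.assoc)
   have dv2: "w div m2 + 1 \<le> c" if "w < c * m2" for c w using less_mult_imp_div_less[OF that] by simp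
   have conv: "real c \<le> t * N1" if "c * n \<le> D" "real D \<le> t * N2" for c D t
   proof -
    have "real c * real n \<le> real D" using that(1) by (metis of_nat_le_iff of_nat_mult)
    also have "real D \<le> t * N2" by (rule that(2))
    also have "... = (t * N1) * real n" unfolding N(3) by simp
    finally have "real c * real n \<le> (t * N1) * real n" .
    thus ?thesis by simp
   qed
   have conv2: "t * N1 \<le> real c" if "D + 1 \<le> c * n" "t * N2 \<le> real D + 1" for c D t
   proof -
    have "real D + 1 \<le> real c * real n" using that(1) by (metis of_nat_1 of_nat_add of_nat_le_iff of_nat_mult)
    moreover have "t * N2 = (t * N1) * real n" unfolding N(3) by simp
    ultimately have "(t * N1) * real n \<le> real c * real n" using that(2) by linarith
    thus ?thesis by simp
   qed
   show ?thesis
   proof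
    fix z assume z: "z \<in> Q"
    have X0: "real A0 \<le> fst z * N1" by (rule conv[OF dv Qs(1)[OF z]]) (use xy(1) in \<open>simp add: X_def\<close>)
    have "y < (R2 + 1) * m2" using xy(2) by (simp add: J1_def)
    hence "y div m2 + 1 \<le> R2 + 1" by (rule dv2)
    hence Y1: "snd z * N2 \<le> real R2 + 1" using Qs(4)[OF z] by linarith
    from h(3) show "z \<in> P"
    proof
     assume "(x, y) \<in> Zc"
     hence "x < ((A0 + 1) * n) * m2" by (simp add: Zc_def I_def m12 algebra_simps)
     hence "x div m2 + 1 \<le> (A0 + 1) * n" by (rule dv2)
     hence "fst z * N1 \<le> real (A0 + 1)" by (rule conv2[OF _ Qs(2)[OF z]])
     moreover have "real B1 \<le> snd z * N1" by (rule conv[OF dv Qs(3)[OF z]]) (use xy(2) in \<open>simp add: J1_def\<close>)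
     ultimately show ?thesis using X0 Y1 QF z by (auto simp: P_def)
    next
     assume zr: "(x, y) \<in> Zr"
     hence "x < (E0 * n) * m2" by (simp add: Zr_def X_def m12 mult.assoc)
     hence "x div m2 + 1 \<le> E0 * n" by (rule dv2)
     hence "fst z * N1 \<le> real E0" by (rule conv2[OF _ Qs(2)[OF z]])
     moreover have "R2 \<le> y div m2" using zr m(2) by (simp add: Zr_def J2_def less_eq_div_iff_mult_less_eq)
     hence "real R2 \<le> snd z * N2" using Qs(3)[OF z] by linarith
     ultimately show ?thesis using X0 Y1 QF z by (auto simp: P_def)
    qed
   qed
  qed
  define S where "S = (\<Sum>Q\<in>A. sz Q * osc v Q)"
  have nn: "0 \<le> sz Q * osc v Q" if "Q \<in> Holes" for Q
   using that Holes_Per sz_pos[of Q] osc_nonneg[OF Lip_bdP[OF v(1)], of Q] by (auto intro: mult_nonneg_nonneg)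
  have lin: "(\<Sum>(x, y)\<in>Z. cost K v x y) \<le> real n ^ K * (S + sqrt (tail K v))" if Zs: "Z \<subseteq> X \<times> J1" "HZ K Z \<subseteq> A" for Z
  proof -
   have "(\<Sum>Q\<in>HZ K Z. sz Q * osc v Q) \<le> S" unfolding S_def by (rule sum_mono2[OF A(1) Zs(2)]) (use nn A(2) in blast)
   hence "real n ^ K * (\<Sum>Q\<in>HZ K Z. sz Q * osc v Q) \<le> real n ^ K * S" by (intro mult_left_mono) auto
   moreover have "Z \<subseteq> ix K \<times> ix K" using Zs(1) ZN by (rule order_trans)
   ultimately show ?thesis using cost_lin[OF bd, of Z K] unfolding distrib_left by linarith
  qed
  have S0: "0 \<le> S + sqrt (tail K v)" unfolding S_def using nn A(2) by (intro add_nonneg_nonneg sum_nonneg) (auto simp: tail_nonneg)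
  have cards: "card I = m1" "card J2 = m2" by (auto simp: I_def J2_def)
  have "(\<Sum>x\<in>I. CC x) = (\<Sum>(x, y)\<in>Zc. cost K v x y)" unfolding CC_def Zc_def by (simp add: sum.cartesian_product)
  also have "... \<le> real n ^ K * (S + sqrt (tail K v))" by (rule lin[OF Z(1)]) (simp add: A_def)
  also have "... = real (card I) * (N1 * (S + sqrt (tail K v)))" unfolding cards rNK by simp
  finally obtain x where x: "x \<in> I" "CC x \<le> N1 * (S + sqrt (tail K v))"
   using exists_le_mean[OF fin(1)] cards(1) m(1) by force
  have "(\<Sum>y\<in>J2. RR y) = (\<Sum>(x, y)\<in>Zr. cost K v x y)" unfolding RR_def Zr_def by (rule sum_prod_le[OF fin(4) refl])
  also have "... \<le> real n ^ K * (S + sqrt (tail K v))" by (rule lin[OF Z(2)]) (simp add: A_def)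
  also have "... = real (card J2) * (N2 * (S + sqrt (tail K v)))" unfolding cards rNK2 by simp
  finally obtain y where y: "y \<in> J2" "RR y \<le> N2 * (S + sqrt (tail K v))"
   using exists_le_mean[OF fin(4)] cards(2) m(2) by force
  have "N1 * (S + sqrt (tail K v)) \<le> N2 * (S + sqrt (tail K v))"
   using S0 N n_ge1 by (intro mult_right_mono) (auto simp: mult_le_cancel_left1)
  hence "e \<le> cc * S + cc * sqrt (tail K v)" using key[OF x(1) y(1)] x(2) y(2) by (simp add: cc_def algebra_simps)
  hence "e \<le> cc * S + d" using K(2) by linarith
  thus ?thesis using A AP unfolding S_def by blast
 qed
 have "P \<noteq> {}"
 proof -
  define x y where "x = real A0 / N1" and "y = real B1 / N1"
  have "(x, y) \<in> C" using circ_corners(3)[of A0 l1 "n * j + b"]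
   by (simp add: C_def x_def y_def N1_def B1_def add.commute)
  hence "(x, y) \<in> F" using Per_F[OF CP] by blast
  moreover have "x * N1 = real A0" "y * N1 = real B1" using N by (simp_all add: x_def y_def)
  moreover from this have "y * N2 = real B1 * real n" unfolding N(3) by simp
  ultimately have "(x, y) \<in> P" by (simp add: P_def R2_def)
  thus ?thesis by blast
 qed
 moreover have "cc > 0" using N by (simp add: cc_def)
 ultimately have "path P C (circ k i j)" unfolding path_def using PF clP dis connI[of C "circ k i j" P cc, OF chain] by blast
 thus ?thesis unfolding C_def l1_def A0_def by blast
qed

text \<open>Transport by an isometric involution that keeps the sizes of circles; it reduces the
  other exits from a cell to \<open>path_right\<close>.\<close>

lemma path_inv:
 assumes t: "GF t" "t ` Out = Out" and inv: "\<And>z. t (t z) = z" and iso: "\<And>z w. dist (t z) (t w) = dist z w"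
  and s: "\<And>Q. Q \<in> Per ==> sz (t ` Q) = sz Q" and C: "C \<in> Per" and P: "path P C T"
 shows "path (t ` P) (t ` C) (t ` T)"
proof -
 have tt: "t ` t ` X = X" for X using inv by (simp add: image_comp comp_def)
 have mem: "z \<in> t ` X \<longleftrightarrow> t z \<in> X" for z X using inv by (metis image_iff)
 have PF: "P \<subseteq> F" and cl: "closed P" and ne: "P \<noteq> {}" and dis: "\<And>D. D \<in> Per ==> sz C \<le> sz D ==> D \<noteq> C ==> D \<inter> P = {}"
  using P unfolding path_def by blast+
 obtain c where c: "c > 0" "conn c P C T" using P unfolding path_def by blast
 have "t ` P \<subseteq> F" using PF GF_mem[OF t(1)] by blast
 moreover have "closed (t ` P)"
 proof -
  have "compact P" using PF cl compact_F by (metis compact_Int_closed inf.absorb_iff2)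
  hence "compact (t ` P)" using GF_cont[OF t(1)] PF by (intro compact_continuous_image) (rule continuous_on_subset)
  thus ?thesis by (rule compact_imp_closed)
 qed
 moreover have "t ` P \<noteq> {}" using ne by simp
 moreover have "D \<inter> t ` P = {}" if D: "D \<in> Per" "sz (t ` C) \<le> sz D" "D \<noteq> t ` C" for D
 proof -
  have "t ` D \<in> Per" by (rule GF_Per[OF t(1) D(1)])
  moreover have "sz C \<le> sz (t ` D)" using D(2) s[OF C] s[OF D(1)] by simp
  moreover have "t ` D \<noteq> C" using D(3) tt[of D] by auto
  ultimately have e: "t ` D \<inter> P = {}" by (rule dis)
  show ?thesis
  proof (intro equals0I)
   fix z assume "z \<in> D \<inter> t ` P"
   hence "t z \<in> t ` D \<inter> P" using mem by blast
   thus False using e by blast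
  qed
 qed
 moreover have "conn c (t ` P) (t ` C) (t ` T)"
 proof (rule connI)
  fix v e d assume v: "Lip v" "\<forall>x\<in>t ` C. v x = e" "\<forall>x\<in>t ` T. v x = 0" and d: "0 < (d :: real)"
  have L: "Lip (v \<circ> t)"
  proof -
   obtain L where L: "L \<ge> 0" "\<And>x y. x \<in> F ==> y \<in> F ==> \<bar>v x - v y\<bar> \<le> L * dist x y" by (rule LipE[OF v(1)]) (rule that)
   have lip: "\<bar>(v \<circ> t) x - (v \<circ> t) y\<bar> \<le> L * dist x y" if "x \<in> F" "y \<in> F" for x y
    using L(2)[OF GF_mem[OF t(1) that(1)] GF_mem[OF t(1) that(2)]] by (simp add: iso)
   show ?thesis by (rule LipI[OF L(1) lip])
  qed
  have vt: "\<forall>x\<in>C. (v \<circ> t) x = e" "\<forall>x\<in>T. (v \<circ> t) x = 0" using v(2,3) by auto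
  obtain A where A: "finite A" "A \<subseteq> Holes" "\<forall>Q\<in>A. Q \<subseteq> P" "e \<le> c * (\<Sum>Q\<in>A. sz Q * osc (v \<circ> t) Q) + d"
   using connD[OF c(2) L vt d] by (elim exE conjE)
  have inj: "inj_on ((`) t) A" by (rule inj_onI) (metis tt)
  have "(\<Sum>Q\<in>(`) t ` A. sz Q * osc v Q) = (\<Sum>Q\<in>A. sz (t ` Q) * osc v (t ` Q))" by (simp add: sum.reindex[OF inj])
  also have "... = (\<Sum>Q\<in>A. sz Q * osc (v \<circ> t) Q)"
  proof (rule sum.cong)
   fix Q assume "Q \<in> A"
   hence "Q \<in> Per" using A(2) Holes_Per by blast
   thus "sz (t ` Q) * osc v (t ` Q) = sz Q * osc (v \<circ> t) Q" by (simp add: s osc_comp)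
  qed simp
  finally have "e \<le> c * (\<Sum>Q\<in>(`) t ` A. sz Q * osc v Q) + d" using A(4) by simp
  moreover have "(`) t ` A \<subseteq> Holes" using A(2) GF_Holes[OF t] by blast
  moreover have "\<forall>Q\<in>(`) t ` A. Q \<subseteq> t ` P" using A(3) by blast
  ultimately show "\<exists>A. finite A \<and> A \<subseteq> Holes \<and> (\<forall>Q\<in>A. Q \<subseteq> t ` P) \<and> e \<le> c * (\<Sum>Q\<in>A. sz Q * osc v Q) + d"
   using A(1) by (intro exI[of _ "(`) t ` A"]) simp
 qed
 ultimately show ?thesis unfolding path_def using c(1) by blast
qed

lemma sz_swap: "Q \<in> Per ==> sz (prod.swap ` Q) = sz Q"
 by (elim Per_cases) (simp add: swap_image_circ sz_circ)

lemma sz_rx: assumes "Q \<in> Per" shows "sz (rx ` Q) = sz Q"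
proof -
 obtain m a b where m: "Q = circ m a b" "hole m a b \<or> (m = 0 \<and> a = 0 \<and> b = 0)" using Per_cases[OF assms] .
 have "a < n ^ m" using m(2) hole_bound by auto
 thus ?thesis unfolding m(1) by (simp add: rx_circ sz_circ)
qed

lemma rx_Out: "rx ` Out = Out" unfolding Out_def using rx_circ[of 0 0 0] by simp

lemma sub_Per: assumes "rem k i j" "a = p \<or> a = q" "b = p \<or> b = q" shows "circ (Suc k) (n * i + a) (n * j + b) \<in> Per"
proof -
 have "a < n" "b < n" using assms(2,3) q_facts by auto
 hence "hole (Suc k) (n * i + a) (n * j + b)" using assms by (simp add: hole_def bad_def)
 thus ?thesis by (auto simp: Per_def Holes_def)
qed

text \<open>If the vertical digit of the cell is p or q, its horizontal digit is not, and the
  sibling above survives. Otherwise its whole row of siblings survives, and one of them lies to the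
  right or to the left. The hypothesis \<open>1 \<le> k\<close> provides the parent.\<close>

lemma path_ex:
 assumes r: "rem k i j" and k: "1 \<le> k" and ab: "a = p \<or> a = q" "b = p \<or> b = q"
 shows "\<exists>P. path P (circ (Suc k) (n * i + a) (n * j + b)) (circ k i j)"
proof -
 obtain l where l: "k = Suc l" using k by (cases k) auto
 have rl: "rem l (i div n) (j div n)" "\<not> bad (i mod n) (j mod n)" using r unfolding l by auto
 have step: "rem k (Suc i) j" if "Suc (i mod n) < n" "\<not> bad (Suc (i mod n)) (j mod n)"
 proof -
  have "Suc i div n = i div n" "Suc i mod n = Suc (i mod n)" using that(1) by (simp_all add: div_Suc mod_Suc)
  thus ?thesis unfolding l using rl(1) that(2) by simp
 qed
 consider (R) "rem k (Suc i) j" | (L) "i > 0" "rem k (i - 1) j" | (T) "rem k i (Suc j)"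
 proof (cases "j mod n = p \<or> j mod n = q")
  case True
  have lt: "Suc (j mod n) < n" using True q_facts by auto
  have "Suc j div n = j div n" "Suc j mod n = Suc (j mod n)" using lt by (simp_all add: div_Suc mod_Suc)
  moreover have "\<not> bad (i mod n) (Suc (j mod n))" using True rl(2) by (auto simp: bad_def)
  ultimately have "rem k i (Suc j)" unfolding l using rl(1) by simp
  thus ?thesis using that(3) by blast
 next
  case F: False
  hence nb: "\<not> bad x (j mod n)" for x by (simp add: bad_def)
  show ?thesis
  proof (cases "Suc (i mod n) < n")
   case True thus ?thesis using that(1) step nb by blast
  next
   case False
   hence im: "i mod n > 0" using n5 by linarith
   hence ip: "i > 0" by (metis gr0I mod_0)
   have "(i - 1) div n = i div n" using im div_Suc[of "i - 1" n] mod_Suc[of "i - 1" n] ip by (simp split: if_splits)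
   hence "rem k (i - 1) j" unfolding l using rl(1) nb by simp
   thus ?thesis using that(2) ip by blast
  qed
 qed
 thus ?thesis
 proof cases
  case R thus ?thesis by (rule path_right[OF r _ ab])
 next
  case T
  have "\<exists>P. path P (circ (Suc k) (n * j + b) (n * i + a)) (circ k j i)"
   by (rule path_right) (use r T rem_swap ab in auto)
  then obtain P where P: "path P (circ (Suc k) (n * j + b) (n * i + a)) (circ k j i)" by blast
  have rs: "rem k j i" using r rem_swap by simp
  from path_inv[OF GF_swap swap_Out _ dist_swap sz_swap sub_Per[OF rs ab(2,1)] P]
  show ?thesis unfolding swap_image_circ by auto
 next
  case L
  define i' where "i' = n ^ k - 1 - i"
  define a' where "a' = n - 1 - a"
  have iN: "i < n ^ k" using rem_bound[OF r] by blast
  have aN: "a < n" "a' = p \<or> a' = q" using ab q_facts by (auto simp: a'_def)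
  have ii: "n ^ k - 1 - i' = i" "i' < n ^ k" using iN by (auto simp: i'_def)
  have r1: "rem k i' j" unfolding i'_def using rem_reflect[OF iN] r by simp
  have "Suc i' = n ^ k - 1 - (i - 1)" using iN L(1) by (simp add: i'_def)
  hence r2: "rem k (Suc i') j" using rem_reflect[of "i - 1" k j] iN L by simp
  obtain P where P: "path P (circ (Suc k) (n * i' + a') (n * j + b)) (circ k i' j)"
   using path_right[OF r1 r2 aN(2) ab(2)] by blast
  have "n * i' + n * i + n = n ^ Suc k"
  proof -
   have "n * i' + n * i + n = n * (i' + i + 1)" by (simp add: algebra_simps)
   also have "i' + i + 1 = n ^ k" using iN by (simp add: i'_def)
   finally show ?thesis by simp
  qed
  hence e: "n ^ Suc k - 1 - (n * i' + a') = n * i + a" "n * i' + a' < n ^ Suc k" using aN(1) by (auto simp: a'_def)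
  from path_inv[OF GF_rx rx_Out rx_rx dist_rx sz_rx sub_Per[OF r1 aN(2) ab(2)] P]
  show ?thesis unfolding rx_circ[OF ii(2)] rx_circ[OF e(2)] ii(1) e(1) by blast
 qed
qed

lemma osc_attained:
 assumes "Lip u" "Q \<in> Per"
 obtains x y where "x \<in> Q" "y \<in> Q" "\<And>z. z \<in> Q ==> u x \<le> u z \<and> u z \<le> u y" "osc u Q = u y - u x"
proof -
 have c: "continuous_on Q u" by (rule continuous_on_subset[OF Lip_cont[OF assms(1)] Per_F[OF assms(2)]])
 obtain x where x: "x \<in> Q" "\<And>z. z \<in> Q ==> u x \<le> u z"
  using continuous_attains_inf[OF Per_compact[OF assms(2)] Per_nonempty[OF assms(2)] c] by blast
 obtain y where y: "y \<in> Q" "\<And>z. z \<in> Q ==> u z \<le> u y"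
  using continuous_attains_sup[OF Per_compact[OF assms(2)] Per_nonempty[OF assms(2)] c] by blast
 have "u y - u x \<le> osc u Q" using osc_ge[OF Lip_bdP[OF assms] y(1) x(1)] by (simp add: dist_real_def)
 moreover have "osc u Q \<le> u y - u x"
 proof (rule osc_le)
  fix z w assume "z \<in> Q" "w \<in> Q"
  thus "dist (u z) (u w) \<le> u y - u x" using x(2)[of z] x(2)[of w] y(2)[of z] y(2)[of w] by (simp add: dist_real_def)
 qed (use x(2)[OF y(1)] in simp)
 ultimately have "osc u Q = u y - u x" by (rule antisym[rotated])
 moreover have "u x \<le> u z \<and> u z \<le> u y" if "z \<in> Q" for z using x(2)[OF that] y(2)[OF that] ..
 ultimately show thesis using that[OF x(1) y(1)] by blast
qed

lemma Lip_min: assumes "Lip u" shows "Lip (\<lambda>x. min (u x) e)"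
proof -
 obtain L where L: "L \<ge> 0" "\<And>x y. x \<in> F ==> y \<in> F ==> \<bar>u x - u y\<bar> \<le> L * dist x y" by (rule LipE[OF assms]) (rule that)
 have lip: "\<bar>min (u x) e - min (u y) e\<bar> \<le> L * dist x y" if "x \<in> F" "y \<in> F" for x y
  using L(2)[OF that] by (simp add: min_def abs_if split: if_splits)
 show ?thesis by (rule LipI[OF L(1) lip])
qed

lemma Lip_max_mult: assumes "Lip u" "Lip v" "0 \<le> e" shows "Lip (\<lambda>x. max (u x) (e * v x))"
proof -
 obtain L where L: "L \<ge> 0" "\<And>x y. x \<in> F ==> y \<in> F ==> \<bar>u x - u y\<bar> \<le> L * dist x y" by (rule LipE[OF assms(1)]) (rule that)
 obtain M where M: "M \<ge> 0" "\<And>x y. x \<in> F ==> y \<in> F ==> \<bar>v x - v y\<bar> \<le> M * dist x y" by (rule LipE[OF assms(2)]) (rule that)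
 have mx: "\<bar>max a b - max c d\<bar> \<le> \<bar>a - c\<bar> + \<bar>b - d\<bar>" for a b c d :: real by (simp add: max_def abs_if)
 have lip: "\<bar>max (u x) (e * v x) - max (u y) (e * v y)\<bar> \<le> (L + e * M) * dist x y" if xy: "x \<in> F" "y \<in> F" for x y
 proof -
  have "e * \<bar>v x - v y\<bar> \<le> e * (M * dist x y)" using M(2)[OF xy] assms(3) by (rule mult_left_mono)
  moreover have "\<bar>e * v x - e * v y\<bar> = e * \<bar>v x - v y\<bar>" using assms(3) by (simp add: right_diff_distrib[symmetric] abs_mult)
  ultimately have "\<bar>max (u x) (e * v x) - max (u y) (e * v y)\<bar> \<le> L * dist x y + e * (M * dist x y)"
   using mx[of "u x" "e * v x" "u y" "e * v y"] L(2)[OF xy] by linarith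
  thus ?thesis by (simp add: algebra_simps)
 qed
 have L0: "0 \<le> L + e * M" using L(1) M(1) assms(3) by simp
 show ?thesis by (rule LipI[OF L0 lip])
qed

text \<open>First variation of the energy under \<open>u \<mapsto> max u (e \<eta>)\<close>.\<close>

lemma perturb:
 assumes u: "adm C B u" "ener u E" and \<eta>: "Lip \<eta>" "\<And>x. \<eta> x \<le> 1" "\<And>D x. D \<in> B ==> x \<in> D ==> \<eta> x = 0" "ener \<eta> H"
  and e: "0 < e" "e \<le> 1" and P: "finite P" "P \<subseteq> Per" "\<And>Q x. Q \<in> P ==> x \<in> Q ==> \<eta> x = 1"
 shows "(\<Sum>Q\<in>P. osc (\<lambda>x. min (u x) e) Q * osc u Q) \<le> E + e\<^sup>2 * H - cap C B"
proof -
 define w where "w x = max (u x) (e * \<eta> x)" for x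
 define v where "v x = min (u x) e" for x
 have Lu: "Lip u" using u(1) by (simp add: adm_def)
 have Lw: "Lip w" unfolding w_def by (rule Lip_max_mult[OF Lu \<eta>(1)]) (use e in simp)
 have aw: "adm C B w"
 proof -
  have le: "e * \<eta> x \<le> 1" for x
  proof -
   have "e * \<eta> x \<le> e * 1" using \<eta>(2) e by (intro mult_left_mono) auto
   also have "... \<le> 1" using e by simp
   finally show ?thesis .
  qed
  have "w x = 1" if "x \<in> C" for x using le[of x] u(1) that unfolding adm_def w_def by (simp add: max_absorb1)
  moreover have "w x = 0" if "D \<in> B" "x \<in> D" for D x
  proof -
   have "u x = 0" using u(1) that unfolding adm_def by blast
   thus ?thesis using \<eta>(3)[OF that] by (simp add: w_def)
  qed
  ultimately show ?thesis using Lw unfolding adm_def by blast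
 qed
 have gen: "(osc w Q)\<^sup>2 \<le> (osc u Q)\<^sup>2 + e\<^sup>2 * (osc \<eta> Q)\<^sup>2" if Q: "Q \<in> Per" for Q
 proof -
  note b = Lip_bdP[OF Lu Q] Lip_bdP[OF \<eta>(1) Q] Lip_bdP[OF Lw Q]
  have o: "0 \<le> osc u Q" "0 \<le> osc \<eta> Q" "0 \<le> osc w Q" using osc_nonneg b by blast+
  have "osc w Q \<le> max (osc u Q) (e * osc \<eta> Q)"
  proof (rule osc_le)
   fix x y assume xy: "x \<in> Q" "y \<in> Q"
   have 1: "\<bar>u x - u y\<bar> \<le> osc u Q" "\<bar>\<eta> x - \<eta> y\<bar> \<le> osc \<eta> Q"
    using osc_ge[OF b(1) xy] osc_ge[OF b(2) xy] by (simp_all add: dist_real_def)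
   have "\<bar>e * \<eta> x - e * \<eta> y\<bar> = e * \<bar>\<eta> x - \<eta> y\<bar>" using e by (simp add: right_diff_distrib[symmetric] abs_mult)
   also have "... \<le> e * osc \<eta> Q" using 1(2) e by (intro mult_left_mono) auto
   finally have 2: "\<bar>e * \<eta> x - e * \<eta> y\<bar> \<le> e * osc \<eta> Q" .
   have mx: "\<bar>max a b - max c d\<bar> \<le> max \<bar>a - c\<bar> \<bar>b - d\<bar>" for a b c d :: real by (simp add: max_def abs_if)
   have "\<bar>w x - w y\<bar> \<le> max \<bar>u x - u y\<bar> \<bar>e * \<eta> x - e * \<eta> y\<bar>" unfolding w_def by (rule mx)
   also have "... \<le> max (osc u Q) (e * osc \<eta> Q)" by (rule max.mono[OF 1(1) 2])
   finally show "dist (w x) (w y) \<le> max (osc u Q) (e * osc \<eta> Q)" by (simp add: dist_real_def)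
  qed (use o e in \<open>simp add: le_max_iff_disj\<close>)
  hence "(osc w Q)\<^sup>2 \<le> (max (osc u Q) (e * osc \<eta> Q))\<^sup>2" using o(3) by (rule power_mono)
  also have "... \<le> (osc u Q)\<^sup>2 + (e * osc \<eta> Q)\<^sup>2" by (simp add: max_def)
  finally show ?thesis by (simp add: power_mult_distrib)
 qed
 \<comment> \<open>Where \<eta> = 1, raising u to the level e removes from the range of u exactly
   the range of the truncation v, so osc w + osc v is at most osc u and the square drops by at least
   osc v times osc u.\<close>
 have inP: "(osc w Q)\<^sup>2 \<le> (osc u Q)\<^sup>2 - osc v Q * osc u Q" if QP: "Q \<in> P" for Q
 proof -
  have Q: "Q \<in> Per" using QP P(2) by blast
  obtain x y where x: "x \<in> Q" "y \<in> Q" "\<And>z. z \<in> Q ==> u x \<le> u z \<and> u z \<le> u y" "osc u Q = u y - u x"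
   by (rule osc_attained[OF Lu Q]) (rule that)
  have xy: "u x \<le> u y" using x(3)[OF x(2)] by blast
  have w: "w z = max (u z) e" if "z \<in> Q" for z using P(3)[OF QP that] by (simp add: w_def)
  have ov: "osc v Q \<le> min (u y) e - min (u x) e"
  proof (rule osc_le)
   fix z z' assume "z \<in> Q" "z' \<in> Q"
   thus "dist (v z) (v z') \<le> min (u y) e - min (u x) e"
    using x(3)[of z] x(3)[of z'] by (simp add: v_def dist_real_def min_def abs_if)
  qed (use xy in \<open>simp add: min_def\<close>)
  have ow: "osc w Q \<le> max (u y) e - max (u x) e"
  proof (rule osc_le)
   fix z z' assume "z \<in> Q" "z' \<in> Q"
   thus "dist (w z) (w z') \<le> max (u y) e - max (u x) e"
    using x(3)[of z] x(3)[of z'] by (simp add: w dist_real_def max_def abs_if)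
  qed (use xy in \<open>simp add: max_def\<close>)
  have sum: "osc w Q \<le> osc u Q - osc v Q'" if "osc v Q' = min (u y) e - min (u x) e" for Q'
   using ow that x(4) by (simp add: min_def max_def split: if_splits)
  have ov': "osc v Q = min (u y) e - min (u x) e"
   using ov osc_ge[OF Lip_bdP[OF Lip_min[OF Lu] Q] x(2,1), of e] xy unfolding v_def by (simp add: dist_real_def)
  have 1: "osc w Q \<le> osc u Q - osc v Q" by (rule sum[OF ov'])
  have 2: "0 \<le> osc w Q" by (rule osc_nonneg[OF Lip_bdP[OF Lw Q]])
  have 3: "0 \<le> osc v Q" unfolding ov' using xy by (simp add: min_def)
  have "(osc w Q)\<^sup>2 \<le> (osc u Q - osc v Q) * osc u Q" unfolding power2_eq_square
   using 1 2 3 by (intro mult_mono) auto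
  thus ?thesis by (simp add: left_diff_distrib power2_eq_square)
 qed
 define S where "S = (\<Sum>Q\<in>P. osc v Q * osc u Q)"
 have "ener w (E + e\<^sup>2 * H - S)" unfolding ener_def
 proof (intro allI impI)
  fix A assume A: "finite A" "A \<subseteq> Per"
  have AP: "finite (A \<union> P)" "A \<union> P \<subseteq> Per" using A P by auto
  have "(\<Sum>Q\<in>A. (osc w Q)\<^sup>2) \<le> (\<Sum>Q\<in>A \<union> P. (osc w Q)\<^sup>2)" by (rule sum_mono2[OF AP(1)]) auto
  also have "... \<le> (\<Sum>Q\<in>A \<union> P. ((osc u Q)\<^sup>2 + e\<^sup>2 * (osc \<eta> Q)\<^sup>2) - (if Q \<in> P then osc v Q * osc u Q else 0))"
  proof (rule sum_mono)
   fix Q assume Q: "Q \<in> A \<union> P"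
   have "0 \<le> e\<^sup>2 * (osc \<eta> Q)\<^sup>2" by simp
   thus "(osc w Q)\<^sup>2 \<le> ((osc u Q)\<^sup>2 + e\<^sup>2 * (osc \<eta> Q)\<^sup>2) - (if Q \<in> P then osc v Q * osc u Q else 0)"
   proof (cases "Q \<in> P")
    case True thus ?thesis using inP[of Q] \<open>0 \<le> e\<^sup>2 * (osc \<eta> Q)\<^sup>2\<close> unfolding if_P[OF True] by linarith
   next
    case False
    have "Q \<in> Per" using Q AP(2) by blast
    thus ?thesis using gen[of Q] False by simp
   qed
  qed
  also have "... = (\<Sum>Q\<in>A \<union> P. (osc u Q)\<^sup>2) + e\<^sup>2 * (\<Sum>Q\<in>A \<union> P. (osc \<eta> Q)\<^sup>2) - (\<Sum>Q\<in>A \<union> P. if Q \<in> P then osc v Q * osc u Q else 0)"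
   by (simp add: sum_subtractf sum.distrib sum_distrib_left)
  finally have 1: "(\<Sum>Q\<in>A. (osc w Q)\<^sup>2) \<le> (\<Sum>Q\<in>A \<union> P. (osc u Q)\<^sup>2) + e\<^sup>2 * (\<Sum>Q\<in>A \<union> P. (osc \<eta> Q)\<^sup>2)
    - (\<Sum>Q\<in>A \<union> P. if Q \<in> P then osc v Q * osc u Q else 0)" .
  have 2: "(\<Sum>Q\<in>A \<union> P. if Q \<in> P then osc v Q * osc u Q else 0) = S"
   unfolding S_def by (rule sum.mono_neutral_cong_right[OF AP(1)]) auto
  have 3: "(\<Sum>Q\<in>A \<union> P. (osc u Q)\<^sup>2) \<le> E" by (rule enerD[OF u(2) AP])
  have 4: "e\<^sup>2 * (\<Sum>Q\<in>A \<union> P. (osc \<eta> Q)\<^sup>2) \<le> e\<^sup>2 * H" by (intro mult_left_mono enerD[OF \<eta>(4) AP]) simp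
  show "(\<Sum>Q\<in>A. (osc w Q)\<^sup>2) \<le> E + e\<^sup>2 * H - S" using 1 2 3 4 by linarith
 qed
 hence "cap C B \<le> E + e\<^sup>2 * H - S" by (rule cap_le[OF aw])
 thus ?thesis unfolding S_def v_def by linarith
qed

text \<open>Pigeonhole: the \<open>card N + 1\<close> open windows between
  \<open>\<tau> * r ^ i\<close> and \<open>M * r ^ i\<close>, with r = \<tau> / M, are disjoint, so
  one of them contains no value of \<rho> on N.\<close>

lemma good_scale:
 fixes \<rho> :: "'a => real" and \<tau> M :: real
 assumes N: "finite N" and \<tau>: "0 < \<tau>" "\<tau> \<le> M"
 shows "\<exists>i\<le>card N. \<forall>Q\<in>N. \<rho> Q \<le> \<tau> * (\<tau> / M) ^ i \<or> M * (\<tau> / M) ^ i \<le> \<rho> Q"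
proof (rule ccontr)
 assume "\<not> ?thesis"
 hence "\<forall>i\<in>{..card N}. \<exists>Q\<in>N. \<tau> * (\<tau> / M) ^ i < \<rho> Q \<and> \<rho> Q < M * (\<tau> / M) ^ i"
  by (metis (no_types, lifting) atMost_iff not_le)
 then obtain f where f: "\<And>i. i \<le> card N ==> f i \<in> N \<and> \<tau> * (\<tau> / M) ^ i < \<rho> (f i) \<and> \<rho> (f i) < M * (\<tau> / M) ^ i"
  by (metis atMost_iff)
 have M: "M > 0" using \<tau> by simp
 have ne: "f i \<noteq> f j" if ij: "i < j" "j \<le> card N" for i j
 proof
  assume eq: "f i = f j"
  have "M * (\<tau> / M) ^ j \<le> M * (\<tau> / M) ^ Suc i"
   using ij \<tau> M by (intro mult_left_mono power_decreasing) auto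
  also have "... = \<tau> * (\<tau> / M) ^ i" using M by simp
  finally show False using f[of i] f[of j] ij eq by simp
 qed
 have "inj_on f {..card N}"
 proof (rule inj_onI)
  fix i j assume "i \<in> {..card N}" "j \<in> {..card N}" "f i = f j"
  thus "i = j" using ne[of i j] ne[of j i] by (metis atMost_iff linorder_neqE_nat)
 qed
 hence "card {..card N} \<le> card N" using f by (intro card_inj_on_le[OF _ _ N]) auto
 thus False by simp
qed

text \<open>The Cauchy property of the sum of squared sizes, obtained from the supremum of its
  finite partial sums.\<close>

lemma small_rest:
 assumes "t > 0" shows "\<exists>N. finite N \<and> N \<subseteq> Holes \<and> (\<forall>A. finite A \<longrightarrow> A \<subseteq> Holes - N \<longrightarrow> (\<Sum>Q\<in>A. (sz Q)\<^sup>2) \<le> t)"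
proof -
 define S where "S = {(\<Sum>Q\<in>A. (sz Q)\<^sup>2) |A. finite A \<and> A \<subseteq> Holes}"
 have ne: "S \<noteq> {}" unfolding S_def by blast
 have bd: "bdd_above S" unfolding S_def using packing1 by (intro bdd_aboveI[of _ 1]) auto
 obtain s where s: "s \<in> S" "Sup S - t < s" using less_cSupD[OF ne, of "Sup S - t"] assms by auto
 then obtain N where N: "finite N" "N \<subseteq> Holes" "s = (\<Sum>Q\<in>N. (sz Q)\<^sup>2)" unfolding S_def by blast
 have "(\<Sum>Q\<in>A. (sz Q)\<^sup>2) \<le> t" if A: "finite A" "A \<subseteq> Holes - N" for A
 proof -
  have "(\<Sum>Q\<in>N \<union> A. (sz Q)\<^sup>2) \<in> S" unfolding S_def using N A by blast
  hence "(\<Sum>Q\<in>N \<union> A. (sz Q)\<^sup>2) \<le> Sup S" using bd by (rule cSup_upper)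
  moreover have "(\<Sum>Q\<in>N \<union> A. (sz Q)\<^sup>2) = s + (\<Sum>Q\<in>A. (sz Q)\<^sup>2)"
   unfolding N(3) by (rule sum.union_disjoint) (use N A in auto)
  ultimately show ?thesis using s(2) by linarith
 qed
 thus ?thesis using N by blast
qed

text \<open>A circle of B that enters the open cell is at least as large as C, hence of generation
  exactly k + 1; the blow-up sends it to one of the four largest holes, where u is 0 by the choice
  of \<open>B0\<close>.\<close>

lemma adm_tp:
 assumes r: "rem k i j" and k: "1 \<le> k" and ab: "a = p \<or> a = q" "b = p \<or> b = q"
  and B: "B \<subseteq> Per" "\<And>D. D \<in> B ==> sz (circ (Suc k) (n * i + a) (n * j + b)) \<le> sz D"
  and B0: "Out \<in> B0" "\<And>a' b'. hole 1 a' b' ==> circ (Suc k) (n * i + a') (n * j + b') \<in> B ==> circ 1 a' b' \<in> B0"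
  and u: "adm (circ 1 a b) B0 u"
 shows "adm (circ (Suc k) (n * i + a) (n * j + b)) B (tp k i j u)"
proof -
 have uO: "u x = 0" if "x \<in> Out" for x using u B0(1) that by (simp add: adm_def)
 have cb: "z \<in> circ (Suc k) (n * i + a') (n * j + b') \<longleftrightarrow> bi k i j z \<in> circ 1 a' b'" for z a' b'
  using circ_bi[of z k 1 i a' j b'] by (simp add: mult.commute)
 have "Lip (tp k i j u)" by (rule Lip_tp[OF r adm_Lip[OF u] uO])
 moreover have "tp k i j u x = 1" if x: "x \<in> circ (Suc k) (n * i + a) (n * j + b)" for x
 proof -
  have bx: "bi k i j x \<in> circ 1 a b" using x cb by blast
  have "hole 1 a b" using ab q_facts by (auto simp: hole_def bad_def)
  hence "bi k i j x \<in> F" using circ_hole_F bx by blast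
  hence "x \<in> sq k i j" using sq_bi F_unit by blast
  thus ?thesis using bx u by (simp add: tp_def adm_def)
 qed
 moreover have "tp k i j u x = 0" if D: "D \<in> B" "x \<in> D" for D x
 proof (cases "x \<in> osq k i j")
  case True
  have "D \<in> Per" using D B by blast
  then obtain m a' b' where m: "hole m a' b'" "D = circ (k + m) (i * n ^ m + a') (j * n ^ m + b')"
   using Per_cell[OF _ r, of D] True D by blast
  have "1 / rn (Suc k) \<le> 1 / rn (k + m)" using B(2)[OF D(1)] unfolding m(2) sz_circ .
  hence "rn (k + m) \<le> rn (Suc k)" by (simp add: field_simps del: power_Suc)
  hence "k + m \<le> Suc k" using n5 by (simp add: power_le_imp_le_exp del: power_Suc)
  hence m1: "m = 1" using hole_pos(3)[OF m(1)] by simp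
  have Dm: "D = circ (Suc k) (n * i + a') (n * j + b')" using m(2) m1 by (simp add: mult.commute)
  hence "circ 1 a' b' \<in> B0" using B0(2) m(1) m1 D(1) by blast
  moreover have "bi k i j x \<in> circ 1 a' b'" using D(2) Dm cb by blast
  ultimately show ?thesis using u by (simp add: tp_def adm_def)
 next
  case False thus ?thesis by (rule tp_out[rotated]) (rule uO)
 qed
 ultimately show ?thesis unfolding adm_def by blast
qed

text \<open>Inside a proper cell the circle \<open>C\<close> sees less than a copy of the whole carpet, because the
 boundary of the cell is not constrained and part of the energy can leak through it.\<close>

lemma strict:
 assumes r: "rem k i j" and k: "1 \<le> k" and ab: "a = p \<or> a = q" "b = p \<or> b = q"
  and C: "C = circ (Suc k) (n * i + a) (n * j + b)"
  and B: "finite B" "B \<subseteq> Per" "C \<notin> B" "\<And>D. D \<in> B ==> sz C \<le> sz D"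
  and B0: "finite B0" "B0 \<subseteq> Per" "Out \<in> B0" "circ 1 a b \<notin> B0" "\<And>a' b'. hole 1 a' b' ==> circ (Suc k) (n * i + a') (n * j + b') \<in> B ==> circ 1 a' b' \<in> B0"
 shows "cap C B < cap (circ 1 a b) B0"
proof (rule ccontr)
 define m where "m = cap (circ 1 a b) B0"
 assume "\<not> cap C B < cap (circ 1 a b) B0"
 hence mB: "m \<le> cap C B" by (simp add: m_def)
 have CP: "C \<in> Per" unfolding C by (rule sub_Per[OF r ab])
 have h1: "hole 1 a b" using ab q_facts by (auto simp: hole_def bad_def)
 have MP: "circ 1 a b \<in> Per" using h1 by (auto simp: Per_def Holes_def)
 obtain P where P: "path P C (circ k i j)" using path_ex[OF r k ab] C by blast
 have PF: "P \<subseteq> F" "closed P" "P \<noteq> {}" and Pd: "\<And>D. D \<in> Per ==> sz C \<le> sz D ==> D \<noteq> C ==> D \<inter> P = {}"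
  using P unfolding path_def by blast+
 obtain c where c: "c > 0" "conn c P C (circ k i j)" using P unfolding path_def by blast
 have "D \<inter> P = {}" if "D \<in> B" for D using Pd[of D] B(2,3,4) that by blast
 then obtain \<eta> where \<eta>: "Lip \<eta>" "\<And>x. \<eta> x \<le> 1" "\<And>x. x \<in> P ==> \<eta> x = 1" "\<And>D x. D \<in> B ==> x \<in> D ==> \<eta> x = 0"
  using cutoff_function[OF PF B(1,2)] by meson
 obtain H where H: "ener \<eta> H" using Lip_ener[OF \<eta>(1)] by blast
 define K where "K = 1 + H"
 have K: "K \<ge> 1" using ener_pos[OF H] by (simp add: K_def)
 \<comment> \<open>Chosen so that Cauchy--Schwarz over the holes outside N yields e / (4 c).\<close>
 define \<theta> where "\<theta> = 1 / (16 * c\<^sup>2 * K)"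
 have \<theta>: "\<theta> > 0" using c(1) K by (simp add: \<theta>_def)
 obtain N where N: "finite N" "N \<subseteq> Holes" "\<And>A. finite A ==> A \<subseteq> Holes - N ==> (\<Sum>Q\<in>A. (sz Q)\<^sup>2) \<le> \<theta>"
  using small_rest[OF \<theta>] by meson
 \<comment> \<open>Chosen so that at most \<open>card N\<close> holes, each with truncated
   oscillation at most \<tau> e, contribute at most e / 8.\<close>
 define \<tau> where "\<tau> = 1 / (8 * c * (real (card N) + 1))"
 have \<tau>: "\<tau> > 0" using c(1) by (simp add: \<tau>_def)
 \<comment> \<open>The window must be wide enough that an oscillation of u above M e forces the
   truncated oscillation below \<tau> e; the summand \<tau> ensures \<tau> \<le> M.\<close>
 define M where "M = K / \<tau> + \<tau>"
 have M: "\<tau> \<le> M" "K / \<tau> \<le> M" "M > 0" using \<tau> K by (auto simp: M_def add_pos_pos)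
 define r where "r = \<tau> / M"
 have r01: "0 < r" "r \<le> 1" using \<tau> M by (auto simp: r_def)
 \<comment> \<open>The accuracy d is fixed before the near-minimiser, whereas the level e depends on
   it; d is the square of the smallest possible level.\<close>
 define d where "d = (r ^ card N)\<^sup>2"
 have d: "d > 0" using r01 by (simp add: d_def)
 obtain u0 where u0: "adm (circ 1 a b) B0 u0" "ener u0 (m + d)"
  using cap_near[OF MP B0(1,2,4) d] unfolding m_def by blast
 define u where "u = tp k i j u0"
 have uO: "u0 x = 0" if "x \<in> Out" for x using u0(1) B0(3) that by (simp add: adm_def)
 have ua: "adm C B u" unfolding u_def C by (rule adm_tp[OF assms(1) k ab B(2) B(4)[unfolded C] B0(3,5) u0(1)])
 have ue: "ener u (m + d)" unfolding u_def by (rule ener_tp[OF assms(1) uO u0(2)])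
 have Lu: "Lip u" by (rule adm_Lip[OF ua])
 obtain s where s: "s \<le> card N" "\<And>Q. Q \<in> N ==> osc u Q \<le> \<tau> * r ^ s \<or> M * r ^ s \<le> osc u Q"
  using good_scale[OF N(1) \<tau> M(1), of "osc u"] unfolding r_def by meson
 define e where "e = r ^ s"
 have e: "0 < e" "e \<le> 1" using r01 by (auto simp: e_def power_le_one)
 have de: "d \<le> e\<^sup>2" unfolding d_def e_def
  using r01 s(1) by (intro power_mono power_decreasing) auto
 define v where "v x = min (u x) e" for x
 have Lv: "Lip v" unfolding v_def by (rule Lip_min[OF Lu])
 have v1: "\<forall>x\<in>C. v x = e" using ua e by (simp add: adm_def v_def)
 have v0: "\<forall>x\<in>circ k i j. v x = 0"
 proof
  fix x assume "x \<in> circ k i j"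
  hence "x \<notin> osq k i j" by (simp add: circ_def)
  hence "u x = 0" unfolding u_def by (rule tp_out[rotated]) (rule uO)
  thus "v x = 0" using e by (simp add: v_def)
 qed
 have "e / 8 > 0" using e by simp
 from connD[OF c(2) Lv v1 v0 this] obtain A where A: "finite A" "A \<subseteq> Holes" "\<And>Q. Q \<in> A ==> Q \<subseteq> P"
  "e \<le> c * (\<Sum>Q\<in>A. sz Q * osc v Q) + e / 8" by blast
 have AP: "A \<subseteq> Per" using A(2) Holes_Per by (rule order_trans)
 have ov0: "0 \<le> osc v Q" "0 < sz Q" "sz Q \<le> 1" if "Q \<in> A" for Q
  using osc_nonneg[OF Lip_bdP[OF Lv]] sz_pos sz_le1 AP that by blast+
 have ovu: "osc v Q \<le> osc u Q" if Q: "Q \<in> A" for Q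
 proof -
  have bQ: "bounded (u ` Q)" using Lip_bdP[OF Lu] AP Q by blast
  show ?thesis
  proof (rule osc_le)
  fix x y assume xy: "x \<in> Q" "y \<in> Q"
  have "\<bar>v x - v y\<bar> \<le> \<bar>u x - u y\<bar>" by (simp add: v_def min_def abs_if)
  thus "dist (v x) (v y) \<le> osc u Q" using osc_ge[OF bQ xy] by (simp add: dist_real_def)
  qed (rule osc_nonneg[OF bQ])
 qed
 \<comment> \<open>By the assumption to be refuted, u is within d of the capacity of (C, B), so the
   first variation along P bounds this sum by a multiple of the square of e.\<close>
 have "(\<Sum>Q\<in>A. osc v Q * osc u Q) \<le> (m + d) + e\<^sup>2 * H - cap C B"
  unfolding v_def by (rule perturb[OF ua ue \<eta>(1,2) \<eta>(4) H e A(1) AP, rotated 2]) (use \<eta>(3) A(3) in \<open>meson subsetD\<close>)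
 hence var: "(\<Sum>Q\<in>A. osc v Q * osc u Q) \<le> e\<^sup>2 * K" using mB de by (simp add: K_def distrib_left)
 \<comment> \<open>On the holes of N the oscillation of u is either below \<tau> e, or at least M e;
   in the latter case the variational bound makes the truncated oscillation small.\<close>
 have big: "osc v Q \<le> \<tau> * e" if Q: "Q \<in> A" "Q \<in> N" for Q
 proof (cases "osc u Q \<le> \<tau> * e")
  case True thus ?thesis using ovu[OF Q(1)] by linarith
 next
  case False
  hence Me: "M * e \<le> osc u Q" using s(2)[OF Q(2)] by (simp add: e_def)
  have "osc v Q * (M * e) \<le> osc v Q * osc u Q" using Me ov0[OF Q(1)] by (intro mult_left_mono)
  also have "... \<le> (\<Sum>Q\<in>A. osc v Q * osc u Q)"
   by (rule member_le_sum[OF Q(1) _ A(1)]) (use ov0(1) ovu in \<open>meson mult_nonneg_nonneg order_trans DiffD1\<close>)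
  also have "... \<le> e\<^sup>2 * K" by (rule var)
  finally have "(osc v Q * M) * e \<le> (e * K) * e" by (simp add: power2_eq_square mult_ac)
  hence "osc v Q * M \<le> e * K" by (rule mult_right_le_imp_le[OF _ e(1)])
  moreover have "osc v Q * (K / \<tau>) \<le> osc v Q * M" using M(2) ov0[OF Q(1)] by (intro mult_left_mono)
  ultimately have "osc v Q * (K / \<tau>) \<le> e * K" by linarith
  hence "osc v Q * K \<le> (\<tau> * e) * K" using \<tau> by (simp add: field_simps)
  thus ?thesis using K by simp
 qed
 have S1: "c * (\<Sum>Q\<in>A \<inter> N. sz Q * osc v Q) \<le> e / 8"
 proof -
  have "(\<Sum>Q\<in>A \<inter> N. sz Q * osc v Q) \<le> (\<Sum>Q\<in>A \<inter> N. 1 * (\<tau> * e))"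
   by (intro sum_mono mult_mono) (use ov0 big in auto)
  also have "... = real (card (A \<inter> N)) * (\<tau> * e)" by simp
  also have "... \<le> (real (card N) + 1) * (\<tau> * e)"
  proof (rule mult_right_mono)
   have "card (A \<inter> N) \<le> card N" by (intro card_mono N(1)) auto
   thus "real (card (A \<inter> N)) \<le> real (card N) + 1" by simp
  qed (use \<tau> e in simp)
  finally have "c * (\<Sum>Q\<in>A \<inter> N. sz Q * osc v Q) \<le> c * ((real (card N) + 1) * (\<tau> * e))" using c(1) by (intro mult_left_mono) auto
  also have "... = e / 8"
  proof -
   have "c * (l * (1 / (8 * c * l) * e)) = e / 8" if "l > 0" for l using c(1) that by (simp add: field_simps)
   from this[of "real (card N) + 1"] show ?thesis unfolding \<tau>_def by simp
  qed
  finally show ?thesis .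
 qed
 \<comment> \<open>Outside N the sizes are small in the square mean, and the variational bound
   controls the squared oscillations of v. With the other two parts the total is e / 2, less than
   the drop e.\<close>
 have S2: "c * (\<Sum>Q\<in>A - N. sz Q * osc v Q) \<le> e / 4"
 proof -
  have "(\<Sum>Q\<in>A - N. sz Q * osc v Q)\<^sup>2 \<le> (\<Sum>Q\<in>A - N. (sz Q)\<^sup>2) * (\<Sum>Q\<in>A - N. (osc v Q)\<^sup>2)" by (rule Cauchy_Schwarz_ineq_sum)
  also have "... \<le> \<theta> * (e\<^sup>2 * K)"
  proof (rule mult_mono)
   show "(\<Sum>Q\<in>A - N. (sz Q)\<^sup>2) \<le> \<theta>" by (rule N(3)) (use A in auto)
   have "(\<Sum>Q\<in>A - N. (osc v Q)\<^sup>2) \<le> (\<Sum>Q\<in>A. (osc v Q)\<^sup>2)" by (rule sum_mono2[OF A(1)]) auto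
   also have "... \<le> (\<Sum>Q\<in>A. osc v Q * osc u Q)" unfolding power2_eq_square by (intro sum_mono mult_left_mono ovu ov0)
   finally show "(\<Sum>Q\<in>A - N. (osc v Q)\<^sup>2) \<le> e\<^sup>2 * K" using var by linarith
  qed (use \<theta> in \<open>auto intro: sum_nonneg\<close>)
  also have "... = (e / (4 * c))\<^sup>2" using c(1) K by (simp add: \<theta>_def power_divide power_mult_distrib)
  finally have "(\<Sum>Q\<in>A - N. sz Q * osc v Q) \<le> e / (4 * c)" by (rule power2_le_imp_le) (use e c in simp)
  hence "c * (\<Sum>Q\<in>A - N. sz Q * osc v Q) \<le> c * (e / (4 * c))" using c(1) by (intro mult_left_mono) auto
  thus ?thesis using c(1) by simp
 qed
 have "(\<Sum>Q\<in>A. sz Q * osc v Q) = (\<Sum>Q\<in>A \<inter> N. sz Q * osc v Q) + (\<Sum>Q\<in>A - N. sz Q * osc v Q)"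
  by (rule sum.Int_Diff[OF A(1)])
 hence "c * (\<Sum>Q\<in>A. sz Q * osc v Q) \<le> e / 8 + e / 4" using S1 S2 by (simp add: distrib_left)
 thus False using A(4) e by linarith
qed

subsection \<open>The five largest circles\<close>

definition X0 :: "plane set set" where "X0 = insert Out (Mc ` {..<4})"

lemma X0: "finite X0" "X0 \<subseteq> Per" "Out \<in> X0" "Mc i \<in> X0"
proof -
 show "finite X0" "X0 \<subseteq> Per" "Out \<in> X0" using Out_Per Mc_Per by (auto simp: X0_def)
 have "Mc i = Mc (i mod 4)" using Mc_eq by simp
 thus "Mc i \<in> X0" by (simp add: X0_def)
qed

lemma X0_cases: assumes "D \<in> X0" "D \<noteq> Out" obtains i where "i < 4" "D = Mc i"
 using assms by (auto simp: X0_def)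

lemma Mc_of: assumes "a = p \<or> a = q" "b = p \<or> b = q" shows "\<exists>i<4. circ 1 a b = Mc i"
proof -
 have "circ 1 p p = Mc 0" "circ 1 q p = Mc 1" "circ 1 q q = Mc 2" "circ 1 p q = Mc 3" by (simp_all add: Mc_def ma_def mb_def)
 moreover have "(0::nat) < 4" "(1::nat) < 4" "(2::nat) < 4" "(3::nat) < 4" by simp_all
 ultimately show ?thesis using assms by metis
qed

lemma hole1: assumes "hole 1 a b" shows "a = p \<or> a = q" "b = p \<or> b = q"
proof -
 have "a div n = 0" "b div n = 0" "bad (a mod n) (b mod n)" using assms by (auto simp: hole_def)
 moreover have "a < n" "b < n" using hole_bound[OF assms] by auto
 ultimately show "a = p \<or> a = q" "b = p \<or> b = q" by (auto simp: bad_def)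
qed

lemma X0_sz: assumes "D \<in> Per" "1 / real n \<le> sz D" shows "D \<in> X0"
proof -
 obtain m a b where m: "D = circ m a b" "hole m a b \<or> (m = 0 \<and> a = 0 \<and> b = 0)" using Per_cases[OF assms(1)] .
 from m(2) show ?thesis
 proof
  assume h: "hole m a b"
  have "1 / real n ^ 1 \<le> 1 / rn m" using assms(2) unfolding m(1) sz_circ by simp
  hence "rn m \<le> real n ^ 1" by (simp add: field_simps)
  hence "m \<le> 1" using n5 by (intro power_le_imp_le_exp[of "real n"]) auto
  hence m1: "m = 1" using hole_pos(3)[OF h] by simp
  have h1: "hole 1 a b" using h m1 by simp
  have "\<exists>i<4. circ 1 a b = Mc i" by (rule Mc_of[OF hole1[OF h1]])
  thus ?thesis using X0(4) m(1) m1 by metis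
 next
  assume "m = 0 \<and> a = 0 \<and> b = 0"
  thus ?thesis using m(1) X0(3) by (simp add: Out_def)
 qed
qed

lemma Mc_X0_rot: "(`) (rot ^^ s) ` (X0 - {Mc i}) \<subseteq> X0 - {Mc (s + i)}"
proof
 fix D assume "D \<in> (`) (rot ^^ s) ` (X0 - {Mc i})"
 then obtain E where E: "E \<in> X0" "E \<noteq> Mc i" "D = (rot ^^ s) ` E" by blast
 have "D \<noteq> Mc (s + i)"
 proof
  assume "D = Mc (s + i)"
  hence "(rot ^^ s) ` E = (rot ^^ s) ` Mc i" using E(3) rots_Mc by simp
  hence "E = Mc i" using GF_inj_im[OF GF_rots Per_F Per_F] E(1) X0(2) Mc_Per by blast
  thus False using E(2) by simp
 qed
 moreover have "D \<in> X0"
 proof (cases "E = Out")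
  case True thus ?thesis using E(3) rots_Out X0(3) by simp
 next
  case False
  then obtain j where "E = Mc j" using X0_cases E(1) by metis
  thus ?thesis using E(3) rots_Mc X0(4) by simp
 qed
 ultimately show "D \<in> X0 - {Mc (s + i)}" by blast
qed

lemma Mc_X0: "finite (X0 - {D})" "X0 - {D} \<subseteq> Per" "D \<notin> X0 - {D}"
 using X0 by auto

lemma cap_Mc: "cap (Mc i) (X0 - {Mc i}) \<le> cap (Mc j) (X0 - {Mc j})"
proof -
 \<comment> \<open>Modulo 4 the summand 3 i plays the role of - i.\<close>
 define s where "s = j + 3 * i"
 have e: "Mc (s + i) = Mc j" unfolding Mc_eq s_def by presburger
 have "cap (Mc i) (X0 - {Mc i}) \<le> cap ((rot ^^ s) ` Mc i) ((`) (rot ^^ s) ` (X0 - {Mc i}))"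
  by (rule cap_GF[OF GF_rots Mc_Per Mc_X0])
 also have "... \<le> cap (Mc j) (X0 - {Mc j})" unfolding rots_Mc e
  by (rule cap_mono[OF Mc_Per Mc_X0 Mc_X0_rot[of s i, unfolded e]])
 finally show ?thesis .
qed

text \<open>If the smallest image C were smaller than 1 / n, it would sit in a proper cell. Its
  capacity relative to the other four images would then be strictly below that of a model in the
  whole carpet, while invariance under f bounds it below by the same model. So all images have size
  at least 1 / n, and a count finishes.\<close>

lemma perm: assumes f: "GF f" shows "(`) f ` X0 = X0"
proof -
 let ?X = "(`) f ` X0"
 have inj: "inj_on ((`) f) Per" by (rule bij_betw_imp_inj_on[OF GF_Per_bij[OF f]])
 have injX: "inj_on ((`) f) X0" by (rule inj_on_subset[OF inj X0(2)])
 have XP: "finite ?X" "?X \<subseteq> Per" using X0(1,2) GF_Per[OF f] by auto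
 have fin: "?X = X0" if "?X \<subseteq> X0"
  using card_subset_eq[OF X0(1) that] card_image[OF injX] by simp
 have img: "?X - {f ` D} = (`) f ` (X0 - {D})" if "D \<in> X0" for D
  using inj_on_image_set_diff[OF injX, of X0 "{D}"] that by auto
 \<comment> \<open>Ties are resolved in favour of a hole: \<open>Out\<close> is selected only if its
   image is strictly the smallest. In that case no sibling of C of its own size is among the
   constraints, and the model has the single constraint \<open>Out\<close>.\<close>
 have "\<exists>D\<in>X0. (\<forall>E\<in>X0. sz (f ` D) \<le> sz (f ` E)) \<and> (D = Out \<longrightarrow> (\<forall>i. sz (f ` Out) < sz (f ` Mc i)))"
 proof (cases "\<exists>i. \<forall>D\<in>X0. sz (f ` Mc i) \<le> sz (f ` D)")
  case True
  then obtain i where "\<forall>D\<in>X0. sz (f ` Mc i) \<le> sz (f ` D)" by blast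
  thus ?thesis using X0(4) Mc_neq_Out by (intro bexI[of _ "Mc i"]) auto
 next
  case False
  obtain D where D: "D \<in> X0" "\<And>E. E \<in> X0 ==> sz (f ` D) \<le> sz (f ` E)"
   using ex_min_if_finite[of "(\<lambda>D. sz (f ` D)) ` X0"] X0(1,3) by (metis (no_types, lifting) arg_min_if_finite(1) arg_min_least empty_iff)
  have DO: "D = Out" using D False X0_cases by metis
  have "sz (f ` Out) < sz (f ` Mc i)" for i
  proof -
   obtain E where "E \<in> X0" "sz (f ` E) < sz (f ` Mc i)" using False by (auto simp: not_le)
   thus ?thesis using D(2)[of E] DO by simp
  qed
  thus ?thesis using D by blast
 qed
 then obtain D0 where D0: "D0 \<in> X0" "\<And>D. D \<in> X0 ==> sz (f ` D0) \<le> sz (f ` D)"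
  "D0 = Out ==> \<forall>i. sz (f ` Out) < sz (f ` Mc i)" by blast
 define C where "C = f ` D0"
 have D0P: "D0 \<in> Per" using D0(1) X0(2) by blast
 have CX: "C \<in> ?X" "C \<in> Per" using D0(1) XP(2) by (auto simp: C_def)
 have Cmin: "sz C \<le> sz D" if "D \<in> ?X" for D using D0(2) that by (auto simp: C_def)
 obtain l \<alpha> \<beta> where l: "C = circ l \<alpha> \<beta>" "hole l \<alpha> \<beta> \<or> (l = 0 \<and> \<alpha> = 0 \<and> \<beta> = 0)" using Per_cases[OF CX(2)] .
 have "1 / real n \<le> sz C"
 proof (rule ccontr)
  assume small: "\<not> 1 / real n \<le> sz C"
  have n1: "1 / real n \<le> 1" using n_ge1 by simp
  have h: "hole l \<alpha> \<beta>"
  proof (rule ccontr)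
   assume "\<not> hole l \<alpha> \<beta>"
   hence "C = Out" using l by (simp add: Out_def)
   thus False using small n1 sz_Out by simp
  qed
  obtain k where k: "l = Suc k" using hole_pos(3)[OF h] gr0_implies_Suc by blast
  have "k \<noteq> 0"
  proof
   assume "k = 0"
   thus False using small l(1) k by (simp add: sz_circ)
  qed
  hence k1: "1 \<le> k" by simp
  define i j a b where "i = \<alpha> div n" and "j = \<beta> div n" and "a = \<alpha> mod n" and "b = \<beta> mod n"
  have r: "rem k i j" and ab: "a = p \<or> a = q" "b = p \<or> b = q"
   using h unfolding k hole_def i_def j_def a_def b_def bad_def by auto
  have C: "C = circ (Suc k) (n * i + a) (n * j + b)" unfolding l(1) k i_def j_def a_def b_def by simp
  obtain y where y: "circ 1 a b = Mc y" using Mc_of[OF ab] by blast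
  let ?B = "?X - {C}"
  have B: "finite ?B" "?B \<subseteq> Per" "C \<notin> ?B" "\<And>D. D \<in> ?B ==> sz C \<le> sz D" using XP Cmin by auto
  have Bim: "?B = (`) f ` (X0 - {D0})" unfolding C_def by (rule img[OF D0(1)])
  have up: "cap D0 (X0 - {D0}) \<le> cap C ?B" unfolding Bim unfolding C_def by (rule cap_GF[OF f D0P Mc_X0])
  show False
  proof (cases "D0 = Out")
   case False
   then obtain x where x: "D0 = Mc x" using X0_cases D0(1) by metis
   \<comment> \<open>The siblings of C that may belong to the constraints correspond to the other
     large holes, so the model is a large hole against the remaining four circles; by rotation its
     capacity does not depend on the hole.\<close>
   have "cap C ?B < cap (circ 1 a b) (X0 - {Mc y})"
   proof (rule strict[OF r k1 ab C B])
    show "Out \<in> X0 - {Mc y}" using X0(3) Mc_neq_Out by auto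
    show "circ 1 a b \<notin> X0 - {Mc y}" using y by simp
    fix a' b' assume h': "hole 1 a' b'" "circ (Suc k) (n * i + a') (n * j + b') \<in> ?B"
    obtain t where t: "circ 1 a' b' = Mc t" using Mc_of[OF hole1[OF h'(1)]] by blast
    have "circ 1 a' b' \<noteq> circ 1 a b"
    proof
     assume "circ 1 a' b' = circ 1 a b"
     hence "a' = a" "b' = b" using circ_inj by blast+
     thus False using h'(2) C by simp
    qed
    thus "circ 1 a' b' \<in> X0 - {Mc y}" using t y X0(4) by simp
   qed (assumption | rule Mc_X0)+
   also have "... = cap (Mc y) (X0 - {Mc y})" by (simp only: y)
   also have "... \<le> cap (Mc x) (X0 - {Mc x})" by (rule cap_Mc)
   also have "... \<le> cap C ?B" using up unfolding x .
   finally show False by simp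
  next
   case True
   have lt: "sz C < sz D" if D: "D \<in> ?B" for D
   proof -
    obtain E where E: "E \<in> X0" "E \<noteq> D0" "D = f ` E" using D unfolding Bim by blast
    then obtain i where "E = Mc i" using X0_cases True by metis
    thus ?thesis using D0(3)[OF True] E(3) True by (simp add: C_def)
   qed
   \<comment> \<open>Here the model is a large hole against \<open>Out\<close> alone; symmetry of
     the capacity and monotonicity in the constraints lead back to \<open>Out\<close> against the
     four holes.\<close>
   have "cap C ?B < cap (circ 1 a b) {Out}"
   proof (rule strict[OF r k1 ab C B])
    show "circ 1 a b \<notin> {Out}" using y Mc_neq_Out by auto
    fix a' b' assume "circ (Suc k) (n * i + a') (n * j + b') \<in> ?B"
    hence "sz C < sz (circ (Suc k) (n * i + a') (n * j + b'))" by (rule lt)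
    thus "circ 1 a' b' \<in> {Out}" unfolding C sz_circ by simp
   qed (use Out_Per in auto)
   also have "... = cap Out {Mc y}" unfolding y by (rule cap_sym[OF Mc_Per Out_Per Mc_neq_Out])
   also have "... \<le> cap Out (X0 - {Out})"
    by (rule cap_mono[OF Out_Per Mc_X0]) (use X0(4) Mc_neq_Out in auto)
   also have "... \<le> cap C ?B" using up unfolding True .
   finally show False by simp
  qed
 qed
 hence "?X \<subseteq> X0" using X0_sz XP(2) Cmin by (meson order_trans subsetD subsetI)
 thus ?thesis by (rule fin)
qed

lemma perm_mem: "GF f ==> D \<in> X0 ==> f ` D \<in> X0" using perm by blast

lemma perm_Mc: assumes f: "GF f" "f ` Out = Out" shows "\<exists>j<4. f ` Mc i = Mc j"
proof -
 have "f ` Mc i \<noteq> Out"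
  using GF_inj_im[OF f(1) Per_F[OF Mc_Per] Per_F[OF Out_Per]] f(2) Mc_neq_Out by metis
 thus ?thesis using X0_cases[OF perm_mem[OF f(1) X0(4)]] by metis
qed

lemma comp_im: "(f \<circ> g) ` A = f ` g ` A" by (simp add: image_comp)

lemma id_im: assumes "\<And>z. z \<in> F ==> h z = z" shows "h ` Mc i = Mc i"
proof -
 have "h ` Mc i = id ` Mc i" by (rule image_cong[OF refl]) (use assms Per_F[OF Mc_Per, of i] in \<open>simp add: subsetD\<close>)
 thus ?thesis by simp
qed

text \<open>After a rotation the map fixes \<open>Mc 0\<close> and permutes the other three large
  holes. If one of these is fixed too, \<open>core\<close> gives the identity; it remains to exclude
  the two 3-cycles.\<close>

lemma pos_rot:
 assumes h: "GF h" "h ` Out = Out" "pos h"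
 shows "\<exists>s. \<forall>z\<in>F. h z = (rot ^^ s) z"
proof -
 obtain t where t: "t < 4" "h ` Mc 0 = Mc t" using perm_Mc[OF h(1,2)] by blast
 define g where "g = (rot ^^ (4 - t)) \<circ> h"
 have g: "GF g" "g ` Out = Out" "pos g"
  unfolding g_def by (intro GF_comp GF_rots h(1), simp only: comp_im h(2) rots_Out, intro pos_comp pos_rots h(3))
 have Mm: "Mc i = Mc j" if "i mod 4 = j mod 4" for i j using that Mc_eq by blast
 have g0: "g ` Mc 0 = Mc 0" unfolding g_def comp_im t(2) rots_Mc by (rule Mm) (use t(1) in simp)
 have u: "\<exists>j. j < 4 \<and> j \<noteq> 0 \<and> g ` Mc i = Mc j" if "i mod 4 \<noteq> 0" for i
 proof -
  obtain j where j: "j < 4" "g ` Mc i = Mc j" using perm_Mc[OF g(1,2)] by blast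
  have "j \<noteq> 0"
  proof
   assume "j = 0"
   hence "Mc i = Mc 0" using GF_inj_im[OF g(1) Per_F[OF Mc_Per] Per_F[OF Mc_Per]] j(2) g0 by metis
   thus False using that by (simp add: Mc_eq)
  qed
  thus ?thesis using j by blast
 qed
 obtain u1 where u1: "u1 < 4" "u1 \<noteq> 0" "g ` Mc 1 = Mc u1" using u[of 1] by auto
 obtain u2 where u2: "u2 < 4" "u2 \<noteq> 0" "g ` Mc 2 = Mc u2" using u[of 2] by auto
 obtain u3 where u3: "u3 < 4" "u3 \<noteq> 0" "g ` Mc 3 = Mc u3" using u[of 3] by auto
 have injM: "i mod 4 = j mod 4" if "g ` Mc i = g ` Mc j" for i j
  using GF_inj_im[OF g(1) Per_F[OF Mc_Per] Per_F[OF Mc_Per] that] Mc_eq by blast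
 have dist: "u1 \<noteq> u2" "u1 \<noteq> u3" "u2 \<noteq> u3" using injM[of 1 2] injM[of 1 3] injM[of 2 3] u1(3) u2(3) u3(3) by auto
 \<comment> \<open>If g agrees with a rotation on two holes, rotating back gives a map fixing both,
   hence the identity; but g fixes \<open>Mc 0\<close> and the rotation does not.\<close>
 have no: False if ab: "(rot ^^ s) ` Mc (a' :: nat) = Mc a" "g ` Mc a = Mc a'" "(rot ^^ s) ` Mc (b' :: nat) = Mc b" "g ` Mc b = Mc b'"
  "a mod 4 \<noteq> b mod 4" "s mod 4 \<noteq> 0" for s a b a' b'
 proof -
  define e where "e = (rot ^^ s) \<circ> g"
  have e: "GF e" "e ` Out = Out" "pos e"
   unfolding e_def by (intro GF_comp GF_rots g(1), simp only: comp_im g(2) rots_Out, intro pos_comp pos_rots g(3))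
  have ea: "e ` Mc a = Mc a" "e ` Mc b = Mc b" unfolding e_def comp_im ab(2,4) using ab(1,3) by auto
  have "e ` Mc 0 = Mc 0" by (rule id_im) (rule core[OF e(1,2) ea ab(5) e(3)])
  hence "Mc (s + 0) = Mc 0" unfolding e_def comp_im g0 rots_Mc .
  thus False using ab(6) by (simp add: Mc_eq)
 qed
 \<comment> \<open>A 3-cycle on the numbers 1, 2, 3 agrees with a shift by 1 or by -1 modulo 4 at
   two places.\<close>
 have "u1 = 1 \<or> u2 = 2 \<or> u3 = 3"
 proof (rule ccontr)
  assume n: "\<not> ?thesis"
  hence "(u1 = 2 \<and> u2 = 3 \<and> u3 = 1) \<or> (u1 = 3 \<and> u2 = 1 \<and> u3 = 2)" using u1 u2 u3 dist by auto
  thus False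
  proof
   assume h: "u1 = 2 \<and> u2 = 3 \<and> u3 = 1"
   show False by (rule no[of 3 2 1 3 2]) (use h u1(3) u2(3) in \<open>auto simp: rots_Mc Mc_eq\<close>)
  next
   assume h: "u1 = 3 \<and> u2 = 1 \<and> u3 = 2"
   show False by (rule no[of 5 1 2 2 3]) (use h u2(3) u3(3) in \<open>auto simp: rots_Mc Mc_eq\<close>)
  qed
 qed
 then obtain i where i: "g ` Mc i = Mc i" "0 mod 4 \<noteq> i mod 4"
 proof (elim disjE)
  assume "u1 = 1" thus thesis using that[of 1] u1(3) by simp
 next
  assume "u2 = 2" thus thesis using that[of 2] u2(3) by simp
 next
  assume "u3 = 3" thus thesis using that[of 3] u3(3) by simp
 qed
 have gid: "g z = z" if "z \<in> F" for z by (rule core[OF g(1,2) g0 i g(3) that])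
 have "h z = (rot ^^ t) z" if z: "z \<in> F" for z
 proof -
  have "(rot ^^ t) (g z) = (rot ^^ (t + (4 - t))) (h z)" by (simp only: g_def comp_apply funpow_add)
  also have "... = h z" using rots4[of 1 "h z"] t(1) by simp
  finally show ?thesis using gid[OF z] by simp
 qed
 thus ?thesis by blast
qed

lemma Out_case:
 assumes f: "GF f" "f ` Out = Out"
 shows "\<exists>s. (\<forall>z\<in>F. f z = (rot ^^ s) z) \<or> (\<forall>z\<in>F. f z = (rot ^^ s) (prod.swap z))"
proof -
 have OF': "Out \<subseteq> F" by (rule Per_F[OF Out_Per])
 have "pos f \<or> pos (f \<circ> prod.swap)"
  by (rule pos_or[OF continuous_on_subset[OF GF_cont[OF f(1)] OF'] inj_on_subset[OF GF_inj[OF f(1)] OF']]) (use f(2) in auto)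
 thus ?thesis
 proof
  assume "pos f"
  thus ?thesis using pos_rot[OF f] by blast
 next
  assume p: "pos (f \<circ> prod.swap)"
  have "GF (f \<circ> prod.swap)" "(f \<circ> prod.swap) ` Out = Out" by (intro GF_comp f(1) GF_swap, simp only: comp_im swap_Out f(2))
  then obtain s where s: "\<And>z. z \<in> F ==> f (prod.swap z) = (rot ^^ s) z" using pos_rot p by (metis comp_apply)
  have "f z = (rot ^^ s) (prod.swap z)" if "z \<in> F" for z
   using s[of "prod.swap z"] that F_swap[of z] by simp
  thus ?thesis by blast
 qed
qed

text \<open>The swap exchanges \<open>Mc 1\<close> and \<open>Mc 3\<close> and fixes the other three
  circles of \<open>X0\<close>. Its conjugate by f therefore exchanges the images of these two, one
  of which is \<open>Out\<close>, and fixes the other three.\<close>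

lemma swap_Mc_exchange:
 assumes f: "GF f" "f ` Mc 1 = Out"
 defines "t \<equiv> f \<circ> prod.swap \<circ> inv_into F f"
 shows "\<exists>x. GF t \<and> t ` Out = Mc x \<and> t ` Mc x = Out \<and> (\<forall>y. y mod 4 \<noteq> x mod 4 \<longrightarrow> t ` Mc y = Mc y)"
proof -
 have tG: "GF t" unfolding t_def by (intro GF_comp f(1) GF_swap GF_inv)
 have tf: "t ` f ` D = f ` prod.swap ` D" if "D \<in> X0" for D
 proof -
  have "D \<subseteq> F" using that X0(2) Per_F by blast
  thus ?thesis unfolding t_def comp_im using GF_inv_im[OF f(1)] by simp
 qed
 have sw: "prod.swap ` Mc 1 = Mc 3" "prod.swap ` Mc 3 = Mc 1" "prod.swap ` Mc 0 = Mc 0" "prod.swap ` Mc 2 = Mc 2"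
  unfolding swap_Mc by (simp_all add: Mc_eq)
 have inj: "f ` D = f ` E \<longleftrightarrow> D = E" if "D \<in> X0" "E \<in> X0" for D E
  using GF_inj_im[OF f(1) Per_F Per_F, of D E] that X0(2) by blast
 have "f ` Mc 3 \<noteq> Out" using inj[OF X0(4) X0(4), of 3 1] f(2) by (simp add: Mc_eq)
 then obtain x where x: "f ` Mc 3 = Mc x" using X0_cases[OF perm_mem[OF f(1) X0(4)]] by metis
 have 1: "t ` Out = Mc x" using tf[OF X0(4), of 1] f(2) sw(1) x by simp
 have 2: "t ` Mc x = Out" using tf[OF X0(4), of 3] f(2) sw(2) x by simp
 have 3: "t ` Mc y = Mc y" if y: "y mod 4 \<noteq> x mod 4" for y
 proof -
  have "Mc y \<in> (`) f ` X0" using perm[OF f(1)] X0(4) by simp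
  then obtain D where D: "D \<in> X0" "Mc y = f ` D" by blast
  have "D \<noteq> Mc 1" using D(2) f(2) Mc_neq_Out by metis
  moreover have "D \<noteq> Mc 3"
  proof
   assume "D = Mc 3"
   hence "Mc y = Mc x" using D(2) x by simp
   thus False using y by (simp add: Mc_eq)
  qed
  ultimately have "prod.swap ` D = D"
  proof (cases "D = Out")
   case False
   then obtain i where i: "i < 4" "D = Mc i" using X0_cases D(1) by metis
   hence "i = 0 \<or> i = 2" using \<open>D \<noteq> Mc 1\<close> \<open>D \<noteq> Mc 3\<close> by (cases i rule: mod4) auto
   thus ?thesis using sw(3,4) i(2) by auto
  qed (simp add: swap_Out)
  thus ?thesis using tf[OF D(1)] D(2) by simp
 qed
 show ?thesis using tG 1 2 3 by blast
qed

lemma mod4_cancel: "(s + x) mod 4 = x mod (4::nat) ==> s mod 4 = 0"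
 by (metis add_diff_cancel_right' mod_eq_dvd_iff_nat le_add2 dvd_imp_mod_0)

text \<open>A map moving \<open>Out\<close> would produce a transposition of \<open>Out\<close> with
  a large hole and, by rotation, one with the next hole. Together they generate a map fixing
  \<open>Out\<close> that exchanges two adjacent holes and fixes the other two, which no symmetry of
  the square does.\<close>

lemma Out_invariant: assumes f: "GF f" shows "f ` Out = Out"
proof (rule ccontr)
 assume ne: "f ` Out \<noteq> Out"
 have "Out \<in> (`) f ` X0" using perm[OF f] X0(3) by simp
 then obtain D where D: "D \<in> X0" "f ` D = Out" by blast
 then obtain a where a: "D = Mc a" using X0_cases[OF D(1)] ne by metis
 define h where "h = f \<circ> (rot ^^ (a + 3))"
 have h: "GF h" unfolding h_def by (rule GF_comp[OF f GF_rots])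
 have "Mc (a + 3 + 1) = Mc a" unfolding Mc_eq by simp
 hence h1: "h ` Mc 1 = Out" unfolding h_def comp_im rots_Mc using D(2) a by simp
 from swap_Mc_exchange[OF h h1] obtain t x where t: "GF t" "t ` Out = Mc x" "t ` Mc x = Out"
  "\<And>y. y mod 4 \<noteq> x mod 4 ==> t ` Mc y = Mc y" by blast
 define t2 where "t2 = (rot ^^ 1) \<circ> t \<circ> (rot ^^ 3)"
 have t2: "GF t2" unfolding t2_def by (intro GF_comp GF_rots t(1))
 have t2im: "t2 ` A = (rot ^^ 1) ` t ` (rot ^^ 3) ` A" for A unfolding t2_def comp_im ..
 have Mm: "Mc i = Mc j" if "i mod 4 = j mod 4" for i j using that Mc_eq by blast
 have t2O: "t2 ` Out = Mc (x + 1)" unfolding t2im rots_Out t(2) rots_Mc by (simp add: add.commute)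
 have M4: "Mc (3 + (x + 1)) = Mc x" by (rule Mm) presburger
 have t2x: "t2 ` Mc (x + 1) = Out" unfolding t2im rots_Mc M4 t(3) rots_Out ..
 have t2y: "t2 ` Mc y = Mc y" if "y mod 4 \<noteq> (x + 1) mod 4" for y
 proof -
  have m: "(3 + y) mod 4 \<noteq> x mod 4"
  proof
   assume "(3 + y) mod 4 = x mod 4"
   hence "(3 + y + 1) mod 4 = (x + 1) mod 4" by (rule mod_add_cong) simp
   moreover have "(3 + y + 1) mod 4 = y mod 4" by presburger
   ultimately show False using that by simp
  qed
  show ?thesis unfolding t2im rots_Mc t(4)[OF m] by (rule Mm) presburger
 qed
 \<comment> \<open>Conjugating the transposition (\<open>Out\<close>, x + 1) by the transposition
   (\<open>Out\<close>, x) gives the transposition (x, x + 1), which keeps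
   \<open>Out\<close>.\<close>
 define e where "e = t \<circ> t2 \<circ> t"
 have e: "GF e" unfolding e_def by (intro GF_comp t(1) t2)
 have eim: "e ` A = t ` t2 ` t ` A" for A unfolding e_def comp_im ..
 have x1: "x mod 4 \<noteq> (x + 1) mod 4" "(x + 1) mod 4 \<noteq> x mod 4" by presburger+
 have eO: "e ` Out = Out" unfolding eim t(2) t2y[OF x1(1)] t(3) ..
 have ex: "e ` Mc x = Mc (x + 1)" unfolding eim t(3) t2O t(4)[OF x1(2)] ..
 have x2: "(x + 2) mod 4 \<noteq> x mod 4" "(x + 2) mod 4 \<noteq> (x + 1) mod 4" "(x + 3) mod 4 \<noteq> x mod 4" "(x + 3) mod 4 \<noteq> (x + 1) mod 4" by presburger+
 have e2: "e ` Mc (x + 2) = Mc (x + 2)" unfolding eim t(4)[OF x2(1)] t2y[OF x2(2)] t(4)[OF x2(1)] ..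
 have e3: "e ` Mc (x + 3) = Mc (x + 3)" unfolding eim t(4)[OF x2(3)] t2y[OF x2(4)] t(4)[OF x2(3)] ..
 have im: "e ` Mc y = k ` Mc y" if "\<forall>z\<in>F. e z = k z" for y k
  using that Per_F[OF Mc_Per, of y] by (intro image_cong) auto
 obtain s where "(\<forall>z\<in>F. e z = (rot ^^ s) z) \<or> (\<forall>z\<in>F. e z = (rot ^^ s) (prod.swap z))" using Out_case[OF e eO] by blast
 thus False
 proof
  assume s: "\<forall>z\<in>F. e z = (rot ^^ s) z"
  have E: "e ` Mc y = Mc (s + y)" for y using im[OF s] rots_Mc by simp
  have "(s + (x + 2)) mod 4 = (x + 2) mod 4" "(s + x) mod 4 = (x + 1) mod 4" using e2 ex unfolding E Mc_eq .
  hence "s mod 4 = 0" by (intro mod4_cancel)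
  hence "(s + x) mod 4 = x mod 4" by (metis add_0 mod_add_left_eq)
  thus False using \<open>(s + x) mod 4 = (x + 1) mod 4\<close> x1(1) by metis
 next
  assume s: "\<forall>z\<in>F. e z = (rot ^^ s) (prod.swap z)"
  have E: "e ` Mc y = Mc (s + 3 * y)" for y
  proof -
   have "e ` Mc y = (\<lambda>z. (rot ^^ s) (prod.swap z)) ` Mc y" by (rule im[OF s])
   also have "... = (rot ^^ s) ` prod.swap ` Mc y" by (simp add: image_image)
   finally show ?thesis by (simp only: swap_Mc rots_Mc)
  qed
  \<comment> \<open>A reflection acts on the indices by y -> s + 3 y, whose fixed points modulo 4
    have the same parity; it cannot fix both x + 2 and x + 3.\<close>
  have "s + 3 * (x + 2) = (s + 2 * x + 4) + (x + 2)" "s + 3 * (x + 3) = (s + 2 * x + 6) + (x + 3)" by simp_all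
  hence "(s + 2 * x + 4) mod 4 = 0" "(s + 2 * x + 6) mod 4 = 0" using e2 e3 mod4_cancel unfolding E Mc_eq by metis+
  thus False by presburger
 qed
qed

lemma GF_isometry: assumes f: "GF f" and z: "z \<in> F" "w \<in> F" shows "dist (f z) (f w) = dist z w"
proof -
 have r: "dist ((rot ^^ s) z) ((rot ^^ s) w) = dist z w" for s z w
  by (induction s) (simp_all add: dist_rot)
 obtain s where "(\<forall>z\<in>F. f z = (rot ^^ s) z) \<or> (\<forall>z\<in>F. f z = (rot ^^ s) (prod.swap z))"
  using Out_case[OF f Out_invariant[OF f]] by blast
 thus ?thesis using z by (auto simp only: r dist_swap)
qed

subsection \<open>The stages of the carpet\<close>

lemma square_corner: "square_at (gr k i, gr k j) (1 / rn k) = sq k i j"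
 unfolding square_at_def sq_times by (simp add: add_divide_distrib)

lemma removed_iff: "(a, b) \<in> removed_indices n p \<longleftrightarrow> bad a b"
 using q_facts unfolding removed_indices_def bad_def by auto

lemma subcorner_eq: "subcorner n (gr k i, gr k j) (1 / rn k) (a, b)
  = (gr (Suc k) (n * i + a), gr (Suc k) (n * j + b))"
 unfolding subcorner_def by (simp add: add_divide_distrib)

lemma remaining_rem: "remaining_corners n p k = (\<lambda>(i, j). (gr k i, gr k j)) ` {(i, j). rem k i j}"
proof (induction k)
 case 0 show ?case by auto
next
 case (Suc k)
 show ?case
 proof (intro equalityI subsetI)
  fix c assume "c \<in> remaining_corners n p (Suc k)"
  then obtain i j a b where h: "rem k i j" "a < n" "b < n" "\<not> bad a b"
   "c = subcorner n (gr k i, gr k j) (1 / rn k) (a, b)"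
   unfolding remaining_corners.simps Suc by (auto simp: removed_iff)
  have "rem (Suc k) (n * i + a) (n * j + b)" using h by simp
  thus "c \<in> (\<lambda>(i, j). (gr (Suc k) i, gr (Suc k) j)) ` {(i, j). rem (Suc k) i j}"
   unfolding h(5) subcorner_eq by (intro image_eqI[of _ _ "(n * i + a, n * j + b)"]) auto
 next
  fix c assume "c \<in> (\<lambda>(i, j). (gr (Suc k) i, gr (Suc k) j)) ` {(i, j). rem (Suc k) i j}"
  then obtain i j where h: "rem (Suc k) i j" "c = (gr (Suc k) i, gr (Suc k) j)" by auto
  have r: "rem k (i div n) (j div n)" "\<not> bad (i mod n) (j mod n)" using h(1) by auto
  have c: "c = subcorner n (gr k (i div n), gr k (j div n)) (1 / rn k) (i mod n, j mod n)"
   unfolding subcorner_eq h(2) by simp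
  have "(gr k (i div n), gr k (j div n)) \<in> remaining_corners n p k"
   unfolding Suc using r(1) by (intro image_eqI[of _ _ "(i div n, j div n)"]) auto
  moreover have "(i mod n, j mod n) \<in> {..<n} \<times> {..<n} - removed_indices n p" using r(2) by (simp add: removed_iff)
  ultimately show "c \<in> remaining_corners n p (Suc k)" unfolding remaining_corners.simps c by blast
 qed
qed

lemma stage_iff: "z \<in> carpet_stage n p (Suc k) \<longleftrightarrow>
  (\<exists>i j. rem k i j \<and> z \<in> sq k i j \<and> (\<forall>a b. bad a b \<longrightarrow> z \<notin> osq (Suc k) (n * i + a) (n * j + b)))"
proof -
 have e: "interior (square_at (subcorner n (gr k i, gr k j) (1 / rn k) (a, b)) (1 / rn (Suc k))) = osq (Suc k) (n * i + a) (n * j + b)" for i j a b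
  unfolding subcorner_eq square_corner interior_sq ..
 have r: "(\<forall>x\<in>removed_indices n p. P x) \<longleftrightarrow> (\<forall>a b. bad a b \<longrightarrow> P (a, b))" for P
  using removed_iff by fast
 show ?thesis unfolding carpet_stage.simps remaining_rem
  by (auto simp: square_corner r e simp del: power_Suc)
qed

text \<open>The two descriptions are matched through the holes: a point of the unit square lies in
  either set exactly when it avoids every open hole.\<close>

lemma carpet_F: "carpet n p = F"
proof (intro equalityI subsetI)
 fix z assume z: "z \<in> carpet n p"
 have st: "z \<in> carpet_stage n p k" for k using z unfolding carpet_def by blast
 have unit: "z \<in> unit_sq" using st[of 0] by simp
 have "z \<notin> osq l \<alpha> \<beta>" if h: "hole l \<alpha> \<beta>" for l \<alpha> \<beta>
 proof
  assume o: "z \<in> osq l \<alpha> \<beta>"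
  obtain k where k: "l = Suc k" using hole_pos(3)[OF h] gr0_implies_Suc by blast
  obtain i j where ij: "z \<in> sq k i j" "\<And>a b. bad a b ==> z \<notin> osq (Suc k) (n * i + a) (n * j + b)"
   using st[of "Suc k"] stage_iff by blast
  have "oseg k (\<alpha> div n) (fst z)" "oseg k (\<beta> div n) (snd z)" using o oseg_parent unfolding k osq_def by blast+
  hence "\<alpha> div n = i" "\<beta> div n = j" using ij(1) oseg_seg_eq unfolding sq_def by blast+
  hence "n * i + \<alpha> mod n = \<alpha>" "n * j + \<beta> mod n = \<beta>" by auto
  moreover have "bad (\<alpha> mod n) (\<beta> mod n)" using h by (simp add: hole_def)
  ultimately show False using ij(2) o k by metis
 qed
 thus "z \<in> F" using not_F_hole[OF unit] by blast
next
 fix z assume z: "z \<in> F"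
 have "z \<in> carpet_stage n p k" for k
 proof (cases k)
  case 0 thus ?thesis using z F_unit by auto
 next
  case (Suc l)
  obtain i j where ij: "rem l i j" "z \<in> sq l i j" using z unfolding F_def by blast
  have "z \<notin> osq (Suc l) (n * i + a) (n * j + b)" if "bad a b" for a b
  proof -
   have "a < n" "b < n" using that q_facts by (auto simp: bad_def)
   hence "hole (Suc l) (n * i + a) (n * j + b)" using ij(1) that by (simp add: hole_def)
   thus ?thesis using F_osq_hole z by blast
  qed
  thus ?thesis using ij stage_iff Suc by blast
 qed
 thus "z \<in> carpet n p" unfolding carpet_def by blast
qed

text \<open>The control function, as a self-homeomorphism of the half-line, is increasing and
  vanishes at 0. Its values give the bounds at a fixed ratio, and its inverse at e gives the ratio
  below which the distortion is at most e.\<close>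

lemma quasisymmetric_GF: assumes "quasisymmetric_map F F f" shows "GF f"
proof -
 obtain g \<eta> \<theta> where g: "homeomorphism F F f g" and h: "homeomorphism {0::real..} {0::real..} \<eta> \<theta>"
  and Q: "\<And>x y z. x \<in> F ==> y \<in> F ==> z \<in> F ==> x \<noteq> z ==> dist (f x) (f y) / dist (f x) (f z) \<le> \<eta> (dist x y / dist x z)"
  using assms unfolding quasisymmetric_map_def by blast
 have inj: "inj_on f F" using g unfolding homeomorphism_def by (metis inj_onI)
 have im: "f ` F = F" using g unfolding homeomorphism_def by blast
 have \<eta>c: "continuous_on {0..} \<eta>" and \<eta>i: "\<eta> ` {0..} = {0..}" and inv: "\<And>x. 0 \<le> x ==> \<theta> (\<eta> x) = x"
  and inv2: "\<And>y. 0 \<le> y ==> \<eta> (\<theta> y) = y" and \<theta>i: "\<theta> ` {0..} = {0..}"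
  using h unfolding homeomorphism_def by auto
 have "inj_on \<eta> {0..}" using inv by (metis atLeast_iff inj_onI)
 hence "strict_mono_on {0..} \<eta> \<or> strict_antimono_on {0..} \<eta>"
  using injective_eq_monotone_map[OF is_interval_ci \<eta>c] by blast
 moreover have "\<not> strict_antimono_on {0..} \<eta>"
 proof
  assume a: "strict_antimono_on {0..} \<eta>"
  have "\<eta> 0 \<in> {0..}" using \<eta>i by (metis atLeast_iff image_eqI order_refl)
  hence "\<eta> 0 + 1 \<in> \<eta> ` {0..}" unfolding \<eta>i by simp
  then obtain x where x: "x \<ge> 0" "\<eta> x = \<eta> 0 + 1" by auto
  hence "x > 0" by (cases "x = 0") auto
  hence "\<eta> x < \<eta> 0" using a x(1) by (auto simp: monotone_on_def)
  thus False using x(2) by simp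
 qed
 ultimately have sm: "strict_mono_on {0..} \<eta>" by blast
 have mono: "\<eta> x \<le> \<eta> y" if "0 \<le> x" "x \<le> y" for x y
  using sm that by (cases "x = y") (auto simp: monotone_on_def less_imp_le)
 have nn: "0 \<le> \<eta> x" if "0 \<le> x" for x using \<eta>i that by force
 have "\<eta> 0 = 0"
 proof -
  have "0 \<in> \<eta> ` {0..}" unfolding \<eta>i by simp
  then obtain x where "x \<ge> 0" "\<eta> x = 0" by auto
  thus ?thesis using mono[of 0 x] nn[of 0] by simp
 qed
 have key: "dist (f x) (f y) \<le> \<eta> t * dist (f x) (f z)"
  if t: "0 \<le> t" and x: "x \<in> F" "y \<in> F" "z \<in> F" and d: "dist x y \<le> t * dist x z" for t x y z
 proof (cases "x = z")
  case True
  hence "x = y" using d by simp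
  thus ?thesis using nn[OF t] by simp
 next
  case False
  hence dz: "dist x z > 0" "dist (f x) (f z) > 0" using inj x by (auto simp: inj_on_def)
  have "dist x y / dist x z \<le> t" using d dz(1) by (simp add: pos_divide_le_eq)
  hence "\<eta> (dist x y / dist x z) \<le> \<eta> t" by (intro mono) auto
  hence "dist (f x) (f y) / dist (f x) (f z) \<le> \<eta> t" using Q[OF x False] by linarith
  thus ?thesis using dz(2) by (simp add: pos_divide_le_eq)
 qed
 have "qs f" unfolding qs_def
 proof (intro conjI allI impI)
  fix t :: real assume t: "0 < t"
  \<comment> \<open>Adding 1 makes the constant positive without a separate argument that \<eta> t
    is.\<close>
  have p: "0 < \<eta> t + 1" using nn[of t] t by simp
  have "dist (f x) (f y) \<le> (\<eta> t + 1) * dist (f x) (f z)" if "x \<in> F" "y \<in> F" "z \<in> F" "dist x y \<le> t * dist x z" for x y z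
   using key[of t, OF _ that] t by (simp add: distrib_right add_increasing2)
  thus "\<exists>H>0. ctrl f t H"
   using p by (intro exI[of _ "\<eta> t + 1"]) simp
 next
  fix e :: real assume e: "0 < e"
  have s0: "\<theta> e \<ge> 0" using \<theta>i e by force
  have "\<theta> e \<noteq> 0" using inv2[of e] e \<open>\<eta> 0 = 0\<close> by auto
  hence s: "\<theta> e > 0" using s0 by simp
  have "dist (f x) (f y) \<le> e * dist (f x) (f z)" if "x \<in> F" "y \<in> F" "z \<in> F" "dist x y \<le> \<theta> e * dist x z" for x y z
   using key[OF s0 that] inv2[of e] e by simp
  thus "\<exists>s>0. ctrl f s e"
   using s by (intro exI[of _ "\<theta> e"]) simp
 qed
 thus ?thesis unfolding GF_def bij_betw_def using inj im by blast
qed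

end

theorem theorem2:
  fixes n p :: nat and f :: "real \<times> real \<Rightarrow> real \<times> real"
  assumes "n \<ge> 5" and "1 \<le> p" and "real p < real n / 2 - 1"
    and "quasisymmetric_map (carpet n p) (carpet n p) f"
  shows "isometry_between (carpet n p) (carpet n p) f"
proof -
  interpret carpet_np n p
  proof
    have "2 * real p + 2 < real n" using assms(3) by simp
    then have "real (2 * p + 2) < real n" by simp
    then show "2 * p + 3 \<le> n" by linarith
  qed (use assms(1,2) in auto)
  have f: "GF f" using assms(4) unfolding carpet_F by (rule quasisymmetric_GF)
  show ?thesis unfolding carpet_F isometry_between_def using GF_im[OF f] GF_isometry[OF f] by blast
qed

end
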